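(* Let $d\ge 1$ and let $\mathcal{FD}\subset\mathcal{P}(\mathcal{M}^\square)$ be the set of all (restricted) fractal distributions on $\mathbb{R}^d$. Then $\mathcal{FD}$ is closed in $\mathcal{P}(\mathcal{M}^\square)$ with respect to the weak topology.
   Context: Equip $\mathbb{R}^d$ with the norm $\|x\|=\max_i|x_i|$ and let $B_1=[-1,1]^d$ be the closed unit ball. $\mathcal{M}$ is the space of Radon measures on $\mathbb{R}^d$ with the weak topology ($\mu_n\to\mu$ iff $\int f\,d\mu_n\to\int f\,d\mu$ for all continuous compactly supported $f$). $\mathcal{M}^\square=\mathcal{P}(B_1)$ is the (compact metrizable) space of Borel probability measures on $B_1$ with the weak topology. For a metric space $X$, $\mathcal{P}(X)$ denotes the Borel probability measures on $X$; elements of $\mathcal{P}(\mathcal{M})$ and of $\mathcal{P}(\mathcal{M}^\square)$ are called distributions, and $\mathcal{P}(\mathcal{M}^\square)$ carries the weak topology. For $\mu\in\mathcal{M}$ with $\mu(B_1)>0$ put $\mu^*=\mu/\mu(B_1)$ and $\mu^\square=\mu|_{B_1}/\mu(B_1)$. Let $T_x\mu(A)=\mu(A+x)$ and $S_t\mu(A)=\mu(e^{-t}A)$, and write $T_x^*\mu=(T_x\mu)^*$, $S_t^*\mu=(S_t\mu)^*$. Let $\mathcal{M}^*=\{\mu\in\mathcal{M}:0\in\operatorname{spt}\mu\}$. A distribution $P\in\mathcal{P}(\mathcal{M})$ is scale-invariant if $P(\mathcal{M}^* )=1$ and $P((S_t^* )^{-1}\mathcal{A})=P(\mathcal{A})$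 for all Borel $\mathcal{A}\subset\mathcal{M}^*$ and all $t>0$. It is quasi-Palm if for every Borel set $\mathcal{A}\subset\mathcal{M}$: $P(\mathcal{A})=1$ if and only if for $P$-almost every $\nu$ one has $T_z^*\nu\in\mathcal{A}$ for $\nu$-almost every $z$. It is an (extended) fractal distribution if it is both scale-invariant and quasi-Palm. A distribution on $\mathcal{M}^\square$ is a (restricted) fractal distribution if it equals $P^\square$, the push-forward of some extended fractal distribution $P$ under $\mu\mapsto\mu^\square$. $\mathcal{FD}$ denotes the set of restricted fractal distributions. *)

theory Defs
  imports "HOL-Probability.Probability"
begin

section \<open>Borel sets and probability measures on abstract topologies\<close>

definition borel_of :: "'a topology \<Rightarrow> 'a measure" where
  "borel_of X = sigma (topspace X) {U. openin X U}"

definition prob_measures :: "'a topology \<Rightarrow> 'a measure set" where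
  "prob_measures X = {P. prob_space P \<and> sets P = sets (borel_of X)}"

definition weak_topology :: "'a topology \<Rightarrow> 'a measure topology" where
  "weak_topology X = topology_generated_by
     {{P \<in> prob_measures X. (\<integral>x. f x \<partial>P) \<in> U} | f U.
        continuous_map X euclideanreal f \<and> bounded (f ` topspace X) \<and> open (U :: real set)}"


section \<open>Radon measures on Euclidean space\<close>

definition radon_measures :: "(real ^ 'n) measure set" where
  "radon_measures = {\<mu>. sets \<mu> = sets borel
     \<and> (\<forall>K. compact K \<longrightarrow> emeasure \<mu> K < \<infinity>)
     \<and> (\<forall>A\<in>sets borel. emeasure \<mu> A = (SUP K\<in>{K. compact K \<and> K \<subseteq> A}. emeasure \<mu> K))}"

text \<open>The initial topology for the maps \<open>\<mu> \<mapsto> \<integral>f d\<mu>\<close>, with \<open>f\<close> continuous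
  of compact support; it is metrizable, so it is determined by its convergent sequences.\<close>

definition radon_topology :: "(real ^ 'n) measure topology" where
  "radon_topology = topology_generated_by
     {{\<mu> \<in> radon_measures. (\<integral>x. f x \<partial>\<mu>) \<in> U} | f U.
        continuous_on UNIV f \<and> compact (closure {x. f x \<noteq> 0}) \<and> open (U :: real set)}"

text \<open>\<^const>\<open>infnorm\<close> is the maximum norm, so this is the cube \<open>[-1,1]^d\<close>.\<close>

definition unit_box :: "(real ^ 'n) set" where
  "unit_box = {x. infnorm x \<le> 1}"

definition box_topology :: "(real ^ 'n) measure topology" where
  "box_topology = weak_topology (top_of_set unit_box)"

definition spt :: "(real ^ 'n) measure \<Rightarrow> (real ^ 'n) set" where
  "spt \<mu> = {x. \<forall>U. open U \<and> x \<in> U \<longrightarrow> emeasure \<mu> U > 0}"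

definition radon_at_origin :: "(real ^ 'n) measure set" where
  "radon_at_origin = {\<mu> \<in> radon_measures. 0 \<in> spt \<mu>}"


section \<open>Normalization, translation and scaling\<close>

text \<open>The two normalizations are meaningful only if \<^term>\<open>emeasure \<mu> unit_box > 0\<close>. The measure
  \<^term>\<open>box_normalize \<mu>\<close> lives on the space \<^const>\<open>unit_box\<close>, not on all of \<open>\<real>^d\<close>.\<close>

definition normalize_measure :: "(real ^ 'n) measure \<Rightarrow> (real ^ 'n) measure" where
  "normalize_measure \<mu> = scale_measure (1 / emeasure \<mu> unit_box) \<mu>"

definition box_normalize :: "(real ^ 'n) measure \<Rightarrow> (real ^ 'n) measure" where
  "box_normalize \<mu> = scale_measure (1 / emeasure \<mu> unit_box) (restrict_space \<mu> unit_box)"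

text \<open>As push-forwards: \<open>A + x\<close> is the preimage of \<open>A\<close> under \<open>y \<mapsto> y - x\<close>, and
  \<open>e\<^sup>-\<^sup>t A\<close> is the preimage of \<open>A\<close> under \<open>y \<mapsto> e\<^sup>t y\<close>.\<close>

definition translate :: "real ^ 'n \<Rightarrow> (real ^ 'n) measure \<Rightarrow> (real ^ 'n) measure" where
  "translate x \<mu> = distr \<mu> borel (\<lambda>y. y - x)"

definition magnify :: "real \<Rightarrow> (real ^ 'n) measure \<Rightarrow> (real ^ 'n) measure" where
  "magnify t \<mu> = distr \<mu> borel (\<lambda>y. exp t *\<^sub>R y)"

definition translate_star :: "real ^ 'n \<Rightarrow> (real ^ 'n) measure \<Rightarrow> (real ^ 'n) measure" where
  "translate_star x \<mu> = normalize_measure (translate x \<mu>)"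

definition magnify_star :: "real \<Rightarrow> (real ^ 'n) measure \<Rightarrow> (real ^ 'n) measure" where
  "magnify_star t \<mu> = normalize_measure (magnify t \<mu>)"


section \<open>Fractal distributions\<close>

definition scale_invariant :: "(real ^ 'n) measure measure \<Rightarrow> bool" where
  "scale_invariant P \<longleftrightarrow>
     emeasure P radon_at_origin = 1 \<and>
     (\<forall>\<A>\<in>sets (borel_of radon_topology). \<A> \<subseteq> radon_at_origin \<longrightarrow>
        (\<forall>t>0. emeasure P {\<mu> \<in> radon_at_origin. magnify_star t \<mu> \<in> \<A>} = emeasure P \<A>))"

definition quasi_palm :: "(real ^ 'n) measure measure \<Rightarrow> bool" where
  "quasi_palm P \<longleftrightarrow>
     (\<forall>\<A>\<in>sets (borel_of radon_topology).
        emeasure P \<A> = 1 \<longleftrightarrow> (AE \<nu> in P. AE z in \<nu>. translate_star z \<nu> \<in> \<A>))"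

definition extended_fractal_distributions :: "(real ^ 'n) measure measure set" where
  "extended_fractal_distributions =
     {P \<in> prob_measures radon_topology. scale_invariant P \<and> quasi_palm P}"

text \<open>The push-forward \<open>P\<^sup>\<box>\<close>. Since \<^const>\<open>box_normalize\<close> is defined only for measures charging
  \<^const>\<open>unit_box\<close>, \<open>P\<close> is first restricted to these; for scale-invariant \<open>P\<close> they have full
  measure.\<close>

definition box_distr :: "(real ^ 'n) measure measure \<Rightarrow> (real ^ 'n) measure measure" where
  "box_distr P = distr (restrict_space P {\<mu> \<in> radon_measures. emeasure \<mu> unit_box > 0})
     (borel_of box_topology) box_normalize"

definition fractal_distributions :: "(real ^ 'n) measure measure set" where
  "fractal_distributions = box_distr ` extended_fractal_distributions"

end

(*
  Quasi-Palm together with scale invariance yields a mass transport principle for an extended fractal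
  distribution P: if every point x of mu sends the mass F(T_x mu) u(y - x) / mu_x(N) to y, where F is
  bounded, measurable and invariant under scalar multiples and u <= N are bump functions, then the
  expected mass sent by the origin equals the expected mass received by it. Indeed the difference D
  averages out: at large magnification D(S_n mu) integrates to a boundary term of order e^-n, so suitable
  convex combinations of D(S_n mu), which converge P-almost everywhere, converge to 0.

  The mass transport principle, unlike the quasi-Palm property, is a family of identities between
  expectations and survives limits. With u = N it also gives a uniform tail bound on
  mu(ball R) / mu(ball r), hence tightness: fractal distributions P_i whose restrictions converge to Q
  have, along a subsequence, almost surely vaguely convergent representatives X_i -> Y. Scale invariance and
  mass transport pass from X_i to Y, and mass transport at all scales (first for continuous F, then
  by a monotone class argument for indicators) gives back the quasi-Palm property of the law of the
  normalized Y. Finally Y does not charge the boundary of the unit cube, by scale invariance, so restriction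
  to the cube is continuous at Y and the restricted law of Y is Q.
*)
theory Submission
  imports Defs
begin

text \<open>The quasi-Palm property is an equivalence between null sets, and null sets are invisible
  to weak limits; hence the exchange for identities between expectations. That exchange is delicate
  for the same reason: the property carries only almost sure statements between the origin and
  typical points. So the averages of D must converge almost everywhere and not just in mean; their
  limit is recognized as zero at typical points, where it can be integrated against the measure
  itself, and then carried back to the origin. A second obstacle is that the mass of the cube is not
  vaguely continuous. The functionals are therefore chosen invariant under scaling of the measure,
  and where a normalization is unavoidable the integral of a continuous bump replaces the mass of
  the cube, until the boundary is known to be null. Almost sure representatives come from the
  Skorohod theorem on the line: laws of random measures are coded in the Hilbert cube by countably
  many integrals, moved to the Cantor set by a Borel section of a space-filling curve, and moved
  back by the continuous curve.\<close>

section \<open>A Skorohod representation on the Hilbert cube\<close>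

text \<open>Pitfall: \<^term>\<open>infdist x {} = 0\<close>, so the plateaus of \<^term>\<open>UNIV\<close> vanish.\<close>

definition plateau :: "'a::metric_space set \<Rightarrow> nat \<Rightarrow> 'a \<Rightarrow> real" where
  "plateau A n x = min 1 (real n * infdist x (- A))"

lemma plateau_nonneg: "0 \<le> plateau A n x"
  by (simp add: plateau_def infdist_nonneg)

lemma plateau_le_1: "plateau A n x \<le> 1"
  by (simp add: plateau_def)

lemma plateau_outside: "x \<notin> A \<Longrightarrow> plateau A n x = 0"
  by (simp add: plateau_def)

lemma continuous_plateau [continuous_intros]: "continuous_on S (plateau A n)"
  unfolding plateau_def by (intro continuous_intros)

lemma borel_measurable_plateau [measurable]: "plateau A n \<in> borel_measurable borel"
  by (rule borel_measurable_continuous_onI) (rule continuous_plateau)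

lemma plateau_le_indicator: "plateau A n x \<le> indicator A x"
  by (simp add: indicator_def plateau_le_1 plateau_outside)

lemma plateau_tendsto:
  assumes "open A" "A \<noteq> UNIV"
  shows "(\<lambda>n. plateau A n x) \<longlonglongrightarrow> indicator A x"
proof (cases "x \<in> A")
  case True
  have "infdist x (- A) > 0"
    using assms True in_closed_iff_infdist_zero[of "- A" x] infdist_nonneg[of x "- A"]
    by (metis ComplD closed_Compl Compl_empty_eq double_complement less_eq_real_def)
  then obtain n0 :: nat where n0: "real n0 * infdist x (- A) > 1"
    using reals_Archimedean3 by blast
  have "plateau A n x = 1" if "n \<ge> n0" for n
  proof -
    have "real n * infdist x (- A) \<ge> real n0 * infdist x (- A)"
      using that by (intro mult_right_mono) (auto simp: infdist_nonneg)
    then show ?thesis using n0 by (simp add: plateau_def)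
  qed
  then show ?thesis using True
    by (intro tendsto_eventually) (auto simp: eventually_sequentially)
qed (simp add: plateau_outside)

lemma plateau_integral_tendsto:
  fixes L :: "'a::metric_space measure"
  assumes "prob_space L" "sets L = sets borel" "open A" "A \<noteq> UNIV"
  shows "(\<lambda>n. \<integral>x. plateau A n x \<partial>L) \<longlonglongrightarrow> measure L A"
proof -
  interpret prob_space L by fact
  have [measurable_cong]: "sets L = sets borel" by fact
  have [measurable]: "A \<in> sets borel" using assms by auto
  have "(\<lambda>n. \<integral>x. plateau A n x \<partial>L) \<longlonglongrightarrow> (\<integral>x. indicator A x \<partial>L)"
    by (rule integral_dominated_convergence[where w = "\<lambda>_. 1"])
      (auto simp: plateau_tendsto assms plateau_nonneg plateau_le_1)
  then show ?thesis using assms by (simp add: sets_eq_imp_space_eq[OF assms(2)])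
qed

text \<open>Finite intersections of a countable basis. A countable pi-system of open sets lets
  countably many plateau integrals determine a Borel probability measure.\<close>

lemma countable_Int_stable_basis:
  obtains \<A> :: "'a::second_countable_topology set set" where
    "countable \<A>" "Int_stable \<A>" "\<And>A. A \<in> \<A> \<Longrightarrow> open A" "sets borel = sigma_sets UNIV \<A>" "UNIV \<in> \<A>"
proof -
  obtain B :: "'a set set" where B: "countable B" "topological_basis B"
    using ex_countable_basis by auto
  define \<A> where "\<A> = Inter ` {S. finite S \<and> S \<subseteq> B}"
  have 1: "countable \<A>"
    unfolding \<A>_def by (intro countable_image countable_Collect_finite_subset B)
  have 2: "Int_stable \<A>"
  proof (rule Int_stableI)
    fix a b assume "a \<in> \<A>" "b \<in> \<A>"
    then obtain S T where "a = \<Inter>S" "b = \<Inter>T" "finite S" "S \<subseteq> B" "finite T" "T \<subseteq> B"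
      unfolding \<A>_def by auto
    then show "a \<inter> b \<in> \<A>" unfolding \<A>_def
      by (intro image_eqI[where x = "S \<union> T"]) auto
  qed
  have 3: "open A" if "A \<in> \<A>" for A
    using that topological_basis_open[OF B(2)] unfolding \<A>_def by (auto intro!: open_Inter)
  have 5: "UNIV \<in> \<A>" unfolding \<A>_def by (intro image_eqI[where x = "{}"]) auto
  have "B \<subseteq> \<A>"
  proof
    fix b assume "b \<in> B"
    then show "b \<in> \<A>" unfolding \<A>_def by (intro image_eqI[where x = "{b}"]) auto
  qed
  then have "topological_basis \<A>"
    using B(2) 3 unfolding topological_basis_def by (meson order_trans)
  then have "borel = sigma UNIV \<A>" using 1 by (rule borel_eq_countable_basis[rotated])
  then have 4: "sets borel = sigma_sets UNIV \<A>" by (metis sets_measure_of subset_UNIV PowI subsetI)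
  show ?thesis using that[OF 1 2 3 4 5] by auto
qed

lemma countable_Int_stable_basis_enum:
  obtains A :: "nat \<Rightarrow> 'a::second_countable_topology set" where
    "Int_stable (range A)" "\<And>n. open (A n)" "sets borel = sigma_sets UNIV (range A)" "UNIV \<in> range A"
proof -
  obtain \<A> :: "'a set set" where \<A>: "countable \<A>" "Int_stable \<A>" "\<And>A. A \<in> \<A> \<Longrightarrow> open A"
    "sets borel = sigma_sets UNIV \<A>" "UNIV \<in> \<A>"
    using countable_Int_stable_basis by metis
  have *: "range (from_nat_into \<A>) = \<A>"
    using \<A>(1,5) by (intro range_from_nat_into) auto
  show ?thesis
    by (rule that[of "from_nat_into \<A>"]) (use \<A> * in \<open>auto intro: from_nat_into\<close>)
qed

text \<open>Plateau integrals converge to the masses of the open sets \<open>A k\<close>, and these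
  sets form a generating pi-system.\<close>

lemma prob_eq_of_plateau:
  fixes L L' :: "'a::{metric_space, second_countable_topology} measure"
  assumes L: "prob_space L" "sets L = sets borel" and L': "prob_space L'" "sets L' = sets borel"
    and gen: "Int_stable (range A)" "\<And>k. open (A k)" "sets borel = sigma_sets UNIV (range A)"
      "UNIV \<in> range A"
    and eq: "\<And>k n. (\<integral>x. plateau (A k) n x \<partial>L) = (\<integral>x. plateau (A k) n x \<partial>L')"
  shows "L = L'"
proof (rule measure_eqI_generator_eq[where E = "range A" and \<Omega> = UNIV and A = "\<lambda>_. UNIV"])
  interpret L: prob_space L by fact
  interpret L': prob_space L' by fact
  have sp: "space L = UNIV" "space L' = UNIV"
    using L(2) L'(2) by (auto dest: sets_eq_imp_space_eq)
  show "emeasure L X = emeasure L' X" if "X \<in> range A" for X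
  \<comment> \<open>The plateaus of the whole space vanish, so its mass is compared through the
    total mass 1.\<close>
  proof (cases "X = UNIV")
    case True
    then show ?thesis using L.emeasure_space_1 L'.emeasure_space_1 sp by simp
  next
    case False
    from that obtain k where k: "X = A k" by blast
    have ne: "A k \<noteq> UNIV" using False k by simp
    have "measure L X = measure L' X"
      using plateau_integral_tendsto[OF L gen(2) ne] plateau_integral_tendsto[OF L' gen(2) ne]
      unfolding eq k by (rule LIMSEQ_unique)
    then show ?thesis by (simp add: L.emeasure_eq_measure L'.emeasure_eq_measure)
  qed
  show "emeasure L UNIV \<noteq> \<infinity>"
    using L.emeasure_space_1 sp by simp
qed (use assms in auto)

section \<open>Schoenberg's curve and a Borel section of it\<close>

text \<open>An even function of period 2 that is 0 on [0, 1/3] and 1 on [2/3, 1], because the cosine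
  is 1/2 and -1/2 at the inner end points. It reads a leading ternary digit 0 or 2 as the bit 0 or
  1.\<close>

definition ramp :: "real \<Rightarrow> real" where
  "ramp t = max 0 (min 1 (1/2 - cos (pi * t)))"

text \<open>Schoenberg's space-filling curve, here onto the Hilbert cube.\<close>

definition hilbert_curve :: "real \<Rightarrow> nat \<Rightarrow> real" where
  "hilbert_curve t j = (\<Sum>k. ramp (3 ^ prod_encode (j, k) * t) / 2 ^ Suc k)"

text \<open>The digit of weight 2^-(k+1). Floors select the expansion that does not end in ones, and
  they make the digit a Borel function.\<close>

definition binary_digit :: "real \<Rightarrow> nat \<Rightarrow> real" where
  "binary_digit x k = real_of_int (\<lfloor>2 ^ Suc k * x\<rfloor> - 2 * \<lfloor>2 ^ k * x\<rfloor>)"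

definition interleaved_digit :: "(nat \<Rightarrow> real) \<Rightarrow> nat \<Rightarrow> real" where
  "interleaved_digit y i = binary_digit (y (fst (prod_decode i))) (snd (prod_decode i))"

text \<open>The point of the Cantor set whose ternary digits encode the binary digits of all
  coordinates at once.\<close>

definition hilbert_section :: "(nat \<Rightarrow> real) \<Rightarrow> real" where
  "hilbert_section y = (\<Sum>i. 2 * interleaved_digit y i / 3 ^ Suc i)"

lemma ramp_bounds: "0 \<le> ramp t" "ramp t \<le> 1"
  by (auto simp: ramp_def)

lemma continuous_hilbert_curve: "continuous_on UNIV hilbert_curve"
proof (rule continuous_on_coordinatewise_then_product)
  fix j
  have "uniform_limit UNIV (\<lambda>n t. \<Sum>k<n. ramp (3 ^ prod_encode (j, k) * t) / 2 ^ Suc k)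
      (\<lambda>t. \<Sum>k. ramp (3 ^ prod_encode (j, k) * t) / 2 ^ Suc k) sequentially"
  proof (rule Weierstrass_m_test)
    show "norm (ramp (3 ^ prod_encode (j, n) * x) / 2 ^ Suc n) \<le> (1/2) ^ Suc n" for n x
      using ramp_bounds by (auto simp: power_divide divide_simps)
    show "summable (\<lambda>n. (1/2::real) ^ Suc n)"
      by (subst summable_Suc_iff) (auto simp: summable_geometric)
  qed
  moreover have "continuous_on UNIV (\<lambda>t. \<Sum>k<n. ramp (3 ^ prod_encode (j, k) * t) / 2 ^ Suc k)" for n
    unfolding ramp_def by (intro continuous_intros) auto
  ultimately show "continuous_on UNIV (\<lambda>t. hilbert_curve t j)"
    unfolding hilbert_curve_def
    by (intro uniform_limit_theorem[where F = sequentially]) auto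
qed

lemma binary_digit_01: "binary_digit x k = 0 \<or> binary_digit x k = 1"
proof -
  have "2 ^ Suc k * x = 2 * (2 ^ k * x)" by simp
  moreover have "\<lfloor>2 * z\<rfloor> - 2 * \<lfloor>z\<rfloor> = 0 \<or> \<lfloor>2 * z\<rfloor> - 2 * \<lfloor>z\<rfloor> = 1" for z :: real
    by linarith
  ultimately show ?thesis unfolding binary_digit_def
    by (metis of_int_0 of_int_1)
qed

lemma binary_expansion:
  assumes "0 \<le> x" "x < 1"
  shows "(\<lambda>k. binary_digit x k / 2 ^ Suc k) sums x"
proof -
  \<comment> \<open>The partial sums telescope to the truncations of x; the start of the induction
    uses that x has integer part 0.\<close>
  have part: "(\<Sum>k<n. binary_digit x k / 2 ^ Suc k) = \<lfloor>2 ^ n * x\<rfloor> / 2 ^ n" for n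
  proof (induction n)
    case 0
    then show ?case using assms by (simp add: floor_eq_iff)
  next
    case (Suc n)
    then show ?case by (simp add: binary_digit_def field_simps)
  qed
  have "(\<lambda>n. \<lfloor>2 ^ n * x\<rfloor> / 2 ^ n) \<longlonglongrightarrow> x"
  proof (rule tendsto_sandwich)
    show "\<forall>\<^sub>F n in sequentially. x - (1/2) ^ n \<le> \<lfloor>2 ^ n * x\<rfloor> / 2 ^ n"
    proof (intro always_eventually allI)
      fix n
      have "2 ^ n * x - 1 \<le> \<lfloor>2 ^ n * x\<rfloor>" by linarith
      then have "(2 ^ n * x - 1) / 2 ^ n \<le> \<lfloor>2 ^ n * x\<rfloor> / 2 ^ n"
        by (intro divide_right_mono) auto
      then show "x - (1/2) ^ n \<le> \<lfloor>2 ^ n * x\<rfloor> / 2 ^ n"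
        by (simp add: diff_divide_distrib power_divide)
    qed
    show "\<forall>\<^sub>F n in sequentially. \<lfloor>2 ^ n * x\<rfloor> / 2 ^ n \<le> x"
      by (intro always_eventually allI) (simp add: divide_le_eq mult.commute)
    have "(\<lambda>n. x - (1/2) ^ n) \<longlonglongrightarrow> x - 0"
      by (intro tendsto_intros LIMSEQ_power_zero) auto
    then show "(\<lambda>n. x - (1/2) ^ n) \<longlonglongrightarrow> x" by simp
  qed auto
  then show ?thesis unfolding sums_def part .
qed

lemma interleaved_digit_01: "interleaved_digit y i = 0 \<or> interleaved_digit y i = 1"
  unfolding interleaved_digit_def by (rule binary_digit_01)

lemma interleaved_digit_bounds: "0 \<le> interleaved_digit y i" "interleaved_digit y i \<le> 1"
  using interleaved_digit_01[of y i] by auto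

lemma ternary_third: "(\<lambda>i. 2 / 3 ^ Suc i :: real) sums 1"
  using sums_mult[OF geometric_sums[of "1/3::real"], of "2/3"] by (simp add: power_divide)

lemma ternary_summable:
  "summable (\<lambda>i. 2 * interleaved_digit y (i + n) / 3 ^ Suc i)"
  by (rule summable_comparison_test'[OF sums_summable[OF ternary_third], of 0])
    (use interleaved_digit_bounds[of y] in \<open>auto simp: abs_mult divide_right_mono\<close>)

lemma ternary_bounds:
  "0 \<le> (\<Sum>i. 2 * interleaved_digit y (i + n) / 3 ^ Suc i)"
  "(\<Sum>i. 2 * interleaved_digit y (i + n) / 3 ^ Suc i) \<le> 1"
proof -
  show "0 \<le> (\<Sum>i. 2 * interleaved_digit y (i + n) / 3 ^ Suc i)"
    by (rule suminf_nonneg[OF ternary_summable])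
      (simp add: interleaved_digit_bounds)
  have "(\<Sum>i. 2 * interleaved_digit y (i + n) / 3 ^ Suc i) \<le> (\<Sum>i. 2 / 3 ^ Suc i)"
    by (rule suminf_le[OF _ ternary_summable sums_summable[OF ternary_third]])
      (simp add: interleaved_digit_bounds divide_right_mono)
  then show "(\<Sum>i. 2 * interleaved_digit y (i + n) / 3 ^ Suc i) \<le> 1"
    using sums_unique[OF ternary_third] by simp
qed

lemma ternary_shift:
  "3 * (\<Sum>i. 2 * interleaved_digit y (i + n) / 3 ^ Suc i) =
     2 * interleaved_digit y n + (\<Sum>i. 2 * interleaved_digit y (i + Suc n) / 3 ^ Suc i)"
proof -
  have "3 * (\<Sum>i. 2 * interleaved_digit y (i + n) / 3 ^ Suc i)
      = (\<Sum>i. 3 * (2 * interleaved_digit y (i + n) / 3 ^ Suc i))"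
    by (rule suminf_mult[symmetric, OF ternary_summable])
  also have "\<dots> = (\<Sum>i. 3 * (2 * interleaved_digit y (Suc i + n) / 3 ^ Suc (Suc i)))
      + 3 * (2 * interleaved_digit y (0 + n) / 3 ^ Suc 0)"
    using suminf_split_head[OF summable_mult[OF ternary_summable], of 3 y n] by simp
  finally show ?thesis by simp
qed

text \<open>Multiplication by 3^n shifts the ternary digits, up to an even integer that the period 2
  of \<open>ramp\<close> ignores. The remaining fraction lies in [0, 1/3] if the n-th bit is 0 and
  in [2/3, 1] if it is 1.\<close>

lemma ramp_hilbert_section:
  "ramp (3 ^ n * hilbert_section y) = interleaved_digit y n"
proof -
  define u where "u n = (\<Sum>i. 2 * interleaved_digit y (i + n) / 3 ^ Suc i)" for n
  have "\<exists>m::int. 3 ^ n * hilbert_section y = 2 * real_of_int m + u n" for n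
  proof (induction n)
    case 0
    show ?case by (rule exI[of _ 0]) (simp add: hilbert_section_def u_def)
  next
    case (Suc n)
    then obtain m :: int where m: "3 ^ n * hilbert_section y = 2 * real_of_int m + u n" by auto
    have "3 ^ Suc n * hilbert_section y = 6 * real_of_int m + 2 * interleaved_digit y n + u (Suc n)"
      using m ternary_shift[of y n] by (simp add: u_def algebra_simps)
    moreover obtain b :: int where "interleaved_digit y n = real_of_int b"
      using interleaved_digit_01[of y n] by (metis of_int_0 of_int_1)
    ultimately show ?case by (intro exI[of _ "3 * m + b"]) simp
  qed
  then obtain m :: int where m: "3 ^ n * hilbert_section y = 2 * real_of_int m + u n" by blast
  have "cos (pi * (2 * real_of_int m + u n)) = cos (pi * u n)"
    using cos.plus_of_int[of "pi * u n" m] by (simp add: algebra_simps)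
  then have r: "ramp (3 ^ n * hilbert_section y) = ramp (u n)"
    by (simp add: m ramp_def)
  have s: "3 * u n = 2 * interleaved_digit y n + u (Suc n)"
    using ternary_shift[of y n] by (simp add: u_def)
  have b: "0 \<le> u (Suc n)" "u (Suc n) \<le> 1"
    using ternary_bounds[of y "Suc n"] by (simp_all add: u_def)
  consider "interleaved_digit y n = 0" | "interleaved_digit y n = 1"
    using interleaved_digit_01[of y n] by blast
  then show ?thesis
  proof cases
    case 1
    have "cos (pi / 3) \<le> cos (pi * u n)"
      using 1 s b by (intro cos_monotone_0_pi_le) auto
    then show ?thesis using 1 unfolding r by (simp add: ramp_def cos_60)
  next
    case 2
    have "cos (pi * u n) \<le> cos (pi * (2/3))"
      using 2 s b by (intro cos_monotone_0_pi_le) auto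
    moreover have "cos (pi * (2/3)) = - (1/2)"
      using cos_120 by (simp add: mult.commute)
    ultimately show ?thesis using 2 unfolding r by (simp add: ramp_def)
  qed
qed

lemma hilbert_curve_section:
  assumes "\<And>j. 0 \<le> y j" "\<And>j. y j < 1"
  shows "hilbert_curve (hilbert_section y) = y"
proof
  fix j
  have "(\<lambda>k. binary_digit (y j) k / 2 ^ Suc k) sums y j"
    by (rule binary_expansion) (use assms in auto)
  then show "hilbert_curve (hilbert_section y) j = y j"
    by (simp add: hilbert_curve_def ramp_hilbert_section interleaved_digit_def sums_iff)
qed

lemma borel_measurable_hilbert_section [measurable]: "hilbert_section \<in> borel_measurable borel"
proof -
  have [measurable]: "(\<lambda>y. interleaved_digit y i) \<in> borel_measurable borel" for i
    unfolding interleaved_digit_def binary_digit_def by measurable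
  show ?thesis unfolding hilbert_section_def by measurable
qed

text \<open>The section is only Borel, but the continuous curve inverts it on the half-open cube. So
  the laws \<open>L i\<close> survive the round trip through the line, and convergence on the line
  becomes convergence in the cube. The limit may leave the half-open cube: coordinates equal to 1
  are possible.\<close>

lemma cube_Skorohod:
  fixes L :: "nat \<Rightarrow> (nat \<Rightarrow> real) measure"
  assumes L: "\<And>i. prob_space (L i)" "\<And>i. sets (L i) = sets borel"
    and cube: "\<And>i. AE y in L i. \<forall>k. 0 \<le> y k \<and> y k < 1"
  obtains r :: "nat \<Rightarrow> nat" and \<Omega> :: "real measure" and Z :: "nat \<Rightarrow> real \<Rightarrow> nat \<Rightarrow> real" and Z'
  where "strict_mono r" "prob_space \<Omega>" "\<And>i. Z i \<in> borel_measurable \<Omega>" "Z' \<in> borel_measurable \<Omega>"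
    "\<And>i. distr \<Omega> borel (Z i) = L (r i)" "\<And>\<omega>. \<omega> \<in> space \<Omega> \<Longrightarrow> (\<lambda>i. Z i \<omega>) \<longlonglongrightarrow> Z' \<omega>"
proof -
  define \<nu> where "\<nu> i = distr (L i) borel hilbert_section" for i
  have [measurable_cong]: "sets (L i) = sets borel" for i by (rule L)
  have rd: "real_distribution (\<nu> i)" for i
  proof -
    interpret L: prob_space "L i" by (rule L)
    interpret prob_space "\<nu> i" unfolding \<nu>_def by (rule L.prob_space_distr) simp
    show ?thesis by standard (simp_all add: \<nu>_def)
  qed
  have hs: "0 \<le> hilbert_section y" "hilbert_section y \<le> 1" for y
    using ternary_bounds[of y 0] by (simp_all add: hilbert_section_def)
  have hs': "-1 < hilbert_section y" for y
    using hs(1)[of y] by linarith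
  \<comment> \<open>The section attains 0, so an interval that is open on the left has to start
    below 0.\<close>
  have one: "measure (\<nu> i) {-1<..1} = 1" for i
  proof -
    interpret L: prob_space "L i" by (rule L)
    have "hilbert_section -` {- 1<..1} \<inter> space (L i) = space (L i)"
      using hs' hs(2) by auto
    then show ?thesis by (simp add: \<nu>_def measure_distr L.prob_space)
  qed
  have "tight \<nu>" unfolding tight_def
  proof (intro conjI allI impI rd)
    fix \<epsilon> :: real assume "\<epsilon> > 0"
    then show "\<exists>a b. a < b \<and> (\<forall>n. 1 - \<epsilon> < measure (\<nu> n) {a<..b})"
      by (intro exI[of _ "-1"] exI[of _ 1]) (simp add: one)
  qed
  from tight_imp_convergent_subsubsequence[OF this strict_mono_id] obtain r M where r: "strict_mono r"
    and M: "real_distribution M" and wc: "weak_conv_m (\<nu> \<circ> id \<circ> r) M" by blast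
  have "real_distribution ((\<nu> \<circ> id \<circ> r) n)" for n using rd by simp
  from Skorohod[OF this M wc] obtain \<Omega> :: "real measure" and Y Y' where Sk': "prob_space \<Omega> \<and>
    (\<forall>n. Y n \<in> measurable \<Omega> borel) \<and> (\<forall>n. distr \<Omega> borel (Y n) = (\<nu> \<circ> id \<circ> r) n) \<and>
    Y' \<in> measurable \<Omega> lborel \<and> distr \<Omega> borel Y' = M \<and> (\<forall>x\<in>space \<Omega>. (\<lambda>n. Y n x) \<longlonglongrightarrow> Y' x)"
    by metis
  then have Sk: "prob_space \<Omega>"
    "\<And>n. Y n \<in> measurable \<Omega> borel" "\<And>n. distr \<Omega> borel (Y n) = \<nu> (r n)"
    "Y' \<in> measurable \<Omega> lborel" "\<And>x. x \<in> space \<Omega> \<Longrightarrow> (\<lambda>n. Y n x) \<longlonglongrightarrow> Y' x"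
    by (simp_all only: comp_apply id_apply)
  have cm [measurable]: "hilbert_curve \<in> borel_measurable borel"
    by (rule borel_measurable_continuous_onI[OF continuous_hilbert_curve])
  note [measurable] = Sk(2)
  have [measurable]: "Y' \<in> borel_measurable \<Omega>" using Sk(4) by simp
  show ?thesis
  proof (rule that[of r \<Omega> "\<lambda>i \<omega>. hilbert_curve (Y i \<omega>)" "\<lambda>\<omega>. hilbert_curve (Y' \<omega>)"])
    show "distr \<Omega> borel (\<lambda>\<omega>. hilbert_curve (Y i \<omega>)) = L (r i)" for i
    proof -
      have "distr \<Omega> borel (\<lambda>\<omega>. hilbert_curve (Y i \<omega>)) = distr (distr \<Omega> borel (Y i)) borel hilbert_curve"
        by (subst distr_distr) (auto simp: comp_def)
      also have "\<dots> = distr (L (r i)) borel (hilbert_curve \<circ> hilbert_section)"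
        unfolding Sk(3) \<nu>_def by (rule distr_distr) auto
      also have "\<dots> = distr (L (r i)) borel (\<lambda>y. y)"
        using cube[of "r i"]
        by (intro distr_cong_AE) (auto elim!: eventually_mono simp: hilbert_curve_section)
      also have "\<dots> = L (r i)" by (rule distr_id2) (simp add: L)
      finally show ?thesis .
    qed
    show "(\<lambda>i. hilbert_curve (Y i \<omega>)) \<longlonglongrightarrow> hilbert_curve (Y' \<omega>)" if "\<omega> \<in> space \<Omega>" for \<omega>
      using Sk(5)[OF that] continuous_hilbert_curve
      by (metis UNIV_I continuous_on_tendsto_compose eventually_sequentiallyI)
  qed (use r Sk in auto)
qed

section \<open>Radon measures and vague convergence\<close>

definition cc :: "('a::euclidean_space \<Rightarrow> real) \<Rightarrow> bool" where
  "cc f \<longleftrightarrow> continuous_on UNIV f \<and> (\<exists>r. \<forall>x. r < norm x \<longrightarrow> f x = 0)"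

lemma cc_iff: "cc f \<longleftrightarrow> continuous_on UNIV f \<and> compact (closure {x. f x \<noteq> 0})"
proof -
  have "(\<exists>r. \<forall>x. r < norm x \<longrightarrow> f x = 0) \<longleftrightarrow> bounded {x. f x \<noteq> 0}"
    unfolding bounded_iff by (auto simp: not_less[symmetric])
  then show ?thesis by (simp add: cc_def)
qed

lemma ccI: "continuous_on UNIV f \<Longrightarrow> (\<And>x. r < norm x \<Longrightarrow> f x = 0) \<Longrightarrow> cc f"
  unfolding cc_def by auto

lemma cc_continuous: "cc f \<Longrightarrow> continuous_on UNIV f"
  by (simp add: cc_def)

lemma cc_borel [measurable_dest]: "cc f \<Longrightarrow> f \<in> borel_measurable borel"
  by (simp add: cc_def borel_measurable_continuous_onI)

lemma cc_supportE:
  assumes "cc f" obtains r where "r > 0" "\<And>x. r < norm x \<Longrightarrow> f x = 0"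
proof -
  obtain r where "\<And>x. r < norm x \<Longrightarrow> f x = 0" using assms by (auto simp: cc_def)
  then show ?thesis using that[of "max r 1"] by auto
qed

lemma cc_mult_left: "cc f \<Longrightarrow> continuous_on UNIV g \<Longrightarrow> cc (\<lambda>x. g x * f x)"
  unfolding cc_def by (auto intro: continuous_intros)

lemma cc_shift:
  assumes "cc f" shows "cc (\<lambda>x. f (x - a))"
proof -
  obtain r where r: "\<And>x. r < norm x \<Longrightarrow> f x = 0" using cc_supportE[OF assms] by metis
  show ?thesis
  proof (rule ccI[where r = "r + norm a"])
    show "continuous_on UNIV (\<lambda>x. f (x - a))"
      by (rule continuous_on_compose2[OF cc_continuous[OF assms]]) (auto intro!: continuous_intros)
    show "f (x - a) = 0" if "r + norm a < norm x" for x
      using that norm_triangle_ineq2[of x a] by (intro r) linarith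
  qed
qed

lemma cc_scaleR:
  assumes "cc f" "c \<noteq> 0" shows "cc (\<lambda>x. f (c *\<^sub>R x))"
proof -
  obtain r where r: "\<And>x. r < norm x \<Longrightarrow> f x = 0" using cc_supportE[OF assms(1)] by metis
  show ?thesis
  proof (rule ccI[where r = "r / \<bar>c\<bar>"])
    show "continuous_on UNIV (\<lambda>x. f (c *\<^sub>R x))"
      by (rule continuous_on_compose2[OF cc_continuous[OF assms(1)]]) (auto intro!: continuous_intros)
    show "f (c *\<^sub>R x) = 0" if "r / \<bar>c\<bar> < norm x" for x
      using that assms(2) by (intro r) (auto simp: field_simps)
  qed
qed

lemma cc_bounded:
  assumes "cc f" obtains B where "B > 0" "\<And>x. \<bar>f x\<bar> \<le> B"
proof -
  obtain r where r: "r > 0" "\<And>x. r < norm x \<Longrightarrow> f x = 0" using cc_supportE[OF assms] by metis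
  have "compact (f ` cball 0 r)"
    by (intro compact_continuous_image continuous_on_subset[OF cc_continuous[OF assms]]) auto
  then have "bounded (f ` cball 0 r)" by (rule compact_imp_bounded)
  then obtain B where B: "\<forall>y\<in>f ` cball 0 r. \<bar>y\<bar> \<le> B" unfolding bounded_iff by auto
  have "\<bar>f x\<bar> \<le> max B 1" for x
    using r(2)[of x] B by (cases "norm x \<le> r") (auto simp: le_max_iff_disj)
  then show ?thesis using that[of "max B 1"] by auto
qed

text \<open>A tent. Unlike the indicator of a ball or of \<open>unit_box\<close> it is continuous,
  so integrals against it pass to vague limits.\<close>

definition nbump :: "real \<Rightarrow> 'a::euclidean_space \<Rightarrow> real" where
  "nbump R x = max 0 (1 - norm x / R)"

lemma nbump_nonneg [simp]: "0 \<le> nbump R x"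
  and nbump_le_1: "R > 0 \<Longrightarrow> nbump R x \<le> 1"
  and nbump_outside: "R > 0 \<Longrightarrow> R \<le> norm x \<Longrightarrow> nbump R x = 0"
  and nbump_minus [simp]: "nbump R (- x) = nbump R x"
  and nbump_pos: "R > 0 \<Longrightarrow> norm x < R \<Longrightarrow> nbump R x > 0"
  by (auto simp: nbump_def)

lemma nbump_ge_half: "R > 0 \<Longrightarrow> norm x \<le> R / 2 \<Longrightarrow> nbump R x \<ge> 1/2"
  by (auto simp: nbump_def field_simps)

lemma nbump_mono: "0 < R \<Longrightarrow> R \<le> S \<Longrightarrow> nbump R x \<le> nbump S x"
  unfolding nbump_def by (intro max.mono diff_left_mono divide_left_mono) auto

lemma cc_nbump: "R > 0 \<Longrightarrow> cc (nbump R)"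
  by (rule ccI[where r = R]) (auto simp: nbump_def intro!: continuous_intros)

lemma nbump_measurable [measurable]: "nbump R \<in> borel_measurable borel"
  unfolding nbump_def by measurable

section \<open>Radon measures and their images under affine maps\<close>

text \<open>Inner regularity is derived from finiteness on balls: cut off at a ball the measure is
  finite, a finite Borel measure on a Polish space is inner regular, and the balls exhaust the
  space.\<close>

lemma radon_measures_iff:
  "\<mu> \<in> radon_measures \<longleftrightarrow> sets \<mu> = sets borel \<and> (\<forall>n::nat. emeasure \<mu> (cball 0 (real n)) < \<infinity>)"
proof safe
  assume \<mu>: "sets \<mu> = sets borel" "\<forall>n::nat. emeasure \<mu> (cball 0 (real n)) < \<infinity>"
  have sp: "space \<mu> = UNIV" using sets_eq_imp_space_eq[OF \<mu>(1)] by simp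
  have [measurable_cong]: "sets \<mu> = sets borel" by fact
  have "emeasure \<mu> A = (SUP K\<in>{K. compact K \<and> K \<subseteq> A}. emeasure \<mu> K)" if [measurable]: "A \<in> sets borel" for A
  proof (rule antisym)
    have "emeasure \<mu> A = emeasure \<mu> (\<Union>n::nat. A \<inter> cball 0 (real n))"
      by (rule arg_cong[where f = "emeasure \<mu>"]) (auto simp: real_arch_simple)
    also have "\<dots> = (SUP n::nat. emeasure \<mu> (A \<inter> cball 0 (real n)))"
      by (rule SUP_emeasure_incseq[symmetric]) (auto simp: incseq_def)
    also have "\<dots> \<le> (SUP K\<in>{K. compact K \<and> K \<subseteq> A}. emeasure \<mu> K)"
    proof (rule SUP_least)
      fix n :: nat
      define \<nu> where "\<nu> = density \<mu> (indicator (cball 0 (real n)))"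
      have \<nu>: "emeasure \<nu> B = emeasure \<mu> (B \<inter> cball 0 (real n))" if "B \<in> sets borel" for B
        proof -
        have [measurable]: "B \<in> sets \<mu>" "cball 0 (real n) \<in> sets \<mu>" using that \<mu>(1) by auto
        show ?thesis unfolding \<nu>_def
          by (subst emeasure_density) (auto simp: indicator_inter_arith[symmetric] Int_commute mult.commute)
      qed
      have "emeasure \<mu> (A \<inter> cball 0 (real n)) = emeasure \<nu> A" by (simp add: \<nu>)
      also have "\<dots> = (SUP K \<in> {K. K \<subseteq> A \<and> compact K}. emeasure \<nu> K)"
        using \<nu>[of UNIV] \<mu>(2)[rule_format, of n] \<mu>(1)
        by (intro inner_regular) (auto simp: \<nu>_def sp)
      also have "\<dots> \<le> (SUP K\<in>{K. compact K \<and> K \<subseteq> A}. emeasure \<mu> K)"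
      proof (rule SUP_mono)
        fix K assume K: "K \<in> {K. K \<subseteq> A \<and> compact K}"
        then have "emeasure \<nu> K = emeasure \<mu> (K \<inter> cball 0 (real n))"
          by (intro \<nu>) (auto intro: borel_compact)
        moreover have "K \<inter> cball 0 (real n) \<in> {K. compact K \<and> K \<subseteq> A}" using K by auto
        ultimately show "\<exists>K'\<in>{K. compact K \<and> K \<subseteq> A}. emeasure \<nu> K \<le> emeasure \<mu> K'"
          by (intro bexI) auto
      qed
      finally show "emeasure \<mu> (A \<inter> cball 0 (real n)) \<le> \<dots>" .
    qed
    finally show "emeasure \<mu> A \<le> (SUP K\<in>{K. compact K \<and> K \<subseteq> A}. emeasure \<mu> K)" .
    show "(SUP K\<in>{K. compact K \<and> K \<subseteq> A}. emeasure \<mu> K) \<le> emeasure \<mu> A"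
      by (rule SUP_least) (auto intro!: emeasure_mono)
  qed
  moreover have "emeasure \<mu> K < \<infinity>" if K: "compact K" for K
  proof -
    obtain b where "\<forall>x\<in>K. norm x \<le> b" using compact_imp_bounded[OF K] by (auto simp: bounded_iff)
    moreover obtain n :: nat where "b \<le> real n" using real_arch_simple by blast
    ultimately have "K \<subseteq> cball 0 (real n)" by force
    then have "emeasure \<mu> K \<le> emeasure \<mu> (cball 0 (real n))" by (intro emeasure_mono) auto
    also have "\<dots> < \<infinity>" using \<mu>(2) by simp
    finally show ?thesis .
  qed
  ultimately show "\<mu> \<in> radon_measures" using \<mu>(1) unfolding radon_measures_def by auto
next
  fix n :: nat
  assume "\<mu> \<in> radon_measures"
  then have "\<forall>K. compact K \<longrightarrow> emeasure \<mu> K < \<infinity>" by (simp add: radon_measures_def)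
  then show "emeasure \<mu> (cball 0 (real n)) < \<infinity>" by simp
qed (auto simp: radon_measures_def)

lemma radon_sets: "\<mu> \<in> radon_measures \<Longrightarrow> sets \<mu> = sets borel"
  and radon_space: "\<mu> \<in> radon_measures \<Longrightarrow> space \<mu> = UNIV"
  using sets_eq_imp_space_eq[of \<mu> borel] by (auto simp: radon_measures_def)

lemma radon_emeasure_bounded:
  assumes "\<mu> \<in> radon_measures" "bounded A" shows "emeasure \<mu> A < \<infinity>"
proof -
  obtain b where "\<forall>x\<in>A. norm x \<le> b" using assms(2) by (auto simp: bounded_iff)
  moreover obtain n :: nat where "b \<le> real n" using real_arch_simple by blast
  ultimately have "A \<subseteq> cball 0 (real n)" by force
  then have "emeasure \<mu> A \<le> emeasure \<mu> (cball 0 (real n))"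
    using assms(1) by (intro emeasure_mono) (auto simp: radon_sets)
  also have "\<dots> < \<infinity>" using assms(1) by (simp add: radon_measures_iff)
  finally show ?thesis .
qed

lemma radon_sigma_finite:
  fixes \<mu> :: "(real ^ 'n) measure"
  assumes "\<mu> \<in> radon_measures" shows "sigma_finite_measure \<mu>"
proof
  show "\<exists>A. countable A \<and> A \<subseteq> sets \<mu> \<and> \<Union>A = space \<mu> \<and> (\<forall>a\<in>A. emeasure \<mu> a \<noteq> \<infinity>)"
  proof (intro exI[of _ "range (\<lambda>n::nat. cball 0 (real n))"] conjI)
    show "\<forall>a\<in>range (\<lambda>n::nat. cball 0 (real n)). emeasure \<mu> a \<noteq> \<infinity>"
    proof
      fix a :: "(real ^ 'n) set" assume "a \<in> range (\<lambda>n::nat. cball 0 (real n))"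
      then have "bounded a" by auto
      then show "emeasure \<mu> a \<noteq> \<infinity>" using radon_emeasure_bounded[OF assms] by (simp add: less_top)
    qed
    show "(\<Union>n::nat. cball 0 (real n)) = space \<mu>"
      unfolding radon_space[OF assms] by (auto simp: real_arch_simple)
  qed (simp_all add: image_subset_iff radon_sets[OF assms])
qed

lemma borel_to_radon_measurable: "\<mu> \<in> radon_measures \<Longrightarrow> g \<in> measurable borel N \<Longrightarrow> g \<in> measurable \<mu> N"
  using measurable_cong_sets[OF radon_sets refl] by blast

lemma radon_integrable_bounded:
  fixes f :: "real ^ 'n \<Rightarrow> real"
  assumes "\<mu> \<in> radon_measures" "f \<in> borel_measurable borel" "\<And>x. \<bar>f x\<bar> \<le> B" "\<And>x. r < norm x \<Longrightarrow> f x = 0"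
  shows "integrable \<mu> f"
proof (rule integrableI_bounded_set[where A = "cball 0 r" and B = B])
  show "f \<in> borel_measurable \<mu>" by (rule borel_to_radon_measurable) fact+
  show "emeasure \<mu> (cball 0 r) < \<infinity>" by (rule radon_emeasure_bounded[OF assms(1) bounded_cball])
  show "AE x in \<mu>. x \<notin> cball 0 r \<longrightarrow> f x = 0" by (intro AE_I2) (simp add: assms(4))
  show "AE x in \<mu>. x \<in> cball 0 r \<longrightarrow> norm (f x) \<le> B" by (intro AE_I2) (simp add: assms(3))
qed (simp add: radon_sets[OF assms(1)])

lemma radon_integrable: "\<mu> \<in> radon_measures \<Longrightarrow> cc f \<Longrightarrow> integrable \<mu> f"
proof -
  assume m: "\<mu> \<in> radon_measures" and f: "cc f"
  obtain B where B: "\<And>x. \<bar>f x\<bar> \<le> B" using cc_bounded[OF f] by blast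
  obtain r where r: "\<And>x. r < norm x \<Longrightarrow> f x = 0" using cc_supportE[OF f] by blast
  show ?thesis by (rule radon_integrable_bounded[OF m cc_borel[OF f] B r])
qed

lemma scale_measure_eq_density:
  "scale_measure (ennreal c) \<mu> = density \<mu> (\<lambda>_. ennreal c)"
  by (rule measure_eqI) (auto simp: emeasure_density nn_integral_cmult_indicator)

lemma integral_scale_measure:
  fixes f :: "'a \<Rightarrow> real"
  assumes "c \<ge> 0" "f \<in> borel_measurable \<mu>"
  shows "(\<integral>x. f x \<partial>scale_measure (ennreal c) \<mu>) = c * (\<integral>x. f x \<partial>\<mu>)"
  unfolding scale_measure_eq_density
  by (subst integral_real_density) (simp_all add: assms)

lemma radon_scale: "\<mu> \<in> radon_measures \<Longrightarrow> scale_measure (ennreal c) \<mu> \<in> radon_measures"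
  by (auto simp: radon_measures_iff ennreal_mult_less_top)

lemma radon_null: "null_measure borel \<in> radon_measures"
  by (simp add: radon_measures_iff)

lemma radon_distr:
  fixes g :: "real ^ 'n \<Rightarrow> real ^ 'n"
  assumes "\<mu> \<in> radon_measures" "continuous_on UNIV g" "\<And>n::nat. bounded (g -` cball 0 (real n))"
  shows "distr \<mu> borel g \<in> radon_measures"
proof -
  have [measurable]: "g \<in> borel_measurable borel" using assms(2) by (rule borel_measurable_continuous_onI)
  have "g \<in> measurable \<mu> borel" by (rule borel_to_radon_measurable[OF assms(1)]) simp
  then show ?thesis
    using radon_space[OF assms(1)] radon_emeasure_bounded[OF assms(1,3)]
    by (auto simp: radon_measures_iff emeasure_distr)
qed

lemma radon_translate: "\<mu> \<in> radon_measures \<Longrightarrow> translate x \<mu> \<in> radon_measures"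
  unfolding translate_def
proof (rule radon_distr)
  fix n :: nat
  have "(\<lambda>y. y - x) -` cball 0 (real n) = cball x (real n)"
    by (auto simp: dist_norm norm_minus_commute)
  then show "bounded ((\<lambda>y. y - x) -` cball 0 (real n))" by simp
qed (auto intro!: continuous_intros)

lemma radon_magnify:
  fixes \<mu> :: "(real ^ 'n) measure"
  shows "\<mu> \<in> radon_measures \<Longrightarrow> magnify t \<mu> \<in> radon_measures"
  unfolding magnify_def
proof (rule radon_distr)
  fix n :: nat
  have "(\<lambda>y::real^'n. exp t *\<^sub>R y) -` cball 0 (real n) \<subseteq> cball 0 (real n / exp t)"
  proof
    fix y :: "real ^ 'n" assume "y \<in> (\<lambda>y. exp t *\<^sub>R y) -` cball 0 (real n)"
    then have "norm (exp t *\<^sub>R y) \<le> real n" by (simp only: vimage_eq mem_cball_0)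
    then show "y \<in> cball 0 (real n / exp t)"
      by (simp only: mem_cball_0) (simp add: pos_le_divide_eq mult.commute)
  qed
  then show "bounded ((\<lambda>y::real^'n. exp t *\<^sub>R y) -` cball 0 (real n))" by (rule bounded_subset[rotated]) simp
qed (auto intro!: continuous_intros)

lemma integral_translate:
  fixes f :: "real ^ 'n \<Rightarrow> real"
  assumes "\<mu> \<in> radon_measures" "f \<in> borel_measurable borel"
  shows "(\<integral>y. f y \<partial>translate x \<mu>) = (\<integral>y. f (y - x) \<partial>\<mu>)"
  unfolding translate_def
  by (rule integral_distr[OF borel_to_radon_measurable[OF assms(1)] assms(2)]) measurable

lemma integral_magnify:
  fixes f :: "real ^ 'n \<Rightarrow> real"
  assumes "\<mu> \<in> radon_measures" "f \<in> borel_measurable borel"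
  shows "(\<integral>y. f y \<partial>magnify t \<mu>) = (\<integral>y. f (exp t *\<^sub>R y) \<partial>\<mu>)"
  unfolding magnify_def
  by (rule integral_distr[OF borel_to_radon_measurable[OF assms(1)] assms(2)]) measurable

section \<open>Vague convergence and vague compactness\<close>

definition vconv :: "(nat \<Rightarrow> (real ^ 'n) measure) \<Rightarrow> (real ^ 'n) measure \<Rightarrow> bool" where
  "vconv X \<mu> \<longleftrightarrow> (\<forall>f. cc f \<longrightarrow> (\<lambda>i. \<integral>x. f x \<partial>X i) \<longlonglongrightarrow> (\<integral>x. f x \<partial>\<mu>))"

text \<open>A homeomorphism onto the open unit ball and its inverse. Escape to infinity becomes
  convergence to the unit sphere.\<close>

definition squash :: "'a::euclidean_space \<Rightarrow> 'a" where "squash x = x /\<^sub>R (1 + norm x)"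
definition unsquash :: "'a::euclidean_space \<Rightarrow> 'a" where "unsquash v = v /\<^sub>R (1 - norm v)"

lemma norm_squash: "norm (squash x) = norm x / (1 + norm x)"
  by (simp add: squash_def divide_inverse mult.commute)

lemma norm_squash_less: "norm (squash x) < 1"
proof -
  have "0 < 1 + norm x" using norm_ge_zero[of x] by linarith
  then show ?thesis unfolding norm_squash by (simp add: divide_less_eq_1_pos)
qed

lemma unsquash_squash [simp]: "unsquash (squash x) = x"
proof -
  have p: "1 + norm x > 0" using norm_ge_zero[of x] by linarith
  have "1 - norm (squash x) = 1 / (1 + norm x)" unfolding norm_squash using p by (simp add: diff_divide_eq_iff)
  then show ?thesis unfolding unsquash_def using p by (simp add: squash_def)
qed

lemma norm_unsquash: "norm v < 1 \<Longrightarrow> norm (unsquash v) = norm v / (1 - norm v)"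
  by (simp add: unsquash_def divide_inverse mult.commute)

lemma continuous_unsquash: "continuous_on (ball 0 1) unsquash"
  unfolding unsquash_def by (intro continuous_intros) auto

text \<open>The support of \<open>h\<close> is mapped into the ball of radius r / (1 + r) < 1, so
  the extension vanishes near the sphere and the two continuous pieces overlap on an open
  set.\<close>

lemma continuous_squash_extend:
  assumes "cc h"
  shows "continuous_on UNIV (\<lambda>v. if norm v < 1 then h (unsquash v) else 0)" (is "continuous_on _ ?g")
proof -
  obtain r where r: "r > 0" "\<And>x. r < norm x \<Longrightarrow> h x = 0" using cc_supportE[OF assms] by metis
  define s where "s = r / (1 + r)"
  have s: "0 < s" "s < 1" using r(1) by (auto simp: s_def field_simps)
  have "continuous_on (ball 0 1) (\<lambda>v. h (unsquash v))"
    by (rule continuous_on_compose2[OF cc_continuous[OF assms] continuous_unsquash]) auto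
  then have 1: "continuous_on (ball 0 1) ?g"
    by (subst continuous_on_cong[OF refl, where g = "\<lambda>v. h (unsquash v)"]) auto
  have zero: "?g v = 0" if "v \<in> - cball 0 s" for v
  proof (cases "norm v < 1")
    case True
    have "r < norm v / (1 - norm v)"
    proof -
      have "s < norm v" using that by simp
      then have "r < norm v * (1 + r)" using r(1) by (simp add: s_def pos_divide_less_eq)
      then show ?thesis using True by (simp add: pos_less_divide_eq algebra_simps)
    qed
    then show ?thesis using True r(2)[of "unsquash v"] by (simp add: norm_unsquash)
  qed simp
  have 2: "continuous_on (- cball 0 s) ?g"
    by (subst continuous_on_cong[OF refl zero]) auto
  have "ball 0 1 \<union> - cball 0 s = (UNIV :: 'a set)" using s by auto
  then show ?thesis using continuous_on_open_Un[OF _ _ 1 2] by auto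
qed

text \<open>From the dimension on, \<open>from_nat_into Basis k\<close> is some default basis
  vector. These repeated coordinates stay in the cube, and \<open>cube_point\<close> does not read
  them.\<close>

definition cube_coord :: "'a::euclidean_space \<Rightarrow> nat \<Rightarrow> real" where
  "cube_coord x k = (1 + squash x \<bullet> from_nat_into Basis k) / 2"

definition cube_point :: "(nat \<Rightarrow> real) \<Rightarrow> 'a::euclidean_space" where
  "cube_point y = (\<Sum>b\<in>Basis. (2 * y (to_nat_on Basis b) - 1) *\<^sub>R b)"

lemma cube_point_coord [simp]: "cube_point (cube_coord x) = squash x"
proof -
  have "cube_point (cube_coord x) = (\<Sum>b\<in>Basis. (squash x \<bullet> b) *\<^sub>R b)"
    unfolding cube_point_def cube_coord_def
    by (intro sum.cong refl) (simp add: from_nat_into_to_nat_on countable_finite add_divide_distrib)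
  then show ?thesis by (simp add: euclidean_representation)
qed

lemma cube_coord_bounds: "0 \<le> cube_coord x k" "cube_coord x k < 1"
proof -
  have "from_nat_into Basis k \<in> (Basis :: 'a set)" by (intro from_nat_into) auto
  from Basis_le_norm[OF this, of "squash x"] norm_squash_less[of x]
  have "\<bar>squash x \<bullet> from_nat_into Basis k\<bar> < 1" by linarith
  then show "0 \<le> cube_coord x k" "cube_coord x k < 1" by (auto simp: cube_coord_def)
qed

lemma continuous_cube_point: "continuous_on UNIV (cube_point :: _ \<Rightarrow> 'a::euclidean_space)"
  unfolding cube_point_def by (intro continuous_intros continuous_on_product_coordinates)

lemma borel_measurable_cube_point [measurable]: "cube_point \<in> borel_measurable borel"
  by (rule borel_measurable_continuous_onI[OF continuous_cube_point])

lemma borel_measurable_cube_coord [measurable]: "cube_coord \<in> borel_measurable borel"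
  unfolding cube_coord_def squash_def
  by (rule measurable_coordinatewise_then_product) measurable

lemma borel_measurable_unsquash [measurable]: "unsquash \<in> borel_measurable borel"
  unfolding unsquash_def by measurable

text \<open>A sum of bumps, each divided by a common bound for its integrals. Multiplying by this
  weight makes all \<open>X i\<close> measures of mass at most 1 at once; as the weight is positive
  it can be divided out again.\<close>

lemma weight_exists:
  fixes X :: "nat \<Rightarrow> (real ^ 'n) measure"
  assumes X: "\<And>i. X i \<in> radon_measures"
    and bd: "\<And>n::nat. \<exists>K. \<forall>i. (\<integral>x. nbump (real (Suc n)) x \<partial>X i) \<le> K"
  obtains \<rho> :: "real ^ 'n \<Rightarrow> real" where "continuous_on UNIV \<rho>" "\<And>x. \<rho> x > 0"
    "\<And>i. integrable (X i) \<rho>" "\<And>i. (\<integral>x. \<rho> x \<partial>X i) \<le> 1"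
proof -
  obtain K0 where K0: "\<And>n i. (\<integral>x. nbump (real (Suc n)) x \<partial>X i) \<le> K0 n"
    using bd by metis
  \<comment> \<open>At least 1, so that the terms are bounded by \<open>(1/2) ^ Suc n\<close>
    pointwise and not only in integral.\<close>
  define K where "K n = max 1 (K0 n)" for n
  have K: "K n \<ge> 1" "(\<integral>x. nbump (real (Suc n)) x \<partial>X i) \<le> K n" for n i
    using K0[of i n] by (auto simp: K_def)
  define a where "a n x = (1/2) ^ Suc n / K n * nbump (real (Suc n)) x" for n and x :: "real ^ 'n"
  define \<rho> where "\<rho> x = (\<Sum>n. a n x)" for x
  have sh: "(\<lambda>n. (1/2::real) ^ Suc n) sums 1" by (rule power_half_series)
  have a0: "0 \<le> a n x" for n x using K(1)[of n] by (simp add: a_def)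
  have a1: "a n x \<le> (1/2) ^ Suc n" for n x
  proof -
    have "(1/2) ^ Suc n / K n \<le> (1/2::real) ^ Suc n" using K(1)[of n] by (simp add: divide_le_eq)
    moreover have "(1/2) ^ Suc n / K n * nbump (real (Suc n)) x \<le> (1/2) ^ Suc n / K n * 1"
      using K(1)[of n] by (intro mult_left_mono nbump_le_1) auto
    ultimately show ?thesis by (simp add: a_def)
  qed
  have sm: "summable (\<lambda>n. a n x)" for x
    by (rule summable_comparison_test'[OF sums_summable[OF sh], of 0]) (use a0 a1 in auto)
  have cont: "continuous_on UNIV \<rho>"
  proof (rule uniform_limit_theorem[where F = sequentially])
    show "uniform_limit UNIV (\<lambda>n x. \<Sum>i<n. a i x) \<rho> sequentially"
      unfolding \<rho>_def
      by (rule Weierstrass_m_test[OF _ sums_summable[OF sh]]) (use a0 a1 in auto)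
    show "\<forall>\<^sub>F n in sequentially. continuous_on UNIV (\<lambda>x. \<Sum>i<n. a i x)"
      unfolding a_def
      by (intro always_eventually allI continuous_intros cc_continuous[OF cc_nbump]) auto
  qed auto
  have pos: "\<rho> x > 0" for x
  proof -
    obtain n :: nat where "norm x < real n" using reals_Archimedean2 by blast
    then have "nbump (real (Suc n)) x > 0" by (intro nbump_pos) auto
    then have "a n x > 0" using K(1)[of n] by (simp add: a_def)
    then show ?thesis unfolding \<rho>_def by (intro suminf_pos2[OF sm a0])
  qed
  have pos0: "0 \<le> \<rho> x" for x using pos[of x] by simp
  have bm: "\<rho> \<in> borel_measurable borel" by (rule borel_measurable_continuous_onI[OF cont])
  have nn: "(\<integral>\<^sup>+x. \<rho> x \<partial>X i) \<le> 1" for i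
  proof -
    have am: "(\<lambda>x. a n x) \<in> borel_measurable borel" for n unfolding a_def by measurable
    have "(\<integral>\<^sup>+x. \<rho> x \<partial>X i) = (\<integral>\<^sup>+x. (\<Sum>n. ennreal (a n x)) \<partial>X i)"
      unfolding \<rho>_def by (intro nn_integral_cong) (rule suminf_ennreal2[symmetric, OF a0 sm])
    also have "\<dots> = (\<Sum>n. \<integral>\<^sup>+x. ennreal (a n x) \<partial>X i)"
      by (rule nn_integral_suminf, rule borel_to_radon_measurable[OF X]) (use am in measurable)
    also have "\<dots> \<le> (\<Sum>n. ennreal ((1/2) ^ Suc n))"
    proof (intro suminf_le allI)
      fix n
      have int: "integrable (X i) (nbump (real (Suc n)))"
        by (rule radon_integrable[OF X cc_nbump]) simp
      then have "(\<integral>\<^sup>+x. ennreal (a n x) \<partial>X i) = ennreal (\<integral>x. a n x \<partial>X i)"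
        by (intro nn_integral_eq_integral) (auto simp: a0, simp add: a_def)
      also have "(\<integral>x. a n x \<partial>X i) = (1/2) ^ Suc n / K n * (\<integral>x. nbump (real (Suc n)) x \<partial>X i)"
        unfolding a_def by (rule integral_mult_right_zero)
      also have "\<dots> \<le> (1/2) ^ Suc n / K n * K n"
        using K[of n] by (intro mult_left_mono K(2)) auto
      also have "\<dots> = (1/2) ^ Suc n" using K(1)[of n] by simp
      finally show "(\<integral>\<^sup>+x. ennreal (a n x) \<partial>X i) \<le> ennreal ((1/2) ^ Suc n)"
        by (simp add: ennreal_leI)
    qed auto
    also have "\<dots> = ennreal (\<Sum>n. (1/2) ^ Suc n)"
      by (rule suminf_ennreal2[OF _ sums_summable[OF sh]]) simp
    also have "\<dots> = ennreal 1"
      unfolding sums_unique[OF sh, symmetric] ..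
    finally show ?thesis by simp
  qed
  have int: "integrable (X i) \<rho>" for i
  proof (rule integrableI_nonneg)
    show "(\<integral>\<^sup>+x. \<rho> x \<partial>X i) < \<infinity>" using nn[of i] by (metis infinity_ennreal_def le_less_trans ennreal_one_less_top)
    qed (simp_all add: pos0 borel_to_radon_measurable[OF X bm])
  have "(\<integral>x. \<rho> x \<partial>X i) \<le> 1" for i
  proof -
    have "ennreal (\<integral>x. \<rho> x \<partial>X i) = (\<integral>\<^sup>+x. \<rho> x \<partial>X i)"
      by (rule nn_integral_eq_integral[OF int, symmetric]) (simp add: pos0)
    then show ?thesis using nn[of i] by (metis ennreal_1 ennreal_le_iff zero_le_one)
  qed
  then show ?thesis using that[OF cont pos int] by simp
qed

text \<open>The weighted measures are normalized to probabilities and coded in the cube, where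
  almost surely convergent representatives exist. The limit is read off as the law of the limiting
  point, reweighted; the total masses \<open>m i\<close> converge separately along a
  subsequence.\<close>

lemma vague_compact:
  fixes X :: "nat \<Rightarrow> (real ^ 'n) measure"
  assumes X: "\<And>i. X i \<in> radon_measures"
    and bd: "\<And>n::nat. \<exists>K. \<forall>i. (\<integral>x. nbump (real (Suc n)) x \<partial>X i) \<le> K"
  obtains r :: "nat \<Rightarrow> nat" and \<mu> where "strict_mono r" "\<mu> \<in> radon_measures" "vconv (X \<circ> r) \<mu>"
proof -
  obtain \<rho> :: "real ^ 'n \<Rightarrow> real" where cont: "continuous_on UNIV \<rho>" and pos: "\<And>x. \<rho> x > 0"
    and int: "\<And>i. integrable (X i) \<rho>" and le1: "\<And>i. (\<integral>x. \<rho> x \<partial>X i) \<le> 1"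
    using weight_exists[OF X bd] by blast
  have pos0: "0 \<le> \<rho> x" for x using pos[of x] by simp
  have ne0: "\<rho> x \<noteq> 0" for x using pos[of x] by simp
  have bm [measurable]: "\<rho> \<in> borel_measurable borel" by (rule borel_measurable_continuous_onI[OF cont])
  define m where "m i = (\<integral>x. \<rho> x \<partial>X i)" for i
  have m01: "0 \<le> m i" "m i \<le> 1" for i
    using le1[of i] unfolding m_def by (simp_all add: pos0)
  \<comment> \<open>If the weighted mass is 0 the measure is null, and the point mass is a
    placeholder that will be multiplied by \<open>m i = 0\<close>.\<close>
  define L where "L i = (if m i > 0 then distr (density (X i) (\<lambda>x. ennreal (\<rho> x / m i))) borel cube_coord
     else return borel (\<lambda>_. 0))" for i
  have mX: "f \<in> measurable borel N \<Longrightarrow> f \<in> measurable (X i) N" for f :: "real ^ 'n \<Rightarrow> 'b" and N i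
    by (rule borel_to_radon_measurable[OF X])
  have mc: "cube_coord \<in> measurable (density (X i) (\<lambda>x. ennreal (\<rho> x / m i))) borel" for i
    using mX[OF borel_measurable_cube_coord, of i] by simp
  have Lp: "prob_space (L i)" for i
  proof (cases "m i > 0")
    case True
    have "(\<integral>\<^sup>+x. ennreal (\<rho> x / m i) \<partial>X i) = ennreal (\<integral>x. \<rho> x / m i \<partial>X i)"
      using int[of i] True by (intro nn_integral_eq_integral) (simp_all add: pos0)
    also have "(\<integral>x. \<rho> x / m i \<partial>X i) = 1" using True by (simp add: m_def)
    finally have "prob_space (density (X i) (\<lambda>x. ennreal (\<rho> x / m i)))"
      by (intro prob_spaceI) (simp add: emeasure_density mX)
    then show ?thesis using True unfolding L_def by (simp add: prob_space.prob_space_distr[OF _ mc])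
  next
    case False
    then show ?thesis unfolding L_def by (simp add: prob_space_return)
  qed
  have Ls: "sets (L i) = sets borel" for i by (simp add: L_def)
  have Lc: "AE y in L i. \<forall>k. 0 \<le> y k \<and> y k < 1" for i
  proof (cases "m i > 0")
    case True
    then show ?thesis unfolding L_def
      by (simp only: if_True) (subst AE_distr_iff[OF mc], measurable, simp add: cube_coord_bounds)
  next
    case False
    then show ?thesis unfolding L_def by (simp add: AE_return)
  qed
  obtain r1 :: "nat \<Rightarrow> nat" and \<Omega> :: "real measure" and Z Z' where r1: "strict_mono r1"
    and "prob_space \<Omega>" and Z [measurable]: "\<And>i. Z i \<in> borel_measurable \<Omega>" "Z' \<in> borel_measurable \<Omega>"
    and law: "\<And>i. distr \<Omega> borel (Z i) = L (r1 i)"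
    and conv: "\<And>\<omega>. \<omega> \<in> space \<Omega> \<Longrightarrow> (\<lambda>i. Z i \<omega>) \<longlonglongrightarrow> Z' \<omega>"
    by (rule cube_Skorohod[OF Lp Ls Lc]) (rule that)
  interpret prob_space \<Omega> by fact
  have "seq_compact {0..1::real}" by (rule compact_imp_seq_compact) simp
  then obtain m0 and r2 :: "nat \<Rightarrow> nat" where m0: "0 \<le> m0" "m0 \<le> 1" and r2: "strict_mono r2"
    and mconv: "(m \<circ> r1 \<circ> r2) \<longlonglongrightarrow> m0"
    using m01 by (elim seq_compactE[of _ "m \<circ> r1"]) auto
  define V where "V \<omega> = (cube_point (Z' \<omega>) :: real ^ 'n)" for \<omega>
  have [measurable]: "V \<in> borel_measurable \<Omega>" unfolding V_def by measurable
  \<comment> \<open>Division by the weight undoes the weighting. Where \<open>V\<close> has reached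
    the unit sphere, the mass has escaped to infinity and is discarded.\<close>
  define w where "w \<omega> = (if norm (V \<omega>) < 1 then m0 / \<rho> (unsquash (V \<omega>)) else 0)" for \<omega>
  have [measurable]: "w \<in> borel_measurable \<Omega>" unfolding w_def by measurable
  have w0: "0 \<le> w \<omega>" for \<omega> using m0 pos[of "unsquash (V \<omega>)"] by (simp add: w_def)
  define \<mu> where "\<mu> = distr (density \<Omega> (\<lambda>\<omega>. ennreal (w \<omega>))) borel (\<lambda>\<omega>. unsquash (V \<omega>))"
  have rad: "\<mu> \<in> radon_measures"
    unfolding radon_measures_iff
  proof (intro conjI allI)
    fix n :: nat
    \<comment> \<open>The weight has a positive minimum on each ball, which bounds the density
      \<open>w\<close> there and makes the limit locally finite.\<close>
    obtain c where c: "c > 0" "\<And>x. x \<in> cball 0 (real n) \<Longrightarrow> c \<le> \<rho> x"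
    proof -
      have "\<exists>x\<in>cball 0 (real n). \<forall>y\<in>cball 0 (real n). \<rho> x \<le> \<rho> y"
        by (rule continuous_attains_inf[OF _ _ continuous_on_subset[OF cont]]) auto
      then show ?thesis using that pos by blast
    qed
    have "emeasure \<mu> (cball 0 (real n)) =
        (\<integral>\<^sup>+\<omega>. ennreal (w \<omega>) * indicator ((\<lambda>\<omega>. unsquash (V \<omega>)) -` cball 0 (real n) \<inter> space \<Omega>) \<omega> \<partial>\<Omega>)"
      unfolding \<mu>_def by (subst emeasure_distr, simp, simp, subst emeasure_density) auto
    also have "\<dots> \<le> (\<integral>\<^sup>+\<omega>. ennreal (m0 / c) \<partial>\<Omega>)"
    proof (rule nn_integral_mono)
      fix \<omega>
      have "w \<omega> \<le> m0 / c" if "unsquash (V \<omega>) \<in> cball 0 (real n)"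
        using c(1) c(2)[OF that] m0 pos[of "unsquash (V \<omega>)"] by (auto simp: w_def intro!: divide_left_mono)
      then show "ennreal (w \<omega>) * indicator ((\<lambda>\<omega>. unsquash (V \<omega>)) -` cball 0 (real n) \<inter> space \<Omega>) \<omega> \<le> ennreal (m0 / c)"
        by (auto simp: indicator_def ennreal_leI)
    qed
    also have "\<dots> = ennreal (m0 / c)" by (simp add: emeasure_space_1)
    finally show "emeasure \<mu> (cball 0 (real n)) < \<infinity>" by (rule le_less_trans) simp
  qed (simp add: \<mu>_def)
  have "vconv (X \<circ> (r1 \<circ> r2)) \<mu>" unfolding vconv_def
  proof (intro allI impI)
    fix f :: "real ^ 'n \<Rightarrow> real" assume f: "cc f"
    define h where "h x = 1 / \<rho> x * f x" for x
    have h: "cc h" unfolding h_def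
      by (rule cc_mult_left[OF f]) (intro continuous_intros cont, simp add: ne0)
    note [measurable] = cc_borel[OF f] cc_borel[OF h]
    define g where "g v = (if norm v < 1 then h (unsquash v) else 0)" for v
    have gc: "continuous_on UNIV g" using continuous_squash_extend[OF h] by (simp add: g_def[abs_def])
    have [measurable]: "g \<in> borel_measurable borel" by (rule borel_measurable_continuous_onI[OF gc])
    obtain B where B: "B > 0" "\<And>x. \<bar>h x\<bar> \<le> B" using cc_bounded[OF h] by blast
    have gB: "\<bar>g v\<bar> \<le> B" for v using B by (auto simp: g_def)
    \<comment> \<open>The weight in \<open>L i\<close> cancels against the factor
      \<open>1 / \<rho> x\<close> in \<open>h\<close>, and \<open>m i\<close> restores the total
      mass.\<close>
    have key: "m i * (\<integral>y. g (cube_point y) \<partial>L i) = (\<integral>x. f x \<partial>X i)" for i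
    proof (cases "m i > 0")
      case True
      have "(\<integral>y. g (cube_point y) \<partial>L i) = (\<integral>x. g (cube_point (cube_coord x)) \<partial>density (X i) (\<lambda>x. ennreal (\<rho> x / m i)))"
        unfolding L_def using True by (simp only: if_True) (rule integral_distr[OF mc], measurable)
      also have "\<dots> = (\<integral>x. \<rho> x / m i * g (squash x) \<partial>X i)"
        unfolding cube_point_coord
        by (rule integral_real_density)
          (use True in \<open>simp_all add: mX pos0 squash_def\<close>)
      also have "\<dots> = (\<integral>x. 1 / m i * f x \<partial>X i)"
        by (rule Bochner_Integration.integral_cong[OF refl])
          (simp add: g_def h_def ne0 norm_squash_less)
      also have "\<dots> = 1 / m i * (\<integral>x. f x \<partial>X i)" by (rule integral_mult_right_zero)
      finally show ?thesis using True by simp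
    next
      case False
      then have m0': "m i = 0" using m01[of i] by simp
      then have "AE x in X i. \<rho> x = 0"
        using integral_nonneg_eq_0_iff_AE[OF int[of i]] unfolding m_def by (simp add: pos0)
      then have "AE x in X i. f x = 0"
        by (rule eventually_mono) (simp add: ne0)
      then have "(\<integral>x. f x \<partial>X i) = 0" by (rule integral_eq_zero_AE)
      then show ?thesis using m0' by simp
    qed
    have "(\<integral>x. f x \<partial>\<mu>) = (\<integral>\<omega>. w \<omega> * f (unsquash (V \<omega>)) \<partial>\<Omega>)"
      unfolding \<mu>_def by (subst integral_distr, simp, simp, subst integral_real_density) (auto simp: w0)
    also have "\<dots> = (\<integral>\<omega>. m0 * g (V \<omega>) \<partial>\<Omega>)"
      by (rule Bochner_Integration.integral_cong[OF refl]) (simp add: w_def g_def h_def)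
    finally have lim: "(\<integral>x. f x \<partial>\<mu>) = m0 * (\<integral>\<omega>. g (V \<omega>) \<partial>\<Omega>)" by simp
    have app: "(\<integral>x. f x \<partial>X ((r1 \<circ> r2) i)) = (m \<circ> r1 \<circ> r2) i * (\<integral>\<omega>. g (cube_point (Z (r2 i) \<omega>)) \<partial>\<Omega>)" for i
    proof -
      have "(\<integral>\<omega>. g (cube_point (Z (r2 i) \<omega>)) \<partial>\<Omega>) = (\<integral>y. g (cube_point y) \<partial>distr \<Omega> borel (Z (r2 i)))"
        by (rule integral_distr[symmetric]) auto
      then show ?thesis using key[of "r1 (r2 i)"] by (simp add: law)
    qed
    have "(\<lambda>i. \<integral>\<omega>. g (cube_point (Z (r2 i) \<omega>)) \<partial>\<Omega>) \<longlonglongrightarrow> (\<integral>\<omega>. g (V \<omega>) \<partial>\<Omega>)"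
    proof (rule integral_dominated_convergence[where w = "\<lambda>_. B"])
      show "AE \<omega> in \<Omega>. (\<lambda>i. g (cube_point (Z (r2 i) \<omega>))) \<longlonglongrightarrow> g (V \<omega>)"
      proof (rule AE_I2)
        fix \<omega> assume "\<omega> \<in> space \<Omega>"
        from LIMSEQ_subseq_LIMSEQ[OF conv[OF this] r2]
        have "(\<lambda>i. Z (r2 i) \<omega>) \<longlonglongrightarrow> Z' \<omega>" by (simp add: comp_def)
        then have "(\<lambda>i. cube_point (Z (r2 i) \<omega>) :: real ^ 'n) \<longlonglongrightarrow> V \<omega>" unfolding V_def
          by (rule continuous_on_tendsto_compose[OF continuous_cube_point]) auto
        then show "(\<lambda>i. g (cube_point (Z (r2 i) \<omega>))) \<longlonglongrightarrow> g (V \<omega>)"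
          by (rule continuous_on_tendsto_compose[OF gc]) auto
      qed
    qed (use gB in auto)
    then show "(\<lambda>i. \<integral>x. f x \<partial>(X \<circ> (r1 \<circ> r2)) i) \<longlonglongrightarrow> (\<integral>x. f x \<partial>\<mu>)"
      unfolding comp_apply[of X] app lim by (intro tendsto_mult mconv)
  qed
  then show ?thesis using that[of "r1 \<circ> r2" \<mu>] r1 r2 rad strict_mono_o by blast
qed

section \<open>The vague topology inside the Hilbert cube\<close>

text \<open>Fixed once by choice, so that the test functions, and with them the map
  \<open>Phi\<close>, are constants.\<close>

definition test_open :: "nat \<Rightarrow> (real ^ 'n) set" where
  "test_open = (SOME A. Int_stable (range A) \<and> (\<forall>n. open (A n)) \<and>
     sets borel = sigma_sets UNIV (range A) \<and> UNIV \<in> range A)"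

lemma test_open:
  "Int_stable (range (test_open :: nat \<Rightarrow> (real ^ 'n) set))" "open (test_open n :: (real ^ 'n) set)"
  "sets borel = sigma_sets UNIV (range (test_open :: nat \<Rightarrow> (real ^ 'n) set))"
  "UNIV \<in> range (test_open :: nat \<Rightarrow> (real ^ 'n) set)"
proof -
  have "\<exists>A :: nat \<Rightarrow> (real ^ 'n) set. Int_stable (range A) \<and> (\<forall>n. open (A n)) \<and>
     sets borel = sigma_sets UNIV (range A) \<and> UNIV \<in> range A"
    by (rule countable_Int_stable_basis_enum[where 'a = "real ^ 'n"]) blast
  from someI_ex[OF this]
  have *: "Int_stable (range (test_open :: nat \<Rightarrow> (real ^ 'n) set)) \<and> (\<forall>n. open (test_open n :: (real ^ 'n) set)) \<and>
     sets borel = sigma_sets UNIV (range (test_open :: nat \<Rightarrow> (real ^ 'n) set)) \<and>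
     UNIV \<in> range (test_open :: nat \<Rightarrow> (real ^ 'n) set)"
    unfolding test_open_def .
  then show "Int_stable (range (test_open :: nat \<Rightarrow> (real ^ 'n) set))"
    "open (test_open n :: (real ^ 'n) set)"
    "sets borel = sigma_sets UNIV (range (test_open :: nat \<Rightarrow> (real ^ 'n) set))"
    "UNIV \<in> range (test_open :: nat \<Rightarrow> (real ^ 'n) set)" by simp_all
qed

definition test_set :: "nat \<Rightarrow> (real ^ 'n) set" where
  "test_set k = test_open (fst (prod_decode k)) \<inter> ball 0 (real (snd (prod_decode k)))"

definition test :: "nat \<Rightarrow> real ^ 'n \<Rightarrow> real" where
  "test k = plateau (test_set (fst (prod_decode k))) (snd (prod_decode k))"

lemma open_test_set: "open (test_set k)"
  by (simp add: test_set_def test_open open_Int)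

lemma bounded_test_set: "bounded (test_set k)"
  unfolding test_set_def by (rule bounded_subset[of "ball 0 _"]) auto

lemma test_nonneg [simp]: "0 \<le> test k x" and test_le_1: "test k x \<le> 1"
  by (simp_all add: test_def plateau_nonneg plateau_le_1)

lemma test_encode: "test (prod_encode (k, n)) = plateau (test_set k) n"
  by (simp add: test_def)

lemma cc_test: "cc (test k :: real ^ 'n \<Rightarrow> real)"
proof -
  define B where "B = (test_set (fst (prod_decode k)) :: (real ^ 'n) set)"
  obtain b where b: "\<forall>x\<in>B. norm x \<le> b"
    using bounded_test_set unfolding B_def bounded_iff by blast
  show ?thesis
  proof (rule ccI[where r = b])
    show "continuous_on UNIV (test k :: real ^ 'n \<Rightarrow> real)" unfolding test_def by (rule continuous_plateau)
    show "test k x = 0" if "b < norm x" for x :: "real ^ 'n"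
      using b that unfolding test_def B_def by (intro plateau_outside) force
  qed
qed

text \<open>Over a ball of radius m >= r + 1 the plateau of slope 1 has reached its maximum on the
  ball of radius r. Such a test function bounds the masses of balls and later stands in for the
  constant 1 on the cube.\<close>

lemma test_eq_1_on_cball:
  obtains k where "\<And>x :: real ^ 'n. norm x \<le> r \<Longrightarrow> test k x = 1"
proof -
  obtain i where i: "test_open i = (UNIV :: (real ^ 'n) set)" using test_open(4) by force
  obtain m :: nat where m: "r + 1 \<le> real m" using real_arch_simple by blast
  have ts: "test_set (prod_encode (i, m)) = (ball 0 (real m) :: (real ^ 'n) set)"
    by (simp add: test_set_def i)
  have ne: "- ball 0 (real m) \<noteq> ({} :: (real ^ 'n) set)"
    using not_bounded_UNIV[where 'a = "real ^ 'n"] bounded_ball[of "0 :: real ^ 'n" "real m"]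
    by (metis Compl_empty_eq double_complement)
  have "test (prod_encode (prod_encode (i, m), 1)) x = 1" if "norm x \<le> r" for x :: "real ^ 'n"
  proof -
    have "1 \<le> dist x y" if y: "y \<in> - ball 0 (real m)" for y
    proof -
      have "real m \<le> norm y" using y by simp
      moreover have "norm y - norm x \<le> dist x y"
        using norm_triangle_ineq2[of y x] by (simp add: dist_norm norm_minus_commute)
      ultimately show ?thesis using \<open>norm x \<le> r\<close> m by linarith
    qed
    then have "1 \<le> infdist x (- ball 0 (real m))"
      unfolding infdist_notempty[OF ne] by (intro cINF_greatest ne)
    then show ?thesis unfolding test_encode ts by (simp add: plateau_def)
  qed
  then show ?thesis using that by blast
qed

lemma radon_plateau_tendsto:
  assumes "\<mu> \<in> radon_measures" "open B" "bounded B"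
  shows "(\<lambda>n. \<integral>x. plateau B n x \<partial>\<mu>) \<longlonglongrightarrow> measure \<mu> B"
proof -
  have ne: "B \<noteq> UNIV" using assms(3) not_bounded_UNIV by metis
  have Bs: "B \<in> sets \<mu>" using assms by (simp add: radon_sets)
  have "(\<lambda>n. \<integral>x. plateau B n x \<partial>\<mu>) \<longlonglongrightarrow> (\<integral>x. indicator B x \<partial>\<mu>)"
  proof (rule integral_dominated_convergence[where w = "indicator B"])
    show "integrable \<mu> (indicator B :: _ \<Rightarrow> real)"
      using Bs radon_emeasure_bounded[OF assms(1,3)] by simp
    show "indicator B \<in> borel_measurable \<mu>" using Bs by simp
    show "plateau B n \<in> borel_measurable \<mu>" for n
      by (rule borel_to_radon_measurable[OF assms(1)]) simp
    show "AE x in \<mu>. norm (plateau B n x) \<le> indicator B x" for n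
      by (intro AE_I2) (simp add: plateau_nonneg plateau_le_indicator)
  qed (simp add: plateau_tendsto[OF assms(2) ne])
  then show ?thesis using radon_space[OF assms(1)] by simp
qed

text \<open>The test sets are bounded and open and closed under intersection. Their masses are
  finite, are limits of plateau integrals and determine the measure.\<close>

lemma radon_eqI:
  assumes "\<mu> \<in> radon_measures" "\<nu> \<in> radon_measures"
    and eq: "\<And>k. (\<integral>x. test k x \<partial>\<mu>) = (\<integral>x. test k x \<partial>\<nu>)"
  shows "\<mu> = \<nu>"
proof -
  obtain i where i: "test_open i = (UNIV :: (real ^ 'a) set)" using test_open(4) by force
  have ball: "ball 0 (real m) \<in> range (test_set :: nat \<Rightarrow> (real ^ 'a) set)" for m :: nat
    by (rule range_eqI[where x = "prod_encode (i, m)"]) (simp add: test_set_def i)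
  show ?thesis
  proof (rule measure_eqI_generator_eq[where E = "range test_set" and \<Omega> = UNIV and A = "\<lambda>m. ball 0 (real m)"])
    show "Int_stable (range (test_set :: nat \<Rightarrow> (real ^ 'a) set))"
    proof (rule Int_stableI)
      fix a b :: "(real ^ 'a) set" assume "a \<in> range test_set" "b \<in> range test_set"
      then obtain k l where kl: "a = test_set k" "b = test_set l" by blast
      have "test_open (fst (prod_decode k)) \<inter> test_open (fst (prod_decode l)) \<in> range (test_open :: nat \<Rightarrow> (real ^ 'a) set)"
        using test_open(1) by (rule Int_stableD) auto
      then obtain j where j: "test_open (fst (prod_decode k)) \<inter> test_open (fst (prod_decode l)) = (test_open j :: (real ^ 'a) set)"
        by blast
      have "a \<inter> b = test_set (prod_encode (j, min (snd (prod_decode k)) (snd (prod_decode l))))"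
        unfolding kl test_set_def prod_encode_inverse fst_conv snd_conv j[symmetric]
        by (auto simp: min_def)
      then show "a \<inter> b \<in> range test_set" by blast
    qed
    show "emeasure \<mu> X = emeasure \<nu> X" if "X \<in> range test_set" for X
    proof -
      from that obtain k where k: "X = test_set k" by blast
      have eq': "(\<integral>x. plateau (test_set k) n x \<partial>\<mu>) = (\<integral>x. plateau (test_set k) n x \<partial>\<nu>)" for n
        using eq[of "prod_encode (k, n)"] unfolding test_encode .
      have "measure \<mu> X = measure \<nu> X"
        using radon_plateau_tendsto[OF assms(1) open_test_set bounded_test_set, of k]
          radon_plateau_tendsto[OF assms(2) open_test_set bounded_test_set, of k]
        unfolding eq' k by (rule LIMSEQ_unique)
      moreover have "emeasure \<mu> X \<noteq> top" "emeasure \<nu> X \<noteq> top"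
        using radon_emeasure_bounded[OF assms(1) bounded_test_set[of k]]
          radon_emeasure_bounded[OF assms(2) bounded_test_set[of k]] k by auto
      ultimately show ?thesis by (simp add: emeasure_eq_ennreal_measure)
    qed
    have "sets borel = sigma_sets UNIV (range (test_set :: nat \<Rightarrow> (real ^ 'a) set))"
    proof (rule antisym)
      have "test_open j \<in> sigma_sets UNIV (range (test_set :: nat \<Rightarrow> (real ^ 'a) set))" for j
      proof -
        have "test_open j = (\<Union>m. test_set (prod_encode (j, m)) :: (real ^ 'a) set)"
          unfolding test_set_def by (auto simp: reals_Archimedean2)
        also have "\<dots> \<in> sigma_sets UNIV (range test_set)"
          by (intro sigma_sets.Union sigma_sets.Basic) blast
        finally show ?thesis .
      qed
      then show "sets borel \<subseteq> sigma_sets UNIV (range (test_set :: nat \<Rightarrow> (real ^ 'a) set))"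
        unfolding test_open(3) by (intro sigma_sets_mono) auto
      have "range (test_set :: nat \<Rightarrow> (real ^ 'a) set) \<subseteq> sets borel"
        by (simp add: image_subset_iff borel_open open_test_set)
      then show "sigma_sets UNIV (range (test_set :: nat \<Rightarrow> (real ^ 'a) set)) \<subseteq> sets borel"
        using sets.sigma_sets_subset[of "range test_set" borel] by simp
    qed
    then show "sets \<mu> = sigma_sets UNIV (range test_set)" "sets \<nu> = sigma_sets UNIV (range test_set)"
      using radon_sets[OF assms(1)] radon_sets[OF assms(2)] by simp_all
    show "(\<Union>m. ball 0 (real m)) = (UNIV :: (real ^ 'a) set)" by (auto simp: reals_Archimedean2)
    show "emeasure \<mu> (ball 0 (real m)) \<noteq> \<infinity>" for m :: nat
      using radon_emeasure_bounded[OF assms(1) bounded_ball, of 0 "real m"] by simp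
    show "range (\<lambda>m. ball 0 (real m)) \<subseteq> range (test_set :: nat \<Rightarrow> (real ^ 'a) set)"
      using ball by blast
  qed auto
qed

text \<open>The quotient t / (1 + t) moves integrals from the half-line to [0, 1); in a limit, a
  coordinate equal to 1 signals infinite mass.\<close>

definition Phi :: "(real ^ 'n) measure \<Rightarrow> nat \<Rightarrow> real" where
  "Phi \<mu> k = (\<integral>x. test k x \<partial>\<mu>) / (1 + (\<integral>x. test k x \<partial>\<mu>))"

lemma Phi_bounds: "0 \<le> Phi \<mu> k" "Phi \<mu> k < 1"
proof -
  have "0 \<le> (\<integral>x. test k x \<partial>\<mu>)" by (rule Bochner_Integration.integral_nonneg) simp
  then have "0 < 1 + (\<integral>x. test k x \<partial>\<mu>)" by linarith
  then show "0 \<le> Phi \<mu> k" "Phi \<mu> k < 1" by (simp_all add: Phi_def divide_less_eq)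
qed

lemma test_integral_Phi: "(\<integral>x. test k x \<partial>\<mu>) = Phi \<mu> k / (1 - Phi \<mu> k)"
proof -
  have "0 \<le> (\<integral>x. test k x \<partial>\<mu>)" by (rule Bochner_Integration.integral_nonneg) simp
  then have p: "1 + (\<integral>x. test k x \<partial>\<mu>) > 0" by linarith
  then have "1 - Phi \<mu> k = 1 / (1 + (\<integral>x. test k x \<partial>\<mu>))" by (simp add: Phi_def diff_divide_eq_iff)
  then show ?thesis using p by (simp add: Phi_def)
qed

lemma Phi_inj:
  assumes "\<mu> \<in> radon_measures" "\<nu> \<in> radon_measures" "Phi \<mu> = Phi \<nu>" shows "\<mu> = \<nu>"
  using assms(1,2) by (rule radon_eqI) (simp add: test_integral_Phi assms(3))

lemma fun_LIMSEQ_iff: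
  fixes X :: "nat \<Rightarrow> nat \<Rightarrow> real"
  shows "X \<longlonglongrightarrow> x \<longleftrightarrow> (\<forall>k. (\<lambda>i. X i k) \<longlonglongrightarrow> x k)"
proof
  assume "X \<longlonglongrightarrow> x"
  then show "\<forall>k. (\<lambda>i. X i k) \<longlonglongrightarrow> x k"
    using continuous_on_tendsto_compose[OF continuous_on_product_coordinates] by (metis UNIV_I always_eventually)
next
  assume *: "\<forall>k. (\<lambda>i. X i k) \<longlonglongrightarrow> x k"
  have "limitin (product_topology (\<lambda>i. euclidean) UNIV) X x sequentially"
    unfolding limitin_componentwise using * by simp
  then show "X \<longlonglongrightarrow> x" by (simp add: euclidean_product_topology)
qed

lemma vconv_Phi: "vconv X \<mu> \<Longrightarrow> (\<lambda>i. Phi (X i)) \<longlonglongrightarrow> Phi \<mu>"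
  unfolding fun_LIMSEQ_iff
proof
  fix k assume "vconv X \<mu>"
  then have "(\<lambda>i. \<integral>x. test k x \<partial>X i) \<longlonglongrightarrow> (\<integral>x. test k x \<partial>\<mu>)" by (simp add: vconv_def cc_test)
  moreover have "0 \<le> (\<integral>x. test k x \<partial>\<mu>)" by (rule Bochner_Integration.integral_nonneg) simp
  then have "1 + (\<integral>x. test k x \<partial>\<mu>) \<noteq> 0" by linarith
  ultimately show "(\<lambda>i. Phi (X i) k) \<longlonglongrightarrow> Phi \<mu> k"
    unfolding Phi_def by (intro tendsto_intros)
qed

text \<open>Limit coordinates below 1 keep every test integral bounded along the sequence. Hence the
  masses of balls are bounded and vague compactness applies.\<close>

lemma Phi_limit_compact:
  fixes X :: "nat \<Rightarrow> (real ^ 'n) measure"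
  assumes X: "\<And>i. X i \<in> radon_measures" and lim: "(\<lambda>i. Phi (X i)) \<longlonglongrightarrow> y" and y: "\<And>k. y k < 1"
  obtains r :: "nat \<Rightarrow> nat" and \<mu> where "strict_mono r" "\<mu> \<in> radon_measures" "vconv (X \<circ> r) \<mu>" "Phi \<mu> = y"
proof -
  have conv: "(\<lambda>i. \<integral>x. test k x \<partial>X i) \<longlonglongrightarrow> y k / (1 - y k)" for k
    unfolding test_integral_Phi using lim y[of k] unfolding fun_LIMSEQ_iff
    by (intro tendsto_intros) auto
  have bd: "\<exists>K. \<forall>i. (\<integral>x. nbump (real (Suc n)) x \<partial>X i) \<le> K" for n :: nat
  proof -
    obtain k where k: "\<And>x :: real ^ 'n. norm x \<le> real (Suc n) \<Longrightarrow> test k x = 1"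
      using test_eq_1_on_cball by blast
    have le: "nbump (real (Suc n)) x \<le> test k x" for x :: "real ^ 'n"
    proof (cases "norm x \<le> real (Suc n)")
      case True
      then show ?thesis using k[of x] nbump_le_1[of "real (Suc n)" x] by simp
    next
      case False
      then show ?thesis using nbump_outside[of "real (Suc n)" x] by simp
    qed
    have "(\<integral>x. nbump (real (Suc n)) x \<partial>X i) \<le> (\<integral>x. test k x \<partial>X i)" for i
      by (rule integral_mono[OF radon_integrable[OF X cc_nbump] radon_integrable[OF X cc_test] le]) simp
    moreover obtain K where "\<And>i. (\<integral>x. test k x \<partial>X i) \<le> K"
      using convergent_imp_Bseq[OF convergentI[OF conv[of k]]] unfolding Bseq_def
      by (metis abs_le_D1 real_norm_def)
    ultimately show ?thesis by (meson order_trans)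
  qed
  obtain r \<mu> where r: "strict_mono r" and \<mu>: "\<mu> \<in> radon_measures" and v: "vconv (X \<circ> r) \<mu>"
    by (rule vague_compact[OF X bd]) (rule that)
  have "(\<lambda>i. Phi ((X \<circ> r) i)) \<longlonglongrightarrow> y"
    using LIMSEQ_subseq_LIMSEQ[OF lim r] by (simp add: comp_def)
  then have "Phi \<mu> = y" using vconv_Phi[OF v] LIMSEQ_unique by blast
  then show ?thesis using that r \<mu> v by blast
qed

lemma not_tendsto_subseq:
  fixes x :: "nat \<Rightarrow> real"
  assumes "\<not> x \<longlonglongrightarrow> l"
  shows "\<exists>r \<epsilon>. strict_mono (r :: nat \<Rightarrow> nat) \<and> \<epsilon> > 0 \<and> (\<forall>i. \<epsilon> \<le> \<bar>x (r i) - l\<bar>)"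
proof -
  from assms obtain \<epsilon> where e: "\<epsilon> > 0" "\<forall>N. \<exists>n\<ge>N. \<epsilon> \<le> \<bar>x n - l\<bar>"
    unfolding lim_sequentially dist_real_def by (auto simp: not_less)
  have "infinite {n. \<epsilon> \<le> \<bar>x n - l\<bar>}"
    unfolding infinite_nat_iff_unbounded_le using e(2) by auto
  then show ?thesis
    using e(1) strict_mono_enumerate enumerate_in_set
    by (intro exI[of _ "enumerate {n. \<epsilon> \<le> \<bar>x n - l\<bar>}"] exI[of _ \<epsilon>]) blast
qed

text \<open>Countably many integrals control all compactly supported functions: every subsequence
  has a further vague limit by compactness, and injectivity of \<open>Phi\<close> leaves only
  \<open>\<mu>\<close> for it.\<close>

lemma Phi_vconv:
  fixes X :: "nat \<Rightarrow> (real ^ 'n) measure"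
  assumes X: "\<And>i. X i \<in> radon_measures" and \<mu>: "\<mu> \<in> radon_measures" and lim: "(\<lambda>i. Phi (X i)) \<longlonglongrightarrow> Phi \<mu>"
  shows "vconv X \<mu>"
  unfolding vconv_def
proof (intro allI impI, rule ccontr)
  fix f :: "real ^ 'n \<Rightarrow> real" assume f: "cc f" and no: "\<not> (\<lambda>i. \<integral>x. f x \<partial>X i) \<longlonglongrightarrow> (\<integral>x. f x \<partial>\<mu>)"
  from not_tendsto_subseq[OF no] obtain r :: "nat \<Rightarrow> nat" and \<epsilon> where r: "strict_mono r" and e: "\<epsilon> > 0"
    "\<forall>i. \<epsilon> \<le> \<bar>(\<integral>x. f x \<partial>X (r i)) - (\<integral>x. f x \<partial>\<mu>)\<bar>"
    by auto
  have lim': "(\<lambda>i. Phi ((X \<circ> r) i)) \<longlonglongrightarrow> Phi \<mu>"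
    using LIMSEQ_subseq_LIMSEQ[OF lim r] by (simp add: comp_def)
  have Xr: "(X \<circ> r) i \<in> radon_measures" for i using X by simp
  obtain s \<nu> where s: "strict_mono s" and \<nu>: "\<nu> \<in> radon_measures" "vconv (X \<circ> r \<circ> s) \<nu>" "Phi \<nu> = Phi \<mu>"
    by (rule Phi_limit_compact[OF Xr lim' Phi_bounds(2)]) (rule that)
  have "\<nu> = \<mu>" by (rule Phi_inj[OF \<nu>(1) \<mu> \<nu>(3)])
  then have "(\<lambda>i. \<integral>x. f x \<partial>X (r (s i))) \<longlonglongrightarrow> (\<integral>x. f x \<partial>\<mu>)"
    using \<nu>(2) f by (simp add: vconv_def)
  from LIMSEQ_D[OF this e(1)] obtain i where "\<bar>(\<integral>x. f x \<partial>X (r (s i))) - (\<integral>x. f x \<partial>\<mu>)\<bar> < \<epsilon>" by auto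
  then show False using e(2)[rule_format, of "s i"] by linarith
qed

lemma topspace_radon: "topspace radon_topology = (radon_measures :: (real ^ 'n) measure set)"
proof -
  have "{\<mu> \<in> radon_measures. (\<integral>x. (\<lambda>_. 0) x \<partial>\<mu>) \<in> (UNIV :: real set)} \<in> {{\<mu> \<in> radon_measures. (\<integral>x. f x \<partial>\<mu>) \<in> U} | f U.
        continuous_on UNIV f \<and> compact (closure {x :: real ^ 'n. f x \<noteq> 0}) \<and> open (U :: real set)}"
    by (intro CollectI exI[of _ "\<lambda>_. 0"] exI[of _ UNIV]) auto
  then show ?thesis unfolding radon_topology_def topology_generated_by_topspace by auto
qed

section \<open>Topologies pulled back from the cube, and their Borel sets\<close>

text \<open>It suffices to treat a subbasic set s. The complement of the closure of the image of M -
  s serves as V: a point of s mapped into that closure would be approached by a sequence from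
  outside s, as the target is first countable.\<close>

lemma sequential_embedding_openE:
  fixes \<phi> :: "'a \<Rightarrow> 'b::first_countable_topology"
  assumes U: "openin (topology_generated_by \<S>) U" and sub: "\<And>s. s \<in> \<S> \<Longrightarrow> s \<subseteq> M"
    and seq: "\<And>s x X. s \<in> \<S> \<Longrightarrow> x \<in> s \<Longrightarrow> (\<And>i. X i \<in> M) \<Longrightarrow> (\<lambda>i. \<phi> (X i)) \<longlonglongrightarrow> \<phi> x \<Longrightarrow> \<exists>i::nat. X i \<in> s"
  obtains V where "open V" "U = {x \<in> M. \<phi> x \<in> V}"
proof -
  have "generate_topology_on \<S> U" using U by (rule openin_topology_generated_by)
  then have "\<exists>V. open V \<and> U = {x \<in> M. \<phi> x \<in> V}"
  proof (induction U)
    case Empty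
    show ?case by (rule exI[of _ "{}"]) auto
  next
    case (Int a b)
    then obtain V W where "open V" "a = {x \<in> M. \<phi> x \<in> V}" "open W" "b = {x \<in> M. \<phi> x \<in> W}" by blast
    then show ?case by (intro exI[of _ "V \<inter> W"]) auto
  next
    case (UN K)
    then have "\<forall>k\<in>K. \<exists>V. open V \<and> k = {x \<in> M. \<phi> x \<in> V}" by blast
    from bchoice[OF this] obtain V where V: "\<forall>k\<in>K. open (V k) \<and> k = {x \<in> M. \<phi> x \<in> V k}" ..
    have "x \<in> \<Union>K \<longleftrightarrow> x \<in> {x \<in> M. \<phi> x \<in> (\<Union>k\<in>K. V k)}" for x
    proof -
      have "x \<in> k \<longleftrightarrow> x \<in> M \<and> \<phi> x \<in> V k" if "k \<in> K" for k using V that by blast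
      then show ?thesis by simp
    qed
    then have "\<Union>K = {x \<in> M. \<phi> x \<in> (\<Union>k\<in>K. V k)}" by blast
    moreover have "open (\<Union>k\<in>K. V k)" using V by (intro open_UN) blast
    ultimately show ?case by blast
  next
    case (Basis s)
    define V where "V = - closure (\<phi> ` (M - s))"
    have "x \<in> s \<longleftrightarrow> \<phi> x \<in> V" if x: "x \<in> M" for x
    proof
      assume "\<phi> x \<in> V"
      then have "\<phi> x \<notin> \<phi> ` (M - s)" unfolding V_def using closure_subset[of "\<phi> ` (M - s)"] by blast
      then show "x \<in> s" using x by blast
    next
      assume xs: "x \<in> s"
      show "\<phi> x \<in> V"
      proof (rule ccontr)
        assume "\<phi> x \<notin> V"
        then have "\<phi> x \<in> closure (\<phi> ` (M - s))" by (simp add: V_def)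
        then obtain Y where Y: "\<And>i. Y i \<in> \<phi> ` (M - s)" "Y \<longlonglongrightarrow> \<phi> x" unfolding closure_sequential by blast
        then have "\<forall>i. \<exists>z. z \<in> M - s \<and> Y i = \<phi> z" by blast
        then obtain X where X: "\<And>i. X i \<in> M - s" "\<And>i. Y i = \<phi> (X i)" by metis
        have "Y = (\<lambda>i. \<phi> (X i))" using X(2) by auto
        with Y(2) have "(\<lambda>i. \<phi> (X i)) \<longlonglongrightarrow> \<phi> x" by simp
        from seq[OF Basis xs _ this] X(1) show False by blast
      qed
    qed
    moreover have "open V" unfolding V_def by (rule open_Compl[OF closed_closure])
    ultimately show ?case using sub[OF Basis] by (intro exI[of _ V]) blast
  qed
  then show ?thesis using that by blast
qed

lemma space_borel_of: "space (borel_of X) = topspace X"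
  unfolding borel_of_def by (rule space_measure_of) (auto dest: openin_subset)

lemma sets_borel_of: "sets (borel_of X) = sigma_sets (topspace X) {U. openin X U}"
  unfolding borel_of_def by (rule sets_measure_of) (auto dest: openin_subset)

lemma measurable_into_borel_of:
  fixes \<phi> :: "'b \<Rightarrow> 'c::topological_space"
  assumes T: "\<And>U. openin T U \<Longrightarrow> \<exists>V. open V \<and> U = {x \<in> topspace T. \<phi> x \<in> V}"
    and X: "\<And>\<omega>. \<omega> \<in> space M \<Longrightarrow> X \<omega> \<in> topspace T" "(\<lambda>\<omega>. \<phi> (X \<omega>)) \<in> borel_measurable M"
  shows "X \<in> measurable M (borel_of T)"
  unfolding borel_of_def
proof (rule measurable_measure_of)
  fix U assume "U \<in> {U. openin T U}"
  then obtain V where V: "open V" "U = {x \<in> topspace T. \<phi> x \<in> V}" using T by blast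
  have "X -` U \<inter> space M = (\<lambda>\<omega>. \<phi> (X \<omega>)) -` V \<inter> space M" using X(1) V(2) by auto
  also have "\<dots> \<in> sets M" using X(2) V(1) by (intro measurable_sets) auto
  finally show "X -` U \<inter> space M \<in> sets M" .
qed (use X(1) in \<open>auto dest: openin_subset\<close>)

text \<open>\<^const>\<open>Phi\<close> is a topological embedding into the Hilbert cube; this is the direction that
  is not plain continuity.\<close>

lemma openin_radonE:
  fixes U :: "(real ^ 'n) measure set"
  assumes "openin radon_topology U"
  obtains V where "open V" "U = {\<mu> \<in> radon_measures. Phi \<mu> \<in> V}"
proof (rule sequential_embedding_openE[OF assms[unfolded radon_topology_def]])
  fix s \<mu> and X :: "nat \<Rightarrow> (real ^ 'n) measure"
  assume "s \<in> {{\<mu> \<in> radon_measures. (\<integral>x. f x \<partial>\<mu>) \<in> U} | f U.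
      continuous_on UNIV f \<and> compact (closure {x :: real ^ 'n. f x \<noteq> 0}) \<and> open (U :: real set)}"
  then obtain f O' where s: "s = {\<mu> \<in> radon_measures. (\<integral>x. f x \<partial>\<mu>) \<in> O'}" and f: "cc f" and O': "open O'"
    unfolding cc_iff by blast
  assume \<mu>: "\<mu> \<in> s" and X: "\<And>i. X i \<in> radon_measures" and lim: "(\<lambda>i. Phi (X i)) \<longlonglongrightarrow> Phi \<mu>"
  have "vconv X \<mu>" by (rule Phi_vconv[OF X _ lim]) (use \<mu> s in blast)
  then have "(\<lambda>i. \<integral>x. f x \<partial>X i) \<longlonglongrightarrow> (\<integral>x. f x \<partial>\<mu>)" using f by (simp add: vconv_def)
  then have "eventually (\<lambda>i. (\<integral>x. f x \<partial>X i) \<in> O') sequentially"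
    by (rule topological_tendstoD[OF _ O']) (use \<mu> s in blast)
  then obtain i where "(\<integral>x. f x \<partial>X i) \<in> O'"
    unfolding eventually_sequentially by blast
  then show "\<exists>i. X i \<in> s" using X unfolding s by blast
qed (use that in \<open>(assumption | blast)+\<close>)

abbreviation radon_borel :: "(real ^ 'n) measure measure" where
  "radon_borel \<equiv> borel_of radon_topology"

lemma space_radon_borel: "space radon_borel = (radon_measures :: (real ^ 'n) measure set)"
  by (simp add: space_borel_of topspace_radon)

lemma measurable_integral_cc:
  assumes "cc f" shows "(\<lambda>\<mu> :: (real ^ 'n) measure. \<integral>x. f x \<partial>\<mu>) \<in> borel_measurable radon_borel"
proof (rule borel_measurableI)
  fix S :: "real set" assume "open S"
  then have "openin radon_topology {\<mu> \<in> radon_measures. (\<integral>x. f x \<partial>\<mu>) \<in> S}"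
    unfolding radon_topology_def using assms unfolding cc_iff
    by (intro topology_generated_by_Basis) blast
  then have "{\<mu> \<in> radon_measures. (\<integral>x. f x \<partial>\<mu>) \<in> S} \<in> sets radon_borel"
    unfolding sets_borel_of by (intro sigma_sets.Basic) simp
  also have "{\<mu> \<in> radon_measures. (\<integral>x. f x \<partial>\<mu>) \<in> S} = (\<lambda>\<mu>. \<integral>x. f x \<partial>\<mu>) -` S \<inter> space radon_borel"
    unfolding space_radon_borel by blast
  finally show "(\<lambda>\<mu> :: (real ^ 'n) measure. \<integral>x. f x \<partial>\<mu>) -` S \<inter> space radon_borel \<in> sets radon_borel" .
qed

lemma measurable_Phi [measurable]: "Phi \<in> borel_measurable radon_borel"
  unfolding Phi_def[abs_def]
  by (rule measurable_coordinatewise_then_product,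
      rule borel_measurable_divide[OF measurable_integral_cc[OF cc_test]
        borel_measurable_add[OF borel_measurable_const measurable_integral_cc[OF cc_test]]])

lemma measurable_into_radon_borel_Phi:
  assumes "\<And>\<omega>. \<omega> \<in> space M \<Longrightarrow> X \<omega> \<in> radon_measures" "(\<lambda>\<omega>. Phi (X \<omega>)) \<in> borel_measurable M"
  shows "X \<in> measurable M radon_borel"
proof (rule measurable_into_borel_of[where \<phi> = Phi])
  show "\<exists>V. open V \<and> U = {\<mu> \<in> topspace radon_topology. Phi \<mu> \<in> V}" if "openin radon_topology U" for U
    using openin_radonE[OF that] unfolding topspace_radon by metis
qed (simp_all add: assms topspace_radon)

lemma measurable_into_radon_borel:
  assumes "\<And>\<omega>. \<omega> \<in> space M \<Longrightarrow> X \<omega> \<in> radon_measures"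
    and "\<And>k. (\<lambda>\<omega>. \<integral>x. test k x \<partial>X \<omega>) \<in> borel_measurable M"
  shows "X \<in> measurable M radon_borel"
proof (rule measurable_into_radon_borel_Phi[OF assms(1)])
  show "(\<lambda>\<omega>. Phi (X \<omega>)) \<in> borel_measurable M"
    unfolding Phi_def
    by (rule measurable_coordinatewise_then_product,
        rule borel_measurable_divide[OF assms(2) borel_measurable_add[OF borel_measurable_const assms(2)]])
qed

text \<open>A point of the closure with all coordinates below 1 is attained by
  \<open>Phi_limit_compact\<close>. This exhibits the range as a Borel set, which makes the inverse
  of \<open>Phi\<close> measurable.\<close>

lemma Phi_range:
  "Phi ` (radon_measures :: (real ^ 'n) measure set) = {y. y \<in> closure (Phi ` (radon_measures :: (real ^ 'n) measure set)) \<and> (\<forall>k. y k < 1)}"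
proof (intro equalityI subsetI)
  fix y assume "y \<in> {y. y \<in> closure (Phi ` (radon_measures :: (real ^ 'n) measure set)) \<and> (\<forall>k. y k < 1)}"
  then have y: "y \<in> closure (Phi ` (radon_measures :: (real ^ 'n) measure set))" "\<And>k. y k < 1" by auto
  then obtain Y where Y: "\<And>i. Y i \<in> Phi ` (radon_measures :: (real ^ 'n) measure set)" "Y \<longlonglongrightarrow> y"
    unfolding closure_sequential by blast
  then have "\<forall>i. \<exists>\<nu>. \<nu> \<in> (radon_measures :: (real ^ 'n) measure set) \<and> Y i = Phi \<nu>" by blast
  then obtain X :: "nat \<Rightarrow> (real ^ 'n) measure" where X: "\<And>i. X i \<in> radon_measures" "\<And>i. Y i = Phi (X i)" by metis
  then have "Y = (\<lambda>i. Phi (X i))" by auto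
  with Y(2) have lim: "(\<lambda>i. Phi (X i)) \<longlonglongrightarrow> y" by simp
  obtain \<mu> :: "(real ^ 'n) measure" where "\<mu> \<in> radon_measures" "Phi \<mu> = y"
    by (rule Phi_limit_compact[OF X(1) lim y(2)]) (rule that)
  then show "y \<in> Phi ` (radon_measures :: (real ^ 'n) measure set)" by blast
next
  fix y assume "y \<in> Phi ` (radon_measures :: (real ^ 'n) measure set)"
  then show "y \<in> {y. y \<in> closure (Phi ` (radon_measures :: (real ^ 'n) measure set)) \<and> (\<forall>k. y k < 1)}"
    using closure_subset Phi_bounds by blast
qed

lemma Phi_range_borel [measurable]: "Phi ` (radon_measures :: (real ^ 'n) measure set) \<in> sets borel"
proof -
  have "{y :: nat \<Rightarrow> real. \<forall>k. y k < 1} \<in> sets borel" by measurable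
  then have *: "closure (Phi ` (radon_measures :: (real ^ 'n) measure set)) \<inter> {y. \<forall>k. y k < 1} \<in> sets borel"
    by (rule sets.Int[OF borel_closed[OF closed_closure]])
  have "Phi ` (radon_measures :: (real ^ 'n) measure set) =
      closure (Phi ` (radon_measures :: (real ^ 'n) measure set)) \<inter> {y. \<forall>k. y k < 1}"
    by (rule trans[OF Phi_range]) blast
  from ssubst[OF this, of "\<lambda>A. A \<in> sets borel", OF *] show ?thesis .
qed

section \<open>Random measures\<close>

lemma measure_bounded_open_measurable:
  fixes X :: "'a \<Rightarrow> (real ^ 'n) measure"
  assumes X: "X \<in> measurable M radon_borel" and B: "open B" "bounded B"
  shows "(\<lambda>\<omega>. measure (X \<omega>) B) \<in> borel_measurable M"
proof (rule borel_measurable_LIMSEQ_real)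
  have "cc (plateau B n :: real ^ 'n \<Rightarrow> real)" for n
  proof -
    obtain b where b: "\<forall>x\<in>B. norm x \<le> b" using B(2) unfolding bounded_iff by blast
    show ?thesis
      by (rule ccI[where r = b]) (use b in \<open>auto intro!: continuous_plateau plateau_outside simp: not_le[symmetric]\<close>)
  qed
  then show "(\<lambda>\<omega>. \<integral>x. plateau B n x \<partial>X \<omega>) \<in> borel_measurable M" for n
    by (rule measurable_compose[OF X measurable_integral_cc])
  show "(\<lambda>n. \<integral>x. plateau B n x \<partial>X \<omega>) \<longlonglongrightarrow> measure (X \<omega>) B" if "\<omega> \<in> space M" for \<omega>
    using measurable_space[OF X that] unfolding space_radon_borel by (rule radon_plateau_tendsto[OF _ B])
qed

lemma random_radon: "X \<in> measurable M radon_borel \<Longrightarrow> \<omega> \<in> space M \<Longrightarrow> X \<omega> \<in> radon_measures"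
  using measurable_space[of X M radon_borel \<omega>] by (simp add: space_radon_borel)

text \<open>Cut off at a ball and divided by a bound of its mass, a random Radon measure is a
  subprobability kernel, for which integrals are measurable. The factor is undone afterwards and the
  balls grow.\<close>

lemma nn_integral_radon_measurable:
  fixes X :: "'a \<Rightarrow> (real ^ 'n) measure"
  assumes X: "X \<in> measurable M radon_borel"
    and f [measurable]: "(\<lambda>(\<omega>, y). f \<omega> y) \<in> borel_measurable (M \<Otimes>\<^sub>M borel)"
  shows "(\<lambda>\<omega>. \<integral>\<^sup>+y. f \<omega> y \<partial>X \<omega>) \<in> borel_measurable M"
proof -
  let ?B = "\<lambda>n::nat. ball 0 (real n) :: (real ^ 'n) set"
  \<comment> \<open>The summand 1 keeps the factor positive and finite also when the ball has mass
    0.\<close>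
  define c where "c n \<omega> = 1 / (1 + measure (X \<omega>) (?B n))" for n \<omega>
  define \<kappa> where "\<kappa> n \<omega> = density (X \<omega>) (\<lambda>y. ennreal (c n \<omega>) * indicator (?B n) y)" for n \<omega>
  have c [measurable]: "c n \<in> borel_measurable M" for n
    unfolding c_def using measure_bounded_open_measurable[OF X] by measurable
  have cpos: "c n \<omega> > 0" for n \<omega>
    using measure_nonneg[of "X \<omega>" "?B n"] unfolding c_def by (intro divide_pos_pos) linarith+
  have Xs: "sets (X \<omega>) = sets borel" if "\<omega> \<in> space M" for \<omega>
    by (rule radon_sets[OF random_radon[OF X that]])
  have fin: "emeasure (X \<omega>) (?B n) = ennreal (measure (X \<omega>) (?B n))" if "\<omega> \<in> space M" for \<omega> n
    using radon_emeasure_bounded[OF random_radon[OF X that] bounded_ball, of 0 "real n"]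
    by (intro emeasure_eq_ennreal_measure) simp
  have em: "emeasure (\<kappa> n \<omega>) A = ennreal (c n \<omega>) * emeasure (X \<omega>) (A \<inter> ?B n)"
    if "\<omega> \<in> space M" "A \<in> sets borel" for n \<omega> A
  proof -
    have [measurable]: "A \<in> sets (X \<omega>)" "?B n \<in> sets (X \<omega>)" using that Xs by auto
    have "emeasure (\<kappa> n \<omega>) A = (\<integral>\<^sup>+y. ennreal (c n \<omega>) * indicator (A \<inter> ?B n) y \<partial>X \<omega>)"
    proof -
      have m: "(\<lambda>y. ennreal (c n \<omega>) * indicator (?B n) y) \<in> borel_measurable (X \<omega>)" by measurable
      show ?thesis unfolding \<kappa>_def emeasure_density[OF m \<open>A \<in> sets (X \<omega>)\<close>]
        by (rule nn_integral_cong) (simp add: indicator_inter_arith ac_simps)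
    qed
    then show ?thesis by (simp add: nn_integral_cmult_indicator)
  qed
  have \<kappa>: "\<kappa> n \<in> measurable M (subprob_algebra borel)" for n
  proof (rule measurable_subprob_algebra_generated[OF test_open(3) test_open(1)])
    fix \<omega> assume \<omega>: "\<omega> \<in> space M"
    show "sets (\<kappa> n \<omega>) = sets borel" using Xs[OF \<omega>] by (simp add: \<kappa>_def)
    have "emeasure (\<kappa> n \<omega>) UNIV = ennreal (c n \<omega> * measure (X \<omega>) (?B n))"
      using cpos[of n \<omega>] by (simp add: em[OF \<omega>] fin[OF \<omega>] ennreal_mult')
    also have "c n \<omega> * measure (X \<omega>) (?B n) \<le> 1"
    proof -
      have "0 < 1 + measure (X \<omega>) (?B n)" using measure_nonneg[of "X \<omega>" "?B n"] by linarith
      then show ?thesis by (simp add: c_def divide_le_eq)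
    qed
    finally have "emeasure (\<kappa> n \<omega>) UNIV \<le> 1" by (simp add: ennreal_leI)
    moreover have "space (\<kappa> n \<omega>) = UNIV"
      using radon_space[OF random_radon[OF X \<omega>]] by (simp add: \<kappa>_def)
    ultimately show "subprob_space (\<kappa> n \<omega>)" by (intro subprob_spaceI) auto
  next
    have "(\<lambda>\<omega>. emeasure (\<kappa> n \<omega>) A) \<in> borel_measurable M" if A: "open A" for A
    proof -
      have B: "open (A \<inter> ?B n)" "bounded (A \<inter> ?B n)" using A by (auto intro: bounded_subset[of "?B n"])
      have "(\<lambda>\<omega>. ennreal (c n \<omega>) * ennreal (measure (X \<omega>) (A \<inter> ?B n))) \<in> borel_measurable M"
        using measure_bounded_open_measurable[OF X B] by measurable
      moreover have "emeasure (\<kappa> n \<omega>) A = ennreal (c n \<omega>) * ennreal (measure (X \<omega>) (A \<inter> ?B n))" if "\<omega> \<in> space M" for \<omega>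
        using radon_emeasure_bounded[OF random_radon[OF X that] B(2)] A
        by (simp add: em[OF that] emeasure_eq_ennreal_measure)
      ultimately show ?thesis by (simp cong: measurable_cong)
    qed
    then show "(\<lambda>\<omega>. emeasure (\<kappa> n \<omega>) UNIV) \<in> borel_measurable M"
      "\<And>A. A \<in> range test_open \<Longrightarrow> (\<lambda>\<omega>. emeasure (\<kappa> n \<omega>) A) \<in> borel_measurable M"
      using test_open(2) by auto
  qed simp
  have "(\<lambda>\<omega>. SUP n. ennreal (1 / c n \<omega>) * (\<integral>\<^sup>+y. f \<omega> y \<partial>\<kappa> n \<omega>)) \<in> borel_measurable M"
    using nn_integral_measurable_subprob_algebra2[OF f \<kappa>] by measurable
  moreover have "(\<integral>\<^sup>+y. f \<omega> y \<partial>X \<omega>) = (SUP n. ennreal (1 / c n \<omega>) * (\<integral>\<^sup>+y. f \<omega> y \<partial>\<kappa> n \<omega>))"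
    if \<omega>: "\<omega> \<in> space M" for \<omega>
  proof -
    have fb: "f \<omega> \<in> borel_measurable borel" using measurable_Pair2[OF f \<omega>] by simp
    have fm [measurable]: "f \<omega> \<in> borel_measurable (X \<omega>)"
      by (rule borel_to_radon_measurable[OF random_radon[OF X \<omega>] fb])
    have Bm [measurable]: "?B n \<in> sets (X \<omega>)" for n using Xs[OF \<omega>] by simp
    have "ennreal (1 / c n \<omega>) * (\<integral>\<^sup>+y. f \<omega> y \<partial>\<kappa> n \<omega>) = (\<integral>\<^sup>+y. f \<omega> y * indicator (?B n) y \<partial>X \<omega>)" for n
    proof -
      have "(\<integral>\<^sup>+y. f \<omega> y \<partial>\<kappa> n \<omega>) = (\<integral>\<^sup>+y. ennreal (c n \<omega>) * (f \<omega> y * indicator (?B n) y) \<partial>X \<omega>)"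
        proof -
        have m: "(\<lambda>y. ennreal (c n \<omega>) * indicator (?B n) y) \<in> borel_measurable (X \<omega>)" by measurable
        show ?thesis unfolding \<kappa>_def nn_integral_density[OF m fm]
          by (rule nn_integral_cong) (simp add: ac_simps)
      qed
      also have "\<dots> = ennreal (c n \<omega>) * (\<integral>\<^sup>+y. f \<omega> y * indicator (?B n) y \<partial>X \<omega>)"
        by (rule nn_integral_cmult) measurable
      finally have "ennreal (1 / c n \<omega>) * (\<integral>\<^sup>+y. f \<omega> y \<partial>\<kappa> n \<omega>)
          = (ennreal (1 / c n \<omega>) * ennreal (c n \<omega>)) * (\<integral>\<^sup>+y. f \<omega> y * indicator (?B n) y \<partial>X \<omega>)"
        by (simp add: mult.assoc)
      also have "ennreal (1 / c n \<omega>) * ennreal (c n \<omega>) = 1"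
        using cpos[of n \<omega>] by (subst ennreal_mult[symmetric]) auto
      finally show ?thesis by simp
    qed
    then have "(SUP n. ennreal (1 / c n \<omega>) * (\<integral>\<^sup>+y. f \<omega> y \<partial>\<kappa> n \<omega>))
        = (SUP n. \<integral>\<^sup>+y. f \<omega> y * indicator (?B n) y \<partial>X \<omega>)" by simp
    also have "\<dots> = (\<integral>\<^sup>+y. (SUP n. f \<omega> y * indicator (?B n) y) \<partial>X \<omega>)"
    proof (rule nn_integral_monotone_convergence_SUP[symmetric])
      show "(\<lambda>y :: real ^ 'n. f \<omega> y * indicator (?B n) y) \<in> borel_measurable (X \<omega>)" for n :: nat by measurable
    qed (auto simp: incseq_def le_fun_def indicator_def)
    also have "\<dots> = (\<integral>\<^sup>+y. f \<omega> y \<partial>X \<omega>)"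
    proof (rule nn_integral_cong)
      fix y :: "real ^ 'n"
      obtain n :: nat where n: "norm y < real n" using reals_Archimedean2 by blast
      show "(SUP n. f \<omega> y * indicator (?B n) y) = f \<omega> y"
      proof (rule antisym)
        show "(SUP n. f \<omega> y * indicator (?B n) y) \<le> f \<omega> y"
          by (rule SUP_least) (auto simp: indicator_def)
        have "f \<omega> y = f \<omega> y * indicator (?B n) y" using n by simp
        also have "\<dots> \<le> (SUP n. f \<omega> y * indicator (?B n) y)"
          by (rule SUP_upper) simp
        finally show "f \<omega> y \<le> (SUP n. f \<omega> y * indicator (?B n) y)" .
      qed
    qed
    finally show ?thesis by simp
  qed
  ultimately show ?thesis by (simp cong: measurable_cong)
qed

lemma integral_radon_measurable:
  fixes X :: "'a \<Rightarrow> (real ^ 'n) measure" and f :: "'a \<Rightarrow> real ^ 'n \<Rightarrow> real"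
  assumes X: "X \<in> measurable M radon_borel"
    and f: "(\<lambda>(\<omega>, y). f \<omega> y) \<in> borel_measurable (M \<Otimes>\<^sub>M borel)" and nn: "\<And>\<omega> y. 0 \<le> f \<omega> y"
  shows "(\<lambda>\<omega>. \<integral>y. f \<omega> y \<partial>X \<omega>) \<in> borel_measurable M"
proof -
  have "(\<lambda>(\<omega>, y). ennreal (f \<omega> y)) \<in> borel_measurable (M \<Otimes>\<^sub>M borel)"
    using f by (simp add: case_prod_beta')
  from nn_integral_radon_measurable[OF X this]
  have "(\<lambda>\<omega>. enn2real (\<integral>\<^sup>+y. ennreal (f \<omega> y) \<partial>X \<omega>)) \<in> borel_measurable M" by measurable
  moreover have "(\<integral>y. f \<omega> y \<partial>X \<omega>) = enn2real (\<integral>\<^sup>+y. ennreal (f \<omega> y) \<partial>X \<omega>)" if \<omega>: "\<omega> \<in> space M" for \<omega>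
  proof (rule integral_eq_nn_integral)
    have "f \<omega> \<in> borel_measurable borel" using measurable_Pair2[OF f \<omega>] by simp
    then show "f \<omega> \<in> borel_measurable (X \<omega>)" by (rule borel_to_radon_measurable[OF random_radon[OF X \<omega>]])
  qed (simp add: nn)
  ultimately show ?thesis by (simp cong: measurable_cong)
qed

lemma emeasure_radon_measurable:
  fixes X :: "'a \<Rightarrow> (real ^ 'n) measure"
  assumes X: "X \<in> measurable M radon_borel" and [measurable]: "A \<in> sets borel"
  shows "(\<lambda>\<omega>. emeasure (X \<omega>) A) \<in> borel_measurable M"
proof -
  have "(\<lambda>\<omega>. \<integral>\<^sup>+y. indicator A y \<partial>X \<omega>) \<in> borel_measurable M"
    by (rule nn_integral_radon_measurable[OF X]) measurable
  moreover have "(\<integral>\<^sup>+y. indicator A y \<partial>X \<omega>) = emeasure (X \<omega>) A" if "\<omega> \<in> space M" for \<omega>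
    using radon_sets[OF random_radon[OF X that]] by simp
  ultimately show ?thesis by (simp cong: measurable_cong)
qed

lemma measurable_scale_radon:
  fixes X :: "'a \<Rightarrow> (real ^ 'n) measure"
  assumes X: "X \<in> measurable M radon_borel" and c: "c \<in> borel_measurable M" and c0: "\<And>\<omega>. 0 \<le> c \<omega>"
  shows "(\<lambda>\<omega>. scale_measure (ennreal (c \<omega>)) (X \<omega>)) \<in> measurable M radon_borel"
proof (rule measurable_into_radon_borel)
  show "scale_measure (ennreal (c \<omega>)) (X \<omega>) \<in> radon_measures" if "\<omega> \<in> space M" for \<omega>
    by (rule radon_scale[OF random_radon[OF X that]])
  fix k
  have "(\<lambda>\<omega>. c \<omega> * (\<integral>x. test k x \<partial>X \<omega>)) \<in> borel_measurable M"
    by (rule borel_measurable_times[OF c measurable_compose[OF X measurable_integral_cc[OF cc_test]]])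
  moreover have "(\<integral>x. test k x \<partial>scale_measure (ennreal (c \<omega>)) (X \<omega>)) = c \<omega> * (\<integral>x. test k x \<partial>X \<omega>)"
    if "\<omega> \<in> space M" for \<omega>
    by (rule integral_scale_measure[OF c0 borel_to_radon_measurable[OF random_radon[OF X that] cc_borel[OF cc_test]]])
  ultimately show "(\<lambda>\<omega>. \<integral>x. test k x \<partial>scale_measure (ennreal (c \<omega>)) (X \<omega>)) \<in> borel_measurable M"
    by (simp cong: measurable_cong)
qed

lemma measurable_magnify:
  fixes X :: "'a \<Rightarrow> (real ^ 'n) measure"
  assumes X: "X \<in> measurable M radon_borel"
  shows "(\<lambda>\<omega>. magnify t (X \<omega>)) \<in> measurable M radon_borel"
proof (rule measurable_into_radon_borel)
  show "magnify t (X \<omega>) \<in> radon_measures" if "\<omega> \<in> space M" for \<omega>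
    by (rule radon_magnify[OF random_radon[OF X that]])
  fix k
  have "(\<lambda>\<omega>. \<integral>x. test k (exp t *\<^sub>R x) \<partial>X \<omega>) \<in> borel_measurable M"
    by (rule measurable_compose[OF X measurable_integral_cc[OF cc_scaleR[OF cc_test]]]) simp
  moreover have "(\<integral>x. test k x \<partial>magnify t (X \<omega>)) = (\<integral>x. test k (exp t *\<^sub>R x) \<partial>X \<omega>)"
    if "\<omega> \<in> space M" for \<omega>
    by (rule integral_magnify[OF random_radon[OF X that] cc_borel[OF cc_test]])
  ultimately show "(\<lambda>\<omega>. \<integral>x. test k x \<partial>magnify t (X \<omega>)) \<in> borel_measurable M"
    by (simp cong: measurable_cong)
qed

lemma measurable_translate:
  fixes X :: "'a \<Rightarrow> (real ^ 'n) measure" and z :: "'a \<Rightarrow> real ^ 'n"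
  assumes X: "X \<in> measurable M radon_borel" and z [measurable]: "z \<in> borel_measurable M"
  shows "(\<lambda>\<omega>. translate (z \<omega>) (X \<omega>)) \<in> measurable M radon_borel"
proof (rule measurable_into_radon_borel)
  show "translate (z \<omega>) (X \<omega>) \<in> radon_measures" if "\<omega> \<in> space M" for \<omega>
    by (rule radon_translate[OF random_radon[OF X that]])
  fix k
  note [measurable] = cc_borel[OF cc_test, of k]
  have "(\<lambda>\<omega>. \<integral>x. test k (x - z \<omega>) \<partial>X \<omega>) \<in> borel_measurable M"
  proof (rule integral_radon_measurable[OF X])
    have "(\<lambda>p. snd p - z (fst p)) \<in> borel_measurable (M \<Otimes>\<^sub>M borel)" by measurable
    from measurable_compose[OF this cc_borel[OF cc_test]]
    show "(\<lambda>(\<omega>, x). test k (x - z \<omega>)) \<in> borel_measurable (M \<Otimes>\<^sub>M borel)"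
      by (simp add: case_prod_beta')
  qed simp
  moreover have "(\<integral>x. test k x \<partial>translate (z \<omega>) (X \<omega>)) = (\<integral>x. test k (x - z \<omega>) \<partial>X \<omega>)"
    if "\<omega> \<in> space M" for \<omega>
    by (rule integral_translate[OF random_radon[OF X that] cc_borel[OF cc_test]])
  ultimately show "(\<lambda>\<omega>. \<integral>x. test k x \<partial>translate (z \<omega>) (X \<omega>)) \<in> borel_measurable M"
    by (simp cong: measurable_cong)
qed

text \<open>A Borel left inverse of \<open>Phi\<close>; the null measure is an arbitrary Radon
  default off the range.\<close>

definition radon_of :: "(nat \<Rightarrow> real) \<Rightarrow> (real ^ 'n) measure" where
  "radon_of y = (if y \<in> Phi ` (radon_measures :: (real ^ 'n) measure set)
     then inv_into radon_measures Phi y else null_measure borel)"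

lemma radon_of_Phi: "\<mu> \<in> radon_measures \<Longrightarrow> radon_of (Phi \<mu>) = \<mu>"
proof -
  assume \<mu>: "\<mu> \<in> radon_measures"
  have "inj_on Phi (radon_measures :: (real ^ 'a) measure set)"
    by (rule inj_onI) (rule Phi_inj)
  then show ?thesis unfolding radon_of_def using \<mu> by (simp add: inv_into_f_f)
qed

lemma Phi_radon_of: "y \<in> Phi ` (radon_measures :: (real ^ 'n) measure set) \<Longrightarrow> Phi (radon_of y :: (real ^ 'n) measure) = y"
  by (simp add: radon_of_def f_inv_into_f)

lemma radon_of_radon: "radon_of y \<in> radon_measures"
  by (simp add: radon_of_def inv_into_into radon_null)

lemma measurable_radon_of [measurable]: "radon_of \<in> measurable borel (radon_borel :: (real ^ 'n) measure measure)"
proof (rule measurable_into_radon_borel_Phi)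
  have "(\<lambda>y. if y \<in> Phi ` (radon_measures :: (real ^ 'n) measure set) then y
      else Phi (null_measure borel :: (real ^ 'n) measure)) \<in> borel_measurable borel"
    by measurable
  also have "(\<lambda>y. if y \<in> Phi ` (radon_measures :: (real ^ 'n) measure set) then y
      else Phi (null_measure borel :: (real ^ 'n) measure)) = (\<lambda>y. Phi (radon_of y :: (real ^ 'n) measure))"
    by (rule ext) (simp add: Phi_radon_of, simp add: radon_of_def)
  finally show "(\<lambda>y. Phi (radon_of y :: (real ^ 'n) measure)) \<in> borel_measurable borel" .
qed (rule radon_of_radon)

text \<open>The Skorohod representation in the cube, applied to the laws of \<open>Phi\<close>.
  Tightness excludes limit coordinates equal to 1, so the limit lies almost surely in the range of
  \<open>Phi\<close> and is again a Radon measure.\<close>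

lemma radon_Skorohod:
  fixes P :: "nat \<Rightarrow> (real ^ 'n) measure measure"
  assumes P: "\<And>i. prob_space (P i)" "\<And>i. sets (P i) = sets radon_borel"
    and tight: "\<And>k \<epsilon>. \<epsilon> > 0 \<Longrightarrow> \<exists>K. \<forall>i. measure (P i) {\<mu> \<in> radon_measures. K < (\<integral>x. test k x \<partial>\<mu>)} \<le> \<epsilon>"
  obtains r :: "nat \<Rightarrow> nat" and \<Omega> :: "real measure" and X X'
  where "strict_mono r" "prob_space \<Omega>" "\<And>i. X i \<in> measurable \<Omega> (radon_borel :: (real ^ 'n) measure measure)"
    "X' \<in> measurable \<Omega> radon_borel" "\<And>i. distr \<Omega> radon_borel (X i) = P (r i)"
    "AE \<omega> in \<Omega>. vconv (\<lambda>i. X i \<omega>) (X' \<omega>)"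
proof -
  have mP: "f \<in> measurable radon_borel N \<Longrightarrow> f \<in> measurable (P i) N" for f :: "(real ^ 'n) measure \<Rightarrow> 'b" and N i
    using measurable_cong_sets[OF P(2) refl] by blast
  have spP: "space (P i) = radon_measures" for i
    using sets_eq_imp_space_eq[OF P(2)] by (simp add: space_radon_borel)
  define L where "L i = distr (P i) borel Phi" for i
  have Lp: "prob_space (L i)" for i
    unfolding L_def by (rule prob_space.prob_space_distr[OF P(1) mP[OF measurable_Phi]])
  have Ls: "sets (L i) = sets borel" for i by (simp add: L_def)
  have Lc: "AE y in L i. \<forall>k. 0 \<le> y k \<and> y k < 1" for i
    unfolding L_def by (subst AE_distr_iff[OF mP[OF measurable_Phi]]) (measurable, simp add: Phi_bounds)
  have Lr: "AE y in L i. y \<in> Phi ` (radon_measures :: (real ^ 'n) measure set)" for i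
    unfolding L_def by (subst AE_distr_iff[OF mP[OF measurable_Phi]]) (measurable, intro AE_I2, simp add: spP)
  obtain r :: "nat \<Rightarrow> nat" and \<Omega> :: "real measure" and Z Z' where r: "strict_mono r"
    and \<Omega>: "prob_space \<Omega>" and Z [measurable]: "\<And>i. Z i \<in> borel_measurable \<Omega>" "Z' \<in> borel_measurable \<Omega>"
    and law: "\<And>i. distr \<Omega> borel (Z i) = L (r i)"
    and conv: "\<And>\<omega>. \<omega> \<in> space \<Omega> \<Longrightarrow> (\<lambda>i. Z i \<omega>) \<longlonglongrightarrow> Z' \<omega>"
    by (rule cube_Skorohod[OF Lp Ls Lc]) (rule that)
  interpret prob_space \<Omega> by fact
  have "AE \<omega> in \<Omega>. Z i \<omega> \<in> Phi ` (radon_measures :: (real ^ 'n) measure set)" for i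
    using Lr[of "r i"] unfolding law[symmetric] by (subst (asm) AE_distr_iff) measurable
  then have AZ: "AE \<omega> in \<Omega>. \<forall>i. Z i \<omega> \<in> Phi ` (radon_measures :: (real ^ 'n) measure set)"
    by (simp add: AE_all_countable)
  have lt1: "AE \<omega> in \<Omega>. Z' \<omega> k < 1" for k
  proof -
    have Zk [measurable]: "(\<lambda>\<omega>. Z' \<omega> k) \<in> borel_measurable \<Omega>" "(\<lambda>\<omega>. Z i \<omega> k) \<in> borel_measurable \<Omega>" for i
      by (auto intro: measurable_product_then_coordinatewise)
    define bad where "bad = {\<omega> \<in> space \<Omega>. 1 \<le> Z' \<omega> k}"
    have [measurable]: "bad \<in> events" unfolding bad_def by measurable
    have "prob bad \<le> \<epsilon>" if e: "\<epsilon> > 0" for \<epsilon>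
    proof -
      obtain K0 where K0: "\<And>i. measure (P i) {\<mu> \<in> radon_measures. K0 < (\<integral>x. test k x \<partial>\<mu>)} \<le> \<epsilon>"
        using tight[OF e] by blast
      define K where "K = max 0 K0"
      have K: "K \<ge> 0" "K0 \<le> K" by (auto simp: K_def)
      define t where "t = K / (1 + K)"
      have t: "0 \<le> t" "t < 1" using K by (auto simp: t_def)
      \<comment> \<open>A continuous cutoff that vanishes at the coordinates of measures with test
        integral at most K and equals 1 at the coordinate 1. Its expectation passes to the limit and
        bounds the probability of infinite mass.\<close>
      define g where "g y = max 0 (min 1 ((y - t) / (1 - t)))" for y :: real
      have gc: "continuous_on UNIV g" unfolding g_def using t by (intro continuous_intros) auto
      have [measurable]: "g \<in> borel_measurable borel" by (rule borel_measurable_continuous_onI[OF gc])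
      have g01: "0 \<le> g y" "g y \<le> 1" for y by (auto simp: g_def)
      have ge: "expectation (\<lambda>\<omega>. g (Z i \<omega> k)) \<le> \<epsilon>" for i
      proof -
        have gm: "(\<lambda>y :: nat \<Rightarrow> real. g (y k)) \<in> borel_measurable borel" by measurable
        have "expectation (\<lambda>\<omega>. g (Z i \<omega> k)) = (\<integral>y. g (y k) \<partial>distr \<Omega> borel (Z i))"
          by (rule integral_distr[symmetric, OF Z(1) gm])
        also have "\<dots> = (\<integral>\<mu>. g (Phi \<mu> k) \<partial>P (r i))"
          unfolding law L_def by (rule integral_distr[OF mP[OF measurable_Phi] gm])
        also have "\<dots> \<le> (\<integral>\<mu>. indicator {\<mu> \<in> radon_measures. K0 < (\<integral>x. test k x \<partial>\<mu>)} \<mu> \<partial>P (r i))"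
        proof (rule integral_mono)
          interpret Pr: prob_space "P (r i)" by (rule P)
          have [measurable]: "(\<lambda>\<mu>. \<integral>x. test k x \<partial>\<mu>) \<in> borel_measurable (P (r i))"
            by (rule mP[OF measurable_integral_cc[OF cc_test]])
          have S: "{\<mu> \<in> radon_measures. K0 < (\<integral>x. test k x \<partial>\<mu>)} \<in> Pr.events"
            unfolding spP[of "r i", symmetric] by measurable
          then show "integrable (P (r i)) (indicator {\<mu> \<in> radon_measures. K0 < (\<integral>x. test k x \<partial>\<mu>)} :: _ \<Rightarrow> real)"
            by (rule integrable_real_indicator) (simp add: Pr.emeasure_finite less_top[symmetric])
          show "integrable (P (r i)) (\<lambda>\<mu>. g (Phi \<mu> k))"
            by (rule Pr.integrable_const_bound[where B = 1])
              (use g01 in \<open>auto intro!: measurable_compose[OF mP[OF measurable_Phi] gm]\<close>)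
          fix \<mu> assume "\<mu> \<in> space (P (r i))"
          then have \<mu>: "\<mu> \<in> radon_measures" by (simp add: spP)
          show "g (Phi \<mu> k) \<le> indicator {\<mu> \<in> radon_measures. K0 < (\<integral>x. test k x \<partial>\<mu>)} \<mu>"
          proof (cases "K0 < (\<integral>x. test k x \<partial>\<mu>)")
            case True
            then show ?thesis using \<mu> g01 by simp
          next
            case False
            let ?a = "\<integral>x. test k x \<partial>\<mu>"
            have a: "0 \<le> ?a" by (rule Bochner_Integration.integral_nonneg) simp
            have "?a \<le> K" using False K by simp
            moreover have "0 < 1 + ?a" "0 < 1 + K" using a K(1) by linarith+
            ultimately have "Phi \<mu> k \<le> t" unfolding Phi_def t_def
              by (simp add: divide_le_eq le_divide_eq algebra_simps)
            then have "(Phi \<mu> k - t) / (1 - t) \<le> 0" using t by (intro divide_nonpos_pos) auto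
            then have "g (Phi \<mu> k) = 0" by (simp add: g_def)
            then show ?thesis by simp
          qed
        qed
        also have "\<dots> = measure (P (r i)) {\<mu> \<in> radon_measures. K0 < (\<integral>x. test k x \<partial>\<mu>)}"
        proof -
          have "{\<mu> :: (real ^ 'n) measure. \<mu> \<in> radon_measures \<and> K0 < (\<integral>x. test k x \<partial>\<mu>)} \<inter> radon_measures =
            {\<mu> \<in> radon_measures. K0 < (\<integral>x. test k x \<partial>\<mu>)}" by blast
          then show ?thesis by (simp add: spP)
        qed
        also have "\<dots> \<le> \<epsilon>" by (rule K0)
        finally show ?thesis .
      qed
      have "(\<lambda>i. expectation (\<lambda>\<omega>. g (Z i \<omega> k))) \<longlonglongrightarrow> expectation (\<lambda>\<omega>. g (Z' \<omega> k))"
      proof (rule integral_dominated_convergence[where w = "\<lambda>_. 1"])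
        show "AE \<omega> in \<Omega>. (\<lambda>i. g (Z i \<omega> k)) \<longlonglongrightarrow> g (Z' \<omega> k)"
        proof (rule AE_I2)
          fix \<omega> assume "\<omega> \<in> space \<Omega>"
          then have "(\<lambda>i. Z i \<omega> k) \<longlonglongrightarrow> Z' \<omega> k" using conv fun_LIMSEQ_iff by metis
          then show "(\<lambda>i. g (Z i \<omega> k)) \<longlonglongrightarrow> g (Z' \<omega> k)"
            by (rule continuous_on_tendsto_compose[OF gc]) auto
        qed
      qed (use g01 in auto)
      then have E: "expectation (\<lambda>\<omega>. g (Z' \<omega> k)) \<le> \<epsilon>"
        by (rule LIMSEQ_le_const2) (use ge in auto)
      have "prob bad = expectation (indicator bad)" by simp
      also have "\<dots> \<le> expectation (\<lambda>\<omega>. g (Z' \<omega> k))"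
      proof (rule integral_mono)
        show "integrable \<Omega> (\<lambda>\<omega>. g (Z' \<omega> k))"
          by (rule integrable_const_bound[where B = 1]) (use g01 in auto)
        show "indicator bad \<omega> \<le> g (Z' \<omega> k)" for \<omega>
          using t g01 by (auto simp: indicator_def bad_def g_def)
        show "integrable \<Omega> (indicator bad :: _ \<Rightarrow> real)"
          by (rule integrable_real_indicator) (simp_all add: emeasure_finite less_top[symmetric])
      qed
      finally show ?thesis using E by simp
    qed
    then have "prob bad \<le> 0" using field_le_epsilon[of "prob bad" 0] by simp
    then have "prob bad = 0" using measure_nonneg[of \<Omega> bad] by linarith
    then have "AE \<omega> in \<Omega>. \<omega> \<notin> bad" by (simp add: prob_eq_0)
    then show ?thesis by (rule AE_mp) (auto simp: bad_def)
  qed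
  then have AZ1: "AE \<omega> in \<Omega>. \<forall>k. Z' \<omega> k < 1" by (simp add: AE_all_countable)
  have AZ': "AE \<omega> in \<Omega>. (\<forall>i. Z i \<omega> \<in> Phi ` (radon_measures :: (real ^ 'n) measure set)) \<and>
      Z' \<omega> \<in> Phi ` (radon_measures :: (real ^ 'n) measure set) \<and> (\<lambda>i. Z i \<omega>) \<longlonglongrightarrow> Z' \<omega>"
    using AZ AZ1 AE_space
  proof eventually_elim
    case (elim \<omega>)
    have "Z' \<omega> \<in> closure (Phi ` (radon_measures :: (real ^ 'n) measure set))"
      unfolding closure_sequential
      by (rule exI[of _ "\<lambda>i. Z i \<omega>"], rule conjI[OF elim(1) conv[OF elim(3)]])
    then have "Z' \<omega> \<in> {y. y \<in> closure (Phi ` (radon_measures :: (real ^ 'n) measure set)) \<and> (\<forall>k. y k < 1)}"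
      using elim(2) by simp
    then have "Z' \<omega> \<in> Phi ` (radon_measures :: (real ^ 'n) measure set)"
      by (subst Phi_range)
    then show ?case using elim(1) conv[OF elim(3)] by simp
  qed
  show ?thesis
  proof (rule that[OF r \<Omega>, of "\<lambda>i \<omega>. radon_of (Z i \<omega>)" "\<lambda>\<omega>. radon_of (Z' \<omega>)"])
    show "(\<lambda>\<omega>. radon_of (Z i \<omega>)) \<in> measurable \<Omega> radon_borel" for i by measurable
    show "(\<lambda>\<omega>. radon_of (Z' \<omega>)) \<in> measurable \<Omega> radon_borel" by measurable
    show "distr \<Omega> radon_borel (\<lambda>\<omega>. radon_of (Z i \<omega>)) = P (r i)" for i
    proof -
      have "distr \<Omega> radon_borel (\<lambda>\<omega>. radon_of (Z i \<omega>)) = distr (distr \<Omega> borel (Z i)) radon_borel radon_of"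
        by (subst distr_distr) (auto simp: comp_def)
      also have "\<dots> = distr (P (r i)) radon_borel (radon_of \<circ> Phi)"
        unfolding law L_def by (rule distr_distr[OF measurable_radon_of mP[OF measurable_Phi]])
      also have "\<dots> = distr (P (r i)) radon_borel (\<lambda>\<mu>. \<mu>)"
        by (rule distr_cong) (auto simp: spP radon_of_Phi)
      also have "\<dots> = P (r i)" by (rule distr_id2) (simp add: P)
      finally show ?thesis .
    qed
    show "AE \<omega> in \<Omega>. vconv (\<lambda>i. radon_of (Z i \<omega>)) (radon_of (Z' \<omega>) :: (real ^ 'n) measure)"
      using AZ'
    proof eventually_elim
      case (elim \<omega>)
      show ?case
        by (rule Phi_vconv[OF radon_of_radon radon_of_radon]) (use elim in \<open>simp add: Phi_radon_of\<close>)
    qed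
  qed
qed

section \<open>Fractal distributions\<close>

lemma translate_translate: 
  fixes \<mu> :: "(real ^ 'n) measure"
  assumes "\<mu> \<in> radon_measures" shows "translate x (translate y \<mu>) = translate (x + y) \<mu>"
proof -
  have m: "(\<lambda>z. z - y) \<in> measurable \<mu> borel" by (rule borel_to_radon_measurable[OF assms]) measurable
  have "distr (distr \<mu> borel (\<lambda>z. z - y)) borel (\<lambda>z. z - x) = distr \<mu> borel ((\<lambda>z. z - x) \<circ> (\<lambda>z. z - y))"
    by (rule distr_distr[OF _ m]) measurable
  then show ?thesis unfolding translate_def by (simp add: comp_def algebra_simps)
qed

lemma magnify_translate:
  fixes \<mu> :: "(real ^ 'n) measure"
  assumes "\<mu> \<in> radon_measures" shows "magnify t (translate x \<mu>) = translate (exp t *\<^sub>R x) (magnify t \<mu>)"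
proof -
  have m: "(\<lambda>z. z - x) \<in> measurable \<mu> borel" "(\<lambda>z. exp t *\<^sub>R z) \<in> measurable \<mu> borel"
    by (rule borel_to_radon_measurable[OF assms], measurable)+
  have "distr (distr \<mu> borel (\<lambda>z. z - x)) borel (\<lambda>z. exp t *\<^sub>R z) = distr \<mu> borel ((\<lambda>z. exp t *\<^sub>R z) \<circ> (\<lambda>z. z - x))"
    by (rule distr_distr[OF _ m(1)]) measurable
  moreover have "distr (distr \<mu> borel (\<lambda>z. exp t *\<^sub>R z)) borel (\<lambda>z. z - exp t *\<^sub>R x) = distr \<mu> borel ((\<lambda>z. z - exp t *\<^sub>R x) \<circ> (\<lambda>z. exp t *\<^sub>R z))"
    by (rule distr_distr[OF _ m(2)]) measurable
  ultimately show ?thesis unfolding translate_def magnify_def by (simp add: comp_def scaleR_diff_right)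
qed

lemma translate_0: "\<mu> \<in> radon_measures \<Longrightarrow> translate 0 \<mu> = \<mu>"
  unfolding translate_def diff_zero by (rule distr_id2[OF radon_sets[symmetric]])

lemma magnify_0: "\<mu> \<in> radon_measures \<Longrightarrow> magnify 0 \<mu> = \<mu>"
  unfolding magnify_def exp_zero scaleR_one by (rule distr_id2[OF radon_sets[symmetric]])

lemma distr_scale_measure: 
  assumes "g \<in> measurable \<mu> N" shows "distr (scale_measure c \<mu>) N g = scale_measure c (distr \<mu> N g)"
proof (rule measure_eqI)
  have "g \<in> measurable (scale_measure c \<mu>) N" using assms by simp
  then show "emeasure (distr (scale_measure c \<mu>) N g) A = emeasure (scale_measure c (distr \<mu> N g)) A"
    if "A \<in> sets (distr (scale_measure c \<mu>) N g)" for A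
    using that assms by (simp add: emeasure_distr space_scale_measure)
qed simp

lemma translate_scale:
  fixes \<mu> :: "(real ^ 'n) measure"
  assumes "\<mu> \<in> radon_measures" shows "translate x (scale_measure c \<mu>) = scale_measure c (translate x \<mu>)"
  unfolding translate_def by (rule distr_scale_measure, rule borel_to_radon_measurable[OF assms]) measurable

lemma magnify_scale:
  fixes \<mu> :: "(real ^ 'n) measure"
  assumes "\<mu> \<in> radon_measures" shows "magnify t (scale_measure c \<mu>) = scale_measure c (magnify t \<mu>)"
  unfolding magnify_def by (rule distr_scale_measure, rule borel_to_radon_measurable[OF assms]) measurable

lemma emeasure_translate:
  fixes \<mu> :: "(real ^ 'n) measure"
  assumes "\<mu> \<in> radon_measures" "A \<in> sets borel"
  shows "emeasure (translate x \<mu>) A = emeasure \<mu> {y. y - x \<in> A}"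
proof -
  have "(\<lambda>y. y - x) \<in> measurable \<mu> borel" by (rule borel_to_radon_measurable[OF assms(1)]) measurable
  then show ?thesis using assms radon_space[OF assms(1)]
    by (simp add: translate_def emeasure_distr vimage_def)
qed

lemma emeasure_magnify:
  fixes \<mu> :: "(real ^ 'n) measure"
  assumes "\<mu> \<in> radon_measures" "A \<in> sets borel"
  shows "emeasure (magnify t \<mu>) A = emeasure \<mu> {y. exp t *\<^sub>R y \<in> A}"
proof -
  have "(\<lambda>y. exp t *\<^sub>R y) \<in> measurable \<mu> borel" by (rule borel_to_radon_measurable[OF assms(1)]) measurable
  then show ?thesis using assms radon_space[OF assms(1)]
    by (simp add: magnify_def emeasure_distr vimage_def)
qed

lemma closed_unit_box: "closed (unit_box :: (real ^ 'n) set)"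
  unfolding unit_box_def by (intro closed_Collect_le continuous_intros)

lemma unit_box_borel [measurable]: "(unit_box :: (real ^ 'n) set) \<in> sets borel"
  by (rule borel_closed[OF closed_unit_box])

lemma bounded_unit_box: "bounded (unit_box :: (real ^ 'n) set)"
proof -
  have "norm x \<le> sqrt (real DIM(real ^ 'n)) * 1" if "x \<in> unit_box" for x :: "real ^ 'n"
  proof -
    have "sqrt (real DIM(real ^ 'n)) * infnorm x \<le> sqrt (real DIM(real ^ 'n)) * 1"
      using that by (intro mult_left_mono) (simp_all add: unit_box_def)
    then show ?thesis using norm_le_infnorm[of x] by linarith
  qed
  then show ?thesis unfolding bounded_iff by blast
qed

lemma ball_subset_unit_box: "ball 0 1 \<subseteq> (unit_box :: (real ^ 'n) set)"
proof
  fix x :: "real ^ 'n" assume "x \<in> ball 0 1"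
  then show "x \<in> unit_box" using infnorm_le_norm[of x] by (simp add: unit_box_def)
qed

text \<open>Countably many balls decide the support condition, so \<open>radon_at_origin\<close> is
  a Borel set.\<close>

lemma radon_at_origin_iff:
  fixes \<mu> :: "(real ^ 'n) measure"
  shows "\<mu> \<in> radon_at_origin \<longleftrightarrow> \<mu> \<in> radon_measures \<and> (\<forall>n::nat. emeasure \<mu> (ball 0 (1 / real (Suc n))) > 0)"
proof
  assume "\<mu> \<in> radon_at_origin"
  then show "\<mu> \<in> radon_measures \<and> (\<forall>n::nat. emeasure \<mu> (ball 0 (1 / real (Suc n))) > 0)"
    unfolding radon_at_origin_def spt_def by simp
next
  assume *: "\<mu> \<in> radon_measures \<and> (\<forall>n::nat. emeasure \<mu> (ball 0 (1 / real (Suc n))) > 0)"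
  have "emeasure \<mu> U > 0" if U: "open U" "0 \<in> U" for U
  proof -
    obtain e where e: "e > 0" "ball 0 e \<subseteq> U" using U open_contains_ball by blast
    obtain n :: nat where "1 / real (Suc n) < e" using nat_approx_posE[OF e(1)] by auto
    then have "ball 0 (1 / real (Suc n)) \<subseteq> U" using e(2) by (force simp: subset_eq)
    then have "emeasure \<mu> (ball 0 (1 / real (Suc n))) \<le> emeasure \<mu> U"
      using * U(1) by (intro emeasure_mono) (auto simp: radon_sets)
    then show ?thesis using * less_le_trans by blast
  qed
  then show "\<mu> \<in> radon_at_origin" using * unfolding radon_at_origin_def spt_def by blast
qed

lemma radon_at_origin_ball:
  "\<mu> \<in> radon_at_origin \<Longrightarrow> e > 0 \<Longrightarrow> emeasure \<mu> (ball 0 e) > 0"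
  unfolding radon_at_origin_def spt_def by simp

lemma radon_at_origin_radon: "\<mu> \<in> radon_at_origin \<Longrightarrow> \<mu> \<in> radon_measures"
  by (simp add: radon_at_origin_def)

lemma radon_at_origin_borel [measurable]: "(radon_at_origin :: (real ^ 'n) measure set) \<in> sets radon_borel"
proof -
  have [measurable]: "(\<lambda>\<mu>. emeasure \<mu> (ball 0 (1 / real (Suc n)) :: (real ^ 'n) set)) \<in> borel_measurable radon_borel" for n
    by (rule emeasure_radon_measurable[of "\<lambda>\<mu>. \<mu>"]) auto
  have "{\<mu> \<in> space radon_borel. \<forall>n::nat. emeasure \<mu> (ball 0 (1 / real (Suc n)) :: (real ^ 'n) set) > 0} \<in> sets radon_borel"
    by measurable
  also have "{\<mu> \<in> space radon_borel. \<forall>n::nat. emeasure \<mu> (ball 0 (1 / real (Suc n)) :: (real ^ 'n) set) > 0} = radon_at_origin"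
    by (auto simp: radon_at_origin_iff space_radon_borel)
  finally show ?thesis .
qed

lemma unit_box_mass:
  fixes \<mu> :: "(real ^ 'n) measure"
  assumes "\<mu> \<in> radon_at_origin"
  shows "emeasure \<mu> unit_box = ennreal (measure \<mu> unit_box)" "0 < measure \<mu> unit_box"
proof -
  note r = radon_at_origin_radon[OF assms]
  show 1: "emeasure \<mu> unit_box = ennreal (measure \<mu> unit_box)"
    using radon_emeasure_bounded[OF r bounded_unit_box] by (intro emeasure_eq_ennreal_measure) simp
  have "0 < emeasure \<mu> (ball 0 1)" by (rule radon_at_origin_ball[OF assms]) simp
  also have "\<dots> \<le> emeasure \<mu> unit_box"
    by (rule emeasure_mono[OF ball_subset_unit_box]) (simp add: radon_sets[OF r])
  finally show "0 < measure \<mu> unit_box" by (simp add: 1)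
qed

lemma normalize_measure_eq:
  fixes \<mu> :: "(real ^ 'n) measure"
  assumes "\<mu> \<in> radon_at_origin"
  shows "normalize_measure \<mu> = scale_measure (ennreal (1 / measure \<mu> unit_box)) \<mu>"
  using unit_box_mass[OF assms] unfolding normalize_measure_def
  by (metis divide_ennreal ennreal_1 zero_le_one)

lemma radon_at_origin_scale:
  "\<mu> \<in> radon_at_origin \<Longrightarrow> c > 0 \<Longrightarrow> scale_measure (ennreal c) \<mu> \<in> radon_at_origin"
  unfolding radon_at_origin_iff by (auto intro!: radon_scale simp: ennreal_zero_less_mult_iff)

lemma radon_at_origin_magnify:
  fixes \<mu> :: "(real ^ 'n) measure"
  assumes "\<mu> \<in> radon_at_origin" shows "magnify t \<mu> \<in> radon_at_origin"
proof -
  have "emeasure (magnify t \<mu>) (ball 0 (1 / real (Suc n))) > 0" for n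
  proof -
    have "{y :: real ^ 'n. exp t *\<^sub>R y \<in> ball 0 a} = ball 0 (a / exp t)" for a
      by (auto simp: pos_less_divide_eq mult.commute[of "exp t"])
    then show ?thesis using radon_at_origin_ball[OF assms, of "1 / real (Suc n) / exp t"]
      by (subst emeasure_magnify[OF radon_at_origin_radon[OF assms]]) auto
  qed
  then show ?thesis unfolding radon_at_origin_iff using radon_magnify[OF radon_at_origin_radon[OF assms]] by blast
qed

text \<open>The complement of the support is a countable union of null basic open sets, hence null.
  At any other z the translate charges every ball about the origin.\<close>

lemma AE_spt:
  fixes \<nu> :: "(real ^ 'n) measure"
  assumes "\<nu> \<in> radon_measures" shows "AE z in \<nu>. translate z \<nu> \<in> radon_at_origin"
proof -
  obtain B :: "(real ^ 'n) set set" where B: "countable B" "topological_basis B"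
    using ex_countable_basis by auto
  have Bo: "b \<in> sets \<nu>" if "b \<in> B" for b
    using topological_basis_open[OF B(2) that] by (simp add: radon_sets[OF assms])
  have "(\<Union>b\<in>{b \<in> B. emeasure \<nu> b = 0}. b) \<in> null_sets \<nu>"
    by (rule null_sets_UN') (use B(1) Bo in auto)
  from AE_not_in[OF this] show ?thesis
  proof (rule AE_mp, intro AE_I2 impI)
    fix z assume z: "z \<notin> (\<Union>b\<in>{b \<in> B. emeasure \<nu> b = 0}. b)"
    have "emeasure (translate z \<nu>) (ball 0 (1 / real (Suc n))) > 0" for n
    proof -
      have e: "{y. y - z \<in> ball 0 (1 / real (Suc n))} = ball z (1 / real (Suc n))"
        by (auto simp: dist_norm norm_minus_commute)
      obtain b where b: "b \<in> B" "z \<in> b" "b \<subseteq> ball z (1 / real (Suc n))"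
        using topological_basisE[OF B(2) open_ball, of z z "1 / real (Suc n)"] by auto
      have "0 < emeasure \<nu> b" using z b by (auto simp: zero_less_iff_neq_zero)
      also have "\<dots> \<le> emeasure \<nu> (ball z (1 / real (Suc n)))"
        by (rule emeasure_mono[OF b(3)]) (simp add: radon_sets[OF assms])
      finally show ?thesis by (subst emeasure_translate[OF assms]) (simp_all only: e, simp)
    qed
    then show "translate z \<nu> \<in> radon_at_origin"
      unfolding radon_at_origin_iff using radon_translate[OF assms] by blast
  qed
qed

text \<open>Such maps depend only on the ray through the measure, so they may be evaluated under
  whichever normalization is convenient.\<close>

definition homogeneous :: "((real ^ 'n) measure \<Rightarrow> 'b) \<Rightarrow> bool" where
  "homogeneous F \<longleftrightarrow> (\<forall>\<mu>\<in>radon_measures. \<forall>c>0. F (scale_measure (ennreal c) \<mu>) = F \<mu>)"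

lemma homogeneousD: "homogeneous F \<Longrightarrow> \<mu> \<in> radon_measures \<Longrightarrow> c > 0 \<Longrightarrow> F (scale_measure (ennreal c) \<mu>) = F \<mu>"
  by (simp add: homogeneous_def)

lemma homogeneous_normalize:
  "homogeneous F \<Longrightarrow> \<mu> \<in> radon_at_origin \<Longrightarrow> F (normalize_measure \<mu>) = F \<mu>"
  using unit_box_mass(2)[of \<mu>] by (simp add: normalize_measure_eq homogeneousD radon_at_origin_radon)

section \<open>Scale invariance and the quasi-Palm property for homogeneous functionals\<close>

locale fractal_dist =
  fixes P :: "(real ^ 'n) measure measure"
  assumes P: "P \<in> extended_fractal_distributions"
begin

sublocale prob_space P
  using P by (simp add: extended_fractal_distributions_def prob_measures_def)

lemma sets_P: "sets P = sets radon_borel"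
  using P by (simp add: extended_fractal_distributions_def prob_measures_def)

lemma space_P: "space P = radon_measures"
  using sets_eq_imp_space_eq[OF sets_P] by (simp add: space_radon_borel)

lemma measurable_P: "f \<in> measurable radon_borel N \<Longrightarrow> f \<in> measurable P N"
  using measurable_cong_sets[OF sets_P refl] by blast

lemma AE_at_origin: "AE \<mu> in P. \<mu> \<in> radon_at_origin"
proof -
  have "emeasure P radon_at_origin = 1"
    using P by (simp add: extended_fractal_distributions_def scale_invariant_def)
  then have "prob radon_at_origin = 1" by (simp add: emeasure_eq_measure)
  then show ?thesis by (subst AE_in_set_eq_1) (simp_all add: sets_P radon_at_origin_borel)
qed

text \<open>A total form of \<open>magnify_star\<close>: the real quotient is 0 when the cube has
  mass 0, whereas the extended quotient would be infinite and the result could fail to be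
  Radon.\<close>

definition flow :: "real \<Rightarrow> (real ^ 'n) measure \<Rightarrow> (real ^ 'n) measure" where
  "flow t \<mu> = scale_measure (ennreal (1 / measure (magnify t \<mu>) unit_box)) (magnify t \<mu>)"

lemma flow_eq: "\<mu> \<in> radon_at_origin \<Longrightarrow> flow t \<mu> = magnify_star t \<mu>"
  unfolding flow_def magnify_star_def by (simp add: normalize_measure_eq radon_at_origin_magnify)

lemma flow_measurable: "flow t \<in> measurable radon_borel radon_borel"
proof -
  have m: "(\<lambda>\<mu>. magnify t \<mu>) \<in> measurable radon_borel (radon_borel :: (real ^ 'n) measure measure)"
    by (rule measurable_magnify) simp
  have "(\<lambda>\<mu>. 1 / measure (magnify t \<mu>) (unit_box :: (real ^ 'n) set)) \<in> borel_measurable radon_borel"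
    unfolding measure_def using emeasure_radon_measurable[OF m unit_box_borel] by measurable
  then show ?thesis unfolding flow_def[abs_def] by (intro measurable_scale_radon[OF m]) simp_all
qed

lemma flow_at_origin: "\<mu> \<in> radon_at_origin \<Longrightarrow> flow t \<mu> \<in> radon_at_origin"
  unfolding flow_def using unit_box_mass(2)[OF radon_at_origin_magnify]
  by (intro radon_at_origin_scale radon_at_origin_magnify) auto

text \<open>Scale invariance speaks of Borel sets inside \<open>radon_at_origin\<close>. That set
  has full measure and is preserved by \<open>flow\<close>, so the invariance extends to all Borel
  sets.\<close>

lemma distr_flow:
  assumes "t > 0" shows "distr P radon_borel (flow t) = P"
proof (rule measure_eqI)
  fix A assume "A \<in> sets (distr P radon_borel (flow t))"
  then have A: "A \<in> sets radon_borel" by simp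
  have A': "A \<inter> radon_at_origin \<in> sets radon_borel" using A by simp
  have f: "flow t \<in> measurable P radon_borel" by (rule measurable_P[OF flow_measurable])
  have eq: "{\<mu> \<in> radon_at_origin. magnify_star t \<mu> \<in> A \<inter> radon_at_origin} = radon_at_origin \<inter> (flow t -` A \<inter> space P)"
    using flow_eq flow_at_origin by (auto simp: space_P radon_at_origin_radon)
  have "emeasure (distr P radon_borel (flow t)) A = emeasure P (flow t -` A \<inter> space P)"
    by (rule emeasure_distr[OF f A])
  also have "\<dots> = emeasure P (radon_at_origin \<inter> (flow t -` A \<inter> space P))"
    using AE_at_origin measurable_sets[OF f A] radon_at_origin_borel
    by (intro emeasure_eq_AE) (auto simp: sets_P)
  also have "\<dots> = emeasure P (A \<inter> radon_at_origin)"
    unfolding eq[symmetric] using P A' assms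
    by (auto simp: extended_fractal_distributions_def scale_invariant_def)
  also have "\<dots> = emeasure P A"
    using AE_at_origin A A' by (intro emeasure_eq_AE) (auto simp: sets_P)
  finally show "emeasure (distr P radon_borel (flow t)) A = emeasure P A" .
qed (simp add: sets_P)

text \<open>P is also the law of \<open>flow 1 \<mu>\<close>, a measure that gives the cube mass
  1.\<close>

lemma AE_unit_box: "AE \<mu> in P. emeasure \<mu> unit_box = 1"
proof -
  have m: "flow 1 \<in> measurable P radon_borel" by (rule measurable_P[OF flow_measurable])
  have "{\<mu> \<in> space radon_borel. emeasure \<mu> (unit_box :: (real ^ 'n) set) = 1} \<in> sets radon_borel"
    using emeasure_radon_measurable[of "\<lambda>\<mu>. \<mu>", OF _ unit_box_borel] by measurable
  then have "(AE \<mu> in distr P radon_borel (flow 1). emeasure \<mu> (unit_box :: (real ^ 'n) set) = 1) \<longleftrightarrow>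
      (AE \<mu> in P. emeasure (flow 1 \<mu>) (unit_box :: (real ^ 'n) set) = 1)"
    by (rule AE_distr_iff[OF m])
  moreover have "AE \<mu> in P. emeasure (flow 1 \<mu>) (unit_box :: (real ^ 'n) set) = 1"
    using AE_at_origin
  proof eventually_elim
    case (elim \<mu>)
    note u = unit_box_mass[OF radon_at_origin_magnify[OF elim, of 1]]
    then show ?case by (simp add: flow_def ennreal_mult'[symmetric])
  qed
  ultimately show ?thesis using distr_flow[OF zero_less_one] by metis
qed

text \<open>A homogeneous functional does not see the normalizing factor in
  \<open>flow\<close>.\<close>

lemma expectation_magnify:
  fixes G :: "(real ^ 'n) measure \<Rightarrow> real"
  assumes "G \<in> borel_measurable radon_borel" "homogeneous G" "t > 0"
  shows "expectation (\<lambda>\<mu>. G (magnify t \<mu>)) = expectation G"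
proof -
  have f: "flow t \<in> measurable P radon_borel" by (rule measurable_P[OF flow_measurable])
  have "expectation G = (\<integral>\<mu>. G \<mu> \<partial>distr P radon_borel (flow t))" by (simp add: distr_flow[OF assms(3)])
  also have "\<dots> = expectation (\<lambda>\<mu>. G (flow t \<mu>))" by (rule integral_distr[OF f assms(1)])
  also have "\<dots> = expectation (\<lambda>\<mu>. G (magnify t \<mu>))"
  proof (rule integral_cong_AE)
    show "(\<lambda>\<mu>. G (flow t \<mu>)) \<in> borel_measurable P" by (rule measurable_compose[OF f assms(1)])
    have "(\<lambda>\<mu>. magnify t \<mu>) \<in> measurable P radon_borel" by (rule measurable_P, rule measurable_magnify) simp
    then show "(\<lambda>\<mu>. G (magnify t \<mu>)) \<in> borel_measurable P" by (rule measurable_compose[OF _ assms(1)])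
    show "AE \<mu> in P. G (flow t \<mu>) = G (magnify t \<mu>)"
      using AE_at_origin
    proof eventually_elim
      case (elim \<mu>)
      show ?case unfolding flow_def
        using unit_box_mass(2)[OF radon_at_origin_magnify[OF elim, of t]]
        by (intro homogeneousD[OF assms(2)] radon_magnify radon_at_origin_radon[OF elim]) simp
    qed
  qed
  finally show ?thesis by simp
qed

text \<open>Homogeneity removes the normalization in \<open>translate_star\<close>. The two sides
  may differ where the translate is not in \<open>radon_at_origin\<close>, but such points are null
  by \<open>AE_spt\<close>.\<close>

lemma quasi_palm_homogeneous:
  assumes Q: "{\<mu> \<in> radon_measures. Q \<mu>} \<in> sets radon_borel" and hom: "homogeneous Q"
  shows "(AE \<mu> in P. Q \<mu>) \<longleftrightarrow> (AE \<nu> in P. AE z in \<nu>. Q (translate z \<nu>))"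
proof -
  let ?A = "{\<mu> \<in> radon_measures. Q \<mu>}"
  have "(AE \<mu> in P. Q \<mu>) \<longleftrightarrow> (AE \<mu> in P. \<mu> \<in> ?A)"
    by (rule AE_cong) (simp add: space_P)
  also have "\<dots> \<longleftrightarrow> emeasure P ?A = 1"
    using Q by (subst AE_in_set_eq_1) (simp_all add: sets_P emeasure_eq_measure)
  also have "\<dots> \<longleftrightarrow> (AE \<nu> in P. AE z in \<nu>. translate_star z \<nu> \<in> ?A)"
    using P Q by (simp add: extended_fractal_distributions_def quasi_palm_def)
  also have "\<dots> \<longleftrightarrow> (AE \<nu> in P. AE z in \<nu>. Q (translate z \<nu>))"
  proof (rule AE_cong)
    fix \<nu> assume "\<nu> \<in> space P"
    then have \<nu>: "\<nu> \<in> radon_measures" by (simp add: space_P)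
    have *: "AE z in \<nu>. (translate_star z \<nu> \<in> ?A) = Q (translate z \<nu>)"
      using AE_spt[OF \<nu>]
    proof eventually_elim
      case (elim z)
      have "translate_star z \<nu> \<in> radon_measures"
        unfolding translate_star_def normalize_measure_eq[OF elim]
        by (rule radon_scale[OF radon_translate[OF \<nu>]])
      then show ?case
        unfolding translate_star_def by (simp add: homogeneous_normalize[OF hom elim])
    qed
    show "(AE z in \<nu>. translate_star z \<nu> \<in> ?A) \<longleftrightarrow> (AE z in \<nu>. Q (translate z \<nu>))"
    proof
      assume "AE z in \<nu>. translate_star z \<nu> \<in> ?A"
      with * show "AE z in \<nu>. Q (translate z \<nu>)" by eventually_elim simp
    next
      assume "AE z in \<nu>. Q (translate z \<nu>)"
      with * show "AE z in \<nu>. translate_star z \<nu> \<in> ?A" by eventually_elim simp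
    qed
  qed
  finally show ?thesis .
qed

end

section \<open>Mass transport\<close>

text \<open>Nearly norm-minimal convex combinations of tails are Cauchy in L2 by the parallelogram
  law, at a rate that gives almost sure convergence. The k-th combination uses only indices from k
  on, so it inherits any decay of the sequence.\<close>

lemma convex_combinations_AE_convergent:
  fixes f :: "nat \<Rightarrow> 'a \<Rightarrow> real"
  assumes "prob_space M" and f [measurable]: "\<And>n. f n \<in> borel_measurable M"
    and B: "\<And>n x. \<bar>f n x\<bar> \<le> B"
  obtains w :: "nat \<Rightarrow> nat \<Rightarrow> real" and m where "\<And>k n. 0 \<le> w k n" "\<And>k. (\<Sum>n\<in>{k..<m k}. w k n) = 1"
    "AE x in M. convergent (\<lambda>k. \<Sum>n\<in>{k..<m k}. w k n * f n x)"
proof -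
  interpret prob_space M by fact
  have B0: "0 \<le> B" using B[of 0 undefined] by linarith
  \<comment> \<open>Convex weights supported in [j, m); carrying m in the pair keeps all sums
    finite.\<close>
  define W where "W j = {(w, m). (\<forall>n. 0 \<le> w n) \<and> (\<forall>n. n < j \<or> m \<le> n \<longrightarrow> w n = 0) \<and> (\<Sum>n<m. w n) = (1::real)}" for j :: nat
  define c where "c p x = (\<Sum>n<snd p. fst p n * f n x)" for p :: "(nat \<Rightarrow> real) \<times> nat" and x
  have cm [measurable]: "c p \<in> borel_measurable M" for p unfolding c_def by measurable
  have cB: "\<bar>c p x\<bar> \<le> B" if "p \<in> W j" for p x j
  proof -
    obtain w m where p: "p = (w, m)" by (cases p)
    have "\<bar>c p x\<bar> \<le> (\<Sum>n<m. \<bar>w n * f n x\<bar>)" unfolding c_def p by simp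
    also have "\<dots> \<le> (\<Sum>n<m. w n * B)"
      using that B unfolding p W_def by (intro sum_mono) (auto simp: abs_mult intro!: mult_left_mono)
    also have "\<dots> = (\<Sum>n<m. w n) * B" by (simp add: sum_distrib_right)
    also have "\<dots> = B" using that unfolding p W_def by simp
    finally show ?thesis .
  qed
  have int2: "integrable M (\<lambda>x. (c p x)\<^sup>2)" if "p \<in> W j" for p j
    by (rule integrable_const_bound[where B = "B\<^sup>2"]) (use cB[OF that] in \<open>auto intro!: AE_I2 simp: abs_le_square_iff[symmetric] B0\<close>)
  define V where "V j = (INF p\<in>W j. expectation (\<lambda>x. (c p x)\<^sup>2))" for j
  have Wne: "(\<lambda>n. if n = j then 1 else 0, Suc j) \<in> W j" for j
    by (auto simp: W_def)
  have bdd: "bdd_below ((\<lambda>p. expectation (\<lambda>x. (c p x)\<^sup>2)) ` W j)" for j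
    by (rule bdd_belowI2[where m = 0]) (simp add: Bochner_Integration.integral_nonneg)
  have Vle: "V j \<le> expectation (\<lambda>x. (c p x)\<^sup>2)" if "p \<in> W j" for p j
    unfolding V_def by (rule cINF_lower[OF bdd that])
  have WW: "W j \<subseteq> W i" if "i \<le> j" for i j using that by (auto simp: W_def)
  have Vmono: "V i \<le> V j" if "i \<le> j" for i j
    unfolding V_def by (rule cINF_superset_mono[OF _ bdd WW[OF that]]) (use Wne in blast, simp)
  have VB: "V j \<le> B\<^sup>2" for j
  proof -
    have "V j \<le> expectation (\<lambda>x. (c (\<lambda>n. if n = j then 1 else 0, Suc j) x)\<^sup>2)" by (rule Vle[OF Wne])
    also have "\<dots> \<le> expectation (\<lambda>x. B\<^sup>2)"
      using cB[OF Wne, of j] by (intro integral_mono int2[OF Wne]) (auto simp: abs_le_square_iff[symmetric] B0)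
    finally show ?thesis by (simp add: prob_space)
  qed
  \<comment> \<open>The infima over tails increase and are bounded by the square of B. Closeness to
    their supremum makes minimizers of different tails comparable.\<close>
  define V' where "V' = (SUP j. V j)"
  have bddV: "bdd_above (range V)" using VB by (intro bdd_aboveI2)
  have VV: "V j \<le> V'" for j unfolding V'_def by (rule cSUP_upper[OF _ bddV]) simp
  have "\<exists>j p. k \<le> j \<and> p \<in> W j \<and> V' - (1/4)^k \<le> V j \<and> expectation (\<lambda>x. (c p x)\<^sup>2) \<le> V' + (1/4)^k" for k :: nat
  proof -
    have "V' - (1/4)^k < V'" by simp
    then obtain i where i: "V' - (1/4)^k < V i"
      unfolding V'_def using less_cSUP_iff[OF _ bddV] by auto
    define j where "j = max i k"
    have "V i \<le> V j" by (rule Vmono) (simp add: j_def)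
    then have j: "V' - (1/4)^k \<le> V j" using i by linarith
    have "V j < V j + (1/4)^k" by simp
    then obtain p where p: "p \<in> W j" "expectation (\<lambda>x. (c p x)\<^sup>2) < V j + (1/4)^k"
      unfolding V_def using cINF_less_iff[OF _ bdd[of j]] Wne[of j] by blast
    then have "expectation (\<lambda>x. (c p x)\<^sup>2) \<le> V' + (1/4)^k" using VV[of j] by linarith
    then show ?thesis using j p(1) by (intro exI[of _ j] exI[of _ p]) (simp add: j_def)
  qed
  then obtain J p where J: "\<And>k. k \<le> J k" "\<And>k. p k \<in> W (J k)" "\<And>k. V' - (1/4)^k \<le> V (J k)"
    "\<And>k. expectation (\<lambda>x. (c (p k) x)\<^sup>2) \<le> V' + (1/4)^k" by metis
  \<comment> \<open>The midpoint q of two consecutive combinations belongs to the tail of the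
    smaller index, so its squared norm is at least V' - (1/4)^k. In the parallelogram identity the
    terms with V' cancel and 8 * (1/4)^k remains.\<close>
  have step: "expectation (\<lambda>x. (c (p k) x - c (p (Suc k)) x)\<^sup>2) \<le> 8 * (1/4)^k" for k
  proof -
    obtain w m where pk: "p k = (w, m)" by (cases "p k")
    obtain w' m' where pk': "p (Suc k) = (w', m')" by (cases "p (Suc k)")
    define i where "i = min (J k) (J (Suc k))"
    define q where "q = (\<lambda>n. (w n + w' n) / 2, max m m')"
    have w: "(\<forall>n. 0 \<le> w n) \<and> (\<forall>n. n < J k \<or> m \<le> n \<longrightarrow> w n = 0) \<and> (\<Sum>n<m. w n) = 1"
      using J(2)[of k] unfolding pk W_def by simp
    have w': "(\<forall>n. 0 \<le> w' n) \<and> (\<forall>n. n < J (Suc k) \<or> m' \<le> n \<longrightarrow> w' n = 0) \<and> (\<Sum>n<m'. w' n) = 1"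
      using J(2)[of "Suc k"] unfolding pk' W_def by simp
    have ext: "(\<Sum>n<max m m'. w n * g n) = (\<Sum>n<m. w n * g n)" "(\<Sum>n<max m m'. w' n * g n) = (\<Sum>n<m'. w' n * g n)" for g :: "nat \<Rightarrow> real"
      by (rule sum.mono_neutral_right; use w w' in auto)+
    have "(\<Sum>n<max m m'. (w n + w' n) / 2) = ((\<Sum>n<max m m'. w n * 1) + (\<Sum>n<max m m'. w' n * 1)) / 2"
      by (simp add: sum.distrib sum_divide_distrib[symmetric])
    also have "\<dots> = 1" unfolding ext using w w' by simp
    finally have "q \<in> W i" using w w' unfolding q_def W_def i_def by auto
    have cq: "c q x = (c (p k) x + c (p (Suc k)) x) / 2" for x
    proof -
      have "c q x = ((\<Sum>n<max m m'. w n * f n x) + (\<Sum>n<max m m'. w' n * f n x)) / 2"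
        unfolding c_def q_def by (simp add: sum.distrib[symmetric] sum_divide_distrib algebra_simps)
      then show ?thesis unfolding ext by (simp add: c_def pk pk')
    qed
    have Vi: "V' - (1/4)^k \<le> V i"
    proof (cases "J k \<le> J (Suc k)")
      case True
      then show ?thesis using J(3)[of k] by (simp add: i_def)
    next
      case False
      have "(1/4)^Suc k \<le> (1/4::real)^k" by simp
      then have "V' - (1/4)^k \<le> V (J (Suc k))" using J(3)[of "Suc k"] by linarith
      then show ?thesis using False by (simp add: i_def min_def)
    qed
    have "(c (p k) x - c (p (Suc k)) x)\<^sup>2 = 2 * (c (p k) x)\<^sup>2 + 2 * (c (p (Suc k)) x)\<^sup>2 - 4 * (c q x)\<^sup>2" for x
      unfolding cq by (simp add: power2_eq_square field_simps)
    then have "expectation (\<lambda>x. (c (p k) x - c (p (Suc k)) x)\<^sup>2)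
        = 2 * expectation (\<lambda>x. (c (p k) x)\<^sup>2) + 2 * expectation (\<lambda>x. (c (p (Suc k)) x)\<^sup>2) - 4 * expectation (\<lambda>x. (c q x)\<^sup>2)"
      using int2[OF J(2)[of k]] int2[OF J(2)[of "Suc k"]] int2[OF \<open>q \<in> W i\<close>] by simp
    also have "\<dots> \<le> 2 * (V' + (1/4)^k) + 2 * (V' + (1/4)^k) - 4 * (V' - (1/4)^k)"
    proof -
      have "V' + (1/4)^Suc k \<le> V' + (1/4)^k" by simp
      from order_trans[OF J(4)[of "Suc k"] this]
      show ?thesis using J(4)[of k] Vle[OF \<open>q \<in> W i\<close>] Vi by argo
    qed
    also have "\<dots> = 8 * (1/4)^k" by simp
    finally show ?thesis .
  qed
  define d where "d k x = \<bar>c (p k) x - c (p (Suc k)) x\<bar>" for k x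
  have dm [measurable]: "d k \<in> borel_measurable M" for k unfolding d_def by measurable
  have dle: "d k x \<le> 2 * B" for k x
    using cB[OF J(2)[of k], of x] cB[OF J(2)[of "Suc k"], of x] unfolding d_def by linarith
  have dint: "integrable M (d k)" "integrable M (\<lambda>x. (d k x)\<^sup>2)" for k
  proof -
    have d0: "0 \<le> d k x" for x by (simp add: d_def)
    show "integrable M (d k)"
      by (rule integrable_const_bound[where B = "2 * B"]) (use dle d0 in \<open>auto intro!: AE_I2\<close>)
    show "integrable M (\<lambda>x. (d k x)\<^sup>2)"
      by (rule integrable_const_bound[where B = "(2 * B)\<^sup>2"]) (intro AE_I2, simp only: real_norm_def abs_power2, rule power_mono[OF dle d0], measurable)
  qed
  \<comment> \<open>Cauchy-Schwarz in the form of a nonnegative variance; the square root of 8 is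
    rounded up to 3.\<close>
  have d1: "expectation (d k) \<le> 3 * (1/2)^k" for k
  proof -
    have "(expectation (d k))\<^sup>2 \<le> expectation (\<lambda>x. (d k x)\<^sup>2)"
    proof -
      have "0 \<le> variance (d k)" by (rule variance_positive)
      then show ?thesis by (simp add: variance_eq[OF dint])
    qed
    also have "\<dots> \<le> 8 * (1/4)^k" using step[of k] by (simp add: d_def)
    also have "\<dots> \<le> (3 * (1/2)^k)\<^sup>2" by (simp add: power_mult_distrib power2_eq_square power_divide divide_right_mono flip: power_mult_distrib)
    finally show ?thesis by (rule power2_le_imp_le) simp
  qed
  have "(\<integral>\<^sup>+x. (\<Sum>k. ennreal (d k x)) \<partial>M) = (\<Sum>k. \<integral>\<^sup>+x. ennreal (d k x) \<partial>M)"
    by (rule nn_integral_suminf) measurable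
  also have "\<dots> = (\<Sum>k. ennreal (expectation (d k)))"
    by (rule suminf_cong, rule nn_integral_eq_integral[OF dint(1)]) (simp add: d_def)
  also have "\<dots> \<le> (\<Sum>k. ennreal (3 * (1/2)^k))"
    using d1 by (intro suminf_le ennreal_leI) auto
  also have "\<dots> = ennreal (\<Sum>k. 3 * (1/2)^k)"
    by (rule suminf_ennreal2) (auto intro!: summable_mult summable_geometric)
  finally have "(\<integral>\<^sup>+x. (\<Sum>k. ennreal (d k x)) \<partial>M) \<noteq> \<infinity>" by (auto simp: top_unique)
  from nn_integral_PInf_AE[OF _ this] have "AE x in M. (\<Sum>k. ennreal (d k x)) \<noteq> \<infinity>" by measurable
  then have conv: "AE x in M. convergent (\<lambda>k. c (p k) x)"
  proof eventually_elim
    case (elim x)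
    have "summable (\<lambda>k. d k x)"
      using elim by (intro summable_suminf_not_top) (auto simp: d_def)
    then have "summable (\<lambda>k. c (p (Suc k)) x - c (p k) x)"
      by (rule summable_comparison_test'[where N = 0]) (simp add: d_def abs_minus_commute)
    then have "convergent (\<lambda>n. \<Sum>k<n. c (p (Suc k)) x - c (p k) x)" by (simp add: summable_iff_convergent)
    then have "convergent (\<lambda>n. c (p n) x - c (p 0) x)" by (simp only: sum_lessThan_telescope[of "\<lambda>k. c (p k) x"])
    then have "convergent (\<lambda>n. (c (p n) x - c (p 0) x) + c (p 0) x)" by (intro convergent_add convergent_const)
    then show ?case by simp
  qed
  \<comment> \<open>As \<open>k \<le> J k\<close>, the weights vanish below k and the sum may start
    there.\<close>
  have cp: "c (p k) x = (\<Sum>n\<in>{k..<snd (p k)}. fst (p k) n * f n x)" "(\<Sum>n\<in>{k..<snd (p k)}. fst (p k) n) = 1"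
    "0 \<le> fst (p k) n" for k x n
  proof -
    obtain w m where pk: "p k = (w, m)" by (cases "p k")
    have w: "(\<forall>n. 0 \<le> w n) \<and> (\<forall>n. n < J k \<or> m \<le> n \<longrightarrow> w n = 0) \<and> (\<Sum>n<m. w n) = 1"
      using J(2)[of k] unfolding pk W_def by simp
    have z: "\<forall>n\<in>{..<m} - {k..<m}. w n = 0"
    proof
      fix n assume "n \<in> {..<m} - {k..<m}"
      then have "n < J k" using J(1)[of k] by auto
      then show "w n = 0" using w by blast
    qed
    then have z': "\<forall>n\<in>{..<m} - {k..<m}. w n * f n x = 0" by auto
    show "c (p k) x = (\<Sum>n\<in>{k..<snd (p k)}. fst (p k) n * f n x)"
      unfolding c_def pk fst_conv snd_conv
      by (rule sum.mono_neutral_right[OF finite_lessThan _ z']) auto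
    have "(\<Sum>n<m. w n) = (\<Sum>n\<in>{k..<m}. w n)"
      by (rule sum.mono_neutral_right[OF finite_lessThan _ z]) auto
    then show "(\<Sum>n\<in>{k..<snd (p k)}. fst (p k) n) = 1" using w by (simp add: pk)
    show "0 \<le> fst (p k) n" using w by (simp add: pk)
  qed
  show ?thesis
    by (rule that[of "\<lambda>k. fst (p k)" "\<lambda>k. snd (p k)"], rule cp(3), rule cp(2))
      (use conv in \<open>simp only: cp(1)\<close>)
qed

section \<open>Transport kernels, outflow and inflow\<close>

definition mass_at :: "real \<Rightarrow> (real ^ 'n) measure \<Rightarrow> real ^ 'n \<Rightarrow> real" where
  "mass_at R \<mu> x = (\<integral>y. nbump R (y - x) \<partial>\<mu>)"

text \<open>In the overview's notation, u is \<open>nbump Q\<close> and N is \<open>nbump R\<close>.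
  For a Radon measure and R > 0 the denominator vanishes only off the support, and there the
  quotient is 0 by convention.\<close>

definition transport :: "((real ^ 'n) measure \<Rightarrow> real) \<Rightarrow> real \<Rightarrow> real \<Rightarrow> (real ^ 'n) measure \<Rightarrow> real ^ 'n \<Rightarrow> real ^ 'n \<Rightarrow> real" where
  "transport F Q R \<mu> x y = F (translate x \<mu>) * nbump Q (y - x) / mass_at R \<mu> x"

definition outflow :: "((real ^ 'n) measure \<Rightarrow> real) \<Rightarrow> real \<Rightarrow> real \<Rightarrow> (real ^ 'n) measure \<Rightarrow> real ^ 'n \<Rightarrow> real" where
  "outflow F Q R \<mu> x = (\<integral>y. transport F Q R \<mu> x y \<partial>\<mu>)"

definition inflow :: "((real ^ 'n) measure \<Rightarrow> real) \<Rightarrow> real \<Rightarrow> real \<Rightarrow> (real ^ 'n) measure \<Rightarrow> real ^ 'n \<Rightarrow> real" where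
  "inflow F Q R \<mu> x = (\<integral>y. transport F Q R \<mu> y x \<partial>\<mu>)"

lemma cc_nbump_shift: "R > 0 \<Longrightarrow> cc (\<lambda>y. nbump R (y - x))"
  by (rule cc_shift[OF cc_nbump])

lemma mass_at_nonneg: "0 \<le> mass_at R \<mu> x"
  unfolding mass_at_def by (rule Bochner_Integration.integral_nonneg) simp

lemma mass_at_translate:
  assumes "\<mu> \<in> radon_measures" shows "mass_at R (translate z \<mu>) x = mass_at R \<mu> (x + z)"
  unfolding mass_at_def by (subst integral_translate[OF assms]) (simp_all add: algebra_simps)

lemma mass_at_scale:
  assumes "\<mu> \<in> radon_measures" "c \<ge> 0" shows "mass_at R (scale_measure (ennreal c) \<mu>) x = c * mass_at R \<mu> x"
  unfolding mass_at_def
  by (rule integral_scale_measure[OF assms(2) borel_to_radon_measurable[OF assms(1)]]) measurable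

text \<open>The covering number bounds the total inflow at a point, because a small ball of mass \<open>m\<close>
  is sent through the transport at rate at most \<open>2 / m\<close> per unit of mass.\<close>

lemma finite_cover_cball:
  fixes R :: real assumes "e > 0"
  obtains A :: "('a::euclidean_space) set" where "finite A" "cball 0 R \<subseteq> (\<Union>a\<in>A. ball a e)"
proof -
  have cov: "cball (0 :: 'a) R \<subseteq> (\<Union>c\<in>cball 0 R. ball c e)" using assms by force
  obtain C :: "'a set" where C: "C \<subseteq> cball 0 R" "finite C" "cball 0 R \<subseteq> (\<Union>a\<in>C. ball a e)"
    by (rule compactE_image[OF compact_cball _ cov]) (auto intro: that)
  then show ?thesis using that by blast
qed

text \<open>On a ball of the cover the integrand is at most K divided by the mass of that ball, so
  the ball contributes at most K whatever the measure. Null balls contribute nothing, which is why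
  the bound is asked for only at positive mass.\<close>

lemma nn_integral_cover_bound:
  fixes \<mu> :: "(real ^ 'n) measure"
  assumes \<mu>: "\<mu> \<in> radon_measures" and f: "f \<in> borel_measurable borel" and A: "finite A" "cball 0 Q \<subseteq> (\<Union>a\<in>A. ball a e)"
    and K: "0 \<le> K"
    and le: "\<And>a y. a \<in> A \<Longrightarrow> y \<in> ball a e \<Longrightarrow> measure \<mu> (ball a e) > 0 \<Longrightarrow> f y \<le> K / measure \<mu> (ball a e)"
    and out: "\<And>y. y \<notin> cball 0 Q \<Longrightarrow> f y = 0" and nn: "\<And>y. 0 \<le> f y"
  shows "(\<integral>\<^sup>+y. ennreal (f y) \<partial>\<mu>) \<le> ennreal (real (card A) * K)"
proof -
  have bs: "ball a e \<in> sets \<mu>" for a by (simp add: radon_sets[OF \<mu>])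
  have fm: "(\<lambda>y. ennreal (f y) * indicator (ball a e) y) \<in> borel_measurable \<mu>" for a
  proof (rule borel_to_radon_measurable[OF \<mu>])
    have "ball a e \<in> sets borel" by simp
    then show "(\<lambda>y. ennreal (f y) * indicator (ball a e) y) \<in> borel_measurable borel"
      using f by (intro borel_measurable_times_ennreal borel_measurable_indicator measurable_compose[OF f measurable_ennreal])
  qed
  have fin: "emeasure \<mu> (ball a e) = ennreal (measure \<mu> (ball a e))" for a
    using radon_emeasure_bounded[OF \<mu> bounded_ball, of a e] by (intro emeasure_eq_ennreal_measure) simp
  have "(\<integral>\<^sup>+y. ennreal (f y) \<partial>\<mu>) \<le> (\<integral>\<^sup>+y. (\<Sum>a\<in>A. ennreal (f y) * indicator (ball a e) y) \<partial>\<mu>)"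
  proof (rule nn_integral_mono)
    fix y
    show "ennreal (f y) \<le> (\<Sum>a\<in>A. ennreal (f y) * indicator (ball a e) y)"
    proof (cases "y \<in> cball 0 Q")
      case True
      then obtain a where a: "a \<in> A" "y \<in> ball a e" using A(2) by blast
      have "ennreal (f y) = ennreal (f y) * indicator (ball a e) y" using a(2) by simp
      also have "\<dots> \<le> (\<Sum>a\<in>A. ennreal (f y) * indicator (ball a e) y)"
        by (rule member_le_sum[OF a(1) _ A(1)]) simp
      finally show ?thesis .
    qed (simp add: out)
  qed
  also have "\<dots> = (\<Sum>a\<in>A. \<integral>\<^sup>+y. ennreal (f y) * indicator (ball a e) y \<partial>\<mu>)"
    by (rule nn_integral_sum[OF fm])
  also have "\<dots> \<le> (\<Sum>a\<in>A. ennreal K)"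
  proof (rule sum_mono)
    fix a assume a: "a \<in> A"
    let ?m = "measure \<mu> (ball a e)"
    show "(\<integral>\<^sup>+y. ennreal (f y) * indicator (ball a e) y \<partial>\<mu>) \<le> ennreal K"
    proof (cases "?m > 0")
      case True
      have "(\<integral>\<^sup>+y. ennreal (f y) * indicator (ball a e) y \<partial>\<mu>) \<le> (\<integral>\<^sup>+y. ennreal (K / ?m) * indicator (ball a e) y \<partial>\<mu>)"
        by (rule nn_integral_mono) (auto simp: indicator_def intro!: ennreal_leI le[OF a _ True])
      also have "\<dots> = ennreal (K / ?m) * ennreal ?m"
        by (subst nn_integral_cmult_indicator[OF bs]) (simp add: fin)
      also have "\<dots> = ennreal K" using True K by (subst ennreal_mult[symmetric]) auto
      finally show ?thesis .
    next
      case False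
      then have "?m = 0" using measure_nonneg[of \<mu> "ball a e"] by linarith
      then have "ball a e \<in> null_sets \<mu>" using bs fin[of a] by (simp add: null_sets_def)
      from AE_not_in[OF this] have "AE y in \<mu>. ennreal (f y) * indicator (ball a e) y = 0"
        by eventually_elim simp
      then have "(\<integral>\<^sup>+y. ennreal (f y) * indicator (ball a e) y \<partial>\<mu>) = 0"
        by (subst nn_integral_0_iff_AE[OF fm])
      then show ?thesis by simp
    qed
  qed
  also have "\<dots> = ennreal (real (card A) * K)"
    using K by (simp add: ennreal_mult ennreal_of_nat_eq_real_of_nat)
  finally show ?thesis .
qed

text \<open>Two points of a ball of radius R / 4 are less than R / 2 apart, and at that distance the
  tent is at least 1/2.\<close>

lemma mass_at_ge_ball:
  fixes \<mu> :: "(real ^ 'n) measure"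
  assumes \<mu>: "\<mu> \<in> radon_measures" and R: "R > 0" and y: "y \<in> ball a (R / 4)"
  shows "measure \<mu> (ball a (R / 4)) / 2 \<le> mass_at R \<mu> y"
proof -
  have bs: "ball a (R / 4) \<in> sets \<mu>" by (simp add: radon_sets[OF \<mu>])
  have int: "integrable \<mu> (indicator (ball a (R / 4)) :: _ \<Rightarrow> real)"
    using bs radon_emeasure_bounded[OF \<mu> bounded_ball] by (intro integrable_real_indicator)
  have "measure \<mu> (ball a (R / 4)) / 2 = (\<integral>z. 1/2 * indicator (ball a (R / 4)) z \<partial>\<mu>)"
    using radon_space[OF \<mu>] by (simp del: indicator_simps)
  also have "\<dots> \<le> (\<integral>z. nbump R (z - y) \<partial>\<mu>)"
  proof (rule integral_mono)
    show "integrable \<mu> (\<lambda>z. 1/2 * indicator (ball a (R / 4)) z :: real)" using int by simp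
    show "integrable \<mu> (\<lambda>z. nbump R (z - y))" by (rule radon_integrable[OF \<mu> cc_nbump_shift[OF R]])
    show "1/2 * indicator (ball a (R / 4)) z \<le> nbump R (z - y)" for z
    proof (cases "z \<in> ball a (R / 4)")
      case True
      have "norm (z - y) \<le> dist a z + dist a y"
        using dist_triangle3[of z y a] by (simp add: dist_norm)
      then have "norm (z - y) \<le> R / 2" using True y by simp
      then show ?thesis using nbump_ge_half[OF R, of "z - y"] True by simp
    qed simp
  qed
  finally show ?thesis by (simp add: mass_at_def)
qed

lemma mass_at_measurable:
  assumes "\<mu> \<in> radon_measures" shows "mass_at R \<mu> \<in> borel_measurable borel"
proof -
  have c: "(\<lambda>_. \<mu>) \<in> measurable borel radon_borel" using assms by (simp add: space_radon_borel)
  show ?thesis unfolding mass_at_def[abs_def]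
  proof (rule integral_radon_measurable[OF c])
    have "(\<lambda>p :: (real ^ 'a) \<times> (real ^ 'a). snd p - fst p) \<in> borel_measurable (borel \<Otimes>\<^sub>M borel)"
      by measurable
    from measurable_compose[OF this nbump_measurable]
    show "(\<lambda>(x, y :: real ^ 'a). nbump R (y - x)) \<in> borel_measurable (borel \<Otimes>\<^sub>M borel)"
      by (simp add: case_prod_beta')
  qed simp
qed

locale transport_kernel =
  fixes F :: "(real ^ 'n) measure \<Rightarrow> real" and Q R :: real
  assumes F_meas [measurable]: "F \<in> borel_measurable radon_borel"
    and F_bounds: "\<And>\<mu>. 0 \<le> F \<mu>" "\<And>\<mu>. F \<mu> \<le> 1" and F_hom: "homogeneous F"
    and QR: "0 < Q" "Q \<le> R"
begin

lemma R_pos: "0 < R" using QR by linarith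

lemma F_translate_measurable:
  assumes "\<mu> \<in> radon_measures" shows "(\<lambda>x. F (translate x \<mu>)) \<in> borel_measurable borel"
proof -
  have c: "(\<lambda>_. \<mu>) \<in> measurable borel radon_borel" using assms by (simp add: space_radon_borel)
  have "(\<lambda>x. translate x \<mu>) \<in> measurable borel radon_borel" by (rule measurable_translate[OF c]) simp
  from measurable_compose[OF this F_meas] show ?thesis .
qed

lemma transport_nonneg: "0 \<le> transport F Q R \<mu> x y"
  unfolding transport_def by (intro divide_nonneg_nonneg mult_nonneg_nonneg F_bounds mass_at_nonneg) simp

lemma transport_measurable1:
  assumes "\<mu> \<in> radon_measures"
  shows "(\<lambda>x. transport F Q R \<mu> x y) \<in> borel_measurable borel" "transport F Q R \<mu> x \<in> borel_measurable borel"
  using F_translate_measurable[OF assms] mass_at_measurable[OF assms]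
  unfolding transport_def by measurable

lemma outflow_eq:
  "outflow F Q R \<mu> x = F (translate x \<mu>) * mass_at Q \<mu> x / mass_at R \<mu> x"
  unfolding outflow_def transport_def mass_at_def by simp

lemma transport_integrable:
  assumes "\<mu> \<in> radon_measures" shows "integrable \<mu> (transport F Q R \<mu> x)"
proof -
  have "integrable \<mu> (\<lambda>y. F (translate x \<mu>) / mass_at R \<mu> x * nbump Q (y - x))"
    using radon_integrable[OF assms cc_nbump_shift[OF QR(1), of x]] by (rule integrable_mult_right)
  then show ?thesis unfolding transport_def by simp
qed

lemma mass_at_mono:
  assumes "\<mu> \<in> radon_measures" shows "mass_at Q \<mu> x \<le> mass_at R \<mu> x"
  unfolding mass_at_def
  by (rule integral_mono[OF radon_integrable[OF assms cc_nbump_shift[OF QR(1)]] radon_integrable[OF assms cc_nbump_shift[OF R_pos]]])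
    (rule nbump_mono[OF QR])

lemma outflow_bounds:
  assumes "\<mu> \<in> radon_measures" shows "0 \<le> outflow F Q R \<mu> x" "outflow F Q R \<mu> x \<le> 1"
proof -
  show "0 \<le> outflow F Q R \<mu> x"
    unfolding outflow_def by (rule Bochner_Integration.integral_nonneg) (rule transport_nonneg)
  have "F (translate x \<mu>) * mass_at Q \<mu> x \<le> 1 * mass_at R \<mu> x"
    by (rule mult_mono[OF F_bounds(2) mass_at_mono[OF assms] _ mass_at_nonneg]) simp
  then show "outflow F Q R \<mu> x \<le> 1"
    unfolding outflow_eq using mass_at_nonneg[of R \<mu> x]
    by (cases "mass_at R \<mu> x = 0") (simp_all add: divide_le_eq)
qed

lemma transport_outside: "Q \<le> norm (y - x) \<Longrightarrow> transport F Q R \<mu> x y = 0"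
  unfolding transport_def by (simp add: nbump_outside QR)

lemma inflow_translate:
  assumes \<mu>: "\<mu> \<in> radon_measures" shows "inflow F Q R (translate z \<mu>) x = inflow F Q R \<mu> (x + z)"
proof -
  have "inflow F Q R (translate z \<mu>) x = (\<integral>y. transport F Q R (translate z \<mu>) (y - z) x \<partial>\<mu>)"
    unfolding inflow_def
    by (rule integral_translate[OF \<mu>]) (rule transport_measurable1[OF radon_translate[OF \<mu>]])
  also have "\<dots> = (\<integral>y. transport F Q R \<mu> y (x + z) \<partial>\<mu>)"
    unfolding transport_def mass_at_translate[OF \<mu>] translate_translate[OF \<mu>] by (simp add: algebra_simps)
  finally show ?thesis by (simp add: inflow_def)
qed

lemma outflow_translate:
  assumes \<mu>: "\<mu> \<in> radon_measures" shows "outflow F Q R (translate z \<mu>) x = outflow F Q R \<mu> (x + z)"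
  unfolding outflow_eq mass_at_translate[OF \<mu>] translate_translate[OF \<mu>] ..

lemma outflow_scale:
  assumes \<mu>: "\<mu> \<in> radon_measures" and c: "c > 0"
  shows "outflow F Q R (scale_measure (ennreal c) \<mu>) x = outflow F Q R \<mu> x"
  unfolding outflow_eq translate_scale[OF \<mu>] homogeneousD[OF F_hom radon_translate[OF \<mu>] c]
    mass_at_scale[OF \<mu> less_imp_le[OF c]] using c by simp

text \<open>The factor 1 / c from the denominator of the kernel cancels the factor c of the
  integrating measure.\<close>

lemma inflow_scale:
  assumes \<mu>: "\<mu> \<in> radon_measures" and c: "c > 0"
  shows "inflow F Q R (scale_measure (ennreal c) \<mu>) x = inflow F Q R \<mu> x"
proof -
  have "transport F Q R (scale_measure (ennreal c) \<mu>) y x = 1 / c * transport F Q R \<mu> y x" for y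
    unfolding transport_def translate_scale[OF \<mu>] homogeneousD[OF F_hom radon_translate[OF \<mu>] c]
      mass_at_scale[OF \<mu> less_imp_le[OF c]] using c by simp
  then have "inflow F Q R (scale_measure (ennreal c) \<mu>) x = (\<integral>y. 1 / c * transport F Q R \<mu> y x \<partial>scale_measure (ennreal c) \<mu>)"
    unfolding inflow_def by simp
  also have "\<dots> = c * (\<integral>y. 1 / c * transport F Q R \<mu> y x \<partial>\<mu>)"
    by (rule integral_scale_measure[OF less_imp_le[OF c]],
        rule borel_measurable_times[OF borel_measurable_const borel_to_radon_measurable[OF \<mu> transport_measurable1(1)[OF \<mu>]]])
  finally show ?thesis using c by (simp add: inflow_def)
qed

lemma nn_inflow_bound:
  assumes \<mu>: "\<mu> \<in> radon_measures" and A: "finite A" "cball (0 :: real ^ 'n) Q \<subseteq> (\<Union>a\<in>A. ball a (R / 4))"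
  shows "(\<integral>\<^sup>+y. ennreal (transport F Q R \<mu> y 0) \<partial>\<mu>) \<le> ennreal (real (card A) * 2)"
proof (rule nn_integral_cover_bound[OF \<mu> transport_measurable1(1)[OF \<mu>] A])
  fix a y assume a: "a \<in> A" and y: "y \<in> ball a (R / 4)" and m: "measure \<mu> (ball a (R / 4)) > 0"
  have ge: "measure \<mu> (ball a (R / 4)) / 2 \<le> mass_at R \<mu> y" by (rule mass_at_ge_ball[OF \<mu> R_pos y])
  have "F (translate y \<mu>) * nbump Q (0 - y) \<le> 1 * 1"
    by (intro mult_mono F_bounds nbump_le_1 QR) simp_all
  then have "transport F Q R \<mu> y 0 \<le> 1 / (measure \<mu> (ball a (R / 4)) / 2)"
    unfolding transport_def using ge m by (intro frac_le) (auto intro: mult_nonneg_nonneg F_bounds)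
  then show "transport F Q R \<mu> y 0 \<le> 2 / measure \<mu> (ball a (R / 4))" by simp
next
  show "transport F Q R \<mu> y 0 = 0" if "y \<notin> cball 0 Q" for y
    by (rule transport_outside) (use that in simp)
qed (auto simp: transport_nonneg)

text \<open>Twice a covering number. It depends on Q, R and the dimension but on no measure, which
  gives one dominating constant for all random measures.\<close>

definition inflow_bound :: real where
  "inflow_bound = (SOME C. \<exists>A. finite A \<and> cball (0 :: real ^ 'n) Q \<subseteq> (\<Union>a\<in>A. ball a (R / 4)) \<and> C = real (card A) * 2)"

lemma inflow_boundE:
  obtains A where "finite A" "cball (0 :: real ^ 'n) Q \<subseteq> (\<Union>a\<in>A. ball a (R / 4))" "inflow_bound = real (card A) * 2"
proof -
  obtain A where "finite A" "cball (0 :: real ^ 'n) Q \<subseteq> (\<Union>a\<in>A. ball a (R / 4))"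
    using finite_cover_cball[of "R / 4" Q] R_pos by auto
  then have "\<exists>C A. finite A \<and> cball (0 :: real ^ 'n) Q \<subseteq> (\<Union>a\<in>A. ball a (R / 4)) \<and> C = real (card A) * 2" by blast
  from someI_ex[OF this] show ?thesis using that unfolding inflow_bound_def by blast
qed

lemma inflow_bound_nonneg: "0 \<le> inflow_bound"
  by (rule inflow_boundE) simp

lemma nn_inflow_le:
  assumes \<mu>: "\<mu> \<in> radon_measures"
  shows "(\<integral>\<^sup>+y. ennreal (transport F Q R \<mu> y x) \<partial>\<mu>) \<le> ennreal inflow_bound"
proof -
  have r: "translate x \<mu> \<in> radon_measures" by (rule radon_translate[OF \<mu>])
  have m: "(\<lambda>y. ennreal (transport F Q R (translate x \<mu>) y 0)) \<in> borel_measurable borel"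
    using transport_measurable1(1)[OF r] by measurable
  have "(\<integral>\<^sup>+y. ennreal (transport F Q R (translate x \<mu>) y 0) \<partial>translate x \<mu>)
      = (\<integral>\<^sup>+y. ennreal (transport F Q R (translate x \<mu>) (y - x) 0) \<partial>\<mu>)"
    unfolding translate_def[of x \<mu>, THEN arg_cong[where f = "\<lambda>\<nu>. nn_integral \<nu> _"]]
    by (rule nn_integral_distr[OF borel_to_radon_measurable[OF \<mu>]]) (use m in measurable)
  also have "\<dots> = (\<integral>\<^sup>+y. ennreal (transport F Q R \<mu> y x) \<partial>\<mu>)"
    unfolding transport_def mass_at_translate[OF \<mu>] translate_translate[OF \<mu>] by (simp add: algebra_simps)
  finally have eq: "(\<integral>\<^sup>+y. ennreal (transport F Q R \<mu> y x) \<partial>\<mu>) =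
    (\<integral>\<^sup>+y. ennreal (transport F Q R (translate x \<mu>) y 0) \<partial>translate x \<mu>)" ..
  show ?thesis
    by (rule inflow_boundE) (use nn_inflow_bound[OF r] in \<open>simp add: eq\<close>)
qed

lemma transport_integrable_in:
  assumes \<mu>: "\<mu> \<in> radon_measures" shows "integrable \<mu> (\<lambda>y. transport F Q R \<mu> y x)"
proof (rule integrableI_nonneg)
  show "(\<lambda>y. transport F Q R \<mu> y x) \<in> borel_measurable \<mu>"
    by (rule borel_to_radon_measurable[OF \<mu> transport_measurable1(1)[OF \<mu>]])
  show "(\<integral>\<^sup>+y. ennreal (transport F Q R \<mu> y x) \<partial>\<mu>) < \<infinity>"
    using nn_inflow_le[OF \<mu>, of x] by (rule le_less_trans) simp
qed (simp add: transport_nonneg)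

lemma inflow_bounds:
  assumes \<mu>: "\<mu> \<in> radon_measures" shows "0 \<le> inflow F Q R \<mu> x" "inflow F Q R \<mu> x \<le> inflow_bound"
proof -
  show "0 \<le> inflow F Q R \<mu> x"
    unfolding inflow_def by (rule Bochner_Integration.integral_nonneg) (rule transport_nonneg)
  have "ennreal (inflow F Q R \<mu> x) = (\<integral>\<^sup>+y. ennreal (transport F Q R \<mu> y x) \<partial>\<mu>)"
    unfolding inflow_def
    by (rule nn_integral_eq_integral[OF transport_integrable_in[OF \<mu>], symmetric]) (simp add: transport_nonneg)
  also have "\<dots> \<le> ennreal inflow_bound" by (rule nn_inflow_le[OF \<mu>])
  finally show "inflow F Q R \<mu> x \<le> inflow_bound"
    unfolding ennreal_le_iff[OF inflow_bound_nonneg] .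
qed

end

lemma plateau_Lipschitz: "\<bar>plateau A n x - plateau A n y\<bar> \<le> real n * dist x y"
proof -
  have "\<bar>real n * infdist x (- A) - real n * infdist y (- A)\<bar> = real n * \<bar>infdist x (- A) - infdist y (- A)\<bar>"
    by (simp add: abs_mult right_diff_distrib[symmetric])
  also have "\<dots> \<le> real n * dist x y" by (intro mult_left_mono infdist_triangle_abs) simp
  finally show ?thesis unfolding plateau_def by linarith
qed

text \<open>Adding the constant C makes the densities nonnegative. The measures with densities C + G
  and C have the same test integrals, so they are equal and their densities agree almost
  everywhere.\<close>

lemma radon_AE_zero:
  fixes \<nu> :: "(real ^ 'n) measure"
  assumes \<nu>: "\<nu> \<in> radon_measures" and G: "G \<in> borel_measurable borel" and C: "\<And>x. \<bar>G x\<bar> \<le> C"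
    and zero: "\<And>k. (\<integral>x. test k x * G x \<partial>\<nu>) = 0"
  shows "AE x in \<nu>. G x = 0"
proof -
  have m: "f \<in> borel_measurable borel \<Longrightarrow> f \<in> measurable \<nu> borel" for f :: "real ^ 'n \<Rightarrow> real"
    by (rule borel_to_radon_measurable[OF \<nu>])
  have C0: "0 \<le> C" using C[of 0] by linarith
  have nn: "0 \<le> C + G x" for x using C[of x] by linarith
  interpret sigma_finite_measure \<nu> by (rule radon_sigma_finite[OF \<nu>])
  define d where "d g = density \<nu> (\<lambda>x. ennreal (g x))" for g :: "real ^ 'n \<Rightarrow> real"
  have drad: "d g \<in> radon_measures" if g: "g \<in> borel_measurable borel" "\<And>x. g x \<le> 2 * C" for g
    unfolding radon_measures_iff
  proof (intro conjI allI)
    show "sets (d g) = sets borel" by (simp add: d_def radon_sets[OF \<nu>])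
    fix n :: nat
    have s: "cball 0 (real n) \<in> sets \<nu>" by (simp add: radon_sets[OF \<nu>])
    have "emeasure (d g) (cball 0 (real n)) = (\<integral>\<^sup>+x. ennreal (g x) * indicator (cball 0 (real n)) x \<partial>\<nu>)"
      unfolding d_def by (rule emeasure_density[OF measurable_compose[OF m[OF g(1)] measurable_ennreal] s])
    also have "\<dots> \<le> (\<integral>\<^sup>+x. ennreal (2 * C) * indicator (cball 0 (real n)) x \<partial>\<nu>)"
      by (intro nn_integral_mono mult_right_mono ennreal_leI g(2)) simp
    also have "\<dots> = ennreal (2 * C) * emeasure \<nu> (cball 0 (real n))"
      by (rule nn_integral_cmult_indicator[OF s])
    also have "\<dots> < \<infinity>"
      using radon_emeasure_bounded[OF \<nu> bounded_cball, of 0 "real n"] by (simp add: ennreal_mult_less_top)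
    finally show "emeasure (d g) (cball 0 (real n)) < \<infinity>" .
  qed
  have gb: "(\<lambda>x. C + G x) \<in> borel_measurable borel" using G by measurable
  have "d (\<lambda>x. C + G x) = d (\<lambda>_. C)"
  proof (rule radon_eqI)
    show "d (\<lambda>x. C + G x) \<in> radon_measures"
    proof (rule drad[OF gb])
      show "C + G x \<le> 2 * C" for x using C[of x] by linarith
    qed
    show "d (\<lambda>_. C) \<in> radon_measures" by (rule drad) (use C0 in auto)
    fix k
    obtain B r where B: "\<And>x :: real ^ 'n. r < norm x \<Longrightarrow> test k x = 0" using cc_supportE[OF cc_test] by metis
    have it: "integrable \<nu> (test k)" by (rule radon_integrable[OF \<nu> cc_test])
    have iG: "integrable \<nu> (\<lambda>x. test k x * G x)"
    proof (rule radon_integrable_bounded[OF \<nu>, where B = C and r = r])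
      show "(\<lambda>x. test k x * G x) \<in> borel_measurable borel" using cc_borel[OF cc_test, of k] G by measurable
      show "\<bar>test k x * G x\<bar> \<le> C" for x
        using mult_mono[OF test_le_1[of k x] C[of x]] by (simp add: abs_mult)
    qed (simp add: B)
    have "(\<integral>x. test k x \<partial>d (\<lambda>x. C + G x)) = (\<integral>x. (C + G x) * test k x \<partial>\<nu>)"
      unfolding d_def by (rule integral_real_density[OF m[OF gb] _ m[OF cc_borel[OF cc_test]]]) (simp add: nn)
    also have "\<dots> = (\<integral>x. C * test k x + test k x * G x \<partial>\<nu>)"
      by (rule Bochner_Integration.integral_cong) (simp_all add: algebra_simps)
    also have "\<dots> = (\<integral>x. C * test k x \<partial>\<nu>)" using it iG zero[of k] by simp
    also have "\<dots> = (\<integral>x. test k x \<partial>d (\<lambda>_. C))"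
      unfolding d_def by (rule integral_real_density[OF _ _ m[OF cc_borel[OF cc_test]], symmetric]) (simp_all add: C0)
    finally show "(\<integral>x. test k x \<partial>d (\<lambda>x. C + G x)) = (\<integral>x. test k x \<partial>d (\<lambda>_. C))" .
  qed
  then have "AE x in \<nu>. ennreal (C + G x) = ennreal C"
    unfolding d_def
    by (subst (asm) density_unique_iff) (auto intro!: measurable_compose[OF m[OF gb] measurable_ennreal])
  then show ?thesis by eventually_elim (simp add: nn C0)
qed

context transport_kernel begin

lemma inflow_measurable:
  assumes \<mu>: "\<mu> \<in> radon_measures" shows "inflow F Q R \<mu> \<in> borel_measurable borel"
proof -
  have c: "(\<lambda>_. \<mu>) \<in> measurable borel radon_borel" using \<mu> by (simp add: space_radon_borel)
  have "(\<lambda>p. transport F Q R \<mu> (snd p) (fst p)) \<in> borel_measurable (borel \<Otimes>\<^sub>M borel)"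
    using F_translate_measurable[OF \<mu>] mass_at_measurable[OF \<mu>] unfolding transport_def by measurable
  then show ?thesis unfolding inflow_def[abs_def]
    by (intro integral_radon_measurable[OF c]) (simp_all add: case_prod_beta' transport_nonneg)
qed

lemma outflow_measurable:
  assumes \<mu>: "\<mu> \<in> radon_measures" shows "outflow F Q R \<mu> \<in> borel_measurable borel"
  using F_translate_measurable[OF \<mu>] mass_at_measurable[OF \<mu>] unfolding outflow_eq[abs_def] by measurable

text \<open>Fubini turns the pairing of \<open>outflow - inflow\<close> with \<open>\<phi>\<close> into the double integral of
  \<open>(\<phi> x - \<phi> y) * transport x y\<close>, and the transport has range \<open>Q\<close>.\<close>

lemma pairing_bound:
  fixes \<phi> :: "real ^ 'n \<Rightarrow> real"
  assumes \<mu>: "\<mu> \<in> radon_measures" and \<phi>: "\<phi> \<in> borel_measurable borel" and L: "0 \<le> L"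
    and Lip: "\<And>x y. \<bar>\<phi> x - \<phi> y\<bar> \<le> L * dist x y" and B: "\<And>x. \<bar>\<phi> x\<bar> \<le> B" and r: "\<And>x. r < norm x \<Longrightarrow> \<phi> x = 0"
  shows "\<bar>\<integral>x. \<phi> x * (outflow F Q R \<mu> x - inflow F Q R \<mu> x) \<partial>\<mu>\<bar> \<le> L * Q * measure \<mu> (cball 0 (r + Q))"
proof -
  let ?t = "transport F Q R \<mu>"
  have B0: "0 \<le> B" using B[of 0] by linarith
  have m: "f \<in> borel_measurable borel \<Longrightarrow> f \<in> measurable \<mu> borel" for f :: "real ^ 'n \<Rightarrow> real"
    by (rule borel_to_radon_measurable[OF \<mu>])
  interpret M: sigma_finite_measure \<mu> by (rule radon_sigma_finite[OF \<mu>])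
  interpret MM: pair_sigma_finite \<mu> \<mu> ..
  have ps: "sets (\<mu> \<Otimes>\<^sub>M \<mu>) = sets (borel \<Otimes>\<^sub>M borel)"
    by (rule sets_pair_measure_cong[OF radon_sets[OF \<mu>] radon_sets[OF \<mu>]])
  have iin: "integrable \<mu> (\<lambda>x. \<bar>\<phi> x\<bar> * inflow F Q R \<mu> x)"
  proof (rule radon_integrable_bounded[OF \<mu>, where B = "B * inflow_bound" and r = r])
    show "(\<lambda>x. \<bar>\<phi> x\<bar> * inflow F Q R \<mu> x) \<in> borel_measurable borel"
      using \<phi> inflow_measurable[OF \<mu>] by measurable
    show "\<bar>\<bar>\<phi> x\<bar> * inflow F Q R \<mu> x\<bar> \<le> B * inflow_bound" for x
      using inflow_bounds[OF \<mu>, of x] B0 by (simp add: abs_mult mult_mono B)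
  qed (simp add: r)
  have iin': "integrable \<mu> (\<lambda>x. \<phi> x * inflow F Q R \<mu> x)"
    by (rule Bochner_Integration.integrable_bound[OF iin])
      (auto intro!: m borel_measurable_times \<phi> inflow_measurable[OF \<mu>] simp: abs_mult inflow_bounds[OF \<mu>])
  have iout: "integrable \<mu> (\<lambda>x. \<phi> x * outflow F Q R \<mu> x)"
  proof (rule radon_integrable_bounded[OF \<mu>, where B = "B * 1" and r = r])
    show "(\<lambda>x. \<phi> x * outflow F Q R \<mu> x) \<in> borel_measurable borel"
      using \<phi> outflow_measurable[OF \<mu>] by measurable
    show "\<bar>\<phi> x * outflow F Q R \<mu> x\<bar> \<le> B * 1" for x
      using outflow_bounds[OF \<mu>, of x] B0 unfolding abs_mult by (intro mult_mono B) auto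
  qed (simp add: r)
  define b where "b x y = \<phi> x * ?t y x" for x y
  have bm: "case_prod b \<in> borel_measurable (\<mu> \<Otimes>\<^sub>M \<mu>)"
  proof -
    have "(\<lambda>p. \<phi> (fst p) * ?t (snd p) (fst p)) \<in> borel_measurable (borel \<Otimes>\<^sub>M borel)"
      using F_translate_measurable[OF \<mu>] mass_at_measurable[OF \<mu>] \<phi> unfolding transport_def by measurable
    then show ?thesis unfolding b_def measurable_cong_sets[OF ps refl] by (simp add: case_prod_beta')
  qed
  \<comment> \<open>Absolute integrability for Fubini comes from the uniform bound on the
    inflow.\<close>
  have bint: "integrable (\<mu> \<Otimes>\<^sub>M \<mu>) (case_prod b)"
  proof (rule MM.Fubini_integrable[OF bm])
    have "(\<integral>y. norm (b x y) \<partial>\<mu>) = \<bar>\<phi> x\<bar> * inflow F Q R \<mu> x" for x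
      unfolding b_def inflow_def by (simp add: abs_mult abs_of_nonneg[OF transport_nonneg])
    then show "integrable \<mu> (\<lambda>x. \<integral>y. norm (case (x, y) of (x, y) \<Rightarrow> b x y) \<partial>\<mu>)" using iin by simp
    show "AE x in \<mu>. integrable \<mu> (\<lambda>y. case (x, y) of (x, y) \<Rightarrow> b x y)"
      unfolding b_def prod.case by (intro AE_I2 integrable_mult_right transport_integrable_in[OF \<mu>])
  qed
  define H' where "H' x = (\<integral>y. \<phi> y * ?t x y \<partial>\<mu>)" for x
  have swap: "(\<integral>x. \<phi> x * inflow F Q R \<mu> x \<partial>\<mu>) = (\<integral>x. H' x \<partial>\<mu>)"
  proof -
    have "(\<integral>x. \<phi> x * inflow F Q R \<mu> x \<partial>\<mu>) = (\<integral>x. (\<integral>y. b x y \<partial>\<mu>) \<partial>\<mu>)"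
      unfolding b_def inflow_def by simp
    also have "\<dots> = (\<integral>y. (\<integral>x. b x y \<partial>\<mu>) \<partial>\<mu>)" by (rule MM.Fubini_integral[OF bint, symmetric])
    finally show ?thesis unfolding b_def H'_def .
  qed
  have iH': "integrable \<mu> H'"
    using MM.integrable_snd[OF bint] unfolding b_def H'_def by simp
  have tp: "integrable \<mu> (\<lambda>y. \<phi> y * ?t x y)" for x
  proof (rule Bochner_Integration.integrable_bound[where f = "\<lambda>y. B * ?t x y"])
    show "integrable \<mu> (\<lambda>y. B * ?t x y)" by (rule integrable_mult_right) (rule transport_integrable[OF \<mu>])
    show "(\<lambda>y. \<phi> y * ?t x y) \<in> borel_measurable \<mu>"
      by (rule m, rule borel_measurable_times[OF \<phi> transport_measurable1(2)[OF \<mu>]])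
    show "AE y in \<mu>. norm (\<phi> y * ?t x y) \<le> norm (B * ?t x y)"
      using B0 B by (intro AE_I2) (simp add: abs_mult mult_right_mono)
  qed
  \<comment> \<open>If x lies outside radius r + Q, both \<open>\<phi> x\<close> and
    \<open>\<phi> y\<close> vanish for every y that x can reach; this is the origin of the enlarged
    ball.\<close>
  have H: "\<bar>\<phi> x * outflow F Q R \<mu> x - H' x\<bar> \<le> L * Q * indicator (cball 0 (r + Q)) x" for x
  proof -
    have "\<phi> x * outflow F Q R \<mu> x - H' x = (\<integral>y. \<phi> x * ?t x y - \<phi> y * ?t x y \<partial>\<mu>)"
      unfolding outflow_def H'_def
      by (subst Bochner_Integration.integral_diff[OF integrable_mult_right[OF transport_integrable[OF \<mu>]] tp]) simp
    also have "\<bar>\<dots>\<bar> \<le> (\<integral>y. L * Q * indicator (cball 0 (r + Q)) x * ?t x y \<partial>\<mu>)"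
    proof (rule order_trans[OF integral_abs_bound], rule integral_mono)
      show "integrable \<mu> (\<lambda>y. \<bar>\<phi> x * ?t x y - \<phi> y * ?t x y\<bar>)"
        by (intro integrable_abs Bochner_Integration.integrable_diff integrable_mult_right transport_integrable[OF \<mu>] tp)
      show "integrable \<mu> (\<lambda>y. L * Q * indicator (cball 0 (r + Q)) x * ?t x y)"
        by (intro integrable_mult_right transport_integrable[OF \<mu>])
      fix y
      show "\<bar>\<phi> x * ?t x y - \<phi> y * ?t x y\<bar> \<le> L * Q * indicator (cball 0 (r + Q)) x * ?t x y"
      proof (cases "norm (y - x) < Q")
        case True
        have "\<bar>\<phi> x * ?t x y - \<phi> y * ?t x y\<bar> = \<bar>\<phi> x - \<phi> y\<bar> * ?t x y"
          by (simp add: left_diff_distrib[symmetric] abs_mult abs_of_nonneg[OF transport_nonneg])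
        also have "\<dots> \<le> L * Q * indicator (cball 0 (r + Q)) x * ?t x y"
        proof (rule mult_right_mono[OF _ transport_nonneg])
          show "\<bar>\<phi> x - \<phi> y\<bar> \<le> L * Q * indicator (cball 0 (r + Q)) x"
          proof (cases "norm x \<le> r + Q")
            case True
            have "L * dist x y \<le> L * Q"
              using \<open>norm (y - x) < Q\<close> by (intro mult_left_mono L) (simp add: dist_norm norm_minus_commute)
            then show ?thesis using Lip[of x y] True by simp
          next
            case False
            have "norm x \<le> norm y + norm (y - x)" using norm_triangle_ineq4[of y "y - x"] by simp
            then have "\<phi> x = 0" "\<phi> y = 0" using False \<open>norm (y - x) < Q\<close> QR(1) by (auto intro!: r)
            then show ?thesis using L QR(1) by simp
          qed
        qed
        finally show ?thesis .
      next
        case False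
        then show ?thesis by (simp add: transport_outside)
      qed
    qed
    also have "\<dots> = L * Q * indicator (cball 0 (r + Q)) x * outflow F Q R \<mu> x"
      unfolding outflow_def by simp
    also have "\<dots> \<le> L * Q * indicator (cball 0 (r + Q)) x * 1"
      by (rule mult_left_mono[OF outflow_bounds(2)[OF \<mu>]]) (use L QR(1) in simp)
    finally show ?thesis by simp
  qed
  have ind: "integrable \<mu> (indicator (cball 0 (r + Q)) :: _ \<Rightarrow> real)"
    using radon_emeasure_bounded[OF \<mu> bounded_cball] by (intro integrable_real_indicator) (simp_all add: radon_sets[OF \<mu>])
  have "(\<integral>x. \<phi> x * (outflow F Q R \<mu> x - inflow F Q R \<mu> x) \<partial>\<mu>) = (\<integral>x. \<phi> x * outflow F Q R \<mu> x - H' x \<partial>\<mu>)"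
    unfolding right_diff_distrib Bochner_Integration.integral_diff[OF iout iin'] swap
    by (rule Bochner_Integration.integral_diff[OF iout iH', symmetric])
  also have "\<bar>\<dots>\<bar> \<le> (\<integral>x. L * Q * indicator (cball 0 (r + Q)) x \<partial>\<mu>)"
    by (rule order_trans[OF integral_abs_bound], rule integral_mono)
      (auto intro!: integrable_abs Bochner_Integration.integrable_diff iout iH' integrable_mult_right ind H)
  also have "\<dots> = L * Q * measure \<mu> (cball 0 (r + Q))"
    using radon_space[OF \<mu>] by (simp del: indicator_simps)
  finally show ?thesis .
qed

text \<open>The difference D of the overview, as seen from the origin.\<close>

definition imbalance :: "(real ^ 'n) measure \<Rightarrow> real" where
  "imbalance \<mu> = outflow F Q R \<mu> 0 - inflow F Q R \<mu> 0"

lemma outflow_0_measurable: "(\<lambda>\<mu>. outflow F Q R \<mu> 0) \<in> borel_measurable radon_borel"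
proof -
  have "(\<lambda>\<mu>. translate (0 :: real ^ 'n) \<mu>) \<in> measurable radon_borel radon_borel"
    by (rule measurable_translate) simp_all
  then have [measurable]: "(\<lambda>\<mu>. F (translate 0 \<mu>)) \<in> borel_measurable radon_borel"
    by (rule measurable_compose[OF _ F_meas])
  have [measurable]: "(\<lambda>\<mu>. mass_at S \<mu> (0 :: real ^ 'n)) \<in> borel_measurable radon_borel" if "S > 0" for S
    unfolding mass_at_def by (rule measurable_integral_cc[OF cc_nbump_shift[OF that]])
  show ?thesis unfolding outflow_eq using QR(1) R_pos by measurable
qed

lemma transport_joint_measurable:
  "(\<lambda>(\<mu>, y). transport F Q R \<mu> y 0) \<in> borel_measurable (radon_borel \<Otimes>\<^sub>M borel)"
proof -
  let ?P = "radon_borel \<Otimes>\<^sub>M borel :: ((real ^ 'n) measure \<times> (real ^ 'n)) measure"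
  have f: "fst \<in> measurable ?P radon_borel" by simp
  have "(\<lambda>p. translate (snd p) (fst p)) \<in> measurable ?P radon_borel"
    by (rule measurable_translate[OF f]) simp
  then have [measurable]: "(\<lambda>p. F (translate (snd p) (fst p))) \<in> borel_measurable ?P"
    by (rule measurable_compose[OF _ F_meas])
  have [measurable]: "(\<lambda>p. mass_at R (fst p) (snd p)) \<in> borel_measurable ?P"
    unfolding mass_at_def
  proof (rule integral_radon_measurable[OF f])
    have "(\<lambda>q :: ((real ^ 'n) measure \<times> (real ^ 'n)) \<times> (real ^ 'n). snd q - snd (fst q)) \<in> borel_measurable (?P \<Otimes>\<^sub>M borel)"
      by measurable
    from measurable_compose[OF this nbump_measurable]
    show "(\<lambda>(p, y). nbump R (y - snd p)) \<in> borel_measurable (?P \<Otimes>\<^sub>M borel)"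
      by (simp add: case_prod_beta')
  qed simp
  show ?thesis unfolding transport_def case_prod_beta' by measurable
qed

lemma inflow_0_measurable: "(\<lambda>\<mu>. inflow F Q R \<mu> 0) \<in> borel_measurable radon_borel"
  unfolding inflow_def
  by (rule integral_radon_measurable[where X = "\<lambda>\<mu>. \<mu>", OF _ transport_joint_measurable transport_nonneg]) simp

lemma imbalance_measurable [measurable]: "imbalance \<in> borel_measurable radon_borel"
  unfolding imbalance_def[abs_def]
  by (rule borel_measurable_diff[OF outflow_0_measurable inflow_0_measurable])

lemma imbalance_homogeneous: "homogeneous imbalance"
  unfolding homogeneous_def imbalance_def by (simp add: outflow_scale inflow_scale)

lemma imbalance_magnify_translate:
  assumes "\<nu> \<in> radon_measures"
  shows "imbalance (magnify t (translate x \<nu>)) =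
    outflow F Q R (magnify t \<nu>) (exp t *\<^sub>R x) - inflow F Q R (magnify t \<nu>) (exp t *\<^sub>R x)"
  unfolding imbalance_def magnify_translate[OF assms]
  by (simp add: outflow_translate[OF radon_magnify[OF assms]] inflow_translate[OF radon_magnify[OF assms]])

lemma imbalance_bound:
  assumes "\<mu> \<in> radon_measures" shows "\<bar>imbalance \<mu>\<bar> \<le> 1 + inflow_bound"
  using outflow_bounds[OF assms, of 0] inflow_bounds[OF assms, of 0] unfolding imbalance_def by linarith

text \<open>After magnification by e^t the test function has Lipschitz constant L e^-t, while the
  transport keeps its range Q. Seen at the original scale, the ball that matters has radius r + Q
  e^-t, which is at most r + Q.\<close>

lemma imbalance_pairing:
  fixes \<phi> :: "real ^ 'n \<Rightarrow> real"
  assumes \<nu>: "\<nu> \<in> radon_measures" and \<phi>: "\<phi> \<in> borel_measurable borel" and L: "0 \<le> L" and t: "0 \<le> t"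
    and Lip: "\<And>x y. \<bar>\<phi> x - \<phi> y\<bar> \<le> L * dist x y" and B: "\<And>x. \<bar>\<phi> x\<bar> \<le> B" and r: "\<And>x. r < norm x \<Longrightarrow> \<phi> x = 0"
  shows "\<bar>\<integral>x. \<phi> x * imbalance (magnify t (translate x \<nu>)) \<partial>\<nu>\<bar> \<le> exp (- t) * (L * Q * measure \<nu> (cball 0 (r + Q)))"
proof -
  let ?l = "magnify t \<nu>"
  have \<lambda>: "?l \<in> radon_measures" by (rule radon_magnify[OF \<nu>])
  define \<psi> where "\<psi> x = \<phi> (exp (- t) *\<^sub>R x)" for x
  have \<psi>m: "\<psi> \<in> borel_measurable borel" unfolding \<psi>_def using \<phi> by measurable
  have "(\<integral>x. \<phi> x * imbalance (magnify t (translate x \<nu>)) \<partial>\<nu>)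
      = (\<integral>x. \<psi> (exp t *\<^sub>R x) * (outflow F Q R ?l (exp t *\<^sub>R x) - inflow F Q R ?l (exp t *\<^sub>R x)) \<partial>\<nu>)"
    unfolding imbalance_magnify_translate[OF \<nu>] \<psi>_def by (simp flip: exp_add)
  also have "\<dots> = (\<integral>x. \<psi> x * (outflow F Q R ?l x - inflow F Q R ?l x) \<partial>?l)"
    by (rule integral_magnify[OF \<nu>, symmetric]) (use \<psi>m outflow_measurable[OF \<lambda>] inflow_measurable[OF \<lambda>] in measurable)
  also have "\<bar>\<dots>\<bar> \<le> (L * exp (- t)) * Q * measure ?l (cball 0 (r * exp t + Q))"
  proof (rule pairing_bound[OF \<lambda> \<psi>m])
    show "0 \<le> L * exp (- t)" using L by simp
    show "\<bar>\<psi> x - \<psi> y\<bar> \<le> L * exp (- t) * dist x y" for x y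
      using Lip[of "exp (- t) *\<^sub>R x" "exp (- t) *\<^sub>R y"]
      by (simp add: \<psi>_def dist_norm scaleR_diff_right[symmetric] mult.assoc)
    show "\<bar>\<psi> x\<bar> \<le> B" for x by (simp add: \<psi>_def B)
    show "\<psi> x = 0" if "r * exp t < norm x" for x
      unfolding \<psi>_def using that by (intro r) (simp add: exp_minus field_simps)
  qed
  also have "\<dots> \<le> (L * exp (- t)) * Q * measure \<nu> (cball 0 (r + Q))"
  proof (rule mult_left_mono)
    have "emeasure ?l (cball 0 (r * exp t + Q)) = emeasure \<nu> {y. exp t *\<^sub>R y \<in> cball 0 (r * exp t + Q)}"
      by (rule emeasure_magnify[OF \<nu>]) simp
    also have "\<dots> \<le> emeasure \<nu> (cball 0 (r + Q))"
    proof (rule emeasure_mono)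
      have "norm y \<le> r + Q" if "exp t * norm y \<le> r * exp t + Q" for y :: "real ^ 'n"
      proof -
        have "1 * Q \<le> exp t * Q" using QR(1) t by (intro mult_right_mono) auto
        then have "exp t * norm y \<le> exp t * (r + Q)" using that by (simp add: algebra_simps)
        then show ?thesis by simp
      qed
      then show "{y :: real ^ 'n. exp t *\<^sub>R y \<in> cball 0 (r * exp t + Q)} \<subseteq> cball 0 (r + Q)" by (auto simp: mem_cball_0 simp del: mem_cball)
    qed (simp add: radon_sets[OF \<nu>])
    finally show "measure ?l (cball 0 (r * exp t + Q)) \<le> measure \<nu> (cball 0 (r + Q))"
      unfolding measure_def using radon_emeasure_bounded[OF \<nu> bounded_cball] by (intro enn2real_mono) auto
  qed (use L QR(1) in simp)
  finally show ?thesis by (simp add: ac_simps)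
qed

text \<open>Each direction of the quasi-Palm equivalence is used once: convergence of the averages
  is carried from the origin to typical points, where pairings with test functions force the limit
  0, and this is carried back. Scale invariance keeps the expectation of the averages constant, so
  it is 0.\<close>

theorem mass_transport:
  assumes "P \<in> extended_fractal_distributions"
  shows "(\<integral>\<mu>. outflow F Q R \<mu> 0 \<partial>P) = (\<integral>\<mu>. inflow F Q R \<mu> 0 \<partial>P)"
proof -
  interpret fractal_dist P by standard (rule assms)
  define C where "C = 1 + inflow_bound"
  \<comment> \<open>Set to 0 outside \<open>radon_measures\<close>, since the lemma on convex
    combinations asks for a bound at every argument.\<close>
  define f where "f n \<mu> = (if \<mu> \<in> radon_measures then imbalance (magnify (real n) \<mu>) else 0)" for n :: nat and \<mu>
  have mg: "(\<lambda>\<mu>. imbalance (magnify t \<mu>)) \<in> borel_measurable radon_borel" for t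
    by (rule measurable_compose[OF measurable_magnify imbalance_measurable]) simp
  have fR: "f n \<mu> = imbalance (magnify (real n) \<mu>)" if "\<mu> \<in> radon_measures" for n \<mu>
    using that by (simp add: f_def)
  have fm [measurable]: "f n \<in> borel_measurable radon_borel" for n
    using mg[of "real n"] by (rule measurable_cong[THEN iffD1, rotated]) (simp add: fR space_radon_borel)
  have fB: "\<bar>f n \<mu>\<bar> \<le> C" for n \<mu>
    using imbalance_bound[OF radon_magnify, of \<mu>] inflow_bound_nonneg by (simp add: f_def C_def)
  have fhom: "f n (scale_measure (ennreal c) \<mu>) = f n \<mu>" if "\<mu> \<in> radon_measures" "c > 0" for n \<mu> c
    using that by (simp add: fR radon_scale magnify_scale homogeneousD[OF imbalance_homogeneous] radon_magnify)
  obtain w m where w: "\<And>k n. 0 \<le> w k n" "\<And>k. (\<Sum>n\<in>{k..<m k}. w k n) = 1"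
    and conv: "AE \<mu> in P. convergent (\<lambda>k. \<Sum>n\<in>{k..<m k}. w k n * f n \<mu>)"
    by (rule convex_combinations_AE_convergent[OF prob_space_axioms measurable_P[OF fm] fB]) (rule that)
  define g where "g k \<mu> = (\<Sum>n\<in>{k..<m k}. w k n * f n \<mu>)" for k \<mu>
  have gm [measurable]: "g k \<in> borel_measurable radon_borel" for k unfolding g_def by measurable
  have gB: "\<bar>g k \<mu>\<bar> \<le> C" for k \<mu>
  proof -
    have "\<bar>g k \<mu>\<bar> \<le> (\<Sum>n\<in>{k..<m k}. w k n * C)"
      unfolding g_def by (rule order_trans[OF sum_abs sum_mono]) (simp add: abs_mult mult_left_mono fB w)
    also have "\<dots> = C" by (simp add: sum_distrib_right[symmetric] w)
    finally show ?thesis .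
  qed
  have ghom: "homogeneous (g k)" for k unfolding homogeneous_def g_def by (simp add: fhom)
  have Eg: "expectation (g k) = expectation imbalance" for k
  proof -
    have "expectation (f n) = expectation imbalance" for n
    proof -
      have "expectation (f n) = expectation (\<lambda>\<mu>. imbalance (magnify (real n) \<mu>))"
        by (rule Bochner_Integration.integral_cong) (simp_all add: fR space_P)
      also have "\<dots> = expectation imbalance"
      proof (cases "n = 0")
        case True
        then show ?thesis by (intro Bochner_Integration.integral_cong) (simp_all add: magnify_0 space_P)
      next
        case False
        then show ?thesis by (intro expectation_magnify[OF imbalance_measurable imbalance_homogeneous]) simp
      qed
      finally show ?thesis .
    qed
    moreover have "integrable P (f n)" for n
      by (rule integrable_const_bound[where B = C]) (use fB measurable_P[OF fm] in auto)
    ultimately show ?thesis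
      unfolding g_def by (subst Bochner_Integration.integral_sum) (simp_all add: sum_distrib_right[symmetric] w)
  qed
  have cs: "{\<mu> \<in> radon_measures. convergent (\<lambda>k. g k \<mu>)} \<in> sets radon_borel"
    unfolding Cauchy_convergent_iff[symmetric] using sets_Collect_Cauchy[of g radon_borel] gm
    by (simp add: space_radon_borel)
  have hc: "homogeneous (\<lambda>\<mu>. convergent (\<lambda>k. g k \<mu>))"
    unfolding homogeneous_def using homogeneousD[OF ghom] by simp
  \<comment> \<open>First use of the quasi-Palm property: convergence at the origin becomes
    convergence at typical points.\<close>
  have AEc: "AE \<nu> in P. AE z in \<nu>. convergent (\<lambda>k. g k (translate z \<nu>))"
    using conv unfolding g_def[symmetric] quasi_palm_homogeneous[OF cs hc] .
  have AE0: "AE \<nu> in P. AE z in \<nu>. (\<lambda>k. g k (translate z \<nu>)) \<longlonglongrightarrow> 0"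
  proof (rule AE_mp[OF AEc], rule AE_I2, rule impI)
    fix \<nu> assume "\<nu> \<in> space P" and A: "AE z in \<nu>. convergent (\<lambda>k. g k (translate z \<nu>))"
    then have \<nu>: "\<nu> \<in> radon_measures" by (simp add: space_P)
    have cst: "(\<lambda>_. \<nu>) \<in> measurable borel radon_borel" using \<nu> by (simp add: space_radon_borel)
    have tm: "(\<lambda>z. translate z \<nu>) \<in> measurable borel radon_borel" by (rule measurable_translate[OF cst]) simp
    have gt [measurable]: "(\<lambda>z. g k (translate z \<nu>)) \<in> borel_measurable borel" for k
      by (rule measurable_compose[OF tm gm])
    \<comment> \<open>The default 0 at points of divergence makes the limit Borel and bounded
      everywhere.\<close>
    define G where "G z = (if convergent (\<lambda>k. g k (translate z \<nu>)) then lim (\<lambda>k. g k (translate z \<nu>)) else 0)" for z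
    have Gm [measurable]: "G \<in> borel_measurable borel"
    proof -
      have "{z. convergent (\<lambda>k. g k (translate z \<nu>))} \<in> sets borel"
        unfolding Cauchy_convergent_iff[symmetric]
        using sets_Collect_Cauchy[of "\<lambda>k z. g k (translate z \<nu>)" borel] gt by simp
      then have [measurable]: "Measurable.pred borel (\<lambda>z. convergent (\<lambda>k. g k (translate z \<nu>)))"
        by (simp add: pred_def)
      have [measurable]: "(\<lambda>z. lim (\<lambda>k. g k (translate z \<nu>))) \<in> borel_measurable borel"
        by (rule borel_measurable_lim_metric) (rule gt)
      show ?thesis unfolding G_def by measurable
    qed
    have Glim: "AE z in \<nu>. (\<lambda>k. g k (translate z \<nu>)) \<longlonglongrightarrow> G z"
      using A by eventually_elim (simp add: G_def convergent_LIMSEQ_iff)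
    have GC: "\<bar>G z\<bar> \<le> C" for z
    proof (cases "convergent (\<lambda>k. g k (translate z \<nu>))")
      case True
      then have "(\<lambda>k. g k (translate z \<nu>)) \<longlonglongrightarrow> G z" by (simp add: G_def convergent_LIMSEQ_iff)
      then have "(\<lambda>k. \<bar>g k (translate z \<nu>)\<bar>) \<longlonglongrightarrow> \<bar>G z\<bar>" by (rule tendsto_rabs)
      then show ?thesis by (rule LIMSEQ_le_const2) (use gB in auto)
    qed (use gB[of 0 \<nu>] in \<open>simp add: G_def\<close>)
    have "AE z in \<nu>. G z = 0"
    proof (rule radon_AE_zero[OF \<nu> Gm GC])
      fix k0
      define \<phi> where "\<phi> = (test k0 :: real ^ 'n \<Rightarrow> real)"
      have \<phi>cc: "cc \<phi>" unfolding \<phi>_def by (rule cc_test)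
      obtain r where r: "\<And>x. r < norm x \<Longrightarrow> \<phi> x = 0" using cc_supportE[OF \<phi>cc] by blast
      have \<phi>1: "\<bar>\<phi> x\<bar> \<le> 1" for x by (simp add: \<phi>_def test_le_1)
      define L where "L = real (snd (prod_decode k0))"
      have Lip: "\<bar>\<phi> x - \<phi> y\<bar> \<le> L * dist x y" for x y
        unfolding \<phi>_def test_def L_def by (rule plateau_Lipschitz)
      define D where "D = L * Q * measure \<nu> (cball 0 (r + Q))"
      have D0: "0 \<le> D" using QR(1) by (simp add: D_def L_def)
      note \<phi>m [measurable] = cc_borel[OF \<phi>cc]
      have fnm: "(\<lambda>z. f n (translate z \<nu>)) \<in> borel_measurable borel" for n by (rule measurable_compose[OF tm fm])
      have int: "integrable \<nu> (\<lambda>z. \<phi> z * h z)" if "h \<in> borel_measurable borel" "\<And>z. \<bar>h z\<bar> \<le> C" for h :: "real ^ 'n \<Rightarrow> real"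
      proof (rule radon_integrable_bounded[OF \<nu>, where B = "1 * C" and r = r])
        show "(\<lambda>z. \<phi> z * h z) \<in> borel_measurable borel" using that(1) by measurable
        show "\<bar>\<phi> z * h z\<bar> \<le> 1 * C" for z unfolding abs_mult by (rule mult_mono[OF \<phi>1 that(2)]) simp_all
      qed (simp add: r)
      \<comment> \<open>All indices in the k-th combination are at least k, so every pairing in it
        is at most exp (- k) * D in absolute value.\<close>
      have bound: "\<bar>\<integral>z. \<phi> z * g k (translate z \<nu>) \<partial>\<nu>\<bar> \<le> exp (- real k) * D" for k
      proof -
        have "(\<integral>z. \<phi> z * g k (translate z \<nu>) \<partial>\<nu>) = (\<integral>z. (\<Sum>n\<in>{k..<m k}. w k n * (\<phi> z * f n (translate z \<nu>))) \<partial>\<nu>)"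
          unfolding g_def sum_distrib_left by (rule Bochner_Integration.integral_cong) (simp_all add: ac_simps)
        also have "\<dots> = (\<Sum>n\<in>{k..<m k}. w k n * (\<integral>z. \<phi> z * f n (translate z \<nu>) \<partial>\<nu>))"
          by (subst Bochner_Integration.integral_sum) (auto intro!: integrable_mult_right int fnm fB)
        also have "\<bar>\<dots>\<bar> \<le> (\<Sum>n\<in>{k..<m k}. w k n * (exp (- real k) * D))"
        proof (rule order_trans[OF sum_abs sum_mono])
          fix n assume n: "n \<in> {k..<m k}"
          have "\<bar>\<integral>z. \<phi> z * f n (translate z \<nu>) \<partial>\<nu>\<bar> \<le> exp (- real n) * D"
            using imbalance_pairing[OF \<nu> \<phi>m _ _ Lip \<phi>1 r, of "real n"]
            by (simp add: fR[OF radon_translate[OF \<nu>]] D_def L_def)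
          also have "\<dots> \<le> exp (- real k) * D" using n D0 by (intro mult_right_mono) auto
          finally show "\<bar>w k n * (\<integral>z. \<phi> z * f n (translate z \<nu>) \<partial>\<nu>)\<bar> \<le> w k n * (exp (- real k) * D)"
            by (simp add: abs_mult w mult_left_mono)
        qed
        also have "\<dots> = exp (- real k) * D" by (simp add: sum_distrib_right[symmetric] w)
        finally show ?thesis .
      qed
      have "(\<lambda>k. exp (- 1 :: real) ^ k) \<longlonglongrightarrow> 0" by (rule LIMSEQ_power_zero) simp
      also have "(\<lambda>k. exp (- 1 :: real) ^ k) = (\<lambda>k. exp (- real k))"
        by (simp flip: exp_of_nat_mult)
      finally have "(\<lambda>k. exp (- real k) * D) \<longlonglongrightarrow> 0 * D"
        by (rule tendsto_mult[OF _ tendsto_const])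
      then have e0: "(\<lambda>k. exp (- real k) * D) \<longlonglongrightarrow> 0" by simp
      have z0: "(\<lambda>k. \<integral>z. \<phi> z * g k (translate z \<nu>) \<partial>\<nu>) \<longlonglongrightarrow> 0"
        by (rule Lim_null_comparison[OF _ e0]) (simp add: bound)
      have "(\<lambda>k. \<integral>z. \<phi> z * g k (translate z \<nu>) \<partial>\<nu>) \<longlonglongrightarrow> (\<integral>z. \<phi> z * G z \<partial>\<nu>)"
      proof (rule integral_dominated_convergence[where w = "\<lambda>z. \<phi> z * C"])
        show "integrable \<nu> (\<lambda>z. \<phi> z * C)" using radon_integrable[OF \<nu> \<phi>cc] by simp
        show "(\<lambda>z. \<phi> z * G z) \<in> borel_measurable \<nu>" by (rule borel_to_radon_measurable[OF \<nu>]) measurable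
        show "(\<lambda>z. \<phi> z * g k (translate z \<nu>)) \<in> borel_measurable \<nu>" for k
          by (rule borel_to_radon_measurable[OF \<nu>]) measurable
        show "AE z in \<nu>. (\<lambda>k. \<phi> z * g k (translate z \<nu>)) \<longlonglongrightarrow> \<phi> z * G z"
          using Glim by eventually_elim (intro tendsto_mult tendsto_const)
        show "AE z in \<nu>. norm (\<phi> z * g k (translate z \<nu>)) \<le> \<phi> z * C" for k
          by (intro AE_I2) (simp add: abs_mult \<phi>_def mult_left_mono gB)
      qed
      with z0 show "(\<integral>x. test k0 x * G x \<partial>\<nu>) = 0" unfolding \<phi>_def using LIMSEQ_unique by blast
    qed
    with Glim show "AE z in \<nu>. (\<lambda>k. g k (translate z \<nu>)) \<longlonglongrightarrow> 0" by eventually_elim simp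
  qed
  have s0: "{\<mu> \<in> radon_measures. (\<lambda>k. g k \<mu>) \<longlonglongrightarrow> 0} \<in> sets radon_borel"
  proof -
    have "{\<mu> \<in> space radon_borel. \<forall>j::nat. \<exists>N. \<forall>k. k \<ge> N \<longrightarrow> \<bar>g k \<mu>\<bar> < 1 / real (Suc j)} \<in> sets radon_borel" by measurable
    also have "{\<mu> \<in> space radon_borel. \<forall>j::nat. \<exists>N. \<forall>k. k \<ge> N \<longrightarrow> \<bar>g k \<mu>\<bar> < 1 / real (Suc j)} = {\<mu> \<in> radon_measures. (\<lambda>k. g k \<mu>) \<longlonglongrightarrow> 0}"
      unfolding space_radon_borel lim_sequentially dist_real_def
    proof (intro Collect_cong conj_cong refl iffI allI impI)
      fix \<mu> and e :: real assume *: "\<forall>j::nat. \<exists>N. \<forall>k. k \<ge> N \<longrightarrow> \<bar>g k \<mu>\<bar> < 1 / real (Suc j)" and e: "0 < e"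
      obtain j :: nat where j: "1 / real (Suc j) < e" using nat_approx_posE[OF e] by auto
      obtain N where "\<forall>k. k \<ge> N \<longrightarrow> \<bar>g k \<mu>\<bar> < 1 / real (Suc j)" using * by blast
      then show "\<exists>N. \<forall>n\<ge>N. \<bar>g n \<mu> - 0\<bar> < e" using j by (intro exI[of _ N]) force
    qed auto
    finally show ?thesis .
  qed
  have h0: "homogeneous (\<lambda>\<mu>. (\<lambda>k. g k \<mu>) \<longlonglongrightarrow> 0)"
    unfolding homogeneous_def using homogeneousD[OF ghom] by simp
  \<comment> \<open>Second use of the quasi-Palm property, in the opposite direction: from typical
    points back to the origin.\<close>
  have "AE \<mu> in P. (\<lambda>k. g k \<mu>) \<longlonglongrightarrow> 0"
    by (rule iffD2[OF quasi_palm_homogeneous[OF s0 h0] AE0])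
  then have "(\<lambda>k. expectation (g k)) \<longlonglongrightarrow> expectation (\<lambda>_. 0)"
    by (intro integral_dominated_convergence[where w = "\<lambda>_. C"]) (use gB measurable_P[OF gm] in auto)
  then have "expectation imbalance = 0" unfolding Eg by (simp add: LIMSEQ_const_iff)
  moreover have "integrable P (\<lambda>\<mu>. outflow F Q R \<mu> 0)"
    by (rule integrable_const_bound[where B = 1])
      (use outflow_bounds measurable_P[OF outflow_0_measurable] in \<open>auto intro!: AE_I2 simp: space_P\<close>)
  moreover have "integrable P (\<lambda>\<mu>. inflow F Q R \<mu> 0)"
    by (rule integrable_const_bound[where B = inflow_bound])
      (use inflow_bounds measurable_P[OF inflow_0_measurable] in \<open>auto intro!: AE_I2 simp: space_P\<close>)
  ultimately show ?thesis unfolding imbalance_def by simp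
qed

end

section \<open>Limits of fractal distributions\<close>

lemma mass_at_pos:
  fixes \<mu> :: "(real ^ 'n) measure"
  assumes "\<mu> \<in> radon_at_origin" "R > 0" shows "0 < mass_at R \<mu> 0"
proof -
  note r = radon_at_origin_radon[OF assms(1)]
  have "0 < emeasure \<mu> (ball 0 (R / 4))" by (rule radon_at_origin_ball[OF assms(1)]) (use assms in simp)
  moreover have "emeasure \<mu> (ball 0 (R / 4)) = ennreal (measure \<mu> (ball 0 (R / 4)))"
    using radon_emeasure_bounded[OF r bounded_ball] by (intro emeasure_eq_ennreal_measure) (simp add: less_top)
  ultimately have "0 < measure \<mu> (ball 0 (R / 4))" by simp
  moreover have "measure \<mu> (ball 0 (R / 4)) / 2 \<le> mass_at R \<mu> 0"
    by (rule mass_at_ge_ball[OF r assms(2)]) (use assms(2) in simp)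
  ultimately show ?thesis by linarith
qed

lemma mass_at_0_measurable [measurable]:
  "R > 0 \<Longrightarrow> (\<lambda>\<mu>. mass_at R \<mu> (z :: real ^ 'n)) \<in> borel_measurable radon_borel"
  unfolding mass_at_def by (rule measurable_integral_cc[OF cc_nbump_shift])

text \<open>Mass transport with the exponential itself as F and with Q = R, so that the outflow at
  the origin is F. The inflow is at most twice a covering number divided by K. The bound says,
  uniformly in P, that the mass at scale r is rarely small compared with the mass at scale
  R.\<close>

lemma tail_bound:
  assumes r: "0 < r" and R: "0 < R"
  obtains C where "0 \<le> C" "\<And>P K. P \<in> (extended_fractal_distributions :: (real ^ 'n) measure measure set) \<Longrightarrow> 0 < K \<Longrightarrow>
    (\<integral>\<mu>. exp (- (K * mass_at r \<mu> 0 / mass_at R \<mu> 0)) \<partial>P) \<le> C / K"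
proof -
  obtain A where A: "finite A" "cball (0 :: real ^ 'n) R \<subseteq> (\<Union>a\<in>A. ball a (r / 4))"
    using finite_cover_cball[of "r / 4" R] r by auto
  show ?thesis
  proof (rule that[of "real (card A) * 2"])
    fix P :: "(real ^ 'n) measure measure" and K :: real
    assume P: "P \<in> extended_fractal_distributions" and K: "0 < K"
    define F where "F \<mu> = exp (- (K * mass_at r \<mu> 0 / mass_at R \<mu> (0 :: real ^ 'n)))" for \<mu>
    interpret transport_kernel F R R
    proof
      show "F \<in> borel_measurable radon_borel" unfolding F_def using r R by measurable
      show "F \<mu> \<le> 1" for \<mu> unfolding F_def using K by (simp add: mass_at_nonneg)
      show "homogeneous F" unfolding homogeneous_def F_def by (simp add: mass_at_scale)
    qed (use R in \<open>auto simp: F_def\<close>)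
    interpret fractal_dist P by standard (rule P)
    have "expectation F = expectation (\<lambda>\<mu>. outflow F R R \<mu> 0)"
    proof (rule integral_cong_AE)
      show "AE \<mu> in P. F \<mu> = outflow F R R \<mu> 0"
        using AE_at_origin
      proof eventually_elim
        case (elim \<mu>)
        show ?case unfolding outflow_eq using mass_at_pos[OF elim R]
          by (simp add: translate_0[OF radon_at_origin_radon[OF elim]])
      qed
    qed (rule measurable_P[OF F_meas], rule measurable_P[OF outflow_0_measurable])
    also have "\<dots> = expectation (\<lambda>\<mu>. inflow F R R \<mu> 0)" by (rule mass_transport[OF P])
    also have "\<dots> \<le> real (card A) * (2 / K)"
    proof (rule integral_le_const)
      show "integrable P (\<lambda>\<mu>. inflow F R R \<mu> 0)"
        by (rule integrable_const_bound[where B = inflow_bound])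
          (use inflow_bounds measurable_P[OF inflow_0_measurable] in \<open>auto intro!: AE_I2 simp: space_P\<close>)
      show "AE \<mu> in P. inflow F R R \<mu> 0 \<le> real (card A) * (2 / K)"
      proof (rule AE_I2)
        fix \<mu> assume "\<mu> \<in> space P"
        then have \<mu>: "\<mu> \<in> radon_measures" by (simp add: space_P)
        have "(\<integral>\<^sup>+y. ennreal (transport F R R \<mu> y 0) \<partial>\<mu>) \<le> ennreal (real (card A) * (2 / K))"
        proof (rule nn_integral_cover_bound[OF \<mu> transport_measurable1(1)[OF \<mu>] A])
          fix a y assume y: "y \<in> ball a (r / 4)" and m: "measure \<mu> (ball a (r / 4)) > 0"
          let ?b = "measure \<mu> (ball a (r / 4))" and ?m = "mass_at r \<mu> y" and ?M = "mass_at R \<mu> y"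
          have ge: "?b / 2 \<le> ?m" by (rule mass_at_ge_ball[OF \<mu> r y])
          have m0: "0 < ?m" using ge m by linarith
          have Fy: "F (translate y \<mu>) = exp (- (K * ?m / ?M))"
            unfolding F_def mass_at_translate[OF \<mu>] by simp
          show "transport F R R \<mu> y 0 \<le> 2 / K / ?b"
          proof (cases "?M = 0")
            case True
            then show ?thesis using K m by (simp add: transport_def)
          next
            case False
            then have M: "0 < ?M" using mass_at_nonneg[of R \<mu> y] by linarith
            let ?x = "K * ?m / ?M"
            have x: "0 < ?x" using K m0 M by simp
            \<comment> \<open>The inequality exp (- x) <= 1 / x trades the mass at scale R in the
              denominator for K times the mass at scale r, which the cover by balls of radius r / 4
              controls.\<close>
            have "?x \<le> exp ?x" using exp_ge_add_one_self[of ?x] by linarith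
            then have "1 / exp ?x \<le> 1 / ?x" by (intro divide_left_mono mult_pos_pos x) simp_all
            then have "exp (- ?x) \<le> 1 / ?x" unfolding exp_minus by (simp only: inverse_eq_divide)
            then have "exp (- ?x) * 1 / ?M \<le> 1 / ?x * 1 / ?M" using M by (intro divide_right_mono mult_right_mono) auto
            also have "\<dots> = 1 / (K * ?m)" using M by simp
            also have "\<dots> \<le> 1 / (K * (?b / 2))" using K ge m by (intro divide_left_mono mult_left_mono) auto
            finally have 1: "exp (- ?x) / ?M \<le> 2 / K / ?b" by simp
            have "transport F R R \<mu> y 0 \<le> exp (- ?x) * 1 / ?M"
              unfolding transport_def Fy using M R
              by (intro divide_right_mono mult_left_mono nbump_le_1) auto
            then show ?thesis using 1 by simp
          qed
        next
          show "transport F R R \<mu> y 0 = 0" if "y \<notin> cball 0 R" for y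
            by (rule transport_outside) (use that in simp)
        qed (use K in \<open>simp_all add: transport_nonneg\<close>)
        moreover have "ennreal (inflow F R R \<mu> 0) = (\<integral>\<^sup>+y. ennreal (transport F R R \<mu> y 0) \<partial>\<mu>)"
          unfolding inflow_def
          by (rule nn_integral_eq_integral[OF transport_integrable_in[OF \<mu>], symmetric]) (simp add: transport_nonneg)
        ultimately have "ennreal (inflow F R R \<mu> 0) \<le> ennreal (real (card A) * (2 / K))" by simp
        then show "inflow F R R \<mu> 0 \<le> real (card A) * (2 / K)"
          using K by (subst (asm) ennreal_le_iff) auto
      qed
    qed
    finally show "(\<integral>\<mu>. exp (- (K * mass_at r \<mu> 0 / mass_at R \<mu> 0)) \<partial>P) \<le> real (card A) * 2 / K"
      unfolding F_def by simp
  qed simp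
qed

section \<open>Normalization by a smoothed mass\<close>

text \<open>Dividing by \<open>mass_at\<close> instead of the mass of the cube gives a normalization
  that is vaguely continuous wherever the smoothed mass is positive.\<close>

definition nrm :: "real \<Rightarrow> (real ^ 'n) measure \<Rightarrow> (real ^ 'n) measure" where
  "nrm R \<mu> = scale_measure (ennreal (1 / mass_at R \<mu> 0)) \<mu>"

lemma nrm_radon: "\<mu> \<in> radon_measures \<Longrightarrow> nrm R \<mu> \<in> radon_measures"
  unfolding nrm_def by (rule radon_scale)

lemma nrm_measurable: "R > 0 \<Longrightarrow> nrm R \<in> measurable radon_borel (radon_borel :: (real ^ 'n) measure measure)"
  unfolding nrm_def[abs_def]
  by (rule measurable_scale_radon) (simp_all add: mass_at_nonneg)

lemma nrm_homogeneous: "homogeneous (nrm R)"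
  unfolding homogeneous_def
proof (intro ballI allI impI)
  fix \<mu> :: "(real ^ 'a) measure" and c :: real assume \<mu>: "\<mu> \<in> radon_measures" and c: "c > 0"
  have "ennreal (1 / (c * mass_at R \<mu> 0)) * ennreal c = ennreal (1 / mass_at R \<mu> 0)"
    using c mass_at_nonneg[of R \<mu> 0] by (subst ennreal_mult[symmetric]) auto
  then show "nrm R (scale_measure (ennreal c) \<mu>) = nrm R \<mu>"
    unfolding nrm_def mass_at_scale[OF \<mu> less_imp_le[OF c]] scale_scale_measure by simp
qed

lemma homogeneous_compose: "homogeneous f \<Longrightarrow> homogeneous (\<lambda>\<mu>. g (f \<mu>))"
  unfolding homogeneous_def by simp

lemma homogeneous_nrm:
  assumes "homogeneous H" "\<mu> \<in> radon_measures" "0 < mass_at R \<mu> 0" shows "H (nrm R \<mu>) = H \<mu>"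
  unfolding nrm_def by (rule homogeneousD[OF assms(1,2)]) (use assms(3) in simp)

lemma vconv_mass_at: "vconv X \<mu> \<Longrightarrow> R > 0 \<Longrightarrow> (\<lambda>i. mass_at R (X i) z) \<longlonglongrightarrow> mass_at R \<mu> z"
  unfolding mass_at_def vconv_def using cc_nbump_shift by blast

lemma vconv_nrm:
  assumes X: "\<And>i. X i \<in> radon_measures" and \<mu>: "\<mu> \<in> radon_measures" and v: "vconv X \<mu>"
    and R: "R > 0" and pos: "0 < mass_at R \<mu> 0"
  shows "vconv (\<lambda>i. nrm R (X i)) (nrm R \<mu>)"
  unfolding vconv_def
proof (intro allI impI)
  fix f :: "real ^ 'a \<Rightarrow> real" assume f: "cc f"
  have eq: "(\<integral>x. f x \<partial>nrm R \<nu>) = 1 / mass_at R \<nu> 0 * (\<integral>x. f x \<partial>\<nu>)" if "\<nu> \<in> radon_measures" for \<nu>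
    unfolding nrm_def
    by (rule integral_scale_measure[OF _ borel_to_radon_measurable[OF that cc_borel[OF f]]]) (simp add: mass_at_nonneg)
  have "(\<lambda>i. 1 / mass_at R (X i) 0 * (\<integral>x. f x \<partial>X i)) \<longlonglongrightarrow> 1 / mass_at R \<mu> 0 * (\<integral>x. f x \<partial>\<mu>)"
    using v f pos unfolding vconv_def
    by (intro tendsto_intros vconv_mass_at[OF v R]) auto
  then show "(\<lambda>i. \<integral>x. f x \<partial>nrm R (X i)) \<longlonglongrightarrow> (\<integral>x. f x \<partial>nrm R \<mu>)" by (simp add: eq X \<mu>)
qed

lemma vconv_magnify:
  assumes X: "\<And>i. X i \<in> radon_measures" and \<mu>: "\<mu> \<in> radon_measures" and v: "vconv X \<mu>"
  shows "vconv (\<lambda>i. magnify t (X i)) (magnify t \<mu>)"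
  unfolding vconv_def
proof (intro allI impI)
  fix f :: "real ^ 'a \<Rightarrow> real" assume f: "cc f"
  have "cc (\<lambda>x. f (exp t *\<^sub>R x))" by (rule cc_scaleR[OF f]) simp
  then have "(\<lambda>i. \<integral>x. f (exp t *\<^sub>R x) \<partial>X i) \<longlonglongrightarrow> (\<integral>x. f (exp t *\<^sub>R x) \<partial>\<mu>)"
    using v by (simp add: vconv_def)
  then show "(\<lambda>i. \<integral>x. f x \<partial>magnify t (X i)) \<longlonglongrightarrow> (\<integral>x. f x \<partial>magnify t \<mu>)"
    by (simp add: integral_magnify[OF _ cc_borel[OF f]] X \<mu>)
qed

text \<open>Homogeneous for every G, and vaguely continuous at positive smoothed mass if G is
  continuous. An indicator G turns a Borel set of the cube into a homogeneous event.\<close>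

definition gauge :: "real \<Rightarrow> ((nat \<Rightarrow> real) \<Rightarrow> real) \<Rightarrow> (real ^ 'n) measure \<Rightarrow> real" where
  "gauge R G \<mu> = G (Phi (nrm R \<mu>))"

lemma gauge_measurable: "R > 0 \<Longrightarrow> G \<in> borel_measurable borel \<Longrightarrow> gauge R G \<in> borel_measurable radon_borel"
  unfolding gauge_def
  by (rule measurable_compose[OF measurable_compose[OF nrm_measurable measurable_Phi]])

lemma gauge_homogeneous: "homogeneous (gauge R G)"
  unfolding gauge_def by (rule homogeneous_compose[OF nrm_homogeneous])

lemma gauge_tendsto:
  assumes "\<And>i. X i \<in> radon_measures" "\<mu> \<in> radon_measures" "vconv X \<mu>" "R > 0" "0 < mass_at R \<mu> 0"
    and G: "continuous_on UNIV G"
  shows "(\<lambda>i. gauge R G (X i)) \<longlonglongrightarrow> gauge R G \<mu>"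
  unfolding gauge_def
  by (rule continuous_on_tendsto_compose[OF G vconv_Phi[OF vconv_nrm[OF assms(1-5)]]]) auto

text \<open>Plateau integrals determine the law of the coordinates \<open>Phi (nrm R _)\<close>, and
  \<open>radon_of\<close> recovers the normalized measure from its coordinates.\<close>

lemma nrm_law_eqI:
  fixes Y :: "'a \<Rightarrow> (real ^ 'n) measure" and Y' :: "'b \<Rightarrow> (real ^ 'n) measure"
  assumes M: "prob_space M" "Y \<in> measurable M radon_borel" and M': "prob_space M'" "Y' \<in> measurable M' radon_borel"
    and R: "R > 0"
    and eq: "\<And>A n. open A \<Longrightarrow> (\<integral>\<omega>. gauge R (plateau A n) (Y \<omega>) \<partial>M) = (\<integral>\<omega>. gauge R (plateau A n) (Y' \<omega>) \<partial>M')"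
  shows "distr M radon_borel (\<lambda>\<omega>. nrm R (Y \<omega>)) = distr M' radon_borel (\<lambda>\<omega>. nrm R (Y' \<omega>))"
proof -
  obtain A :: "nat \<Rightarrow> (nat \<Rightarrow> real) set" where A: "Int_stable (range A)" "\<And>n. open (A n)"
    "sets borel = sigma_sets UNIV (range A)" "UNIV \<in> range A"
    using countable_Int_stable_basis_enum by metis
  have m: "(\<lambda>\<omega>. nrm R (Y \<omega>)) \<in> measurable M radon_borel" "(\<lambda>\<omega>. nrm R (Y' \<omega>)) \<in> measurable M' radon_borel"
    by (rule measurable_compose[OF M(2) nrm_measurable[OF R]], rule measurable_compose[OF M'(2) nrm_measurable[OF R]])
  have mP: "(\<lambda>\<omega>. Phi (nrm R (Y \<omega>))) \<in> borel_measurable M" "(\<lambda>\<omega>. Phi (nrm R (Y' \<omega>))) \<in> borel_measurable M'"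
    by (rule measurable_compose[OF m(1) measurable_Phi], rule measurable_compose[OF m(2) measurable_Phi])
  have law: "distr M borel (\<lambda>\<omega>. Phi (nrm R (Y \<omega>))) = distr M' borel (\<lambda>\<omega>. Phi (nrm R (Y' \<omega>)))"
  proof (rule prob_eq_of_plateau[OF prob_space.prob_space_distr[OF M(1) mP(1)] _ prob_space.prob_space_distr[OF M'(1) mP(2)] _ A])
    show "(\<integral>x. plateau (A k) n x \<partial>distr M borel (\<lambda>\<omega>. Phi (nrm R (Y \<omega>)))) = (\<integral>x. plateau (A k) n x \<partial>distr M' borel (\<lambda>\<omega>. Phi (nrm R (Y' \<omega>))))" for k n
      unfolding integral_distr[OF mP(1) borel_measurable_plateau] integral_distr[OF mP(2) borel_measurable_plateau]
      using eq[OF A(2)] by (simp add: gauge_def)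
  qed simp_all
  have inv: "distr N radon_borel (\<lambda>\<omega>. nrm R (W \<omega>)) = distr (distr N borel (\<lambda>\<omega>. Phi (nrm R (W \<omega>)))) radon_borel radon_of"
    if W: "W \<in> measurable N radon_borel" for N :: "'c measure" and W :: "'c \<Rightarrow> (real ^ 'n) measure"
  proof -
    have "(\<lambda>\<omega>. Phi (nrm R (W \<omega>))) \<in> borel_measurable N"
      by (rule measurable_compose[OF measurable_compose[OF W nrm_measurable[OF R]] measurable_Phi])
    then have "distr (distr N borel (\<lambda>\<omega>. Phi (nrm R (W \<omega>)))) radon_borel radon_of = distr N radon_borel (radon_of \<circ> (\<lambda>\<omega>. Phi (nrm R (W \<omega>))))"
      by (rule distr_distr[OF measurable_radon_of])
    also have "\<dots> = distr N radon_borel (\<lambda>\<omega>. nrm R (W \<omega>))"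
      by (rule distr_cong) (simp_all add: radon_of_Phi nrm_radon random_radon[OF W])
    finally show ?thesis ..
  qed
  show ?thesis unfolding inv[OF M(2)] inv[OF M'(2)] law ..
qed

locale limit_setup = prob_space \<Omega> for \<Omega> :: "real measure" +
  fixes Pn :: "nat \<Rightarrow> (real ^ 'n) measure measure" and X :: "nat \<Rightarrow> real \<Rightarrow> (real ^ 'n) measure"
    and Y :: "real \<Rightarrow> (real ^ 'n) measure"
  assumes Pn: "\<And>i. Pn i \<in> extended_fractal_distributions"
    and X [measurable]: "\<And>i. X i \<in> measurable \<Omega> radon_borel" and Y [measurable]: "Y \<in> measurable \<Omega> radon_borel"
    and law: "\<And>i. distr \<Omega> radon_borel (X i) = Pn i"
    and conv: "AE \<omega> in \<Omega>. vconv (\<lambda>i. X i \<omega>) (Y \<omega>)"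
begin

lemma X_radon: "\<omega> \<in> space \<Omega> \<Longrightarrow> X i \<omega> \<in> radon_measures"
  by (rule random_radon[OF X])

lemma Y_radon: "\<omega> \<in> space \<Omega> \<Longrightarrow> Y \<omega> \<in> radon_measures"
  by (rule random_radon[OF Y])

lemma AE_X:
  assumes "\<And>i. AE \<mu> in Pn i. Q \<mu>" "{\<mu> \<in> radon_measures. Q \<mu>} \<in> sets radon_borel"
  shows "AE \<omega> in \<Omega>. \<forall>i. Q (X i \<omega>)"
proof -
  have "AE \<omega> in \<Omega>. Q (X i \<omega>)" for i
    using assms unfolding law[symmetric] by (subst (asm) AE_distr_iff) (simp_all add: space_radon_borel)
  then show ?thesis by (simp add: AE_all_countable)
qed

lemma expectation_X:
  fixes f :: "(real ^ 'n) measure \<Rightarrow> real"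
  assumes "f \<in> borel_measurable radon_borel"
  shows "expectation (\<lambda>\<omega>. f (X i \<omega>)) = (\<integral>\<mu>. f \<mu> \<partial>Pn i)"
  unfolding law[symmetric] by (rule integral_distr[OF X assms, symmetric])

lemma AE_X_origin: "AE \<omega> in \<Omega>. \<forall>i. X i \<omega> \<in> radon_at_origin"
proof (rule AE_X)
  have "{\<mu> :: (real ^ 'n) measure. \<mu> \<in> radon_measures \<and> \<mu> \<in> radon_at_origin} = radon_at_origin"
    by (auto simp: radon_at_origin_radon)
  then show "{\<mu> :: (real ^ 'n) measure. \<mu> \<in> radon_measures \<and> \<mu> \<in> radon_at_origin} \<in> sets radon_borel" by simp
  show "AE \<mu> in Pn i. \<mu> \<in> radon_at_origin" for i
    by (rule fractal_dist.AE_at_origin) (standard, rule Pn)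
qed

lemma AE_X_box: "AE \<omega> in \<Omega>. \<forall>i. emeasure (X i \<omega>) unit_box = 1"
proof (rule AE_X)
  have "{\<mu> \<in> space radon_borel. emeasure \<mu> (unit_box :: (real ^ 'n) set) = 1} \<in> sets radon_borel"
    using emeasure_radon_measurable[of "\<lambda>\<mu>. \<mu>", OF _ unit_box_borel] by measurable
  then show "{\<mu> \<in> radon_measures. emeasure \<mu> (unit_box :: (real ^ 'n) set) = 1} \<in> sets radon_borel"
    by (simp add: space_radon_borel)
  show "AE \<mu> in Pn i. emeasure \<mu> (unit_box :: (real ^ 'n) set) = 1" for i
    by (rule fractal_dist.AE_unit_box) (standard, rule Pn)
qed

text \<open>The measures \<open>X i \<omega>\<close> give the cube mass 1, and a bump twice as wide
  as a ball around the cube is at least 1/2 on the cube. The lower bound 1/2 survives the vague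
  limit.\<close>

lemma AE_Y_mass_pos:
  obtains R where "0 < R" "AE \<omega> in \<Omega>. 0 < mass_at R (Y \<omega>) 0"
proof -
  obtain b where b: "\<forall>x\<in>(unit_box :: (real ^ 'n) set). norm x \<le> b" using bounded_unit_box unfolding bounded_iff by blast
  define R where "R = 2 * max b 1"
  have R: "0 < R" "\<And>x :: real ^ 'n. x \<in> unit_box \<Longrightarrow> norm x \<le> R / 2" using b by (auto simp: R_def le_max_iff_disj)
  have "AE \<omega> in \<Omega>. 0 < mass_at R (Y \<omega>) 0"
    using AE_X_box conv AE_space
  proof eventually_elim
    case (elim \<omega>)
    have "1 / 2 \<le> mass_at R (X i \<omega>) 0" for i
    proof -
      note \<mu> = X_radon[OF elim(3), of i]
      have bs: "(unit_box :: (real ^ 'n) set) \<in> sets (X i \<omega>)" by (simp add: radon_sets[OF \<mu>])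
      have "measure (X i \<omega>) unit_box = 1" using elim(1) by (simp add: measure_def)
      then have "1 / 2 = (\<integral>z. (1/2 :: real) * indicator unit_box z \<partial>X i \<omega>)"
        using radon_space[OF \<mu>] by (simp del: indicator_simps)
      also have "\<dots> \<le> (\<integral>z. nbump R (z - 0) \<partial>X i \<omega>)"
      proof (rule integral_mono)
        show "integrable (X i \<omega>) (\<lambda>z. 1/2 * indicator unit_box z :: real)"
          by (rule integrable_mult_right, rule integrable_real_indicator[OF bs]) (use elim(1) in simp)
        show "integrable (X i \<omega>) (\<lambda>z. nbump R (z - 0))" by (rule radon_integrable[OF \<mu> cc_nbump_shift[OF R(1)]])
        show "1/2 * indicator unit_box z \<le> nbump R (z - 0)" for z :: "real ^ 'n"
          using nbump_ge_half[OF R(1), of z] R(2)[of z] by (cases "z \<in> unit_box") auto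
      qed
      finally show ?thesis by (simp add: mass_at_def)
    qed
    then have "1 / 2 \<le> mass_at R (Y \<omega>) 0"
      by (intro LIMSEQ_le_const[OF vconv_mass_at[OF elim(2) R(1)]]) auto
    then show ?case by linarith
  qed
  then show ?thesis using that R(1) by blast
qed

text \<open>The tail bound passes to the limit. Where the mass at scale r vanishes the exponential
  is 1, so this event has probability at most C / K for every K; countably many radii r
  suffice.\<close>

lemma AE_Y_origin: "AE \<omega> in \<Omega>. Y \<omega> \<in> radon_at_origin"
proof -
  obtain R where R: "0 < R" and pos: "AE \<omega> in \<Omega>. 0 < mass_at R (Y \<omega>) 0" by (rule AE_Y_mass_pos)
  have "AE \<omega> in \<Omega>. 0 < mass_at r (Y \<omega>) 0" if r: "0 < r" for r
  proof -
    obtain C where C: "0 \<le> C" "\<And>P K. P \<in> (extended_fractal_distributions :: (real ^ 'n) measure measure set) \<Longrightarrow> 0 < K \<Longrightarrow>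
      (\<integral>\<mu>. exp (- (K * mass_at r \<mu> 0 / mass_at R \<mu> 0)) \<partial>P) \<le> C / K"
      using tail_bound[OF r R] by blast
    define F where "F K \<mu> = exp (- (K * mass_at r \<mu> 0 / mass_at R \<mu> (0 :: real ^ 'n)))" for K \<mu>
    have Fm: "F K \<in> borel_measurable radon_borel" for K unfolding F_def using r R by measurable
    have FX [measurable]: "(\<lambda>\<omega>. F K (X i \<omega>)) \<in> borel_measurable \<Omega>" for K i by (rule measurable_compose[OF X Fm])
    have FY [measurable]: "(\<lambda>\<omega>. F K (Y \<omega>)) \<in> borel_measurable \<Omega>" for K by (rule measurable_compose[OF Y Fm])
    have F1: "0 \<le> F K \<mu>" "0 < K \<Longrightarrow> F K \<mu> \<le> 1" for K \<mu> unfolding F_def by (simp_all add: mass_at_nonneg)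
    have FK: "expectation (\<lambda>\<omega>. F K (Y \<omega>)) \<le> C / K" if K: "0 < K" for K
    proof (rule LIMSEQ_le_const2)
      show "(\<lambda>i. expectation (\<lambda>\<omega>. F K (X i \<omega>))) \<longlonglongrightarrow> expectation (\<lambda>\<omega>. F K (Y \<omega>))"
      proof (rule integral_dominated_convergence[where w = "\<lambda>_. 1"])
        show "AE \<omega> in \<Omega>. (\<lambda>i. F K (X i \<omega>)) \<longlonglongrightarrow> F K (Y \<omega>)"
          using conv pos
        proof eventually_elim
          case (elim \<omega>)
          show ?case unfolding F_def
            by (intro tendsto_intros vconv_mass_at[OF elim(1)] r R) (use elim(2) in simp)
        qed
      qed (use F1 K in auto)
      show "\<exists>N. \<forall>i\<ge>N. expectation (\<lambda>\<omega>. F K (X i \<omega>)) \<le> C / K"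
        unfolding expectation_X[OF Fm] using C(2)[OF Pn K] unfolding F_def[abs_def] by blast
    qed
    have mY [measurable]: "(\<lambda>\<omega>. mass_at r (Y \<omega>) 0) \<in> borel_measurable \<Omega>"
      by (rule measurable_compose[OF Y mass_at_0_measurable[OF r]])
    define bad where "bad = {\<omega> \<in> space \<Omega>. mass_at r (Y \<omega>) 0 = 0}"
    have [measurable]: "bad \<in> events" unfolding bad_def by measurable
    have "prob bad \<le> C / real (Suc n)" for n
    proof -
      have "prob bad = expectation (indicator bad)" by simp
      also have "\<dots> \<le> expectation (\<lambda>\<omega>. F (real (Suc n)) (Y \<omega>))"
      proof (rule integral_mono)
        show "integrable \<Omega> (indicator bad :: _ \<Rightarrow> real)"
          by (rule integrable_real_indicator) (simp_all add: emeasure_finite less_top[symmetric])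
        show "integrable \<Omega> (\<lambda>\<omega>. F (real (Suc n)) (Y \<omega>))"
          by (rule integrable_const_bound[where B = 1]) (use F1 in auto)
        show "indicator bad \<omega> \<le> F (real (Suc n)) (Y \<omega>)" for \<omega>
          by (auto simp: indicator_def bad_def F_def)
      qed
      also have "\<dots> \<le> C / real (Suc n)" by (rule FK) simp
      finally show ?thesis .
    qed
    moreover have "(\<lambda>n. C / real (Suc n)) \<longlonglongrightarrow> 0"
      by (rule LIMSEQ_Suc[OF lim_const_over_n])
    ultimately have "prob bad \<le> 0" by (intro LIMSEQ_le_const) auto
    then have "prob bad = 0" using measure_nonneg[of \<Omega> bad] by linarith
    then have "AE \<omega> in \<Omega>. \<omega> \<notin> bad" by (simp add: prob_eq_0)
    with AE_space show ?thesis
    proof eventually_elim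
      case (elim \<omega>)
      then show ?case using mass_at_nonneg[of r "Y \<omega>" 0] by (auto simp: bad_def)
    qed
  qed
  then have "AE \<omega> in \<Omega>. 0 < mass_at (1 / real (Suc n)) (Y \<omega>) 0" for n by simp
  then have "AE \<omega> in \<Omega>. \<forall>n. 0 < mass_at (1 / real (Suc n)) (Y \<omega>) 0" by (simp add: AE_all_countable)
  with AE_space show ?thesis
  proof eventually_elim
    case (elim \<omega>)
    note \<mu> = Y_radon[OF elim(1)]
    have "emeasure (Y \<omega>) (ball 0 (1 / real (Suc n))) > 0" for n
    proof (rule ccontr)
      assume "\<not> ?thesis"
      then have "ball 0 (1 / real (Suc n)) \<in> null_sets (Y \<omega>)" by (simp add: null_sets_def radon_sets[OF \<mu>])
      from AE_not_in[OF this] have "AE y in Y \<omega>. nbump (1 / real (Suc n)) (y - 0) = 0"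
        by eventually_elim (intro nbump_outside, simp_all)
      then have "mass_at (1 / real (Suc n)) (Y \<omega>) 0 = 0"
        unfolding mass_at_def by (rule integral_eq_zero_AE)
      then show False using elim(2)[rule_format, of n] by simp
    qed
    then show ?case unfolding radon_at_origin_iff using \<mu> by blast
  qed
qed

lemma AE_good: "AE \<omega> in \<Omega>. \<omega> \<in> space \<Omega> \<and> Y \<omega> \<in> radon_at_origin \<and> vconv (\<lambda>i. X i \<omega>) (Y \<omega>)"
  using AE_space AE_Y_origin conv by eventually_elim simp

text \<open>Both expectations are limits of the ones for \<open>X i\<close>, which agree by scale
  invariance.\<close>

lemma gauge_limit_magnify:
  assumes R: "0 < R" and t: "0 < t" and G: "continuous_on UNIV G" and B: "\<And>y. \<bar>G y\<bar> \<le> 1"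
  shows "expectation (\<lambda>\<omega>. gauge R G (magnify t (Y \<omega>))) = expectation (\<lambda>\<omega>. gauge R G (Y \<omega>))"
proof -
  have Gm: "G \<in> borel_measurable borel" by (rule borel_measurable_continuous_onI[OF G])
  note gm = gauge_measurable[OF R Gm]
  have gB: "\<bar>gauge R G \<mu>\<bar> \<le> 1" for \<mu> :: "(real ^ 'n) measure" by (simp add: gauge_def B)
  have mm: "(\<lambda>\<mu>. gauge R G (magnify t \<mu>)) \<in> borel_measurable (radon_borel :: (real ^ 'n) measure measure)"
    by (rule measurable_compose[OF measurable_magnify gm]) simp
  have "(\<lambda>i. expectation (\<lambda>\<omega>. gauge R G (X i \<omega>))) \<longlonglongrightarrow> expectation (\<lambda>\<omega>. gauge R G (Y \<omega>))"
  proof (rule integral_dominated_convergence[where w = "\<lambda>_. 1"])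
    show "AE \<omega> in \<Omega>. (\<lambda>i. gauge R G (X i \<omega>)) \<longlonglongrightarrow> gauge R G (Y \<omega>)"
      using AE_good
    proof eventually_elim
      case (elim \<omega>)
      then show ?case by (intro gauge_tendsto X_radon Y_radon R mass_at_pos G) auto
    qed
  qed (use gB measurable_compose[OF X gm] measurable_compose[OF Y gm] in auto)
  moreover have "(\<lambda>i. expectation (\<lambda>\<omega>. gauge R G (magnify t (X i \<omega>)))) \<longlonglongrightarrow> expectation (\<lambda>\<omega>. gauge R G (magnify t (Y \<omega>)))"
  proof (rule integral_dominated_convergence[where w = "\<lambda>_. 1"])
    show "AE \<omega> in \<Omega>. (\<lambda>i. gauge R G (magnify t (X i \<omega>))) \<longlonglongrightarrow> gauge R G (magnify t (Y \<omega>))"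
      using AE_good
    proof eventually_elim
      case (elim \<omega>)
      then show ?case
        by (intro gauge_tendsto radon_magnify X_radon Y_radon R mass_at_pos radon_at_origin_magnify vconv_magnify G) auto
    qed
  qed (use gB measurable_compose[OF X mm] measurable_compose[OF Y mm] in auto)
  moreover have "expectation (\<lambda>\<omega>. gauge R G (magnify t (X i \<omega>))) = expectation (\<lambda>\<omega>. gauge R G (X i \<omega>))" for i
  proof -
    interpret Pi: fractal_dist "Pn i" by standard (rule Pn)
    show ?thesis unfolding expectation_X[OF gm] expectation_X[OF mm]
      by (rule Pi.expectation_magnify[OF gm gauge_homogeneous t])
  qed
  ultimately show ?thesis using LIMSEQ_unique by simp
qed

lemma nrm_law_magnify:
  assumes R: "0 < R" and t: "0 < t"
  shows "distr \<Omega> radon_borel (\<lambda>\<omega>. nrm R (magnify t (Y \<omega>))) = distr \<Omega> radon_borel (\<lambda>\<omega>. nrm R (Y \<omega>))"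
  by (rule nrm_law_eqI[OF prob_space_axioms measurable_magnify[OF Y] prob_space_axioms Y R])
    (rule gauge_limit_magnify[OF R t continuous_plateau], simp add: plateau_nonneg plateau_le_1)

text \<open>A homogeneous functional factors through \<open>nrm 1\<close> at measures with the
  origin in their support, so invariance of the normalized law is enough.\<close>

lemma expectation_magnify_Y:
  fixes H :: "(real ^ 'n) measure \<Rightarrow> real"
  assumes H: "H \<in> borel_measurable radon_borel" "homogeneous H" and t: "0 < t"
  shows "expectation (\<lambda>\<omega>. H (magnify t (Y \<omega>))) = expectation (\<lambda>\<omega>. H (Y \<omega>))"
proof -
  have *: "expectation (\<lambda>\<omega>. H (W \<omega>)) = (\<integral>\<mu>. H \<mu> \<partial>distr \<Omega> radon_borel (\<lambda>\<omega>. nrm 1 (W \<omega>)))"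
    if W: "W \<in> measurable \<Omega> radon_borel" and pos: "AE \<omega> in \<Omega>. W \<omega> \<in> radon_at_origin" for W
  proof -
    have n: "(\<lambda>\<omega>. nrm 1 (W \<omega>)) \<in> measurable \<Omega> radon_borel"
      by (rule measurable_compose[OF W nrm_measurable]) simp
    have "(\<integral>\<mu>. H \<mu> \<partial>distr \<Omega> radon_borel (\<lambda>\<omega>. nrm 1 (W \<omega>))) = expectation (\<lambda>\<omega>. H (nrm 1 (W \<omega>)))"
      by (rule integral_distr[OF n H(1)])
    also have "\<dots> = expectation (\<lambda>\<omega>. H (W \<omega>))"
    proof (rule integral_cong_AE)
      show "AE \<omega> in \<Omega>. H (nrm 1 (W \<omega>)) = H (W \<omega>)"
        using pos by eventually_elim (intro homogeneous_nrm H(2) radon_at_origin_radon mass_at_pos, auto)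
    qed (rule measurable_compose[OF n H(1)], rule measurable_compose[OF W H(1)])
    finally show ?thesis ..
  qed
  have "AE \<omega> in \<Omega>. magnify t (Y \<omega>) \<in> radon_at_origin"
    using AE_Y_origin by eventually_elim (rule radon_at_origin_magnify)
  then show ?thesis using nrm_law_magnify[OF _ t, of 1] AE_Y_origin
    by (simp add: *[OF measurable_magnify[OF Y]] *[OF Y])
qed

end

section \<open>Vague limits of integrals with varying integrands\<close>

text \<open>If uniform convergence failed, the offending points would lie in a fixed ball and
  accumulate somewhere, contradicting convergence along that subsequence. Hence \<open>cconv\<close>
  has to allow subsequences.\<close>

lemma continuous_convergence_uniform:
  fixes \<psi> :: "nat \<Rightarrow> 'a::euclidean_space \<Rightarrow> real"
  assumes supp: "\<And>i x. Q < norm x \<Longrightarrow> \<psi> i x = 0" "\<And>x. Q < norm x \<Longrightarrow> \<psi>0 x = 0"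
    and cconv: "\<And>r s y. strict_mono (r :: nat \<Rightarrow> nat) \<Longrightarrow> s \<longlonglongrightarrow> y \<Longrightarrow> (\<lambda>i. \<psi> (r i) (s i)) \<longlonglongrightarrow> \<psi>0 y"
    and c0: "continuous_on UNIV \<psi>0" and e: "\<epsilon> > 0"
  shows "\<exists>N. \<forall>i\<ge>N. \<forall>x. \<bar>\<psi> i x - \<psi>0 x\<bar> \<le> \<epsilon>"
proof (rule ccontr)
  assume "\<not> ?thesis"
  then have "\<forall>N. \<exists>i\<ge>N. \<exists>x. \<epsilon> < \<bar>\<psi> i x - \<psi>0 x\<bar>" by (auto simp: not_le)
  then have inf: "infinite {i. \<exists>x. \<epsilon> < \<bar>\<psi> i x - \<psi>0 x\<bar>}"
    unfolding infinite_nat_iff_unbounded_le by blast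
  define r where "r = enumerate {i. \<exists>x. \<epsilon> < \<bar>\<psi> i x - \<psi>0 x\<bar>}"
  have r: "strict_mono r" unfolding r_def by (rule strict_mono_enumerate[OF inf])
  have "\<forall>j. \<exists>x. \<epsilon> < \<bar>\<psi> (r j) x - \<psi>0 x\<bar>"
    using enumerate_in_set[OF inf] unfolding r_def by blast
  then obtain x where x: "\<And>j. \<epsilon> < \<bar>\<psi> (r j) (x j) - \<psi>0 (x j)\<bar>" by metis
  have xQ: "x j \<in> cball 0 Q" for j
    using x[of j] supp(1)[of "x j" "r j"] supp(2)[of "x j"] e by (cases "Q < norm (x j)") auto
  then have "\<forall>j. x j \<in> cball 0 Q" by blast
  from seq_compactE[OF compact_imp_seq_compact[OF compact_cball] this]
  obtain y and s :: "nat \<Rightarrow> nat" where s: "strict_mono s" and y: "(x \<circ> s) \<longlonglongrightarrow> y"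
    by blast
  have "(\<lambda>i. \<psi> ((r \<circ> s) i) ((x \<circ> s) i)) \<longlonglongrightarrow> \<psi>0 y"
    by (rule cconv[OF strict_mono_o[OF r s] y])
  moreover have "(\<lambda>i. \<psi>0 ((x \<circ> s) i)) \<longlonglongrightarrow> \<psi>0 y"
    by (rule continuous_on_tendsto_compose[OF c0 y]) auto
  ultimately have "(\<lambda>i. \<bar>\<psi> ((r \<circ> s) i) ((x \<circ> s) i) - \<psi>0 ((x \<circ> s) i)\<bar>) \<longlonglongrightarrow> \<bar>\<psi>0 y - \<psi>0 y\<bar>"
    by (intro tendsto_intros)
  moreover have "\<epsilon> \<le> \<bar>\<psi> ((r \<circ> s) i) ((x \<circ> s) i) - \<psi>0 ((x \<circ> s) i)\<bar>" for i
    using x[of "s i"] by simp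
  ultimately have "\<epsilon> \<le> \<bar>\<psi>0 y - \<psi>0 y\<bar>"
    by (intro LIMSEQ_le_const) auto
  then show False using e by simp
qed

text \<open>The integrands converge uniformly on a common ball, and the masses of that ball stay
  bounded because a tent over it has convergent integrals.\<close>

lemma vconv_integral_moving:
  fixes X :: "nat \<Rightarrow> (real ^ 'n) measure" and \<psi> :: "nat \<Rightarrow> real ^ 'n \<Rightarrow> real"
  assumes X: "\<And>i. X i \<in> radon_measures" and v: "vconv X \<mu>" and Q: "0 < Q"
    and m: "\<And>i. \<psi> i \<in> borel_measurable borel"
    and supp: "\<And>i x. Q < norm x \<Longrightarrow> \<psi> i x = 0" "\<And>x. Q < norm x \<Longrightarrow> \<psi>0 x = 0"
    and cconv: "\<And>r s y. strict_mono (r :: nat \<Rightarrow> nat) \<Longrightarrow> s \<longlonglongrightarrow> y \<Longrightarrow> (\<lambda>i. \<psi> (r i) (s i)) \<longlonglongrightarrow> \<psi>0 y"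
    and c0: "continuous_on UNIV \<psi>0"
  shows "(\<lambda>i. \<integral>x. \<psi> i x \<partial>X i) \<longlonglongrightarrow> (\<integral>x. \<psi>0 x \<partial>\<mu>)"
proof -
  have cc0: "cc \<psi>0" by (rule ccI[OF c0 supp(2)])
  obtain B where B: "B > 0" "\<And>x. \<bar>\<psi>0 x\<bar> \<le> B" using cc_bounded[OF cc0] by blast
  have ccb: "cc (nbump (2 * Q) :: real ^ 'n \<Rightarrow> real)" by (rule cc_nbump) (use Q in simp)
  have ib: "integrable (X i) (nbump (2 * Q))" for i by (rule radon_integrable[OF X ccb])
  define c where "c i = (\<integral>x. nbump (2 * Q) x \<partial>X i)" for i
  have cl: "(\<lambda>i. c i) \<longlonglongrightarrow> (\<integral>x. nbump (2 * Q) x \<partial>\<mu>)" using v ccb by (simp add: vconv_def c_def)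
  obtain K where K: "K > 0" and cK: "\<And>i. norm (c i) \<le> K"
    using BseqE[OF convergent_imp_Bseq[OF convergentI[OF cl]]] by blast
  have cK': "c i \<le> K" for i using cK[of i] by simp
  have d0: "(\<lambda>i. (\<integral>x. \<psi> i x \<partial>X i) - (\<integral>x. \<psi>0 x \<partial>X i)) \<longlonglongrightarrow> 0"
  proof (rule LIMSEQ_I)
    fix e :: real assume e: "0 < e"
    \<comment> \<open>Bounding the indicator of the ball by twice the tent costs a factor 2, so the
      total error is at most e / 2.\<close>
    define \<epsilon> where "\<epsilon> = e / (4 * K)"
    have \<epsilon>: "\<epsilon> > 0" using e K by (simp add: \<epsilon>_def)
    obtain N where N: "\<And>i x. i \<ge> N \<Longrightarrow> \<bar>\<psi> i x - \<psi>0 x\<bar> \<le> \<epsilon>"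
    proof -
      have "\<exists>N. \<forall>i\<ge>N. \<forall>x. \<bar>\<psi> i x - \<psi>0 x\<bar> \<le> \<epsilon>"
        by (rule continuous_convergence_uniform[OF supp cconv c0 \<epsilon>])
      then show ?thesis using that by blast
    qed
    have "norm ((\<integral>x. \<psi> i x \<partial>X i) - (\<integral>x. \<psi>0 x \<partial>X i) - 0) < e" if i: "i \<ge> N" for i
    proof -
      have i0: "integrable (X i) \<psi>0" by (rule radon_integrable[OF X cc0])
      have "\<bar>\<psi> i x\<bar> \<le> \<epsilon> + B" for x using N[OF i, of x] B(2)[of x] by linarith
      then have i1: "integrable (X i) (\<psi> i)"
        by (rule radon_integrable_bounded[OF X m]) (rule supp(1))
      have "\<bar>(\<integral>x. \<psi> i x \<partial>X i) - (\<integral>x. \<psi>0 x \<partial>X i)\<bar> = \<bar>\<integral>x. \<psi> i x - \<psi>0 x \<partial>X i\<bar>"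
        using i0 i1 by simp
      also have "\<dots> \<le> (\<integral>x. \<epsilon> * 2 * nbump (2 * Q) x \<partial>X i)"
      proof (rule order_trans[OF integral_abs_bound], rule integral_mono)
        show "integrable (X i) (\<lambda>x. \<bar>\<psi> i x - \<psi>0 x\<bar>)" using i0 i1 by simp
        show "integrable (X i) (\<lambda>x. \<epsilon> * 2 * nbump (2 * Q) x)" by (rule integrable_mult_right) (rule ib)
        fix x
        show "\<bar>\<psi> i x - \<psi>0 x\<bar> \<le> \<epsilon> * 2 * nbump (2 * Q) x"
        proof (cases "Q < norm x")
          case True
          then show ?thesis using \<epsilon> by (simp add: supp)
        next
          case False
          then have "1 / 2 \<le> nbump (2 * Q) x" by (intro nbump_ge_half) (use Q in auto)
          then have "\<epsilon> * 2 * (1 / 2) \<le> \<epsilon> * 2 * nbump (2 * Q) x" using \<epsilon> by (intro mult_left_mono) auto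
          then show ?thesis using N[OF i, of x] by linarith
        qed
      qed
      also have "\<dots> = \<epsilon> * 2 * c i" unfolding c_def by (rule integral_mult_right_zero)
      also have "\<dots> \<le> \<epsilon> * 2 * K" using \<epsilon> cK' by (intro mult_left_mono) auto
      also have "\<dots> < e" using e K by (simp add: \<epsilon>_def)
      finally show ?thesis by simp
    qed
    then show "\<exists>N. \<forall>i\<ge>N. norm ((\<integral>x. \<psi> i x \<partial>X i) - (\<integral>x. \<psi>0 x \<partial>X i) - 0) < e" by blast
  qed
  have d1: "(\<lambda>i. \<integral>x. \<psi>0 x \<partial>X i) \<longlonglongrightarrow> (\<integral>x. \<psi>0 x \<partial>\<mu>)" using v cc0 by (simp add: vconv_def)
  from tendsto_add[OF d0 d1] show ?thesis by simp
qed

lemma vconv_subseq: "vconv X \<mu> \<Longrightarrow> strict_mono r \<Longrightarrow> vconv (\<lambda>i. X (r i)) \<mu>"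
  unfolding vconv_def using LIMSEQ_subseq_LIMSEQ[of "\<lambda>i. integral\<^sup>L (X i) _" _ r] by (auto simp: comp_def)

lemma vconv_const: "vconv (\<lambda>_. \<mu>) \<mu>"
  by (simp add: vconv_def)

text \<open>Shifting the test function instead of the measure reduces this to
  \<open>vconv_integral_moving\<close>; convergent shifts are bounded and keep the supports in one
  ball.\<close>

lemma vconv_translate:
  fixes X :: "nat \<Rightarrow> (real ^ 'n) measure"
  assumes X: "\<And>i. X i \<in> radon_measures" and \<mu>: "\<mu> \<in> radon_measures" and v: "vconv X \<mu>" and s: "s \<longlonglongrightarrow> y"
  shows "vconv (\<lambda>i. translate (s i) (X i)) (translate y \<mu>)"
  unfolding vconv_def
proof (intro allI impI)
  fix f :: "real ^ 'n \<Rightarrow> real" assume f: "cc f"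
  obtain rf where rf: "rf > 0" "\<And>x. rf < norm x \<Longrightarrow> f x = 0" using cc_supportE[OF f] by blast
  obtain b where b: "b > 0" "\<And>i. norm (s i) \<le> b"
    using convergent_imp_Bseq[OF convergentI[OF s]] unfolding Bseq_def by blast
  have yb: "norm y \<le> b" by (rule LIMSEQ_le_const2[OF tendsto_norm[OF s]]) (use b in auto)
  have out: "f (x - z) = 0" if "rf + b < norm x" "norm z \<le> b" for x z
    using that norm_triangle_ineq2[of x z] by (intro rf(2)) linarith
  have "(\<lambda>i. \<integral>x. f (x - s i) \<partial>X i) \<longlonglongrightarrow> (\<integral>x. f (x - y) \<partial>\<mu>)"
  proof (rule vconv_integral_moving[OF X v, where Q = "rf + b"])
    show "(\<lambda>i. f (u i - s (r i))) \<longlonglongrightarrow> f (x - y)" if r: "strict_mono r" and u: "u \<longlonglongrightarrow> x" for r :: "nat \<Rightarrow> nat" and u x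
    proof (rule continuous_on_tendsto_compose[OF cc_continuous[OF f]])
      show "(\<lambda>i. u i - s (r i)) \<longlonglongrightarrow> x - y"
        using LIMSEQ_subseq_LIMSEQ[OF s r] by (intro tendsto_diff u) (simp add: comp_def)
    qed auto
    show "continuous_on UNIV (\<lambda>x. f (x - y))" by (rule cc_continuous[OF cc_shift[OF f]])
    show "(\<lambda>x. f (x - s i)) \<in> borel_measurable borel" for i by (rule cc_borel[OF cc_shift[OF f]])
  qed (use rf(1) b yb out in auto)
  then show "(\<lambda>i. \<integral>x. f x \<partial>translate (s i) (X i)) \<longlonglongrightarrow> (\<integral>x. f x \<partial>translate y \<mu>)"
    by (simp add: integral_translate[OF _ cc_borel[OF f]] X \<mu>)
qed

lemma transport_kernel_gauge:
  assumes "G \<in> borel_measurable borel" "\<And>y. 0 \<le> G y" "\<And>y. G y \<le> 1" "0 < Q" "Q \<le> R"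
  shows "transport_kernel (gauge R G :: (real ^ 'n) measure \<Rightarrow> real) Q R"
proof
  show "gauge R G \<in> borel_measurable (radon_borel :: (real ^ 'n) measure measure)"
    by (rule gauge_measurable) (use assms in auto)
qed (use assms gauge_homogeneous in \<open>auto simp: gauge_def\<close>)

text \<open>The ball of radius 8 * Q / 4 = 2 * Q about the origin has positive mass and contains y,
  so \<open>mass_at_ge_ball\<close> applies at y.\<close>

lemma mass_at_pos_near:
  fixes \<mu> :: "(real ^ 'n) measure"
  assumes \<mu>: "\<mu> \<in> radon_at_origin" and Q: "0 < Q" and y: "norm y \<le> Q"
  shows "0 < mass_at (8 * Q) \<mu> y"
proof -
  note r = radon_at_origin_radon[OF \<mu>]
  have "0 < emeasure \<mu> (ball 0 (8 * Q / 4))" by (rule radon_at_origin_ball[OF \<mu>]) (use Q in simp)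
  moreover have "emeasure \<mu> (ball 0 (8 * Q / 4)) = ennreal (measure \<mu> (ball 0 (8 * Q / 4)))"
    using radon_emeasure_bounded[OF r bounded_ball] by (intro emeasure_eq_ennreal_measure) (simp add: less_top)
  ultimately have "0 < measure \<mu> (ball 0 (8 * Q / 4))" by simp
  moreover have "measure \<mu> (ball 0 (8 * Q / 4)) / 2 \<le> mass_at (8 * Q) \<mu> y"
    by (rule mass_at_ge_ball[OF r]) (use Q y in auto)
  ultimately show ?thesis by linarith
qed

text \<open>If the limit point lies within Q, the denominator has a positive limit. If it lies
  outside, the bump vanishes eventually and no quotient by a possibly vanishing mass has to
  converge.\<close>

lemma gauge_transport_tendsto:
  fixes X :: "nat \<Rightarrow> (real ^ 'n) measure"
  assumes X: "\<And>i. X i \<in> radon_measures" and \<mu>: "\<mu> \<in> radon_at_origin" and v: "vconv X \<mu>" and s: "s \<longlonglongrightarrow> y"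
    and G: "continuous_on UNIV G" and Q: "0 < Q"
  shows "(\<lambda>i. transport (gauge (8 * Q) G) Q (8 * Q) (X i) (s i) 0) \<longlonglongrightarrow> transport (gauge (8 * Q) G) Q (8 * Q) \<mu> y 0"
proof (cases "norm y \<le> Q")
  case True
  note r = radon_at_origin_radon[OF \<mu>]
  have R: "0 < 8 * Q" using Q by simp
  have pos: "0 < mass_at (8 * Q) \<mu> y" by (rule mass_at_pos_near[OF \<mu> Q True])
  have vt: "vconv (\<lambda>i. translate (s i) (X i)) (translate y \<mu>)" by (rule vconv_translate[OF X r v s])
  have g: "(\<lambda>i. gauge (8 * Q) G (translate (s i) (X i))) \<longlonglongrightarrow> gauge (8 * Q) G (translate y \<mu>)"
    by (rule gauge_tendsto[OF radon_translate[OF X] radon_translate[OF r] vt R _ G]) (simp add: mass_at_translate[OF r] pos)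
  have mm: "(\<lambda>i. mass_at (8 * Q) (X i) (s i)) \<longlonglongrightarrow> mass_at (8 * Q) \<mu> y"
    using vconv_mass_at[OF vt R, of 0] by (simp add: mass_at_translate X r)
  have nb: "(\<lambda>i. nbump Q (0 - s i)) \<longlonglongrightarrow> nbump Q (0 - y)"
    by (rule continuous_on_tendsto_compose[OF cc_continuous[OF cc_nbump[OF Q]]]) (auto intro!: tendsto_intros s)
  show ?thesis unfolding transport_def by (intro tendsto_divide tendsto_mult g nb mm) (use pos in simp)
next
  case False
  have ev: "\<forall>\<^sub>F i in sequentially. Q < norm (s i)"
    using False by (intro order_tendstoD(1)[OF tendsto_norm[OF s]]) simp
  have z: "transport (gauge (8 * Q) G) Q (8 * Q) \<nu> x 0 = 0" if "Q < norm x" for \<nu> and x :: "real ^ 'n"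
    unfolding transport_def using that Q by (simp add: nbump_outside)
  have "(\<lambda>i. transport (gauge (8 * Q) G) Q (8 * Q) (X i) (s i) 0) \<longlonglongrightarrow> 0"
    by (rule tendsto_eventually) (use ev in eventually_elim, rule z)
  then show ?thesis using False by (simp add: z)
qed

text \<open>The integrand changes with the measure, but along convergent points it converges, and
  its support stays within radius Q.\<close>

lemma gauge_inflow_tendsto:
  fixes X :: "nat \<Rightarrow> (real ^ 'n) measure"
  assumes X: "\<And>i. X i \<in> radon_measures" and \<mu>: "\<mu> \<in> radon_at_origin" and v: "vconv X \<mu>"
    and G: "continuous_on UNIV G" "\<And>y. 0 \<le> G y" "\<And>y. G y \<le> 1" and Q: "0 < Q"
  shows "(\<lambda>i. inflow (gauge (8 * Q) G) Q (8 * Q) (X i) 0) \<longlonglongrightarrow> inflow (gauge (8 * Q) G) Q (8 * Q) \<mu> 0"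
proof -
  note r = radon_at_origin_radon[OF \<mu>]
  interpret transport_kernel "gauge (8 * Q) G :: (real ^ 'n) measure \<Rightarrow> real" Q "8 * Q"
    by (rule transport_kernel_gauge[OF borel_measurable_continuous_onI[OF G(1)] G(2,3)]) (use Q in auto)
  show ?thesis unfolding inflow_def
  proof (rule vconv_integral_moving[OF X v Q])
    show "(\<lambda>y. transport (gauge (8 * Q) G) Q (8 * Q) (X i) y 0) \<in> borel_measurable borel" for i
      by (rule transport_measurable1[OF X])
    show "transport (gauge (8 * Q) G) Q (8 * Q) (X i) x 0 = 0" if "Q < norm x" for i x
      by (rule transport_outside) (use that in simp)
    show "transport (gauge (8 * Q) G) Q (8 * Q) \<mu> x 0 = 0" if "Q < norm x" for x
      by (rule transport_outside) (use that in simp)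
    show "(\<lambda>i. transport (gauge (8 * Q) G) Q (8 * Q) (X (r i)) (s i) 0) \<longlonglongrightarrow> transport (gauge (8 * Q) G) Q (8 * Q) \<mu> y 0"
      if "strict_mono r" "s \<longlonglongrightarrow> y" for r :: "nat \<Rightarrow> nat" and s y
      by (rule gauge_transport_tendsto[OF X \<mu> vconv_subseq[OF v that(1)] that(2) G(1) Q])
    show "continuous_on UNIV (\<lambda>y. transport (gauge (8 * Q) G) Q (8 * Q) \<mu> y 0)"
      unfolding continuous_on_sequentially comp_def
      by (intro ballI allI impI, elim conjE) (rule gauge_transport_tendsto[OF r \<mu> vconv_const _ G(1) Q])
  qed
qed

section \<open>Mass transport for the limit, first for continuous and then for Borel events\<close>

context limit_setup begin

text \<open>The factor 8 makes the normalizing mass positive at all points within distance \<open>Q\<close> of the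
  origin as soon as the origin lies in the support, so the transport is continuous there.\<close>

definition balanced :: "real \<Rightarrow> ((nat \<Rightarrow> real) \<Rightarrow> real) \<Rightarrow> bool" where
  "balanced Q H \<longleftrightarrow> expectation (\<lambda>\<omega>. outflow (gauge (8 * Q) H) Q (8 * Q) (Y \<omega>) 0) =
     expectation (\<lambda>\<omega>. inflow (gauge (8 * Q) H) Q (8 * Q) (Y \<omega>) 0)"

text \<open>Inflow and outflow are uniformly bounded and converge almost surely along
  \<open>X i\<close>, so the identity for each \<open>Pn i\<close> passes to Y.\<close>

lemma balanced_continuous:
  assumes G: "continuous_on UNIV G" "\<And>y. 0 \<le> G y" "\<And>y. G y \<le> 1" and Q: "0 < Q"
  shows "balanced Q G"
proof -
  interpret K: transport_kernel "gauge (8 * Q) G :: (real ^ 'n) measure \<Rightarrow> real" Q "8 * Q"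
    by (rule transport_kernel_gauge[OF borel_measurable_continuous_onI[OF G(1)] G(2,3)]) (use Q in auto)
  let ?o = "\<lambda>\<mu> :: (real ^ 'n) measure. outflow (gauge (8 * Q) G) Q (8 * Q) \<mu> 0"
  let ?i = "\<lambda>\<mu> :: (real ^ 'n) measure. inflow (gauge (8 * Q) G) Q (8 * Q) \<mu> 0"
  have "(\<lambda>i. expectation (\<lambda>\<omega>. ?o (X i \<omega>))) \<longlonglongrightarrow> expectation (\<lambda>\<omega>. ?o (Y \<omega>))"
  proof (rule integral_dominated_convergence[where w = "\<lambda>_. 1"])
    show "(\<lambda>\<omega>. ?o (Y \<omega>)) \<in> borel_measurable \<Omega>" by (rule measurable_compose[OF Y K.outflow_0_measurable])
    show "(\<lambda>\<omega>. ?o (X i \<omega>)) \<in> borel_measurable \<Omega>" for i by (rule measurable_compose[OF X K.outflow_0_measurable])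
    show "AE \<omega> in \<Omega>. norm (?o (X i \<omega>)) \<le> 1" for i
      by (rule AE_I2) (simp add: K.outflow_bounds X_radon)
    show "AE \<omega> in \<Omega>. (\<lambda>i. ?o (X i \<omega>)) \<longlonglongrightarrow> ?o (Y \<omega>)"
      using AE_good
    proof eventually_elim
      case (elim \<omega>)
      then have pos: "0 < mass_at (8 * Q) (Y \<omega>) 0" by (intro mass_at_pos) (use Q in auto)
      have "(\<lambda>i. gauge (8 * Q) G (X i \<omega>)) \<longlonglongrightarrow> gauge (8 * Q) G (Y \<omega>)"
        using elim by (intro gauge_tendsto X_radon Y_radon pos G) (use Q in auto)
      moreover have "(\<lambda>i. mass_at S (X i \<omega>) 0) \<longlonglongrightarrow> mass_at S (Y \<omega>) 0" if "S > 0" for S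
        by (rule vconv_mass_at[OF _ that]) (use elim in simp)
      ultimately show ?case unfolding K.outflow_eq
        using elim pos Q by (simp add: translate_0 X_radon Y_radon) (intro tendsto_intros; simp)
    qed
  qed simp
  moreover have "(\<lambda>i. expectation (\<lambda>\<omega>. ?i (X i \<omega>))) \<longlonglongrightarrow> expectation (\<lambda>\<omega>. ?i (Y \<omega>))"
  proof (rule integral_dominated_convergence[where w = "\<lambda>_. K.inflow_bound"])
    show "(\<lambda>\<omega>. ?i (Y \<omega>)) \<in> borel_measurable \<Omega>" by (rule measurable_compose[OF Y K.inflow_0_measurable])
    show "(\<lambda>\<omega>. ?i (X i \<omega>)) \<in> borel_measurable \<Omega>" for i by (rule measurable_compose[OF X K.inflow_0_measurable])
    show "AE \<omega> in \<Omega>. norm (?i (X i \<omega>)) \<le> K.inflow_bound" for i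
      by (rule AE_I2) (simp add: K.inflow_bounds X_radon)
    show "AE \<omega> in \<Omega>. (\<lambda>i. ?i (X i \<omega>)) \<longlonglongrightarrow> ?i (Y \<omega>)"
      using AE_good by eventually_elim (intro gauge_inflow_tendsto X_radon G Q; simp)
  qed simp
  moreover have "expectation (\<lambda>\<omega>. ?o (X i \<omega>)) = expectation (\<lambda>\<omega>. ?i (X i \<omega>))" for i
    unfolding expectation_X[OF K.outflow_0_measurable] expectation_X[OF K.inflow_0_measurable]
    by (rule K.mass_transport[OF Pn])
  ultimately show ?thesis unfolding balanced_def using LIMSEQ_unique by simp
qed

lemma transport_gauge_add:
  assumes "\<And>y. H y = H1 y + H2 y"
  shows "transport (gauge R H) Q S \<mu> x z = transport (gauge R H1) Q S \<mu> x z + transport (gauge R H2) Q S \<mu> x z"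
  unfolding transport_def gauge_def assms by (simp add: add_divide_distrib distrib_right)

text \<open>Sums serve disjoint unions and differences serve complements in the induction over Borel
  sets.\<close>

lemma balanced_add:
  assumes Q: "0 < Q"
    and H: "H1 \<in> borel_measurable borel" "\<And>y. 0 \<le> H1 y" "H2 \<in> borel_measurable borel" "\<And>y. 0 \<le> H2 y"
    and sum: "\<And>y. H y = H1 y + H2 y" "\<And>y. H y \<le> 1"
  shows "balanced Q H1 \<Longrightarrow> balanced Q H2 \<Longrightarrow> balanced Q H"
    and "balanced Q H \<Longrightarrow> balanced Q H1 \<Longrightarrow> balanced Q H2"
proof -
  have le: "H1 y \<le> 1" "H2 y \<le> 1" for y using H(2)[of y] H(4)[of y] sum(1)[of y] sum(2)[of y] by linarith+
  interpret K1: transport_kernel "gauge (8 * Q) H1 :: (real ^ 'n) measure \<Rightarrow> real" Q "8 * Q"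
    by (rule transport_kernel_gauge[OF H(1,2) le(1)]) (use Q in auto)
  interpret K2: transport_kernel "gauge (8 * Q) H2 :: (real ^ 'n) measure \<Rightarrow> real" Q "8 * Q"
    by (rule transport_kernel_gauge[OF H(3,4) le(2)]) (use Q in auto)
  have o1: "integrable \<Omega> (\<lambda>\<omega>. outflow (gauge (8 * Q) H1) Q (8 * Q) (Y \<omega>) 0)"
    by (rule integrable_const_bound[where B = 1])
      (auto intro!: AE_I2 measurable_compose[OF Y K1.outflow_0_measurable] simp: K1.outflow_bounds Y_radon)
  have o2: "integrable \<Omega> (\<lambda>\<omega>. outflow (gauge (8 * Q) H2) Q (8 * Q) (Y \<omega>) 0)"
    by (rule integrable_const_bound[where B = 1])
      (auto intro!: AE_I2 measurable_compose[OF Y K2.outflow_0_measurable] simp: K2.outflow_bounds Y_radon)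
  have i1: "integrable \<Omega> (\<lambda>\<omega>. inflow (gauge (8 * Q) H1) Q (8 * Q) (Y \<omega>) 0)"
    by (rule integrable_const_bound[where B = K1.inflow_bound])
      (auto intro!: AE_I2 measurable_compose[OF Y K1.inflow_0_measurable] simp: K1.inflow_bounds Y_radon)
  have i2: "integrable \<Omega> (\<lambda>\<omega>. inflow (gauge (8 * Q) H2) Q (8 * Q) (Y \<omega>) 0)"
    by (rule integrable_const_bound[where B = K2.inflow_bound])
      (auto intro!: AE_I2 measurable_compose[OF Y K2.inflow_0_measurable] simp: K2.inflow_bounds Y_radon)
  have out: "expectation (\<lambda>\<omega>. outflow (gauge (8 * Q) H) Q (8 * Q) (Y \<omega>) 0) =
      expectation (\<lambda>\<omega>. outflow (gauge (8 * Q) H1) Q (8 * Q) (Y \<omega>) 0) + expectation (\<lambda>\<omega>. outflow (gauge (8 * Q) H2) Q (8 * Q) (Y \<omega>) 0)"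
    unfolding Bochner_Integration.integral_add[OF o1 o2, symmetric]
  proof (rule Bochner_Integration.integral_cong[OF refl])
    fix \<omega> assume \<omega>: "\<omega> \<in> space \<Omega>"
    show "outflow (gauge (8 * Q) H) Q (8 * Q) (Y \<omega>) 0 =
      outflow (gauge (8 * Q) H1) Q (8 * Q) (Y \<omega>) 0 + outflow (gauge (8 * Q) H2) Q (8 * Q) (Y \<omega>) 0"
      unfolding outflow_def transport_gauge_add[of H, OF sum(1)]
      by (rule Bochner_Integration.integral_add[OF K1.transport_integrable[OF Y_radon[OF \<omega>]] K2.transport_integrable[OF Y_radon[OF \<omega>]]])
  qed
  have inn: "expectation (\<lambda>\<omega>. inflow (gauge (8 * Q) H) Q (8 * Q) (Y \<omega>) 0) =
      expectation (\<lambda>\<omega>. inflow (gauge (8 * Q) H1) Q (8 * Q) (Y \<omega>) 0) + expectation (\<lambda>\<omega>. inflow (gauge (8 * Q) H2) Q (8 * Q) (Y \<omega>) 0)"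
    unfolding Bochner_Integration.integral_add[OF i1 i2, symmetric]
  proof (rule Bochner_Integration.integral_cong[OF refl])
    fix \<omega> assume \<omega>: "\<omega> \<in> space \<Omega>"
    show "inflow (gauge (8 * Q) H) Q (8 * Q) (Y \<omega>) 0 =
      inflow (gauge (8 * Q) H1) Q (8 * Q) (Y \<omega>) 0 + inflow (gauge (8 * Q) H2) Q (8 * Q) (Y \<omega>) 0"
      unfolding inflow_def transport_gauge_add[of H, OF sum(1)]
      by (rule Bochner_Integration.integral_add[OF K1.transport_integrable_in[OF Y_radon[OF \<omega>]] K2.transport_integrable_in[OF Y_radon[OF \<omega>]]])
  qed
  show "balanced Q H1 \<Longrightarrow> balanced Q H2 \<Longrightarrow> balanced Q H"
    and "balanced Q H \<Longrightarrow> balanced Q H1 \<Longrightarrow> balanced Q H2"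
    unfolding balanced_def out inn by simp_all
qed

lemma balanced_limit:
  assumes Q: "0 < Q"
    and H: "\<And>n. Hn n \<in> borel_measurable borel" "\<And>n y. 0 \<le> Hn n y" "\<And>n y. Hn n y \<le> 1"
    and lim: "\<And>y. (\<lambda>n. Hn n y) \<longlonglongrightarrow> H y" and b: "\<And>n. balanced Q (Hn n)"
  shows "balanced Q H"
proof -
  have Hm: "H \<in> borel_measurable borel" by (rule borel_measurable_LIMSEQ_real[OF lim H(1)])
  have H0: "0 \<le> H y" for y by (rule LIMSEQ_le_const[OF lim]) (use H in auto)
  have H1: "H y \<le> 1" for y by (rule LIMSEQ_le_const2[OF lim]) (use H in auto)
  interpret K: transport_kernel "gauge (8 * Q) H :: (real ^ 'n) measure \<Rightarrow> real" Q "8 * Q"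
    by (rule transport_kernel_gauge[OF Hm H0 H1]) (use Q in auto)
  interpret Kn: transport_kernel "gauge (8 * Q) (Hn n) :: (real ^ 'n) measure \<Rightarrow> real" Q "8 * Q" for n
    by (rule transport_kernel_gauge[OF H]) (use Q in auto)
  \<comment> \<open>The kernel with the constant gauge 1 dominates the kernels of all
    \<open>Hn n\<close>, pointwise and hence in inflow.\<close>
  interpret K1: transport_kernel "gauge (8 * Q) (\<lambda>_. 1) :: (real ^ 'n) measure \<Rightarrow> real" Q "8 * Q"
    by (rule transport_kernel_gauge) (use Q in auto)
  have tl: "(\<lambda>n. transport (gauge (8 * Q) (Hn n)) Q (8 * Q) \<mu> x y) \<longlonglongrightarrow> transport (gauge (8 * Q) H) Q (8 * Q) \<mu> x y" for \<mu> :: "(real ^ 'n) measure" and x y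
  proof (cases "mass_at (8 * Q) \<mu> x = 0")
    case True
    then show ?thesis by (simp add: transport_def)
  next
    case False
    then show ?thesis unfolding transport_def gauge_def by (intro tendsto_intros lim)
  qed
  have t1: "transport (gauge (8 * Q) (Hn n)) Q (8 * Q) \<mu> x y \<le> transport (gauge (8 * Q) (\<lambda>_. 1)) Q (8 * Q) \<mu> x y" for n and \<mu> :: "(real ^ 'n) measure" and x y
    unfolding transport_def gauge_def by (intro divide_right_mono mult_right_mono H(3) mass_at_nonneg) simp
  have il: "(\<lambda>n. inflow (gauge (8 * Q) (Hn n)) Q (8 * Q) \<mu> 0) \<longlonglongrightarrow> inflow (gauge (8 * Q) H) Q (8 * Q) \<mu> 0"
    if \<mu>: "\<mu> \<in> radon_measures" for \<mu> :: "(real ^ 'n) measure"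
    unfolding inflow_def
  proof (rule integral_dominated_convergence[OF _ _ K1.transport_integrable_in[OF \<mu>]])
    show "(\<lambda>y. transport (gauge (8 * Q) H) Q (8 * Q) \<mu> y 0) \<in> borel_measurable \<mu>"
      by (rule borel_to_radon_measurable[OF \<mu> K.transport_measurable1(1)[OF \<mu>]])
    show "(\<lambda>y. transport (gauge (8 * Q) (Hn n)) Q (8 * Q) \<mu> y 0) \<in> borel_measurable \<mu>" for n
      by (rule borel_to_radon_measurable[OF \<mu> Kn.transport_measurable1(1)[OF \<mu>]])
  qed (auto intro!: AE_I2 tl t1 simp: Kn.transport_nonneg)
  have ol: "(\<lambda>n. outflow (gauge (8 * Q) (Hn n)) Q (8 * Q) \<mu> 0) \<longlonglongrightarrow> outflow (gauge (8 * Q) H) Q (8 * Q) \<mu> 0"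
    for \<mu> :: "(real ^ 'n) measure"
  proof (cases "mass_at (8 * Q) \<mu> 0 = 0")
    case True
    then show ?thesis by (simp add: K.outflow_eq Kn.outflow_eq)
  next
    case False
    then show ?thesis unfolding K.outflow_eq Kn.outflow_eq gauge_def by (intro tendsto_intros lim)
  qed
  have ib: "inflow (gauge (8 * Q) (Hn n)) Q (8 * Q) \<mu> 0 \<le> K1.inflow_bound" if \<mu>: "\<mu> \<in> radon_measures" for n and \<mu> :: "(real ^ 'n) measure"
  proof -
    have "inflow (gauge (8 * Q) (Hn n)) Q (8 * Q) \<mu> 0 \<le> inflow (gauge (8 * Q) (\<lambda>_. 1)) Q (8 * Q) \<mu> 0"
      unfolding inflow_def by (rule integral_mono[OF Kn.transport_integrable_in[OF \<mu>] K1.transport_integrable_in[OF \<mu>] t1])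
    then show ?thesis using K1.inflow_bounds(2)[OF \<mu>, of 0] by linarith
  qed
  have "(\<lambda>n. expectation (\<lambda>\<omega>. outflow (gauge (8 * Q) (Hn n)) Q (8 * Q) (Y \<omega>) 0)) \<longlonglongrightarrow> expectation (\<lambda>\<omega>. outflow (gauge (8 * Q) H) Q (8 * Q) (Y \<omega>) 0)"
    by (rule integral_dominated_convergence[where w = "\<lambda>_. 1"])
      (auto intro!: AE_I2 ol measurable_compose[OF Y K.outflow_0_measurable] measurable_compose[OF Y Kn.outflow_0_measurable]
        simp: Kn.outflow_bounds Y_radon)
  moreover have "(\<lambda>n. expectation (\<lambda>\<omega>. inflow (gauge (8 * Q) (Hn n)) Q (8 * Q) (Y \<omega>) 0)) \<longlonglongrightarrow> expectation (\<lambda>\<omega>. inflow (gauge (8 * Q) H) Q (8 * Q) (Y \<omega>) 0)"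
    by (rule integral_dominated_convergence[where w = "\<lambda>_. K1.inflow_bound"])
      (auto intro!: AE_I2 il measurable_compose[OF Y K.inflow_0_measurable] measurable_compose[OF Y Kn.inflow_0_measurable]
        simp: Kn.inflow_bounds Y_radon ib)
  ultimately show ?thesis using b unfolding balanced_def using LIMSEQ_unique by simp
qed

text \<open>A Dynkin argument: open sets are limits of plateaus, and the balanced sets are stable
  under complements and countable disjoint unions.\<close>

lemma balanced_indicator:
  assumes Q: "0 < Q" and S: "S \<in> sets borel"
  shows "balanced Q (indicator S)"
proof -
  obtain A :: "nat \<Rightarrow> (nat \<Rightarrow> real) set" where A: "Int_stable (range A)" "\<And>n. open (A n)"
    "sets borel = sigma_sets UNIV (range A)" "UNIV \<in> range A"
    using countable_Int_stable_basis_enum by metis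
  have one: "balanced Q (\<lambda>_. 1)" and zero: "balanced Q (\<lambda>_. 0)"
    by (rule balanced_continuous[OF _ _ _ Q]; simp)+
  have sb: "T \<in> sigma_sets UNIV (range A) \<Longrightarrow> (indicator T :: _ \<Rightarrow> real) \<in> borel_measurable borel" for T
    unfolding A(3)[symmetric] by simp
  have "Int_stable (range A)" "range A \<subseteq> Pow UNIV" "S \<in> sigma_sets UNIV (range A)" using A(1,3) S by auto
  then show ?thesis
  proof (induction rule: sigma_sets_induct_disjoint)
    case (basic T)
    show ?case
    \<comment> \<open>The plateaus of the whole space vanish and do not approximate its indicator,
      the constant 1.\<close>
    proof (cases "T = UNIV")
      case True
      then show ?thesis using one by (simp add: indicator_def)
    next
      case False
      have T: "open T" using basic A(2) by auto
      show ?thesis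
        by (rule balanced_limit[OF Q borel_measurable_plateau plateau_nonneg plateau_le_1 plateau_tendsto[OF T False]])
          (rule balanced_continuous[OF continuous_plateau plateau_nonneg plateau_le_1 Q])
    qed
  next
    case empty
    then show ?case using zero by (simp add: indicator_def)
  next
    case (compl T)
    show ?case
      by (rule balanced_add(2)[OF Q sb[OF compl(1)] _ sb[OF sigma_sets.Compl[OF compl(1)]] _ _ _ one compl(2)])
        (auto simp: indicator_def)
  next
    case (union T)
    have fin: "balanced Q (indicator (\<Union>i<n. T i))" for n
    proof (induction n)
      case 0
      then show ?case using zero by (simp add: indicator_def)
    next
      case (Suc n)
      have "T i \<inter> T n = {}" if "i < n" for i
        using disjoint_family_onD[OF union(1), of i n] that by simp
      then have disj: "(\<Union>i<n. T i) \<inter> T n = {}" by blast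
      have m: "(\<Union>i<n. T i) \<in> sets borel" "T n \<in> sets borel" using union(2) unfolding A(3)[symmetric] by auto
      show ?case
        by (intro balanced_add(1)[OF Q borel_measurable_indicator[OF m(1)] _ borel_measurable_indicator[OF m(2)] _ _ _ Suc union(3)[of n]])
          (use disj in \<open>auto simp: indicator_def lessThan_Suc\<close>)
    qed
    show ?case
    proof (rule balanced_limit[OF Q _ _ _ _ fin])
      show "(indicator (\<Union>i<n. T i) :: _ \<Rightarrow> real) \<in> borel_measurable borel" for n
        using union(2) unfolding A(3)[symmetric] by (intro borel_measurable_indicator) auto
      show "(\<lambda>n. indicator (\<Union>i<n. T i) y :: real) \<longlonglongrightarrow> indicator (\<Union>i. T i) y" for y
        by (rule LIMSEQ_indicator_UN)
    qed (auto simp: indicator_def)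
  qed
qed

end

text \<open>A total variant of \<^const>\<open>normalize_measure\<close>: off \<^const>\<open>radon_at_origin\<close> it is the zero
  measure, which keeps it Radon and measurable.\<close>

definition star :: "(real ^ 'n) measure \<Rightarrow> (real ^ 'n) measure" where
  "star \<mu> = scale_measure (ennreal (if \<mu> \<in> radon_at_origin then 1 / measure \<mu> unit_box else 0)) \<mu>"

lemma star_eq: "\<mu> \<in> radon_at_origin \<Longrightarrow> star \<mu> = normalize_measure \<mu>"
  by (simp add: star_def normalize_measure_eq)

lemma star_at_origin: "\<mu> \<in> radon_at_origin \<Longrightarrow> star \<mu> \<in> radon_at_origin"
  using unit_box_mass(2)[of \<mu>] by (simp add: star_def radon_at_origin_scale)

lemma star_measurable: "star \<in> measurable radon_borel (radon_borel :: (real ^ 'n) measure measure)"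
proof -
  have [measurable]: "(\<lambda>\<mu>. measure \<mu> (unit_box :: (real ^ 'n) set)) \<in> borel_measurable radon_borel"
    unfolding measure_def using emeasure_radon_measurable[of "\<lambda>\<mu>. \<mu>", OF _ unit_box_borel] by measurable
  have "(\<lambda>\<mu>. if \<mu> \<in> radon_at_origin then 1 / measure \<mu> (unit_box :: (real ^ 'n) set) else 0) \<in> borel_measurable radon_borel"
    by measurable
  then show ?thesis unfolding star_def[abs_def] by (intro measurable_scale_radon) simp_all
qed

lemma radon_at_origin_scale_iff:
  assumes \<mu>: "\<mu> \<in> radon_measures" and c: "c > 0"
  shows "scale_measure (ennreal c) \<mu> \<in> radon_at_origin \<longleftrightarrow> \<mu> \<in> radon_at_origin"
  using c radon_scale[OF \<mu>] \<mu> unfolding radon_at_origin_iff by (simp add: ennreal_zero_less_mult_iff)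

lemma star_homogeneous: "homogeneous star"
  unfolding homogeneous_def
proof (intro ballI allI impI)
  fix \<mu> :: "(real ^ 'a) measure" and c :: real assume \<mu>: "\<mu> \<in> radon_measures" and c: "c > 0"
  show "star (scale_measure (ennreal c) \<mu>) = star \<mu>"
  proof (cases "\<mu> \<in> radon_at_origin")
    case True
    have "ennreal (1 / (c * measure \<mu> unit_box)) * ennreal c = ennreal (1 / measure \<mu> unit_box)"
      using c by (subst ennreal_mult[symmetric]) auto
    then show ?thesis using True c by (simp add: star_def radon_at_origin_scale_iff[OF \<mu> c])
  next
    case False
    then show ?thesis by (simp add: star_def radon_at_origin_scale_iff[OF \<mu> c])
  qed
qed

lemma star_scale_pos:
  "\<mu> \<in> radon_at_origin \<Longrightarrow> \<exists>c>0. star \<mu> = scale_measure (ennreal c) \<mu>"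
  using unit_box_mass(2)[of \<mu>] by (intro exI[of _ "1 / measure \<mu> unit_box"]) (simp add: star_def)

lemma star_magnify_star:
  assumes "\<mu> \<in> radon_at_origin" shows "star (magnify t (star \<mu>)) = star (magnify t \<mu>)"
proof -
  note r = radon_at_origin_radon[OF assms]
  obtain c where c: "c > 0" "star \<mu> = scale_measure (ennreal c) \<mu>" using star_scale_pos[OF assms] by blast
  show ?thesis unfolding c(2) magnify_scale[OF r] by (rule homogeneousD[OF star_homogeneous radon_magnify[OF r] c(1)])
qed

lemma AE_scale_measure:
  assumes "c > 0" shows "(AE x in scale_measure (ennreal c) \<mu>. P x) \<longleftrightarrow> (AE x in \<mu>. P x)"
  unfolding scale_measure_eq_density by (subst AE_density) (use assms in auto)

lemma AE_translate_star:
  assumes "\<nu> \<in> radon_measures"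
  shows "(AE z in \<nu>. translate_star z \<nu> \<in> A) \<longleftrightarrow> (AE z in \<nu>. star (translate z \<nu>) \<in> A)"
proof -
  have *: "AE z in \<nu>. translate_star z \<nu> = star (translate z \<nu>)"
    using AE_spt[OF assms] by eventually_elim (simp add: translate_star_def star_eq)
  show ?thesis
  proof
    assume "AE z in \<nu>. translate_star z \<nu> \<in> A"
    with * show "AE z in \<nu>. star (translate z \<nu>) \<in> A" by eventually_elim simp
  next
    assume "AE z in \<nu>. star (translate z \<nu>) \<in> A"
    with * show "AE z in \<nu>. translate_star z \<nu> \<in> A" by eventually_elim simp
  qed
qed

lemma star_translate_measurable:
  fixes X :: "'a \<Rightarrow> (real ^ 'n) measure"
  assumes X: "X \<in> measurable M radon_borel"
  shows "(\<lambda>p. star (translate (snd p) (X (fst p)))) \<in> measurable (M \<Otimes>\<^sub>M borel) radon_borel"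
proof -
  have "(\<lambda>p. translate (snd p) (X (fst p))) \<in> measurable (M \<Otimes>\<^sub>M borel) radon_borel"
    by (rule measurable_translate[OF measurable_compose[OF measurable_fst X]]) simp
  then show ?thesis by (rule measurable_compose[OF _ star_measurable])
qed

text \<open>The almost everywhere condition is the vanishing of an integral of an indicator, and
  that integral depends measurably on \<open>\<nu>\<close>.\<close>

lemma AE_star_translate_borel:
  assumes A: "A \<in> sets (radon_borel :: (real ^ 'n) measure measure)"
  shows "{\<nu> \<in> space radon_borel. AE z in \<nu>. star (translate z \<nu>) \<in> A} \<in> sets radon_borel"
proof -
  let ?P = "radon_borel \<Otimes>\<^sub>M borel :: ((real ^ 'n) measure \<times> (real ^ 'n)) measure"
  have "(\<lambda>p. indicator (- A) (star (translate (snd p) (fst p))) :: ennreal) \<in> borel_measurable ?P"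
  proof -
    have "(indicator (space radon_borel - A) :: _ \<Rightarrow> ennreal) \<in> borel_measurable radon_borel"
      using A by (intro borel_measurable_indicator) auto
    from measurable_compose[OF star_translate_measurable[of "\<lambda>\<mu>. \<mu>"] this]
    have "(\<lambda>p. indicator (space radon_borel - A) (star (translate (snd p) (fst p))) :: ennreal) \<in> borel_measurable ?P" by simp
    moreover have "indicator (space radon_borel - A) (star (translate (snd p) (fst p))) = (indicator (- A) (star (translate (snd p) (fst p))) :: ennreal)"
      if "p \<in> space ?P" for p
      using measurable_space[OF star_translate_measurable[of "\<lambda>\<mu>. \<mu>"] that] by (simp add: indicator_def)
    ultimately show ?thesis by (simp cong: measurable_cong)
  qed
  then have m: "(\<lambda>(\<nu>, z). indicator (- A) (star (translate z \<nu>)) :: ennreal) \<in> borel_measurable ?P"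
    by (simp add: case_prod_beta')
  have [measurable]: "(\<lambda>\<nu>. \<integral>\<^sup>+z. indicator (- A) (star (translate z \<nu>)) \<partial>\<nu>) \<in> borel_measurable radon_borel"
    by (rule nn_integral_radon_measurable[where X = "\<lambda>\<mu>. \<mu>", OF _ m]) simp
  have "{\<nu> \<in> space radon_borel. (\<integral>\<^sup>+z. indicator (- A) (star (translate z \<nu>)) \<partial>\<nu>) = 0} \<in> sets radon_borel"
    by measurable
  also have "{\<nu> \<in> space radon_borel. (\<integral>\<^sup>+z. indicator (- A) (star (translate z \<nu>)) \<partial>\<nu>) = 0}
      = {\<nu> \<in> space radon_borel. AE z in \<nu>. star (translate z \<nu>) \<in> A}"
  proof (intro Collect_cong conj_cong refl)
    fix \<nu> :: "(real ^ 'n) measure" assume \<nu>: "\<nu> \<in> space radon_borel"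
    then have r: "\<nu> \<in> radon_measures" by (simp add: space_radon_borel)
    have "(\<lambda>z. indicator (- A) (star (translate z \<nu>)) :: ennreal) \<in> borel_measurable borel"
      using measurable_Pair2[OF m \<nu>] by simp
    then have "(\<lambda>z. indicator (- A) (star (translate z \<nu>)) :: ennreal) \<in> borel_measurable \<nu>"
      by (rule borel_to_radon_measurable[OF r])
    then show "(\<integral>\<^sup>+z. indicator (- A) (star (translate z \<nu>)) \<partial>\<nu>) = 0 \<longleftrightarrow> (AE z in \<nu>. star (translate z \<nu>) \<in> A)"
      by (subst nn_integral_0_iff_AE) (auto simp: indicator_def)
  qed
  finally show ?thesis .
qed

lemma AE_iff_cong:
  assumes "AE x in M. P x = Q x" shows "(AE x in M. P x) \<longleftrightarrow> (AE x in M. Q x)"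
proof
  assume "AE x in M. P x"
  with assms show "AE x in M. Q x" by eventually_elim simp
next
  assume "AE x in M. Q x"
  with assms show "AE x in M. P x" by eventually_elim simp
qed

section \<open>The normalized limit is an extended fractal distribution\<close>

context limit_setup begin

definition limit_dist :: "(real ^ 'n) measure measure" where
  "limit_dist = distr \<Omega> radon_borel (\<lambda>\<omega>. star (Y \<omega>))"

lemma star_Y: "(\<lambda>\<omega>. star (Y \<omega>)) \<in> measurable \<Omega> radon_borel"
  by (rule measurable_compose[OF Y star_measurable])

lemma prob_space_limit_dist: "prob_space limit_dist"
  unfolding limit_dist_def by (rule prob_space_distr[OF star_Y])

lemma emeasure_limit_dist:
  assumes A: "A \<in> sets radon_borel"
  shows "emeasure limit_dist A = ennreal (expectation (\<lambda>\<omega>. indicator A (star (Y \<omega>))))"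
proof -
  have s: "(\<lambda>\<omega>. star (Y \<omega>)) -` A \<inter> space \<Omega> \<in> events" by (rule measurable_sets[OF star_Y A])
  have "emeasure limit_dist A = emeasure \<Omega> ((\<lambda>\<omega>. star (Y \<omega>)) -` A \<inter> space \<Omega>)"
    unfolding limit_dist_def by (rule emeasure_distr[OF star_Y A])
  also have "\<dots> = ennreal (expectation (indicator ((\<lambda>\<omega>. star (Y \<omega>)) -` A \<inter> space \<Omega>)))"
    using s by (simp add: emeasure_eq_measure)
  also have "expectation (indicator ((\<lambda>\<omega>. star (Y \<omega>)) -` A \<inter> space \<Omega>)) = expectation (\<lambda>\<omega>. indicator A (star (Y \<omega>)))"
    by (rule Bochner_Integration.integral_cong) (simp_all add: indicator_def)
  finally show ?thesis .
qed

lemma limit_dist_eq_1_iff: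
  assumes A: "A \<in> sets radon_borel"
  shows "emeasure limit_dist A = 1 \<longleftrightarrow> (AE \<omega> in \<Omega>. star (Y \<omega>) \<in> A)"
proof -
  interpret L: prob_space limit_dist by (rule prob_space_limit_dist)
  have "emeasure limit_dist A = 1 \<longleftrightarrow> (AE \<nu> in limit_dist. \<nu> \<in> A)"
    using A by (subst L.AE_in_set_eq_1) (simp_all add: limit_dist_def L.emeasure_eq_measure[unfolded limit_dist_def])
  also have "\<dots> \<longleftrightarrow> (AE \<omega> in \<Omega>. star (Y \<omega>) \<in> A)"
  proof -
    have "{\<nu> \<in> space radon_borel. \<nu> \<in> A} = A" using sets.sets_into_space[OF A] by blast
    then show ?thesis unfolding limit_dist_def using A by (intro AE_distr_iff[OF star_Y]) simp
  qed
  finally show ?thesis .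
qed

text \<open>Membership of \<open>star \<mu>\<close> in A is homogeneous, so its indicator is covered
  by \<open>expectation_magnify_Y\<close>. Normalizing before magnifying does not change the
  normalized result.\<close>

lemma scale_invariant_limit_dist: "scale_invariant limit_dist"
  unfolding scale_invariant_def
proof (intro conjI ballI impI allI)
  show "emeasure limit_dist radon_at_origin = 1"
    unfolding limit_dist_eq_1_iff[OF radon_at_origin_borel]
    using AE_Y_origin by eventually_elim (rule star_at_origin)
  fix A :: "(real ^ 'n) measure set" and t :: real assume A: "A \<in> sets radon_borel" "A \<subseteq> radon_at_origin" and t: "t > 0"
  define H :: "(real ^ 'n) measure \<Rightarrow> real" where "H \<mu> = indicator A (star \<mu>)" for \<mu>
  have Hm: "H \<in> borel_measurable radon_borel"
    unfolding H_def using A(1) by (intro measurable_compose[OF star_measurable] borel_measurable_indicator)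
  have Hh: "homogeneous H" unfolding H_def by (rule homogeneous_compose[OF star_homogeneous])
  define B where "B = {\<mu> \<in> radon_at_origin. magnify_star t \<mu> \<in> A}"
  have sm: "(\<lambda>\<mu>. star (magnify t \<mu>)) \<in> measurable radon_borel (radon_borel :: (real ^ 'n) measure measure)"
    by (rule measurable_compose[OF measurable_magnify star_measurable]) simp
  have Beq: "B = radon_at_origin \<inter> ((\<lambda>\<mu>. star (magnify t \<mu>)) -` A \<inter> space radon_borel)"
    unfolding B_def magnify_star_def
    by (auto simp: star_eq radon_at_origin_magnify space_radon_borel radon_at_origin_radon)
  have Bs: "B \<in> sets radon_borel"
    unfolding Beq by (rule sets.Int[OF radon_at_origin_borel measurable_sets[OF sm A(1)]])
  have "expectation (\<lambda>\<omega>. indicator B (star (Y \<omega>))) = expectation (\<lambda>\<omega>. H (magnify t (Y \<omega>)))"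
  proof (rule integral_cong_AE)
    show "(\<lambda>\<omega>. indicator B (star (Y \<omega>)) :: real) \<in> borel_measurable \<Omega>"
      by (rule measurable_compose[OF star_Y borel_measurable_indicator[OF Bs]])
    show "(\<lambda>\<omega>. H (magnify t (Y \<omega>))) \<in> borel_measurable \<Omega>"
      by (rule measurable_compose[OF measurable_magnify[OF Y] Hm])
    show "AE \<omega> in \<Omega>. indicator B (star (Y \<omega>)) = H (magnify t (Y \<omega>))"
      using AE_Y_origin
    proof eventually_elim
      case (elim \<omega>)
      have "star (Y \<omega>) \<in> B \<longleftrightarrow> star (magnify t (Y \<omega>)) \<in> A"
        unfolding B_def magnify_star_def
        using star_at_origin[OF elim] star_magnify_star[OF elim, of t]
        by (simp add: star_eq[symmetric] radon_at_origin_magnify)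
      then show ?case by (simp add: H_def indicator_def)
    qed
  qed
  also have "\<dots> = expectation (\<lambda>\<omega>. H (Y \<omega>))" by (rule expectation_magnify_Y[OF Hm Hh t])
  finally show "emeasure limit_dist {\<mu> \<in> radon_at_origin. magnify_star t \<mu> \<in> A} = emeasure limit_dist A"
    unfolding B_def[symmetric] emeasure_limit_dist[OF Bs] emeasure_limit_dist[OF A(1)] by (simp add: H_def)
qed

text \<open>Mass transport with F the indicator of the exceptional event. The outflow vanishes
  almost surely iff the origin is almost surely good, the inflow iff almost all points within Q are
  good. Both are nonnegative with equal expectations, so they vanish together.\<close>

lemma palm_at_scale:
  assumes A: "A \<in> sets radon_borel" and Q: "0 < Q"
  shows "(AE \<omega> in \<Omega>. star (Y \<omega>) \<in> A) \<longleftrightarrow> (AE \<omega> in \<Omega>. AE z in Y \<omega>. norm z < Q \<longrightarrow> star (translate z (Y \<omega>)) \<in> A)"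
proof -
  \<comment> \<open>The exceptional event as a Borel set of the cube, so that its indicator can
    enter a gauge.\<close>
  define S where "S = {y. star (radon_of y :: (real ^ 'n) measure) \<notin> A}"
  have sr: "(\<lambda>y. star (radon_of y :: (real ^ 'n) measure)) \<in> measurable borel radon_borel"
    by (rule measurable_compose[OF measurable_radon_of star_measurable])
  have S: "S \<in> sets borel"
  proof -
    have "(\<lambda>y. star (radon_of y :: (real ^ 'n) measure)) -` A \<inter> space borel \<in> sets borel" by (rule measurable_sets[OF sr A])
    then have "- ((\<lambda>y. star (radon_of y :: (real ^ 'n) measure)) -` A) \<in> sets borel" by (intro borel_comp) simp
    also have "- ((\<lambda>y. star (radon_of y :: (real ^ 'n) measure)) -` A) = S" by (auto simp: S_def)
    finally show ?thesis .
  qed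
  define F :: "(real ^ 'n) measure \<Rightarrow> real" where "F = gauge (8 * Q) (indicator S)"
  have R: "0 < 8 * Q" using Q by simp
  interpret K: transport_kernel F Q "8 * Q"
    unfolding F_def by (rule transport_kernel_gauge) (use S Q in auto)
  have F: "F \<mu> = (if star \<mu> \<in> A then 0 else 1)" if "\<mu> \<in> radon_measures" "0 < mass_at (8 * Q) \<mu> 0" for \<mu>
    unfolding F_def gauge_def
    using radon_of_Phi[OF nrm_radon[OF that(1)]] homogeneous_nrm[OF star_homogeneous that]
    by (simp add: S_def indicator_def)
  have bal: "expectation (\<lambda>\<omega>. outflow F Q (8 * Q) (Y \<omega>) 0) = expectation (\<lambda>\<omega>. inflow F Q (8 * Q) (Y \<omega>) 0)"
    using balanced_indicator[OF Q S] unfolding balanced_def F_def .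
  have io: "integrable \<Omega> (\<lambda>\<omega>. outflow F Q (8 * Q) (Y \<omega>) 0)"
    by (rule integrable_const_bound[where B = 1])
      (auto intro!: AE_I2 measurable_compose[OF Y K.outflow_0_measurable] simp: K.outflow_bounds Y_radon)
  have ii: "integrable \<Omega> (\<lambda>\<omega>. inflow F Q (8 * Q) (Y \<omega>) 0)"
    by (rule integrable_const_bound[where B = K.inflow_bound])
      (auto intro!: AE_I2 measurable_compose[OF Y K.inflow_0_measurable] simp: K.inflow_bounds Y_radon)
  have "(AE \<omega> in \<Omega>. star (Y \<omega>) \<in> A) \<longleftrightarrow> (AE \<omega> in \<Omega>. outflow F Q (8 * Q) (Y \<omega>) 0 = 0)"
  proof -
    have "AE \<omega> in \<Omega>. (star (Y \<omega>) \<in> A) = (outflow F Q (8 * Q) (Y \<omega>) 0 = 0)"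
      using AE_Y_origin
    proof eventually_elim
      case (elim \<omega>)
      note r = radon_at_origin_radon[OF elim]
      show ?case unfolding K.outflow_eq translate_0[OF r]
        using F[OF r mass_at_pos[OF elim R]] mass_at_pos[OF elim R] mass_at_pos[OF elim Q] by simp
    qed
    then show ?thesis by (rule AE_iff_cong)
  qed
  also have "\<dots> \<longleftrightarrow> expectation (\<lambda>\<omega>. outflow F Q (8 * Q) (Y \<omega>) 0) = 0"
    by (rule integral_nonneg_eq_0_iff_AE[OF io, symmetric]) (simp add: K.outflow_bounds Y_radon)
  also have "\<dots> \<longleftrightarrow> (AE \<omega> in \<Omega>. inflow F Q (8 * Q) (Y \<omega>) 0 = 0)"
    unfolding bal by (rule integral_nonneg_eq_0_iff_AE[OF ii]) (simp add: K.inflow_bounds Y_radon)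
  also have "\<dots> \<longleftrightarrow> (AE \<omega> in \<Omega>. AE z in Y \<omega>. norm z < Q \<longrightarrow> star (translate z (Y \<omega>)) \<in> A)"
  proof (rule AE_cong)
    fix \<omega> assume "\<omega> \<in> space \<Omega>"
    then have r: "Y \<omega> \<in> radon_measures" by (rule Y_radon)
    have "inflow F Q (8 * Q) (Y \<omega>) 0 = 0 \<longleftrightarrow> (AE z in Y \<omega>. transport F Q (8 * Q) (Y \<omega>) z 0 = 0)"
      unfolding inflow_def by (rule integral_nonneg_eq_0_iff_AE[OF K.transport_integrable_in[OF r]]) (simp add: K.transport_nonneg)
    also have "\<dots> \<longleftrightarrow> (AE z in Y \<omega>. norm z < Q \<longrightarrow> star (translate z (Y \<omega>)) \<in> A)"
    proof -
      have "AE z in Y \<omega>. (transport F Q (8 * Q) (Y \<omega>) z 0 = 0) = (norm z < Q \<longrightarrow> star (translate z (Y \<omega>)) \<in> A)"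
        using AE_spt[OF r]
      proof eventually_elim
        case (elim z)
        have pos: "0 < mass_at (8 * Q) (translate z (Y \<omega>)) 0" by (rule mass_at_pos[OF elim R])
        have pos': "0 < mass_at (8 * Q) (Y \<omega>) z" using pos by (simp add: mass_at_translate[OF r])
        have "nbump Q (0 - z) = 0 \<longleftrightarrow> \<not> norm z < Q"
          using nbump_pos[OF Q, of "0 - z"] nbump_outside[OF Q, of "0 - z"] by (cases "norm z < Q") auto
        then show ?case unfolding transport_def F[OF radon_translate[OF r] pos] using pos' by simp
      qed
      then show ?thesis by (rule AE_iff_cong)
    qed
    finally show "inflow F Q (8 * Q) (Y \<omega>) 0 = 0 \<longleftrightarrow> (AE z in Y \<omega>. norm z < Q \<longrightarrow> star (translate z (Y \<omega>)) \<in> A)" .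
  qed
  finally show ?thesis .
qed

text \<open>\<open>palm_at_scale\<close> at a single scale gives the conclusion at the origin; the
  converse uses all integer scales to exhaust the space.\<close>

lemma quasi_palm_limit_dist: "quasi_palm limit_dist"
  unfolding quasi_palm_def
proof
  fix A assume A: "A \<in> sets (radon_borel :: (real ^ 'n) measure measure)"
  have "(AE \<nu> in limit_dist. AE z in \<nu>. translate_star z \<nu> \<in> A) \<longleftrightarrow> (AE \<nu> in limit_dist. AE z in \<nu>. star (translate z \<nu>) \<in> A)"
    by (rule AE_cong, rule AE_translate_star) (simp add: limit_dist_def space_radon_borel)
  also have "\<dots> \<longleftrightarrow> (AE \<omega> in \<Omega>. AE z in star (Y \<omega>). star (translate z (star (Y \<omega>))) \<in> A)"
    unfolding limit_dist_def by (rule AE_distr_iff[OF star_Y AE_star_translate_borel[OF A]])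
  \<comment> \<open>Normalizing Y multiplies it by a positive constant, which changes neither its
    null sets nor \<open>star\<close> of its translates.\<close>
  also have "\<dots> \<longleftrightarrow> (AE \<omega> in \<Omega>. AE z in Y \<omega>. star (translate z (Y \<omega>)) \<in> A)"
  proof -
    have "AE \<omega> in \<Omega>. (AE z in star (Y \<omega>). star (translate z (star (Y \<omega>))) \<in> A) = (AE z in Y \<omega>. star (translate z (Y \<omega>)) \<in> A)"
      using AE_Y_origin
    proof eventually_elim
      case (elim \<omega>)
      note r = radon_at_origin_radon[OF elim]
      obtain c where c: "c > 0" "star (Y \<omega>) = scale_measure (ennreal c) (Y \<omega>)" using star_scale_pos[OF elim] by blast
      show ?case unfolding c(2) AE_scale_measure[OF c(1)] translate_scale[OF r]
        homogeneousD[OF star_homogeneous radon_translate[OF r] c(1)] ..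
    qed
    then show ?thesis by (rule AE_iff_cong)
  qed
  also have "\<dots> \<longleftrightarrow> (AE \<omega> in \<Omega>. star (Y \<omega>) \<in> A)"
  proof
    assume "AE \<omega> in \<Omega>. AE z in Y \<omega>. star (translate z (Y \<omega>)) \<in> A"
    then have "AE \<omega> in \<Omega>. AE z in Y \<omega>. norm z < 1 \<longrightarrow> star (translate z (Y \<omega>)) \<in> A"
      by (rule eventually_mono) (erule eventually_mono, simp)
    then show "AE \<omega> in \<Omega>. star (Y \<omega>) \<in> A" using palm_at_scale[OF A zero_less_one] by blast
  next
    assume "AE \<omega> in \<Omega>. star (Y \<omega>) \<in> A"
    then have "AE \<omega> in \<Omega>. AE z in Y \<omega>. norm z < real (Suc n) \<longrightarrow> star (translate z (Y \<omega>)) \<in> A" for n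
      using palm_at_scale[OF A, of "real (Suc n)"] by simp
    then have "AE \<omega> in \<Omega>. \<forall>n. AE z in Y \<omega>. norm z < real (Suc n) \<longrightarrow> star (translate z (Y \<omega>)) \<in> A"
      by (simp add: AE_all_countable)
    then show "AE \<omega> in \<Omega>. AE z in Y \<omega>. star (translate z (Y \<omega>)) \<in> A"
    proof eventually_elim
      case (elim \<omega>)
      then have "AE z in Y \<omega>. \<forall>n. norm z < real (Suc n) \<longrightarrow> star (translate z (Y \<omega>)) \<in> A"
        unfolding AE_all_countable .
      then show ?case
      proof eventually_elim
        case (elim z)
        obtain n :: nat where "norm z < real n" using reals_Archimedean2 by blast
        then have "norm z < real (Suc n)" by simp
        then show ?case using elim by blast
      qed
    qed
  qed
  finally show "emeasure limit_dist A = 1 \<longleftrightarrow> (AE \<nu> in limit_dist. AE z in \<nu>. translate_star z \<nu> \<in> A)"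
    unfolding limit_dist_eq_1_iff[OF A] ..
qed

theorem limit_dist_extended_fractal: "limit_dist \<in> extended_fractal_distributions"
  unfolding extended_fractal_distributions_def prob_measures_def
  using prob_space_limit_dist scale_invariant_limit_dist quasi_palm_limit_dist by (simp add: limit_dist_def)

end

section \<open>Distributions on the cube\<close>

lemma topspace_weak: "topspace (weak_topology X) = prob_measures X"
proof -
  have "{P \<in> prob_measures X. (\<integral>x. (\<lambda>_. 0) x \<partial>P) \<in> (UNIV :: real set)} \<in> {{P \<in> prob_measures X. (\<integral>x. f x \<partial>P) \<in> U} | f U.
        continuous_map X euclideanreal f \<and> bounded (f ` topspace X) \<and> open (U :: real set)}"
    by (intro CollectI exI[of _ "\<lambda>_. 0"] exI[of _ UNIV]) (auto intro: bounded_subset[of "{0}"])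
  then show ?thesis unfolding weak_topology_def topology_generated_by_topspace by auto
qed

lemma openin_weak:
  assumes "continuous_map X euclideanreal f" "bounded (f ` topspace X)" "open U"
  shows "openin (weak_topology X) {P \<in> prob_measures X. (\<integral>x. f x \<partial>P) \<in> U}"
  unfolding weak_topology_def using assms by (intro topology_generated_by_Basis) blast

text \<open>Views a measure on the subspace \<open>unit_box\<close> as a Borel measure on the whole
  space, so that \<open>Phi\<close> and vague convergence apply to it.\<close>

definition box_embed :: "(real ^ 'n) measure \<Rightarrow> (real ^ 'n) measure" where
  "box_embed \<eta> = distr \<eta> borel (\<lambda>x. x)"

abbreviation box_measures :: "(real ^ 'n) measure set" where
  "box_measures \<equiv> prob_measures (top_of_set unit_box)"

abbreviation box_borel :: "(real ^ 'n) measure measure" where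
  "box_borel \<equiv> borel_of box_topology"

lemma sets_borel_of_subspace:
  fixes S :: "'a::topological_space set"
  assumes "S \<in> sets borel" shows "sets (borel_of (top_of_set S)) = sets (restrict_space borel S)"
proof -
  have "sets (restrict_space borel S) = (\<inter>) S ` sigma_sets UNIV {U. open U}"
    by (simp add: sets_restrict_space borel_def)
  also have "\<dots> = sigma_sets S ((\<inter>) S ` {U. open U})" by (rule sigma_sets_Int) (use assms in \<open>auto simp: borel_def\<close>)
  also have "(\<inter>) S ` {U. open U} = {U. openin (top_of_set S) U}" by (auto simp: openin_open)
  finally show ?thesis by (simp add: sets_borel_of)
qed

lemma box_measures_iff: "\<eta> \<in> box_measures \<longleftrightarrow> prob_space \<eta> \<and> sets \<eta> = sets (restrict_space borel unit_box)"
  by (simp add: prob_measures_def sets_borel_of_subspace[OF unit_box_borel])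

lemma box_measurable_id: "\<eta> \<in> box_measures \<Longrightarrow> (\<lambda>x. x) \<in> measurable \<eta> borel"
  unfolding box_measures_iff by (subst measurable_cong_sets[OF _ refl, of _ "restrict_space borel unit_box"])
    (auto intro: measurable_restrict_space1)

lemma space_box_measure: "\<eta> \<in> box_measures \<Longrightarrow> space \<eta> = unit_box"
  unfolding box_measures_iff using sets_eq_imp_space_eq[of \<eta> "restrict_space borel unit_box"]
  by (simp add: space_restrict_space)

lemma box_embed_radon:
  fixes \<eta> :: "(real ^ 'n) measure"
  assumes "\<eta> \<in> box_measures" shows "box_embed \<eta> \<in> radon_measures"
proof -
  have "prob_space (box_embed \<eta>)"
    unfolding box_embed_def using assms box_measurable_id[OF assms] by (intro prob_space.prob_space_distr) (auto simp: box_measures_iff)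
  then have "emeasure (box_embed \<eta>) A < \<infinity>" for A
    using prob_space.emeasure_le_1[of "box_embed \<eta>" A] by (simp add: order_le_less_trans)
  then show ?thesis unfolding radon_measures_iff by (simp add: box_embed_def)
qed

lemma integral_box_embed:
  fixes f :: "real ^ 'n \<Rightarrow> real"
  assumes "\<eta> \<in> box_measures" "f \<in> borel_measurable borel"
  shows "(\<integral>x. f x \<partial>box_embed \<eta>) = (\<integral>x. f x \<partial>\<eta>)"
  unfolding box_embed_def by (rule integral_distr[OF box_measurable_id[OF assms(1)] assms(2)])

text \<open>Tietze extension, cut off by a test function that is 1 on the cube.\<close>

lemma cc_extension:
  fixes f :: "real ^ 'n \<Rightarrow> real"
  assumes "continuous_on unit_box f"
  obtains g where "cc g" "\<And>x. x \<in> unit_box \<Longrightarrow> g x = f x"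
proof -
  obtain g where g: "continuous_on UNIV g" "\<And>x. x \<in> unit_box \<Longrightarrow> g x = f x"
    using Tietze_unbounded[OF assms, of UNIV] closed_unit_box by (metis closed_closedin subtopology_UNIV)
  obtain b where b: "\<forall>x\<in>(unit_box :: (real ^ 'n) set). norm x \<le> b" using bounded_unit_box unfolding bounded_iff by blast
  obtain k where k: "\<And>x :: real ^ 'n. norm x \<le> b \<Longrightarrow> test k x = 1" using test_eq_1_on_cball by blast
  show ?thesis
    by (rule that[of "\<lambda>x. g x * test k x"]) (use cc_mult_left[OF cc_test g(1)] g(2) b k in auto)
qed

text \<open>The same embedding argument as for Radon measures. Weak convergence on the cube follows
  from vague convergence because functions on the cube extend to compactly supported ones.\<close>

lemma openin_boxE:
  fixes U :: "(real ^ 'n) measure set"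
  assumes "openin box_topology U"
  obtains V where "open V" "U = {\<eta> \<in> box_measures. Phi (box_embed \<eta>) \<in> V}"
proof (rule sequential_embedding_openE[where \<phi> = "\<lambda>\<eta>. Phi (box_embed \<eta>)" and M = box_measures,
    OF assms[unfolded box_topology_def weak_topology_def]])
  fix s \<eta> and X :: "nat \<Rightarrow> (real ^ 'n) measure"
  assume "s \<in> {{\<eta> \<in> box_measures. (\<integral>x. f x \<partial>\<eta>) \<in> U} | f U.
      continuous_map (top_of_set (unit_box :: (real ^ 'n) set)) euclideanreal f
      \<and> bounded (f ` topspace (top_of_set unit_box)) \<and> open (U :: real set)}"
  then obtain f O' where s: "s = {\<eta> \<in> box_measures. (\<integral>x. f x \<partial>\<eta>) \<in> O'}"
    and f': "continuous_map (top_of_set (unit_box :: (real ^ 'n) set)) euclideanreal f" and O': "open O'"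
    by blast
  have f: "continuous_on (unit_box :: (real ^ 'n) set) f" using f' by simp
  obtain g where g: "cc g" "\<And>x. x \<in> unit_box \<Longrightarrow> g x = f x" by (rule cc_extension[OF f]) (rule that)
  have fg: "(\<integral>x. f x \<partial>\<eta>) = (\<integral>x. g x \<partial>box_embed \<eta>)" if "\<eta> \<in> box_measures" for \<eta>
    unfolding integral_box_embed[OF that cc_borel[OF g(1)]]
    by (rule Bochner_Integration.integral_cong) (auto simp: space_box_measure[OF that] g(2))
  assume \<eta>: "\<eta> \<in> s" and X: "\<And>i. X i \<in> box_measures" and lim: "(\<lambda>i. Phi (box_embed (X i))) \<longlonglongrightarrow> Phi (box_embed \<eta>)"
  have \<eta>b: "\<eta> \<in> box_measures" using \<eta> s by blast
  have "vconv (\<lambda>i. box_embed (X i)) (box_embed \<eta>)" by (rule Phi_vconv[OF box_embed_radon[OF X] box_embed_radon[OF \<eta>b] lim])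
  then have "(\<lambda>i. \<integral>x. f x \<partial>X i) \<longlonglongrightarrow> (\<integral>x. f x \<partial>\<eta>)" using g(1) by (simp add: vconv_def fg[OF X] fg[OF \<eta>b])
  then have "eventually (\<lambda>i. (\<integral>x. f x \<partial>X i) \<in> O') sequentially"
    by (rule topological_tendstoD[OF _ O']) (use \<eta> s in blast)
  then obtain i where "(\<integral>x. f x \<partial>X i) \<in> O'"
    unfolding eventually_sequentially by blast
  then show "\<exists>i. X i \<in> s" using X unfolding s by blast
qed (use that in \<open>(assumption | blast)+\<close>)

lemma topspace_box: "topspace box_topology = box_measures"
  unfolding box_topology_def by (rule topspace_weak)

lemma space_box_borel: "space box_borel = box_measures"
  by (simp add: space_borel_of topspace_box)

lemma openin_box_integral:
  assumes "cc f" "open U" shows "openin box_topology {\<eta> \<in> box_measures. (\<integral>x. f x \<partial>box_embed \<eta>) \<in> U}"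
proof -
  obtain B where "B > 0" and B: "\<And>x. \<bar>f x\<bar> \<le> B" by (rule cc_bounded[OF assms(1)]) (rule that)
  have "{\<eta> \<in> box_measures. (\<integral>x. f x \<partial>box_embed \<eta>) \<in> U} = {\<eta> \<in> box_measures. (\<integral>x. f x \<partial>\<eta>) \<in> U}"
    using integral_box_embed[OF _ cc_borel[OF assms(1)]] by auto
  moreover have "openin box_topology {\<eta> \<in> box_measures. (\<integral>x. f x \<partial>\<eta>) \<in> U}"
    unfolding box_topology_def
  proof (rule openin_weak[OF _ _ assms(2)])
    show "bounded (f ` topspace (top_of_set unit_box))" unfolding bounded_iff using B by auto
    show "continuous_map (top_of_set unit_box) euclideanreal f"
      using continuous_on_subset[OF cc_continuous[OF assms(1)]] by simp
  qed
  ultimately show ?thesis by simp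
qed

lemma continuous_map_box_integral:
  assumes "cc f" shows "continuous_map box_topology euclideanreal (\<lambda>\<eta>. \<integral>x. f x \<partial>box_embed \<eta>)"
  unfolding continuous_map_def topspace_box using openin_box_integral[OF assms] by simp

lemma continuous_map_Phi_box: "continuous_map box_topology euclidean (\<lambda>\<eta>. Phi (box_embed \<eta>))"
proof -
  have "continuous_map box_topology euclideanreal (\<lambda>\<eta>. Phi (box_embed \<eta>) k)" for k
  proof -
    \<comment> \<open>The absolute value makes the quotient continuous on the whole line and changes
      nothing at the nonnegative integrals inserted into it.\<close>
    have "continuous_map euclideanreal euclideanreal (\<lambda>t. t / (1 + \<bar>t\<bar>))"
      unfolding continuous_map_iff_continuous2 by (intro continuous_intros) (simp add: add_nonneg_eq_0_iff)
    from continuous_map_compose[OF continuous_map_box_integral[OF cc_test[of k]] this]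
    show ?thesis unfolding comp_def Phi_def by (simp add: Bochner_Integration.integral_nonneg)
  qed
  then show ?thesis unfolding euclidean_product_topology[symmetric] continuous_map_componentwise_UNIV by blast
qed

lemma measurable_Phi_box: "(\<lambda>\<eta>. Phi (box_embed \<eta>)) \<in> borel_measurable (box_borel :: (real ^ 'n) measure measure)"
proof (rule borel_measurableI)
  fix V :: "(nat \<Rightarrow> real) set" assume "open V"
  then have "openin box_topology {\<eta> \<in> topspace (box_topology :: (real ^ 'n) measure topology). Phi (box_embed \<eta>) \<in> V}"
    by (intro openin_continuous_map_preimage[OF continuous_map_Phi_box]) simp
  then have "{\<eta> \<in> topspace (box_topology :: (real ^ 'n) measure topology). Phi (box_embed \<eta>) \<in> V} \<in> sets box_borel"
    unfolding sets_borel_of by (intro sigma_sets.Basic) simp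
  also have "{\<eta> \<in> topspace (box_topology :: (real ^ 'n) measure topology). Phi (box_embed \<eta>) \<in> V} = (\<lambda>\<eta>. Phi (box_embed \<eta>)) -` V \<inter> space box_borel"
    unfolding space_box_borel topspace_box by blast
  finally show "(\<lambda>\<eta> :: (real ^ 'n) measure. Phi (box_embed \<eta>)) -` V \<inter> space box_borel \<in> sets box_borel" .
qed

lemma measurable_into_box_borel:
  assumes "\<And>\<omega>. \<omega> \<in> space M \<Longrightarrow> X \<omega> \<in> box_measures" "(\<lambda>\<omega>. Phi (box_embed (X \<omega>))) \<in> borel_measurable M"
  shows "X \<in> measurable M box_borel"
proof (rule measurable_into_borel_of[where \<phi> = "\<lambda>\<eta>. Phi (box_embed \<eta>)"])
  show "\<exists>V. open V \<and> U = {\<eta> \<in> topspace box_topology. Phi (box_embed \<eta>) \<in> V}" if "openin box_topology U" for U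
    using openin_boxE[OF that] unfolding topspace_box by metis
qed (simp_all add: assms topspace_box)

text \<open>Every open set of distributions on the cube is a preimage under the coding map, so the
  law of the code determines the distribution.\<close>

lemma box_distribution_eqI:
  fixes Q Q' :: "(real ^ 'n) measure measure"
  assumes Q: "Q \<in> prob_measures box_topology" "Q' \<in> prob_measures box_topology"
    and gen: "Int_stable (range A)" "\<And>k. open (A k)" "sets borel = sigma_sets UNIV (range A)" "UNIV \<in> range A"
    and eq: "\<And>k n. (\<integral>\<eta>. plateau (A k) n (Phi (box_embed \<eta>)) \<partial>Q) = (\<integral>\<eta>. plateau (A k) n (Phi (box_embed \<eta>)) \<partial>Q')"
  shows "Q = Q'"
proof -
  let ?P = "\<lambda>\<eta> :: (real ^ 'n) measure. Phi (box_embed \<eta>)"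
  have p: "prob_space Q" "prob_space Q'" and s: "sets Q = sets box_borel" "sets Q' = sets box_borel"
    using Q by (auto simp: prob_measures_def)
  have m: "?P \<in> borel_measurable Q" "?P \<in> borel_measurable Q'"
    using measurable_Phi_box by (simp_all cong: measurable_cong_sets add: measurable_cong_sets[OF s(1) refl] measurable_cong_sets[OF s(2) refl])
  have d: "distr Q borel ?P = distr Q' borel ?P"
    by (rule prob_eq_of_plateau[OF _ _ _ _ gen])
      (use p m eq in \<open>auto intro: prob_space.prob_space_distr simp: integral_distr[OF m(1)] integral_distr[OF m(2)]\<close>)
  show ?thesis
  proof (rule measure_eqI_generator_eq[where E = "{U. openin box_topology U}" and \<Omega> = box_measures and A = "\<lambda>_. box_measures"])
    show "Int_stable {U. openin box_topology U}" by (auto simp: Int_stable_def)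
    show "{U. openin box_topology U} \<subseteq> Pow box_measures" unfolding topspace_box[symmetric] by (auto dest: openin_subset)
    show "sets Q = sigma_sets box_measures {U. openin box_topology U}" "sets Q' = sigma_sets box_measures {U. openin box_topology U}"
      unfolding s sets_borel_of topspace_box by simp_all
    show "range (\<lambda>_. box_measures) \<subseteq> {U. openin box_topology U}" unfolding topspace_box[symmetric] by auto
    show "emeasure Q box_measures \<noteq> \<infinity>"
      using prob_space.emeasure_le_1[OF p(1), of box_measures] by (auto simp: top_unique)
    fix U :: "(real ^ 'n) measure set" assume "U \<in> {U. openin box_topology U}"
    then obtain V where V: "open V" "U = {\<eta> \<in> box_measures. Phi (box_embed \<eta>) \<in> V}" using openin_boxE by blast
    have sp: "space Q = box_measures" "space Q' = box_measures"
      using sets_eq_imp_space_eq[OF s(1)] sets_eq_imp_space_eq[OF s(2)] by (simp_all add: space_box_borel)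
    have "emeasure (distr Q borel ?P) V = emeasure Q U" "emeasure (distr Q' borel ?P) V = emeasure Q' U"
      using V m by (simp_all add: emeasure_distr sp vimage_def Int_def conj_commute)
    then show "emeasure Q U = emeasure Q' U" using d by simp
  qed auto
qed

section \<open>Restriction to the cube as a measurable map\<close>

text \<open>The set to which \<open>box_distr\<close> restricts a distribution.\<close>

definition charging :: "(real ^ 'n) measure set" where
  "charging = {\<mu> \<in> radon_measures. emeasure \<mu> unit_box > 0}"

lemma charging_radon: "\<mu> \<in> charging \<Longrightarrow> \<mu> \<in> radon_measures"
  and origin_charging: "\<mu> \<in> radon_at_origin \<Longrightarrow> \<mu> \<in> charging"
  using unit_box_mass[of \<mu>] by (auto simp: charging_def radon_at_origin_radon)

lemma charging_borel [measurable]: "(charging :: (real ^ 'n) measure set) \<in> sets radon_borel"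
proof -
  have "{\<mu> \<in> space radon_borel. emeasure \<mu> (unit_box :: (real ^ 'n) set) > 0} \<in> sets radon_borel"
    using emeasure_radon_measurable[of "\<lambda>\<mu>. \<mu>", OF _ unit_box_borel] by measurable
  then show ?thesis by (simp add: charging_def space_radon_borel)
qed

lemma charging_mass:
  fixes \<mu> :: "(real ^ 'n) measure"
  assumes "\<mu> \<in> charging"
  shows "emeasure \<mu> unit_box = ennreal (measure \<mu> unit_box)" "0 < measure \<mu> unit_box"
    and "box_normalize \<mu> = scale_measure (ennreal (1 / measure \<mu> unit_box)) (restrict_space \<mu> unit_box)"
proof -
  have "emeasure \<mu> unit_box < \<infinity>" using radon_emeasure_bounded[OF charging_radon[OF assms] bounded_unit_box] .
  then show e: "emeasure \<mu> unit_box = ennreal (measure \<mu> unit_box)" by (intro emeasure_eq_ennreal_measure) simp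
  show p: "0 < measure \<mu> unit_box" using assms e unfolding charging_def by simp
  have "1 / emeasure \<mu> unit_box = ennreal (1 / measure \<mu> unit_box)"
    unfolding e using p by (subst divide_ennreal[symmetric]) simp_all
  then show "box_normalize \<mu> = scale_measure (ennreal (1 / measure \<mu> unit_box)) (restrict_space \<mu> unit_box)"
    by (simp add: box_normalize_def)
qed

lemma box_normalize_box:
  fixes \<mu> :: "(real ^ 'n) measure"
  assumes "\<mu> \<in> charging" shows "box_normalize \<mu> \<in> box_measures"
proof -
  note m = charging_mass[OF assms] and r = charging_radon[OF assms]
  have "emeasure (restrict_space \<mu> unit_box) unit_box = emeasure \<mu> unit_box"
    by (rule emeasure_restrict_space) (auto simp: radon_space[OF r] radon_sets[OF r])
  then have "emeasure (box_normalize \<mu>) unit_box = ennreal (1 / measure \<mu> unit_box) * ennreal (measure \<mu> unit_box)"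
    unfolding m(3) using m(1) by simp
  also have "\<dots> = 1" using m(2) by (subst ennreal_mult[symmetric]) auto
  finally have "emeasure (box_normalize \<mu>) (space (box_normalize \<mu>)) = 1"
    by (simp add: box_normalize_def space_scale_measure space_restrict_space radon_space[OF r])
  then show ?thesis unfolding box_measures_iff
    by (auto intro!: prob_spaceI simp: box_normalize_def sets_restrict_space radon_sets[OF r])
qed

lemma integral_box_normalize:
  fixes f :: "real ^ 'n \<Rightarrow> real"
  assumes "\<mu> \<in> charging" "f \<in> borel_measurable borel"
  shows "(\<integral>x. f x \<partial>box_embed (box_normalize \<mu>)) = (\<integral>x. indicator unit_box x * f x \<partial>\<mu>) / measure \<mu> unit_box"
proof -
  note m = charging_mass[OF assms(1)] and r = charging_radon[OF assms(1)]
  have fm: "f \<in> borel_measurable (restrict_space \<mu> unit_box)"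
    by (rule measurable_restrict_space1[OF borel_to_radon_measurable[OF r assms(2)]])
  have "(\<integral>x. f x \<partial>box_embed (box_normalize \<mu>)) = (1 / measure \<mu> unit_box) * (\<integral>x. f x \<partial>restrict_space \<mu> unit_box)"
    unfolding integral_box_embed[OF box_normalize_box[OF assms(1)] assms(2)] unfolding m(3)
    by (rule integral_scale_measure[OF _ fm]) simp
  also have "(\<integral>x. f x \<partial>restrict_space \<mu> unit_box) = (\<integral>x. indicator unit_box x *\<^sub>R f x \<partial>\<mu>)"
    by (rule integral_restrict_space) (simp add: radon_sets[OF r] radon_space[OF r])
  finally show ?thesis by simp
qed

lemma box_normalize_measurable:
  "box_normalize \<in> measurable (restrict_space radon_borel charging) (box_borel :: (real ^ 'n) measure measure)"
proof (rule measurable_into_box_borel)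
  let ?M = "restrict_space radon_borel charging :: (real ^ 'n) measure measure"
  have sp: "\<mu> \<in> charging" if "\<mu> \<in> space ?M" for \<mu> using that by (simp add: space_restrict_space)
  show "box_normalize \<mu> \<in> box_measures" if "\<mu> \<in> space ?M" for \<mu> using box_normalize_box[OF sp[OF that]] .
  have id: "(\<lambda>\<mu>. \<mu>) \<in> measurable ?M radon_borel" by (rule measurable_restrict_space1) simp
  have me: "(\<lambda>\<mu>. measure \<mu> unit_box) \<in> borel_measurable ?M"
    unfolding measure_def using emeasure_radon_measurable[OF id unit_box_borel] by measurable
  have "(\<lambda>\<mu>. \<integral>x. test k x \<partial>box_embed (box_normalize \<mu>)) \<in> borel_measurable ?M" for k
  proof (subst measurable_cong)
    show "(\<integral>x. test k x \<partial>box_embed (box_normalize \<mu>)) = (\<integral>x. indicator unit_box x * test k x \<partial>\<mu>) / measure \<mu> unit_box"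
      if "\<mu> \<in> space ?M" for \<mu>
      by (rule integral_box_normalize[OF sp[OF that] cc_borel[OF cc_test]])
    have t [measurable]: "test k \<in> borel_measurable (borel :: (real ^ 'n) measure)" by (rule cc_borel[OF cc_test])
    have "(\<lambda>\<mu>. \<integral>x. indicator unit_box x * test k x \<partial>\<mu>) \<in> borel_measurable ?M"
      by (rule integral_radon_measurable[OF id]) simp_all
    then show "(\<lambda>\<mu>. (\<integral>x. indicator unit_box x * test k x \<partial>\<mu>) / measure \<mu> unit_box) \<in> borel_measurable ?M"
      using me by (rule borel_measurable_divide)
  qed
  then show "(\<lambda>\<mu>. Phi (box_embed (box_normalize \<mu>))) \<in> borel_measurable ?M"
    unfolding Phi_def
    by (intro measurable_coordinatewise_then_product borel_measurable_divide borel_measurable_add borel_measurable_const)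
qed

text \<open>The value 0 off \<open>charging\<close> turns integrals over the restricted space in
  \<open>box_distr\<close> into integrals over all of P.\<close>

definition box_functional :: "((nat \<Rightarrow> real) \<Rightarrow> real) \<Rightarrow> (real ^ 'n) measure \<Rightarrow> real" where
  "box_functional G \<mu> = (if \<mu> \<in> charging then G (Phi (box_embed (box_normalize \<mu>))) else 0)"

lemma box_functional_measurable:
  assumes "G \<in> borel_measurable borel"
  shows "box_functional G \<in> borel_measurable (radon_borel :: (real ^ 'n) measure measure)"
proof -
  have "(\<lambda>\<mu>. G (Phi (box_embed (box_normalize \<mu>)))) \<in> borel_measurable (restrict_space radon_borel (charging :: (real ^ 'n) measure set))"
    by (rule measurable_compose[OF measurable_compose[OF box_normalize_measurable measurable_Phi_box] assms])
  then show ?thesis unfolding box_functional_def[abs_def]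
    by (subst (asm) measurable_restrict_space_iff[where c = 0]) (simp_all add: charging_borel sets.Int_space_eq2)
qed

context fractal_dist begin

lemma emeasure_charging: "emeasure P charging = 1"
proof -
  interpret prob_space P using P by (simp add: extended_fractal_distributions_def prob_measures_def)
  have "AE \<mu> in P. \<mu> \<in> charging" using AE_at_origin by eventually_elim (rule origin_charging)
  then have "prob charging = 1" by (subst prob_eq_1) (simp_all add: sets_P charging_borel)
  then show ?thesis by (simp add: emeasure_eq_measure)
qed

lemma box_distr_eq: "box_distr P = distr (restrict_space P charging) box_borel box_normalize"
  by (simp add: box_distr_def charging_def)

lemma box_normalize_measurable_P: "box_normalize \<in> measurable (restrict_space P charging) box_borel"
proof -
  have "sets (restrict_space P charging) = sets (restrict_space radon_borel charging)"
    by (rule sets_restrict_space_cong[OF sets_P])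
  then show ?thesis using box_normalize_measurable by (simp cong: measurable_cong_sets)
qed

lemma box_distr_prob: "box_distr P \<in> prob_measures box_topology"
proof -
  have "prob_space (restrict_space P charging)"
    by (rule prob_space_restrict_space[OF _ emeasure_charging]) (simp add: sets_P charging_borel)
  then show ?thesis unfolding prob_measures_def box_distr_eq
    by (simp add: prob_space.prob_space_distr[OF _ box_normalize_measurable_P])
qed

lemma integral_box_distr:
  assumes G: "G \<in> borel_measurable borel"
  shows "(\<integral>\<eta>. G (Phi (box_embed \<eta>)) \<partial>box_distr P) = (\<integral>\<mu>. box_functional G \<mu> \<partial>P)"
proof -
  have "(\<integral>\<eta>. G (Phi (box_embed \<eta>)) \<partial>box_distr P) = (\<integral>\<mu>. G (Phi (box_embed (box_normalize \<mu>))) \<partial>restrict_space P charging)"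
    unfolding box_distr_eq by (rule integral_distr[OF box_normalize_measurable_P measurable_compose[OF measurable_Phi_box G]])
  also have "\<dots> = (\<integral>\<mu>. indicator charging \<mu> *\<^sub>R G (Phi (box_embed (box_normalize \<mu>))) \<partial>P)"
    by (rule integral_restrict_space) (simp add: sets_P charging_borel)
  also have "\<dots> = (\<integral>\<mu>. box_functional G \<mu> \<partial>P)"
    by (rule Bochner_Integration.integral_cong) (simp_all add: box_functional_def)
  finally show ?thesis .
qed

end

section \<open>The boundary of the cube and convergence of restrictions\<close>

definition box_boundary :: "(real ^ 'n) set" where
  "box_boundary = {x. infnorm x = 1}"

lemma open_box: "open {x :: real ^ 'n. infnorm x < 1}"
  by (intro open_Collect_less continuous_intros)

lemma box_boundary_borel [measurable]: "(box_boundary :: (real ^ 'n) set) \<in> sets borel"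
  unfolding box_boundary_def by (intro borel_closed closed_Collect_eq continuous_intros)

lemma unit_box_split: "unit_box = {x :: real ^ 'n. infnorm x < 1} \<union> box_boundary"
  by (auto simp: unit_box_def box_boundary_def)

text \<open>A portmanteau argument: the indicator of the cube lies between the plateaus of its
  interior and one minus the plateaus of its exterior. Both bounds converge to the same integral if
  the boundary is null.\<close>

lemma box_integral_tendsto:
  fixes f :: "real ^ 'n \<Rightarrow> real"
  assumes X: "\<And>i. X i \<in> radon_measures" and \<mu>: "\<mu> \<in> radon_measures" and conv: "vconv X \<mu>"
    and null: "emeasure \<mu> box_boundary = 0" and f: "cc f" "\<And>x. 0 \<le> f x"
  shows "(\<lambda>i. \<integral>x. indicator unit_box x * f x \<partial>X i) \<longlonglongrightarrow> (\<integral>x. indicator unit_box x * f x \<partial>\<mu>)"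
proof -
  define U where "U = {x :: real ^ 'n. infnorm x < 1}"
  have oU: "open U" unfolding U_def by (rule open_box)
  have UB: "U \<subseteq> unit_box" by (auto simp: U_def unit_box_def)
  have nU: "U \<noteq> UNIV" using UB bounded_unit_box bounded_subset not_bounded_UNIV by metis
  have oB: "open (- unit_box :: (real ^ 'n) set)" by (rule open_Compl[OF closed_unit_box])
  have "(0 :: real ^ 'n) \<in> unit_box" by (simp add: unit_box_def infnorm_0)
  then have nB: "(- unit_box :: (real ^ 'n) set) \<noteq> UNIV" by blast
  define lower where "lower n x = plateau U n x * f x" for n x
  define upper where "upper n x = (1 - plateau (- unit_box) n x) * f x" for n x
  have ccl: "cc (lower n)" and ccu: "cc (upper n)" for n
    unfolding lower_def[abs_def] upper_def[abs_def] by (intro cc_mult_left[OF f(1)] continuous_intros)+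
  have fi [measurable]: "f \<in> borel_measurable borel" by (rule cc_borel[OF f(1)])
  have le: "lower n x \<le> indicator unit_box x * f x" "indicator unit_box x * f x \<le> upper n x" for n x
  proof -
    have "indicator U x \<le> (indicator unit_box x :: real)" using UB by (auto simp: indicator_def)
    then have "plateau U n x \<le> indicator unit_box x"
      by (rule order_trans[OF plateau_le_indicator])
    then show "lower n x \<le> indicator unit_box x * f x" unfolding lower_def by (rule mult_right_mono[OF _ f(2)])
    have "indicator unit_box x \<le> 1 - plateau (- unit_box) n x"
      using plateau_le_indicator[of "- unit_box" n x] by (auto simp: indicator_def split: if_splits)
    then show "indicator unit_box x * f x \<le> upper n x" unfolding upper_def by (rule mult_right_mono[OF _ f(2)])
  qed
  have bi: "integrable \<nu> (\<lambda>x. indicator unit_box x * f x)" if "\<nu> \<in> radon_measures" for \<nu> :: "(real ^ 'n) measure"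
    by (rule Bochner_Integration.integrable_bound[OF radon_integrable[OF that f(1)]])
      (use f(2) in \<open>auto intro!: borel_to_radon_measurable[OF that] simp: indicator_def\<close>)
  have AEb: "AE x in \<mu>. x \<notin> box_boundary"
    by (rule AE_not_in) (simp add: null_sets_def null radon_sets[OF \<mu>])
  have l: "(\<lambda>n. \<integral>x. lower n x \<partial>\<mu>) \<longlonglongrightarrow> (\<integral>x. indicator unit_box x * f x \<partial>\<mu>)"
  proof (rule integral_dominated_convergence[OF _ _ radon_integrable[OF \<mu> f(1)]])
    show "AE x in \<mu>. (\<lambda>n. lower n x) \<longlonglongrightarrow> indicator unit_box x * f x"
      using AEb
    proof eventually_elim
      case (elim x)
      then have "indicator unit_box x = (indicator U x :: real)" unfolding unit_box_split U_def[symmetric] by (auto simp: indicator_def)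
      then show ?case unfolding lower_def using plateau_tendsto[OF oU nU, of x] by (simp only:) (intro tendsto_intros)
    qed
    show "AE x in \<mu>. norm (lower n x) \<le> f x" for n
      unfolding lower_def using f(2) plateau_nonneg[of U n] plateau_le_1[of U n]
      by (intro always_eventually allI) (simp add: abs_mult mult_left_le_one_le)
  qed (auto intro!: borel_to_radon_measurable[OF \<mu>] cc_borel[OF ccl])
  have u: "(\<lambda>n. \<integral>x. upper n x \<partial>\<mu>) \<longlonglongrightarrow> (\<integral>x. indicator unit_box x * f x \<partial>\<mu>)"
  proof (rule integral_dominated_convergence[OF _ _ radon_integrable[OF \<mu> f(1)]])
    have "(\<lambda>n. upper n x) \<longlonglongrightarrow> (1 - indicator (- unit_box) x) * f x" for x
      unfolding upper_def by (intro tendsto_intros plateau_tendsto[OF oB nB])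
    moreover have "1 - indicator (- unit_box) x = (indicator unit_box x :: real)" for x :: "real ^ 'n" by (simp add: indicator_def)
    ultimately show "AE x in \<mu>. (\<lambda>n. upper n x) \<longlonglongrightarrow> indicator unit_box x * f x" by simp
    show "AE x in \<mu>. norm (upper n x) \<le> f x" for n
      proof (intro always_eventually allI)
      fix x :: "real ^ 'n"
      have "\<bar>1 - plateau (- unit_box) n x\<bar> \<le> 1"
        using plateau_nonneg[of "- unit_box" n x] plateau_le_1[of "- unit_box" n x] by linarith
      then show "norm (upper n x) \<le> f x"
        unfolding upper_def using f(2)[of x] by (simp add: abs_mult mult_left_le_one_le)
    qed
  qed (auto intro!: borel_to_radon_measurable[OF \<mu>] cc_borel[OF ccu])
  have b: "(\<integral>x. lower n x \<partial>X i) \<le> (\<integral>x. indicator unit_box x * f x \<partial>X i)"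
    "(\<integral>x. indicator unit_box x * f x \<partial>X i) \<le> (\<integral>x. upper n x \<partial>X i)" for n i
    by (intro integral_mono le bi X radon_integrable[OF X] ccl ccu)+
  show ?thesis
  proof (rule order_tendstoI)
    fix a assume "a < (\<integral>x. indicator unit_box x * f x \<partial>\<mu>)"
    then obtain n where "a < (\<integral>x. lower n x \<partial>\<mu>)" using order_tendstoD(1)[OF l] unfolding eventually_sequentially by blast
    then have "eventually (\<lambda>i. a < (\<integral>x. lower n x \<partial>X i)) sequentially"
      using order_tendstoD(1) conv ccl unfolding vconv_def by blast
    then show "eventually (\<lambda>i. a < (\<integral>x. indicator unit_box x * f x \<partial>X i)) sequentially"
      by eventually_elim (use b(1) less_le_trans in blast)
  next
    fix a assume "(\<integral>x. indicator unit_box x * f x \<partial>\<mu>) < a"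
    then obtain n where "(\<integral>x. upper n x \<partial>\<mu>) < a" using order_tendstoD(2)[OF u] unfolding eventually_sequentially by blast
    then have "eventually (\<lambda>i. (\<integral>x. upper n x \<partial>X i) < a) sequentially"
      using order_tendstoD(2) conv ccu unfolding vconv_def by blast
    then show "eventually (\<lambda>i. (\<integral>x. indicator unit_box x * f x \<partial>X i) < a) sequentially"
      by eventually_elim (use b(2) le_less_trans in blast)
  qed
qed

lemma box_functional_tendsto:
  fixes X :: "nat \<Rightarrow> (real ^ 'n) measure"
  assumes X: "\<And>i. X i \<in> charging" and \<mu>: "\<mu> \<in> charging" and conv: "vconv X \<mu>"
    and null: "emeasure \<mu> box_boundary = 0" and G: "continuous_on UNIV G"
  shows "(\<lambda>i. box_functional G (X i)) \<longlonglongrightarrow> box_functional G \<mu>"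
proof -
  obtain b where b: "\<forall>x\<in>(unit_box :: (real ^ 'n) set). norm x \<le> b" using bounded_unit_box unfolding bounded_iff by blast
  \<comment> \<open>This test function is 1 on the cube, so the mass of the cube is itself one of
    the convergent integrals.\<close>
  obtain k where k: "\<And>x :: real ^ 'n. norm x \<le> b \<Longrightarrow> test k x = 1" using test_eq_1_on_cball by blast
  note t = box_integral_tendsto[OF charging_radon[OF X] charging_radon[OF \<mu>] conv null cc_test test_nonneg]
  have mass: "(\<integral>x. indicator unit_box x * test k x \<partial>\<nu>) = measure \<nu> unit_box" if "\<nu> \<in> radon_measures" for \<nu> :: "(real ^ 'n) measure"
  proof -
    have "(\<lambda>x :: real ^ 'n. indicator unit_box x * test k x) = indicator unit_box" using b k by (auto simp: indicator_def)
    then show ?thesis by (simp add: radon_space[OF that])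
  qed
  have "(\<lambda>i. measure (X i) unit_box) \<longlonglongrightarrow> measure \<mu> unit_box"
    using t[of k] unfolding mass[OF charging_radon[OF X]] mass[OF charging_radon[OF \<mu>]] .
  then have lim: "(\<lambda>i. \<integral>x. test j x \<partial>box_embed (box_normalize (X i))) \<longlonglongrightarrow> (\<integral>x. test j x \<partial>box_embed (box_normalize \<mu>))" for j
    unfolding integral_box_normalize[OF X cc_borel[OF cc_test]] integral_box_normalize[OF \<mu> cc_borel[OF cc_test]]
    using charging_mass(2)[OF \<mu>] by (intro tendsto_divide t) auto
  have "(\<lambda>i. Phi (box_embed (box_normalize (X i)))) \<longlonglongrightarrow> Phi (box_embed (box_normalize \<mu>))"
    unfolding fun_LIMSEQ_iff
  proof
    fix j
    have "1 + (\<integral>x. test j x \<partial>box_embed (box_normalize \<mu>)) \<noteq> 0"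
    proof -
      have "0 \<le> (\<integral>x. test j x \<partial>box_embed (box_normalize \<mu>))" by (simp add: Bochner_Integration.integral_nonneg)
      then show ?thesis by linarith
    qed
    then show "(\<lambda>i. Phi (box_embed (box_normalize (X i))) j) \<longlonglongrightarrow> Phi (box_embed (box_normalize \<mu>)) j"
      unfolding Phi_def by (intro tendsto_intros lim)
  qed
  then show ?thesis using X \<mu> continuous_on_tendsto_compose[OF G] by (simp add: box_functional_def)
qed

lemma box_normalize_star:
  fixes \<mu> :: "(real ^ 'n) measure"
  assumes "\<mu> \<in> radon_at_origin" shows "box_normalize (star \<mu>) = box_normalize \<mu>"
proof -
  note o = star_at_origin[OF assms]
  note c = origin_charging[OF assms] and c' = origin_charging[OF o]
  define m where "m = measure \<mu> unit_box"
  have m: "m > 0" unfolding m_def by (rule charging_mass(2)[OF c])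
  have s: "star \<mu> = scale_measure (ennreal (1 / m)) \<mu>" using assms by (simp add: star_def m_def)
  have m1: "measure (star \<mu>) unit_box = 1"
    unfolding s measure_def using charging_mass(1)[OF c] m by (simp add: m_def[symmetric] ennreal_mult[symmetric])
  have "box_normalize (star \<mu>) = restrict_space (star \<mu>) unit_box"
    unfolding charging_mass(3)[OF c'] m1 by simp
  also have "\<dots> = scale_measure (ennreal (1 / m)) (restrict_space \<mu> unit_box)"
    unfolding s
    by (rule measure_eqI) (auto simp: sets_restrict_space emeasure_restrict_space radon_sets[OF charging_radon[OF c]] radon_space[OF charging_radon[OF c]] space_scale_measure)
  also have "\<dots> = box_normalize \<mu>" unfolding charging_mass(3)[OF c] m_def ..
  finally show ?thesis .
qed

context limit_setup begin

text \<open>By scale invariance the expected relative mass of the boundary is the same for the spheres of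
  all radii below 1, but the masses of infinitely many disjoint spheres tend to zero.\<close>

lemma AE_Y_boundary: "AE \<omega> in \<Omega>. emeasure (Y \<omega>) box_boundary = 0"
proof -
  define h where "h \<mu> = measure \<mu> (box_boundary :: (real ^ 'n) set) / measure \<mu> unit_box" for \<mu>
  have hm: "h \<in> borel_measurable radon_borel"
    unfolding h_def measure_def using emeasure_radon_measurable[of "\<lambda>\<mu>. \<mu>", OF _ box_boundary_borel]
      emeasure_radon_measurable[of "\<lambda>\<mu>. \<mu>", OF _ unit_box_borel] by measurable
  have hh: "homogeneous h"
    unfolding homogeneous_def h_def by (simp add: measure_scale_measure)
  have sub: "(box_boundary :: (real ^ 'n) set) \<subseteq> unit_box" unfolding unit_box_split by blast
  have bnd: "0 \<le> h \<mu>" "h \<mu> \<le> 1" if \<mu>: "\<mu> \<in> radon_measures" for \<mu>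
  proof -
    have "measure \<mu> (box_boundary :: (real ^ 'n) set) \<le> measure \<mu> unit_box"
      by (rule measure_mono_fmeasurable[OF sub])
        (use radon_emeasure_bounded[OF \<mu> bounded_unit_box] in \<open>auto simp: radon_sets[OF \<mu>] fmeasurable_def\<close>)
    then show "0 \<le> h \<mu>" "h \<mu> \<le> 1" unfolding h_def by (auto simp: divide_le_eq_1 less_le)
  qed
  \<comment> \<open>Distinct magnifications: \<open>t j\<close> pulls the boundary back to the
    sphere of radius exp (- t j). These spheres are disjoint, and their radii lie between exp (-1)
    and 1.\<close>
  define t where "t j = 1 / real (Suc j)" for j
  have t: "0 < t j" "t j \<le> 1" for j by (auto simp: t_def)
  define D where "D j = {y :: real ^ 'n. exp (t j) *\<^sub>R y \<in> box_boundary}" for j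
  have D: "D j = {y. infnorm y = exp (- t j)}" for j
    by (auto simp: D_def box_boundary_def infnorm_mul exp_minus field_simps)
  have Db: "D j \<in> sets borel" for j
    unfolding D by (intro borel_closed closed_Collect_eq continuous_intros)
  have "D i \<inter> D j = {}" if "i \<noteq> j" for i j using that by (auto simp: D t_def)
  then have disj: "disjoint_family D" by (auto simp: disjoint_family_on_def)
  have DB: "D j \<subseteq> unit_box" for j using t[of j] by (auto simp: D unit_box_def)
  have lim: "(\<lambda>j. h (magnify (t j) \<mu>)) \<longlonglongrightarrow> 0" if o: "\<mu> \<in> radon_at_origin" for \<mu>
  proof -
    note r = radon_at_origin_radon[OF o]
    have UB: "(\<Union>j. D j) \<subseteq> unit_box" using DB by blast
    have "emeasure \<mu> (\<Union>j. D j) < \<infinity>" by (rule radon_emeasure_bounded[OF r bounded_subset[OF bounded_unit_box UB]])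
    then have "(\<lambda>j. measure \<mu> (D j)) sums measure \<mu> (\<Union>j. D j)"
      by (intro measure_UNION disj) (use Db in \<open>auto simp: radon_sets[OF r]\<close>)
    then have D0: "(\<lambda>j. measure \<mu> (D j)) \<longlonglongrightarrow> 0" by (intro summable_LIMSEQ_zero) (rule sums_summable)
    \<comment> \<open>Every magnified cube, pulled back, contains this ball, so its mass bounds all
      denominators of h from below.\<close>
    define m where "m = measure \<mu> (ball 0 (exp (-1)) :: (real ^ 'n) set)"
    have "emeasure \<mu> (ball 0 (exp (-1))) > 0" by (rule radon_at_origin_ball[OF o]) simp
    moreover have "emeasure \<mu> (ball 0 (exp (-1))) < \<infinity>" by (rule radon_emeasure_bounded[OF r bounded_ball])
    ultimately have m: "m > 0" unfolding m_def measure_def by (simp add: enn2real_positive_iff)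
    have le: "h (magnify (t j) \<mu>) \<le> measure \<mu> (D j) / m" for j
    proof -
      let ?E = "{y :: real ^ 'n. exp (t j) *\<^sub>R y \<in> unit_box}"
      have E: "?E = {y. infnorm y \<le> exp (- t j)}"
        by (auto simp: unit_box_def infnorm_mul exp_minus field_simps)
      have Es: "?E \<in> sets \<mu>" unfolding E radon_sets[OF r] by (intro borel_closed closed_Collect_le continuous_intros)
      have "?E \<subseteq> unit_box" using t[of j] unfolding E by (auto simp: unit_box_def intro: order_trans)
      then have Ef: "emeasure \<mu> ?E < \<infinity>" by (intro radon_emeasure_bounded[OF r bounded_subset[OF bounded_unit_box]])
      have "ball 0 (exp (-1)) \<subseteq> ?E"
      proof
        fix y :: "real ^ 'n" assume "y \<in> ball 0 (exp (-1))"
        then have "infnorm y \<le> exp (- 1)" using infnorm_le_norm[of y] by simp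
        also have "\<dots> \<le> exp (- t j)" using t[of j] by simp
        finally show "y \<in> ?E" unfolding E by simp
      qed
      then have "m \<le> measure \<mu> ?E" unfolding m_def
        by (intro measure_mono_fmeasurable) (use Es Ef in \<open>auto simp: radon_sets[OF r] fmeasurable_def\<close>)
      then have "measure \<mu> (D j) / measure \<mu> ?E \<le> measure \<mu> (D j) / m" using m by (intro divide_left_mono) auto
      then show ?thesis
        unfolding h_def measure_def emeasure_magnify[OF r box_boundary_borel] emeasure_magnify[OF r unit_box_borel] D_def .
    qed
    show ?thesis
    proof (rule tendsto_sandwich[OF _ _ tendsto_const])
      show "eventually (\<lambda>j. 0 \<le> h (magnify (t j) \<mu>)) sequentially" using bnd(1)[OF radon_magnify[OF r]] by simp
      show "eventually (\<lambda>j. h (magnify (t j) \<mu>) \<le> measure \<mu> (D j) / m) sequentially" using le by simp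
      show "(\<lambda>j. measure \<mu> (D j) / m) \<longlonglongrightarrow> 0" by (rule tendsto_eq_intros D0 refl)+ (use m in auto)
    qed
  qed
  have "(\<lambda>j. expectation (\<lambda>\<omega>. h (magnify (t j) (Y \<omega>)))) \<longlonglongrightarrow> expectation (\<lambda>\<omega>. 0)"
  proof (rule integral_dominated_convergence[where w = "\<lambda>_. 1"])
    show "AE \<omega> in \<Omega>. (\<lambda>j. h (magnify (t j) (Y \<omega>))) \<longlonglongrightarrow> 0" using AE_Y_origin by eventually_elim (rule lim)
    show "AE \<omega> in \<Omega>. norm (h (magnify (t j) (Y \<omega>))) \<le> 1" for j
      using AE_space by eventually_elim (simp add: bnd radon_magnify Y_radon)
  qed (auto intro!: measurable_compose[OF measurable_magnify[OF Y] hm])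
  then have E0: "expectation (\<lambda>\<omega>. h (Y \<omega>)) = 0"
    unfolding expectation_magnify_Y[OF hm hh t(1)] by (simp add: LIMSEQ_const_iff)
  have int: "integrable \<Omega> (\<lambda>\<omega>. h (Y \<omega>))"
    by (rule integrable_const_bound[where B = 1]) (auto intro!: AE_I2 measurable_compose[OF Y hm] simp: bnd Y_radon)
  have "AE \<omega> in \<Omega>. h (Y \<omega>) = 0"
    using E0 by (subst integral_nonneg_eq_0_iff_AE[OF int, symmetric]) (simp_all add: bnd Y_radon)
  then show ?thesis
    using AE_Y_origin
  proof eventually_elim
    case (elim \<omega>)
    note r = radon_at_origin_radon[OF elim(2)]
    have "bounded (box_boundary :: (real ^ 'n) set)" by (rule bounded_subset[OF bounded_unit_box sub])
    from radon_emeasure_bounded[OF r this] have "emeasure (Y \<omega>) box_boundary = ennreal (measure (Y \<omega>) box_boundary)"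
      by (intro emeasure_eq_ennreal_measure) simp
    then show ?case using elim(1) unit_box_mass(2)[OF elim(2)] by (simp add: h_def)
  qed
qed

text \<open>Almost surely Y does not charge the boundary, so the functionals converge along
  \<open>X i\<close>; passing from Y to \<open>star Y\<close> leaves the normalized restriction
  unchanged.\<close>

lemma box_functional_integral_tendsto:
  assumes G: "continuous_on UNIV G" "\<And>y. \<bar>G y\<bar> \<le> 1"
  shows "(\<lambda>i. \<integral>\<mu>. box_functional G \<mu> \<partial>Pn i) \<longlonglongrightarrow> (\<integral>\<mu>. box_functional G \<mu> \<partial>limit_dist)"
proof -
  have "G \<in> borel_measurable borel" by (rule borel_measurable_continuous_onI[OF G(1)])
  note m = box_functional_measurable[OF this]
  have b: "\<bar>box_functional G \<mu>\<bar> \<le> 1" for \<mu> :: "(real ^ 'n) measure" using G(2) by (simp add: box_functional_def)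
  have "(\<lambda>i. expectation (\<lambda>\<omega>. box_functional G (X i \<omega>))) \<longlonglongrightarrow> expectation (\<lambda>\<omega>. box_functional G (star (Y \<omega>)))"
  proof (rule integral_dominated_convergence[where w = "\<lambda>_. 1"])
    show "AE \<omega> in \<Omega>. (\<lambda>i. box_functional G (X i \<omega>)) \<longlonglongrightarrow> box_functional G (star (Y \<omega>))"
      using AE_X_origin AE_Y_origin AE_Y_boundary conv
    proof eventually_elim
      case (elim \<omega>)
      have "box_functional G (star (Y \<omega>)) = box_functional G (Y \<omega>)"
        using origin_charging[OF elim(2)] origin_charging[OF star_at_origin[OF elim(2)]]
        by (simp add: box_functional_def box_normalize_star[OF elim(2)])
      moreover have "X i \<omega> \<in> charging" for i using elim(1) origin_charging by blast
      ultimately show ?case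
        using box_functional_tendsto[OF _ origin_charging[OF elim(2)] elim(4,3) G(1)] by simp
    qed
  qed (use b in \<open>auto intro!: measurable_compose[OF X m] measurable_compose[OF star_Y m]\<close>)
  then show ?thesis
    unfolding expectation_X[OF m] limit_dist_def by (simp add: integral_distr[OF star_Y m])
qed

end

text \<open>With cube mass 1 the mass at scale 1 is at most 1. A test integral above 2 * L forces
  the mass at scale R above L and hence the exponential of \<open>tail_bound\<close> above exp (-1),
  so Markov's inequality bounds the probability by exp 1 * C / L.\<close>

lemma extended_fractal_tight:
  fixes E :: "nat \<Rightarrow> (real ^ 'n) measure measure"
  assumes E: "\<And>i. E i \<in> extended_fractal_distributions" and \<epsilon>: "\<epsilon> > 0"
  shows "\<exists>K. \<forall>i. measure (E i) {\<mu> \<in> radon_measures. K < (\<integral>x. test k x \<partial>\<mu>)} \<le> \<epsilon>"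
proof -
  obtain r0 where r0: "r0 > 0" "\<And>x :: real ^ 'n. r0 < norm x \<Longrightarrow> test k x = 0" by (rule cc_supportE[OF cc_test]) (rule that)
  \<comment> \<open>Twice the support radius, so that the tent is at least 1/2 where the test
    function may be nonzero.\<close>
  define R where "R = 2 * r0"
  have R: "0 < R" using r0 by (simp add: R_def)
  have t: "test k x \<le> 2 * nbump R x" for x :: "real ^ 'n"
    using r0(2)[of x] nbump_ge_half[OF R, of x] test_le_1[of k x] by (cases "norm x \<le> r0") (auto simp: R_def)
  have tm: "(\<integral>x. test k x \<partial>\<mu>) \<le> 2 * mass_at R \<mu> 0" if \<mu>: "\<mu> \<in> radon_measures" for \<mu> :: "(real ^ 'n) measure"
  proof -
    have "(\<integral>x. test k x \<partial>\<mu>) \<le> (\<integral>x. 2 * nbump R x \<partial>\<mu>)"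
      by (intro integral_mono radon_integrable[OF \<mu> cc_test] integrable_mult_right radon_integrable[OF \<mu> cc_nbump[OF R]] t)
    then show ?thesis by (simp add: mass_at_def)
  qed
  obtain C where C: "0 \<le> C" "\<And>P K. P \<in> (extended_fractal_distributions :: (real ^ 'n) measure measure set) \<Longrightarrow> 0 < K \<Longrightarrow>
    (\<integral>\<mu>. exp (- (K * mass_at 1 \<mu> 0 / mass_at R \<mu> 0)) \<partial>P) \<le> C / K"
    by (rule tail_bound[OF zero_less_one R]) (rule that)
  \<comment> \<open>Chosen so that exp 1 * C / L is at most epsilon; the summand 1 keeps L positive
    when C is 0.\<close>
  define L where "L = exp 1 * C / \<epsilon> + 1"
  have L: "L > 0" using C(1) \<epsilon> by (simp add: L_def add_nonneg_pos)
  have "measure (E i) {\<mu> \<in> radon_measures. 2 * L < (\<integral>x. test k x \<partial>\<mu>)} \<le> \<epsilon>" for i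
  proof -
    interpret fractal_dist "E i" by standard (rule E)
    interpret prob_space "E i" using E by (simp add: extended_fractal_distributions_def prob_measures_def)
    define S where "S = {\<mu> :: (real ^ 'n) measure. \<mu> \<in> radon_measures \<and> 2 * L < (\<integral>x. test k x \<partial>\<mu>)}"
    define f where "f \<mu> = exp (- (L * mass_at 1 \<mu> 0 / mass_at R \<mu> (0 :: real ^ 'n)))" for \<mu>
    have "{\<mu> \<in> space radon_borel. 2 * L < (\<integral>x. test k x \<partial>\<mu>)} \<in> sets (radon_borel :: (real ^ 'n) measure measure)"
      using measurable_integral_cc[OF cc_test[of k, where 'n = 'n]] by measurable
    then have S: "S \<in> events" by (simp add: S_def space_radon_borel sets_P)
    have [measurable]: "(\<lambda>\<mu>. mass_at R \<mu> (0 :: real ^ 'n)) \<in> borel_measurable radon_borel"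
      "(\<lambda>\<mu>. mass_at 1 \<mu> (0 :: real ^ 'n)) \<in> borel_measurable radon_borel"
      using mass_at_0_measurable[OF R] mass_at_0_measurable[OF zero_less_one] by simp_all
    have fm: "f \<in> borel_measurable (E i)" unfolding f_def
      by (intro measurable_P) measurable
    have f01: "0 \<le> f \<mu>" "f \<mu> \<le> 1" for \<mu> using L mass_at_nonneg[of 1 \<mu> 0] mass_at_nonneg[of R \<mu> 0] by (auto simp: f_def)
    have fi: "integrable (E i) (\<lambda>\<mu>. exp 1 * f \<mu>)"
      by (intro integrable_mult_right integrable_const_bound[where B = 1] fm) (auto intro!: AE_I2 simp: f01)
    have "prob S = expectation (indicator S)" using S by simp
    also have "\<dots> \<le> expectation (\<lambda>\<mu>. exp 1 * f \<mu>)"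
    proof (rule integral_mono_AE[OF _ fi])
      show "integrable (E i) (indicator S :: _ \<Rightarrow> real)" using S by (simp add: integrable_real_indicator less_top[symmetric])
      show "AE \<mu> in E i. indicator S \<mu> \<le> exp 1 * f \<mu>"
        using AE_unit_box AE_space
      proof eventually_elim
        case (elim \<mu>)
        then have \<mu>: "\<mu> \<in> radon_measures" by (simp add: space_P)
        show ?case
        proof (cases "\<mu> \<in> S")
          case True
          then have big: "L < mass_at R \<mu> 0" using tm[OF \<mu>] by (simp add: S_def)
          have "mass_at 1 \<mu> 0 \<le> 1"
          proof -
            have bs: "(unit_box :: (real ^ 'n) set) \<in> sets \<mu>" by (simp add: radon_sets[OF \<mu>])
            have "mass_at 1 \<mu> 0 \<le> (\<integral>x. indicator unit_box x \<partial>\<mu>)" unfolding mass_at_def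
            proof (rule integral_mono)
              show "integrable \<mu> (\<lambda>y. nbump 1 (y - 0) :: real)" using radon_integrable[OF \<mu> cc_nbump[OF zero_less_one]] by simp
              show "integrable \<mu> (indicator unit_box :: _ \<Rightarrow> real)" by (rule integrable_real_indicator[OF bs]) (use elim(1) in simp)
              show "nbump 1 (x - 0) \<le> (indicator unit_box x :: real)" for x :: "real ^ 'n"
              proof (cases "x \<in> unit_box")
                case True
                then show ?thesis using nbump_le_1[of 1 x] by simp
              next
                case False
                then have "x \<notin> ball 0 1" using ball_subset_unit_box by blast
                then show ?thesis using nbump_outside[of 1 x] by simp
              qed
            qed
            also have "\<dots> = 1" using elim(1) radon_space[OF \<mu>] by (simp add: measure_def)
            finally show ?thesis .
          qed
          then have "L * mass_at 1 \<mu> 0 / mass_at R \<mu> 0 \<le> L * 1 / L"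
            using big L mass_at_nonneg[of 1 \<mu> 0] by (intro frac_le mult_left_mono) auto
          then have "exp (-1) \<le> f \<mu>" unfolding f_def using L by simp
          then have "exp 1 * exp (-1) \<le> exp 1 * f \<mu>" by (intro mult_left_mono) simp_all
          then show ?thesis using True by (simp add: exp_minus)
        next
          case False
          then show ?thesis using f01[of \<mu>] by simp
        qed
      qed
    qed
    also have "\<dots> = exp 1 * expectation f" by simp
    also have "\<dots> \<le> exp 1 * (C / L)" unfolding f_def by (intro mult_left_mono C(2)[OF E L]) simp
    also have "\<dots> \<le> \<epsilon>"
    proof -
      have "exp 1 * C \<le> \<epsilon> * L" using \<epsilon> by (simp add: L_def field_simps)
      then show ?thesis using L by (simp add: field_simps)
    qed
    finally show ?thesis unfolding S_def .
  qed
  then show ?thesis by blast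
qed

lemma continuous_map_box_test:
  assumes "continuous_on UNIV G"
  shows "continuous_map box_topology euclideanreal (\<lambda>\<eta>. G (Phi (box_embed \<eta>)))"
  using continuous_map_compose[OF continuous_map_Phi_box] assms unfolding continuous_map_iff_continuous2[symmetric] comp_def by blast

text \<open>Points of the closure are reached through countably many functionals: neighbourhoods cut
  out by the first i of them supply a sequence, and agreement on all of them identifies the limit
  with Q.\<close>

theorem theorem1p1:
  shows "closedin (weak_topology box_topology)
           (fractal_distributions :: (real ^ 'n) measure measure set)"
proof -
  let ?W = "weak_topology (box_topology :: (real ^ 'n) measure topology)"
  have sub: "(fractal_distributions :: (real ^ 'n) measure measure set) \<subseteq> topspace ?W"
    unfolding topspace_weak fractal_distributions_def
    by (intro image_subsetI fractal_dist.box_distr_prob fractal_dist.intro)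
  have "Q \<in> fractal_distributions" if Q: "Q \<in> ?W closure_of fractal_distributions" for Q
  proof -
    have Qp: "Q \<in> prob_measures box_topology"
      and near: "\<And>T. Q \<in> T \<Longrightarrow> openin ?W T \<Longrightarrow> \<exists>P\<in>fractal_distributions. P \<in> T"
      using Q unfolding in_closure_of topspace_weak by blast+
    obtain A :: "nat \<Rightarrow> (nat \<Rightarrow> real) set" where A: "Int_stable (range A)" "\<And>n. open (A n)"
      "sets borel = sigma_sets UNIV (range A)" "UNIV \<in> range A"
      using countable_Int_stable_basis_enum by metis
    \<comment> \<open>One enumeration of all plateaus of all basic open sets. These functionals
      define the neighbourhoods below and separate distributions on the cube.\<close>
    define G where "G m = plateau (A (fst (prod_decode m))) (snd (prod_decode m))" for m
    have G: "continuous_on UNIV (G m)" "\<bar>G m y\<bar> \<le> 1" for m y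
      unfolding G_def by (rule continuous_plateau) (simp add: plateau_nonneg plateau_le_1)
    define g where "g m \<eta> = G m (Phi (box_embed (\<eta> :: (real ^ 'n) measure)))" for m \<eta>
    have "\<exists>P\<in>extended_fractal_distributions. \<forall>m\<le>i. \<bar>(\<integral>\<eta>. g m \<eta> \<partial>box_distr P) - (\<integral>\<eta>. g m \<eta> \<partial>Q)\<bar> < 1 / real (Suc i)" for i
    proof -
      define B where "B m = {P \<in> prob_measures box_topology. (\<integral>\<eta>. g m \<eta> \<partial>P) \<in> ball (\<integral>\<eta>. g m \<eta> \<partial>Q) (1 / real (Suc i))}" for m
      have "openin ?W (B m)" for m
        unfolding B_def
      proof (rule openin_weak[OF _ _ open_ball])
        show "continuous_map box_topology euclideanreal (g m)" unfolding g_def by (rule continuous_map_box_test[OF G(1)])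
        show "bounded (g m ` topspace box_topology)" unfolding bounded_iff g_def using G(2) by auto
      qed
      then have "openin ?W (\<Inter>m\<in>{..i}. B m)" by (intro openin_INT2) auto
      moreover have "Q \<in> (\<Inter>m\<in>{..i}. B m)" using Qp by (auto simp: B_def)
      ultimately obtain P where "P \<in> fractal_distributions" "P \<in> (\<Inter>m\<in>{..i}. B m)" using near by blast
      then obtain P' where P': "P' \<in> extended_fractal_distributions" "P = box_distr P'" unfolding fractal_distributions_def by blast
      have "\<bar>(\<integral>\<eta>. g m \<eta> \<partial>box_distr P') - (\<integral>\<eta>. g m \<eta> \<partial>Q)\<bar> < 1 / real (Suc i)" if "m \<le> i" for m
        using \<open>P \<in> (\<Inter>m\<in>{..i}. B m)\<close> that unfolding P'(2) B_def by (simp add: dist_real_def abs_minus_commute)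
      then show ?thesis using P'(1) by blast
    qed
    \<comment> \<open>A diagonal choice: \<open>E i\<close> is within 1 / (i + 1) of Q in the
      functionals with index up to i, so every fixed functional converges along the
      sequence.\<close>
    then obtain E where E: "\<And>i. E i \<in> extended_fractal_distributions"
      "\<And>i m. m \<le> i \<Longrightarrow> \<bar>(\<integral>\<eta>. g m \<eta> \<partial>box_distr (E i)) - (\<integral>\<eta>. g m \<eta> \<partial>Q)\<bar> < 1 / real (Suc i)"
      by metis
    have limQ: "(\<lambda>i. \<integral>\<eta>. g m \<eta> \<partial>box_distr (E i)) \<longlonglongrightarrow> (\<integral>\<eta>. g m \<eta> \<partial>Q)" for m
    proof (rule LIM_zero_cancel, rule tendsto_rabs_zero_cancel, rule tendsto_sandwich[OF _ _ tendsto_const LIMSEQ_inverse_real_of_nat])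
      show "eventually (\<lambda>i. \<bar>(\<integral>\<eta>. g m \<eta> \<partial>box_distr (E i)) - (\<integral>\<eta>. g m \<eta> \<partial>Q)\<bar> \<le> inverse (real (Suc i))) sequentially"
        using eventually_ge_at_top[of m]
      proof eventually_elim
        case (elim i)
        then show ?case using E(2)[of m i] by (simp add: inverse_eq_divide)
      qed
    qed simp
    have Ep: "prob_space (E i)" "sets (E i) = sets radon_borel" for i
      using E(1)[of i] by (auto simp: extended_fractal_distributions_def prob_measures_def)
    obtain r :: "nat \<Rightarrow> nat" and \<Omega> :: "real measure" and X Y
      where r: "strict_mono r" and \<Omega>: "prob_space \<Omega>" and X: "\<And>i. X i \<in> measurable \<Omega> (radon_borel :: (real ^ 'n) measure measure)"
        and Y: "Y \<in> measurable \<Omega> radon_borel" and law: "\<And>i. distr \<Omega> radon_borel (X i) = E (r i)"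
        and conv: "AE \<omega> in \<Omega>. vconv (\<lambda>i. X i \<omega>) (Y \<omega>)"
      by (rule radon_Skorohod[OF Ep extended_fractal_tight[OF E(1)]]) (assumption | rule that)+
    interpret limit_setup \<Omega> "\<lambda>i. E (r i)" X Y
      by (intro limit_setup.intro limit_setup_axioms.intro \<Omega> E(1) X Y law conv)
    interpret F: fractal_dist limit_dist by standard (rule limit_dist_extended_fractal)
    have eq: "(\<integral>\<eta>. g m \<eta> \<partial>Q) = (\<integral>\<eta>. g m \<eta> \<partial>box_distr limit_dist)" for m
    proof -
      have Gb: "G m \<in> borel_measurable borel" by (rule borel_measurable_continuous_onI[OF G(1)])
      have "(\<integral>\<eta>. g m \<eta> \<partial>box_distr (E i)) = (\<integral>\<mu>. box_functional (G m) \<mu> \<partial>E i)" for i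
        unfolding g_def by (rule fractal_dist.integral_box_distr[OF fractal_dist.intro[OF E(1)] Gb])
      then have "(\<lambda>i. \<integral>\<eta>. g m \<eta> \<partial>box_distr (E (r i))) \<longlonglongrightarrow> (\<integral>\<eta>. g m \<eta> \<partial>box_distr limit_dist)"
        using box_functional_integral_tendsto[OF G] F.integral_box_distr[OF Gb] by (simp add: g_def)
      moreover have "(\<lambda>i. \<integral>\<eta>. g m \<eta> \<partial>box_distr (E (r i))) \<longlonglongrightarrow> (\<integral>\<eta>. g m \<eta> \<partial>Q)"
        using LIMSEQ_subseq_LIMSEQ[OF limQ r] by (simp add: comp_def)
      ultimately show ?thesis by (rule LIMSEQ_unique[symmetric])
    qed
    have "Q = box_distr limit_dist"
    proof (rule box_distribution_eqI[OF Qp F.box_distr_prob A])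
      fix k n
      show "(\<integral>\<eta>. plateau (A k) n (Phi (box_embed \<eta>)) \<partial>Q) = (\<integral>\<eta>. plateau (A k) n (Phi (box_embed \<eta>)) \<partial>box_distr limit_dist)"
        using eq[of "prod_encode (k, n)"] by (simp add: g_def G_def)
    qed
    then show ?thesis unfolding fractal_distributions_def using limit_dist_extended_fractal by blast
  qed
  then show ?thesis using sub closure_of_subset_eq by blast
qed



end
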